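(* Let the loss $\ell$ and the data distribution $\mathbb P$ satisfy the standing assumptions on loss, data and compatibility stated in the context. Let $\pi_0\in\mathcal P_2(\overline\Theta)$ be omni-directional, let $(\pi_t)_{t\ge 0}$ be the Wasserstein gradient flow of $\mathcal R$ starting at $\pi_0$, and assume that the Morse-Sard condition stated in the context holds for $(\pi_t)_{t\ge0}$. Let $$\Omega^{lim}=\{(g,V)\;:\;\exists\, t_n\to\infty \text{ such that } \delta_\pi\mathcal R(\pi_{t_n},\cdot)\to g \text{ and } \nabla_\theta\delta_\pi\mathcal R(\pi_{t_n},\cdot)\to V \text{ locally uniformly on }\overline\Theta\}.$$ Then: 1. $\Omega^{lim}$ is not empty. 2. $\lim_{t\to\infty}\mathcal R(\pi_t)=\inf_{\pi\in\mathcal P_2(\overline\Theta)}\mathcal R(\pi)$ if and only if $\Omega^{lim}$ consists of only one element. Moreover, if $\Omega^{lim}$ consists of only one element $(g,V)$, then $g=\lim_{t\to\infty}\delta_\pi\mathcal R(\pi_t,\cdot)\equiv 0$.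
   Context: **Network.** Let $d\ge 1$ and $\Theta=\{(a,w,b)\in\mathbb R\times\mathbb R^d\times\mathbb R: a^2<|w|^2+b^2\}$, with closure $\overline\Theta\subset\mathbb R^{d+2}$; write $\theta=(a,w,b)$. Let $\sigma(z)=\max\{z,0\}$, $\sigma'(z)=1_{\{z>0\}}$, $\phi(\theta;x)=a\,\sigma(w^Tx+b)$ and $\nabla_\theta\phi(\theta;x)=\big(\sigma(w^Tx+b),\,a\,\sigma'(w^Tx+b)\,x,\,a\,\sigma'(w^Tx+b)\big)$ for $x\in\mathbb R^d$. $\mathcal P_2(\overline\Theta)$ is the set of Borel probability measures on $\overline\Theta$ with finite second moment $N(\pi)=\int|\theta|^2\,\pi(d\theta)$, and $f_\pi(x)=\int_{\overline\Theta}\phi(\theta;x)\,\pi(d\theta)$. **Loss.** $\ell:\mathbb R\times\mathbb R\to[0,\infty)$ is jointly continuous, continuously differentiable in the first argument with $|\partial_1\ell|\le C_\ell$ for some constant $C_\ell$, and $y\mapsto\ell(y,\bar y)$ is convex for every $\bar y$. **Data.** $\mathbb P$ is a Borel probability measure on $\mathbb R^d\times\mathbb R$ with $\int(|x|+|y|)\,d\mathbb P<\infty$; $\overline{\mathbb P}$ is its marginal on $\mathbb R^d$ and $\mathbb P^x$ are the conditional distributions of $y$ given $x$. The span of $\{\phi(\theta;\cdot):\theta\in\Theta\}$ is dense in $L^1(\overline{\mathbb P})$, and the map $S^d\to L^1(\sqrt{1+|x|^2}\cdot\overline{\mathbb P})$, $(w,b)\mapsto 1_{\{x\,:\,w^Tx+b>0\}}$,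 is Lipschitz continuous (here $S^d\subset\mathbb R^{d+1}$ is the unit sphere and $h\cdot\mu$ is the measure with density $h$ with respect to $\mu$). **Compatibility.** With $L_x(\alpha)=\int_{\mathbb R}\ell(\alpha,y)\,\mathbb P^x(dy)$: $\lim_{|\alpha|\to\infty}L_x(\alpha)=\infty$ for $\overline{\mathbb P}$-a.e. $x$; $\int\ell(0,y)\,d\mathbb P<\infty$; and there is a $\overline{\mathbb P}$-measurable $f^*\in L^1(\overline{\mathbb P})$ with $f^*(x)\in\operatorname{argmin}_\alpha L_x(\alpha)$ for $\overline{\mathbb P}$-a.e. $x$. **Risk and gradient flow.** $\mathcal R(\pi)=\int\ell(f_\pi(x),y)\,\mathbb P(dx\otimes dy)$, $\delta_\pi\mathcal R(\pi,\theta)=\int(\partial_1\ell)(f_\pi(x),y)\,\phi(\theta;x)\,\mathbb P(dx\otimes dy)$, $\nabla_\theta\delta_\pi\mathcal R(\pi,\theta)=\int(\partial_1\ell)(f_\pi(x),y)\,\nabla_\theta\phi(\theta;x)\,\mathbb P(dx\otimes dy)$. The Wasserstein gradient flow starting at $\pi_0$ is the locally absolutely continuous curve $t\mapsto\pi_t\in\mathcal P_2(\overline\Theta)$ with respect to the 2-Wasserstein distance, with initial value $\pi_0$, satisfying $\partial_t\pi_t=\mathrm{div}_\theta(\pi_t\nabla_\theta\delta_\pi\mathcal R(\pi_t,\cdot))$ in the sense that $\frac{d}{dt}\int\psi\,d\pi_t=-\int\langle\nabla\psi,\nabla_\theta\delta_\pi\mathcal R(\pi_t,\cdot)\rangle\,d\pi_t$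 for a.e. $t>0$ and all $\psi\in C_c^\infty(\mathbb R^{d+2})$. **Omni-directional.** A probability measure is omni-directional if every nonempty open cone in $\Theta$ (open $C\subseteq\Theta$ with $\lambda C\subseteq C$ for all $\lambda>0$) has positive measure. **Morse-Sard condition.** Whenever $t_n\to\infty$, $\delta_\pi\mathcal R(\pi_{t_n},\cdot)\to g$ and $\nabla_\theta\delta_\pi\mathcal R(\pi_{t_n},\cdot)\to V$ locally uniformly on $\overline\Theta$, then for Lebesgue-a.e. $s\in\mathbb R$ the tangential gradient $\nabla^Sg(\theta)=(I-\theta\otimes\theta)V(\theta)$ does not vanish at any point of $\{\theta\in\overline\Theta:|\theta|=1,\ g(\theta)=s\}$. *)

theory Defs
  imports "HOL-Probability.Probability"
begin

text \<open>The dimension \<open>d\<close> is \<open>CARD('n)\<close>; a parameter is \<open>\<theta> = (a, w, b)\<close>. The norm of the product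
  type is the Euclidean norm of \<open>\<real>\<^sup>d\<^sup>+\<^sup>2\<close>.\<close>

type_synonym 'n param = "real \<times> (real ^ 'n) \<times> real"

definition locally_uniform_limit ::
    "'a::metric_space set \<Rightarrow> ('i \<Rightarrow> 'a \<Rightarrow> 'b::metric_space) \<Rightarrow> ('a \<Rightarrow> 'b) \<Rightarrow> 'i filter \<Rightarrow> bool" where
  "locally_uniform_limit S f l F \<longleftrightarrow> (\<forall>x\<in>S. \<exists>e>0. uniform_limit (S \<inter> ball x e) f l F)"

primrec C_k :: "nat \<Rightarrow> ('a::euclidean_space \<Rightarrow> real) \<Rightarrow> bool" where
  "C_k 0 f \<longleftrightarrow> continuous_on UNIV f"
| "C_k (Suc k) f \<longleftrightarrow>
     (\<forall>x. f differentiable (at x)) \<and> (\<forall>i\<in>Basis. C_k k (\<lambda>x. frechet_derivative f (at x) i))"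

definition test_function :: "('a::euclidean_space \<Rightarrow> real) \<Rightarrow> bool" where
  "test_function f \<longleftrightarrow> (\<forall>k. C_k k f) \<and> compact (closure {x. f x \<noteq> 0})"

definition gradient :: "('a::real_inner \<Rightarrow> real) \<Rightarrow> 'a \<Rightarrow> 'a" where
  "gradient f x = (THE D. GDERIV f x :> D)"

definition couplings :: "'a measure \<Rightarrow> 'a measure \<Rightarrow> ('a \<times> 'a) measure set" where
  "couplings \<mu> \<nu> = {\<gamma>. sets \<gamma> = sets (\<mu> \<Otimes>\<^sub>M \<nu>) \<and> distr \<gamma> \<mu> fst = \<mu> \<and> distr \<gamma> \<nu> snd = \<nu>}"

text \<open>The infimum is finite whenever both measures are probability measures with finite second
  moment, so that \<^const>\<open>enn2real\<close> loses nothing there.\<close>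

definition wasserstein2 :: "'a::metric_space measure \<Rightarrow> 'a measure \<Rightarrow> real" where
  "wasserstein2 \<mu> \<nu> =
     sqrt (enn2real (INF \<gamma>\<in>couplings \<mu> \<nu>. \<integral>\<^sup>+ z. ennreal ((dist (fst z) (snd z))\<^sup>2) \<partial>\<gamma>))"

text \<open>Absolute continuity in a metric space on every compact interval \<open>[0, T]\<close>, in the form usual
  for gradient flows: increments are dominated by the integral of a locally integrable function.\<close>

definition locally_AC_curve :: "('a \<Rightarrow> 'a \<Rightarrow> real) \<Rightarrow> (real \<Rightarrow> 'a) \<Rightarrow> bool" where
  "locally_AC_curve D c \<longleftrightarrow>
     (\<exists>m :: real \<Rightarrow> real. (\<forall>T>0. set_integrable lborel {0..T} m) \<and>
        (\<forall>s t. 0 \<le> s \<and> s \<le> t \<longrightarrow> D (c s) (c t) \<le> (LINT r:{s..t}|lborel. m r)))"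

definition Theta :: "('n::finite) param set" where
  "Theta = {(a, w, b). a\<^sup>2 < (norm w)\<^sup>2 + b\<^sup>2}"

definition relu :: "real \<Rightarrow> real" where
  "relu z = max z 0"

definition relu' :: "real \<Rightarrow> real" where
  "relu' z = (if z > 0 then 1 else 0)"

fun phi :: "('n::finite) param \<Rightarrow> real ^ 'n \<Rightarrow> real" where
  "phi (a, w, b) x = a * relu (w \<bullet> x + b)"

fun grad_phi :: "('n::finite) param \<Rightarrow> real ^ 'n \<Rightarrow> 'n param" where
  "grad_phi (a, w, b) x =
     (relu (w \<bullet> x + b), (a * relu' (w \<bullet> x + b)) *\<^sub>R x, a * relu' (w \<bullet> x + b))"

definition P2 :: "('n::finite) param measure set" where
  "P2 = {\<pi> \<in> space (prob_algebra (restrict_space borel (closure Theta))).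
           integrable \<pi> (\<lambda>\<theta>. (norm \<theta>)\<^sup>2)}"

definition network :: "('n::finite) param measure \<Rightarrow> real ^ 'n \<Rightarrow> real" where
  "network \<pi> x = (\<integral>\<theta>. phi \<theta> x \<partial>\<pi>)"

definition omni_directional :: "('n::finite) param measure \<Rightarrow> bool" where
  "omni_directional \<pi> \<longleftrightarrow>
     (\<forall>C. open C \<and> C \<noteq> {} \<and> C \<subseteq> Theta \<and> (\<forall>r>0. \<forall>\<theta>\<in>C. r *\<^sub>R \<theta> \<in> C) \<longrightarrow> measure \<pi> C > 0)"

definition D1 :: "(real \<Rightarrow> real \<Rightarrow> real) \<Rightarrow> real \<Rightarrow> real \<Rightarrow> real" where
  "D1 l y y' = deriv (\<lambda>z. l z y') y"

definition loss_assms :: "(real \<Rightarrow> real \<Rightarrow> real) \<Rightarrow> bool" where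
  "loss_assms l \<longleftrightarrow>
     (\<forall>y y'. l y y' \<ge> 0) \<and>
     continuous_on UNIV (\<lambda>(y, y'). l y y') \<and>
     (\<forall>y'. (\<lambda>y. l y y') C1_differentiable_on UNIV) \<and>
     (\<exists>C. \<forall>y y'. \<bar>D1 l y y'\<bar> \<le> C) \<and>
     (\<forall>y'. convex_on UNIV (\<lambda>y. l y y'))"

definition marginal :: "((real ^ 'n) \<times> real) measure \<Rightarrow> (real ^ 'n) measure" where
  "marginal P = distr P borel fst"

text \<open>The last two conjuncts: density in \<open>L\<^sup>1\<close> of the span of the functions \<open>phi \<theta>\<close>, whose elements
  are written as finite linear combinations, and Lipschitz continuity of the half-space
  indicators as a map from \<open>S\<^sup>d\<close> into the weighted \<open>L\<^sup>1\<close> space.\<close>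

definition data_assms :: "((real ^ 'n) \<times> real) measure \<Rightarrow> bool" where
  "data_assms P \<longleftrightarrow>
     sets P = sets borel \<and> prob_space P \<and>
     integrable P (\<lambda>(x, y). norm x + \<bar>y\<bar>) \<and>
     (\<forall>f. integrable (marginal P) f \<longrightarrow> (\<forall>e>0. \<exists>T c. finite T \<and> T \<subseteq> Theta \<and>
        (\<integral>x. \<bar>f x - (\<Sum>\<theta>\<in>T. c \<theta> * phi \<theta> x)\<bar> \<partial>marginal P) < e)) \<and>
     (\<exists>K. \<forall>w b w' b'. (w, b) \<in> sphere 0 1 \<and> (w', b') \<in> sphere 0 1 \<longrightarrow>
        (\<integral>x. \<bar>indicator {x. w \<bullet> x + b > 0} x - indicator {x. w' \<bullet> x + b' > 0} x\<bar>
           \<partial>density (marginal P) (\<lambda>x. ennreal (sqrt (1 + (norm x)\<^sup>2))))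
        \<le> K * dist (w, b) (w', b'))"

text \<open>\<open>Px x\<close> is the conditional distribution of \<open>y\<close> given \<open>x\<close>. Such a kernel exists and is
  unique up to a null set of the marginal.\<close>

definition conditional_distribution ::
    "((real ^ 'n) \<times> real) measure \<Rightarrow> (real ^ 'n \<Rightarrow> real measure) \<Rightarrow> bool" where
  "conditional_distribution P Px \<longleftrightarrow>
     Px \<in> borel \<rightarrow>\<^sub>M prob_algebra borel \<and>
     (\<forall>A\<in>sets borel. \<forall>B\<in>sets borel.
        emeasure P (A \<times> B) = (\<integral>\<^sup>+ x\<in>A. emeasure (Px x) B \<partial>marginal P))"

definition conditional_loss ::
    "(real \<Rightarrow> real \<Rightarrow> real) \<Rightarrow> (real ^ 'n \<Rightarrow> real measure) \<Rightarrow> real ^ 'n \<Rightarrow> real \<Rightarrow> real" where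
  "conditional_loss l Px x \<alpha> = (\<integral>y. l \<alpha> y \<partial>Px x)"

text \<open>Integrability of \<open>l 0 y\<close>, together with the bound on the derivative of the loss, makes
  \<^const>\<open>conditional_loss\<close> a genuine (finite) integral for almost every \<open>x\<close>.\<close>

definition compatibility_assms ::
    "(real \<Rightarrow> real \<Rightarrow> real) \<Rightarrow> ((real ^ 'n) \<times> real) measure \<Rightarrow> (real ^ 'n \<Rightarrow> real measure) \<Rightarrow> bool" where
  "compatibility_assms l P Px \<longleftrightarrow>
     (AE x in marginal P. filterlim (conditional_loss l Px x) at_top at_infinity) \<and>
     integrable P (\<lambda>(x, y). l 0 y) \<and>
     (\<exists>f. integrable (marginal P) f \<and>
        (AE x in marginal P. \<forall>\<alpha>. conditional_loss l Px x (f x) \<le> conditional_loss l Px x \<alpha>))"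

definition risk ::
    "(real \<Rightarrow> real \<Rightarrow> real) \<Rightarrow> ((real ^ 'n) \<times> real) measure \<Rightarrow> ('n::finite) param measure \<Rightarrow> real" where
  "risk l P \<pi> = (\<integral>(x, y). l (network \<pi> x) y \<partial>P)"

definition delta_risk ::
    "(real \<Rightarrow> real \<Rightarrow> real) \<Rightarrow> ((real ^ 'n) \<times> real) measure \<Rightarrow> ('n::finite) param measure \<Rightarrow> 'n param \<Rightarrow> real"
  where
  "delta_risk l P \<pi> \<theta> = (\<integral>(x, y). D1 l (network \<pi> x) y * phi \<theta> x \<partial>P)"

definition grad_delta_risk ::
    "(real \<Rightarrow> real \<Rightarrow> real) \<Rightarrow> ((real ^ 'n) \<times> real) measure \<Rightarrow> ('n::finite) param measure \<Rightarrow> 'n param \<Rightarrow> 'n param"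
  where
  "grad_delta_risk l P \<pi> \<theta> = (\<integral>(x, y). D1 l (network \<pi> x) y *\<^sub>R grad_phi \<theta> x \<partial>P)"

text \<open>Only the values \<open>flow t\<close> with \<open>t \<ge> 0\<close> are relevant.\<close>

definition wasserstein_gradient_flow ::
    "(real \<Rightarrow> real \<Rightarrow> real) \<Rightarrow> ((real ^ 'n) \<times> real) measure \<Rightarrow> ('n::finite) param measure
      \<Rightarrow> (real \<Rightarrow> 'n param measure) \<Rightarrow> bool" where
  "wasserstein_gradient_flow l P \<pi>0 flow \<longleftrightarrow>
     (\<forall>t\<ge>0. flow t \<in> P2) \<and>
     flow 0 = \<pi>0 \<and>
     locally_AC_curve wasserstein2 flow \<and>
     (\<forall>\<psi>. test_function \<psi> \<longrightarrow>
        (AE t in lborel. t > 0 \<longrightarrow>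
           ((\<lambda>s. \<integral>\<theta>. \<psi> \<theta> \<partial>flow s) has_real_derivative
              - (\<integral>\<theta>. gradient \<psi> \<theta> \<bullet> grad_delta_risk l P (flow t) \<theta> \<partial>flow t)) (at t)))"

text \<open>The limits are functions on \<open>closure Theta\<close> only; \<^const>\<open>extensional\<close> fixes their values
  elsewhere, so that limits agreeing on \<open>closure Theta\<close> are not counted as different.\<close>

definition Omega_lim ::
    "(real \<Rightarrow> real \<Rightarrow> real) \<Rightarrow> ((real ^ 'n) \<times> real) measure \<Rightarrow> (real \<Rightarrow> ('n::finite) param measure)
      \<Rightarrow> (('n param \<Rightarrow> real) \<times> ('n param \<Rightarrow> 'n param)) set" where
  "Omega_lim l P flow =
     {(g, V). g \<in> extensional (closure Theta) \<and> V \<in> extensional (closure Theta) \<and>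
        (\<exists>t :: nat \<Rightarrow> real. (\<forall>n. t n \<ge> 0) \<and> filterlim t at_top sequentially \<and>
           locally_uniform_limit (closure Theta) (\<lambda>n. delta_risk l P (flow (t n))) g sequentially \<and>
           locally_uniform_limit (closure Theta) (\<lambda>n. grad_delta_risk l P (flow (t n))) V sequentially)}"

definition tangential :: "'a::real_inner \<Rightarrow> 'a \<Rightarrow> 'a" where
  "tangential \<theta> v = v - (\<theta> \<bullet> v) *\<^sub>R \<theta>"

definition morse_sard ::
    "(real \<Rightarrow> real \<Rightarrow> real) \<Rightarrow> ((real ^ 'n) \<times> real) measure \<Rightarrow> (real \<Rightarrow> ('n::finite) param measure) \<Rightarrow> bool"
  where
  "morse_sard l P flow \<longleftrightarrow>
     (\<forall>(g, V) \<in> Omega_lim l P flow. AE s in lborel.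
        \<forall>\<theta> \<in> closure Theta. norm \<theta> = 1 \<and> g \<theta> = s \<longrightarrow> tangential \<theta> (V \<theta>) \<noteq> 0)"

end

theory Submission
  imports Defs "HOL-Complex_Analysis.Complex_Analysis"
begin

text \<open>The velocity field \<open>- \<nabla>\<delta>\<R>(\<pi>\<^sub>t)\<close> is Lipschitz on the cone \<open>closure Theta\<close> and homogeneous of
  degree one, so the gradient flow is the image of \<open>\<pi>\<^sub>0\<close> under the flow maps \<open>X\<^sub>t\<close>, which preserve
  the cone. By homogeneity the second moment has derivative \<open>- 4 \<integral>\<delta>\<R>(\<pi>\<^sub>t) d\<pi>\<^sub>t\<close>, which convexity of the
  risk bounds above by a constant; the second moment therefore grows at most linearly. The potentials and
  their gradients are equi-Lipschitz on the unit ball of the cone, whence limits exist by Arzela and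
  Ascoli.

  If \<open>(g, V)\<close> is the only limit, then \<open>g\<close> cannot be negative anywhere: by the Morse-Sard condition and
  omni-directionality, a set of trajectories of positive mass would grow exponentially. As \<open>g\<close> is odd
  in \<open>a\<close>, it vanishes. If the risk then stayed above \<open>\<R>(\<pi>) + e\<close> for some \<open>\<pi>\<close>, convexity would make
  the second moment decrease at a linear rate forever, which is absurd.

  Conversely, along a minimising sequence the conditional excess losses tend to \<open>0\<close> almost everywhere
  up to a subsequence, because the span of the features is dense and a pointwise minimiser of the
  conditional loss exists. Coercivity then forces the conditional derivatives of the loss to \<open>0\<close>, and
  with them every limit of potentials and gradients.\<close>

section \<open>Absolutely continuous curves and derivatives\<close>

text \<open>The flow is given only through test functions that do not depend on time, with a null
  set of times that may vary with the test function, whereas all later arguments need trajectories.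
  The velocity is merely Lipschitz, so a test function pulled back along the flow maps is no longer
  smooth and uniqueness by duality is out of reach. It is replaced by smooth supersolutions attached
  to single trajectories; their products control unions of balls, which gives mass inequalities on
  compact sets, and regularity together with total mass one turns these into the identity of
  \<open>distr_flow_map\<close>. Lipschitz continuity of the gradient is special to the cone: the
  ReLU gradient jumps across a hyperplane by a height proportional to \<bar>a\<bar>, the data
  condition controls the norm of u times the mass of switching inputs, and \<bar>a\<bar> \<le>
  \<open>norm u\<close> joins the two. The risk is never differentiated in time. Convexity compares
  it with the potential frozen at the later of two times, which is why monotonicity is always read
  off left difference quotients.\<close>

lemma absolutely_continuous_zero_derivative:
  fixes G M :: "real \<Rightarrow> real"
  assumes T: "0 \<le> T"
    and M: "integrable lborel M" "\<And>r. 0 \<le> M r"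
    and inc: "\<And>s t. 0 \<le> s \<Longrightarrow> s \<le> t \<Longrightarrow> t \<le> T \<Longrightarrow> \<bar>G t - G s\<bar> \<le> (LINT r:{s..t}|lborel. M r)"
    and ae: "AE t in lborel. 0 < t \<and> t < T \<longrightarrow> (G has_real_derivative 0) (at t)"
  shows "G T = G 0"
proof -
  \<comment> \<open>\<open>\<nu>\<close> dominates the increments of \<open>G\<close> and does not
    charge null sets of times. By outer regularity the bad times lie in an open set of small
    \<open>\<nu>\<close>-mass; there the domination is used, at all other times the zero
    derivative.\<close>
  define \<nu> where "\<nu> = density lborel (\<lambda>r. ennreal (M r))"
  have Mm[measurable]: "M \<in> borel_measurable borel"
    using borel_measurable_integrable[OF M(1)] by simp
  have sn[simp]: "sets \<nu> = sets borel" "space \<nu> = UNIV" by (auto simp: \<nu>_def)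
  have em: "emeasure \<nu> A = (\<integral>\<^sup>+ r. ennreal (M r) * indicator A r \<partial>lborel)" if "A \<in> sets borel" for A
    unfolding \<nu>_def by (subst emeasure_density) (use that in auto)
  have fin: "emeasure \<nu> (space \<nu>) \<noteq> \<infinity>"
    using M by (simp add: em nn_integral_eq_integral)
  interpret finite_measure \<nu> by standard (use fin in simp)
  have msr: "measure \<nu> {s..t} = (LINT r:{s..t}|lborel. M r)" for s t
  proof -
    have i: "integrable lborel (\<lambda>r. M r * indicator {s..t} r)"
      using integrable_mult_indicator[of "{s..t}" lborel M] M(1) by (simp add: mult.commute)
    have "emeasure \<nu> {s..t} = (\<integral>\<^sup>+ r. ennreal (M r * indicator {s..t} r) \<partial>lborel)"
      by (subst em) (auto intro!: nn_integral_cong simp: indicator_def)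
    also have "\<dots> = ennreal (\<integral>r. M r * indicator {s..t} r \<partial>lborel)"
      by (rule nn_integral_eq_integral[OF i]) (use M(2) in auto)
    finally show ?thesis
      by (simp add: measure_def set_lebesgue_integral_def mult.commute M(2) integral_nonneg_AE)
  qed
  obtain N where N: "N \<in> null_sets lborel" "{t. \<not> (0 < t \<and> t < T \<longrightarrow> (G has_real_derivative 0) (at t))} \<subseteq> N"
    using ae by (auto elim!: AE_E simp: null_sets_def)
  \<comment> \<open>The derivative is known in the open interval only, so both endpoints count as
    bad times.\<close>
  define N' where "N' = N \<union> {0, T}"
  have N': "N' \<in> null_sets lborel"
    unfolding N'_def using N(1) by (intro null_sets.Un) (auto simp: finite_imp_null_set_lborel)
  have N'b: "N' \<in> sets borel" using N' by (auto simp: null_sets_def)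
  have "emeasure \<nu> N' = 0"
    unfolding em[OF N'b] using N'b AE_not_in[OF N'] by (subst nn_integral_0_iff_AE) auto
  then have inf0: "(INF U \<in> {U. N' \<subseteq> U \<and> open U}. emeasure \<nu> U) = 0"
    using outer_regular[of \<nu> N'] N'b fin by simp
  have key: "\<bar>G T - G 0\<bar> \<le> e * T + e" if e: "e > 0" for e
  proof -
    obtain U where U: "N' \<subseteq> U" "open U" "emeasure \<nu> U < ennreal e"
      using INF_less_iff[of "emeasure \<nu>" "{U. N' \<subseteq> U \<and> open U}" "ennreal e"] inf0 e by auto
    have Ub: "U \<in> sets borel" using U(2) by auto
    have mU: "measure \<nu> U \<le> e"
      using U(3) e by (simp add: emeasure_eq_measure ennreal_less_iff less_imp_le)
    \<comment> \<open>This estimate adds up over adjacent intervals, so bisection reduces it to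
      short intervals around a single point. Half-open intervals keep the pieces disjoint.\<close>
    let ?P = "\<lambda>a b. 0 \<le> a \<and> b \<le> T \<longrightarrow> \<bar>G b - G a\<bar> \<le> e * (b - a) + measure \<nu> (U \<inter> {a<..b})"
    have "?P 0 T"
    proof (rule Bolzano[where P = ?P, OF T])
      fix a b c assume 1: "?P a b" "?P b c" "a \<le> b" "b \<le> c"
      have "measure \<nu> (U \<inter> {a<..b}) + measure \<nu> (U \<inter> {b<..c}) = measure \<nu> (U \<inter> {a<..c})"
        by (subst finite_measure_Union[symmetric])
           (use 1 Ub in \<open>auto intro!: arg_cong[where f="measure \<nu>"] simp: sn\<close>)
      then show "?P a c" using 1 by (auto simp: algebra_simps)
    next
      fix x assume 2: "0 \<le> x" "x \<le> T"
      show "\<exists>d>0. \<forall>a b. a \<le> x \<and> x \<le> b \<and> b - a < d \<longrightarrow> ?P a b"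
      proof (cases "x \<in> N'")
        case True
        then obtain d where d: "d > 0" "ball x d \<subseteq> U" using U by (meson open_contains_ball subsetD)
        have st: "\<bar>G b - G a\<bar> \<le> e * (b - a) + measure \<nu> (U \<inter> {a<..b})"
          if ab: "a \<le> x \<and> x \<le> b \<and> b - a < d" "0 \<le> a \<and> b \<le> T" for a b
        proof -
          have abd: "{a..b} \<subseteq> ball x d" using ab by (auto simp: dist_real_def)
          have "{a<..b} \<subseteq> {a..b}" by auto
          also note abd also note d(2)
          finally have sub: "U \<inter> {a<..b} = {a<..b}" by auto
          have "\<bar>G b - G a\<bar> \<le> measure \<nu> {a..b}" using inc[of a b] ab by (auto simp: msr)
          also have "measure \<nu> {a..b} = measure \<nu> ({a} \<union> {a<..b})"
            using ab by (intro arg_cong[where f="measure \<nu>"]) auto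
          also have "\<dots> = measure \<nu> {a} + measure \<nu> {a<..b}"
            by (subst finite_measure_Union) auto
          also have "measure \<nu> {a} = 0"
          proof -
            have "emeasure \<nu> {a} = 0"
              by (subst em) (auto simp: nn_integral_0_iff_AE AE_lborel_singleton[THEN eventually_mono])
            then show ?thesis by (simp add: measure_def)
          qed
          finally have le: "\<bar>G b - G a\<bar> \<le> measure \<nu> {a<..b}" by simp
          moreover have "0 \<le> e * (b - a)" using ab e by (intro mult_nonneg_nonneg) auto
          ultimately show ?thesis unfolding sub by linarith
        qed
        show ?thesis using d(1) st by auto
      next
        case False
        then have x: "0 < x" "x < T" "x \<notin> N" using 2 by (auto simp: N'_def less_le)
        then have "(G has_real_derivative 0) (at x)" using N(2) by auto
        then have "(\<lambda>h. (G (x + h) - G x) / h) \<midarrow>0\<rightarrow> 0" by (simp add: DERIV_def)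
        then obtain d where d: "d > 0" "\<And>h. h \<noteq> 0 \<Longrightarrow> \<bar>h\<bar> < d \<Longrightarrow> \<bar>(G (x + h) - G x) / h\<bar> < e"
          using e by (auto simp: LIM_def)
        have d': "\<bar>G y - G x\<bar> \<le> e * \<bar>y - x\<bar>" if "\<bar>y - x\<bar> < d" for y
          using d(2)[of "y - x"] that by (cases "y = x") (auto simp: abs_divide divide_simps mult.commute split: if_splits)
        show ?thesis
        proof (intro exI[of _ d] conjI d allI impI)
          fix a b assume ab: "a \<le> x \<and> x \<le> b \<and> b - a < d" "0 \<le> a \<and> b \<le> T"
          have "\<bar>G b - G a\<bar> \<le> \<bar>G b - G x\<bar> + \<bar>G a - G x\<bar>" by simp
          also have "\<dots> \<le> e * \<bar>b - x\<bar> + e * \<bar>a - x\<bar>" using ab by (intro add_mono d') auto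
          also have "\<dots> = e * (b - a)" using ab by (auto simp: algebra_simps)
          finally show "\<bar>G b - G a\<bar> \<le> e * (b - a) + measure \<nu> (U \<inter> {a<..b})"
            by (smt (verit) measure_nonneg)
        qed
      qed
    qed
    then have "\<bar>G T - G 0\<bar> \<le> e * T + measure \<nu> (U \<inter> {0<..T})" by simp
    also have "measure \<nu> (U \<inter> {0<..T}) \<le> measure \<nu> U" by (intro finite_measure_mono) (use Ub in auto)
    finally show ?thesis using mU by simp
  qed
  have "\<bar>G T - G 0\<bar> \<le> 0 + e'" if "e' > 0" for e'
  proof -
    have "\<bar>G T - G 0\<bar> \<le> (e' / (T+1)) * T + e' / (T+1)" using that T by (intro key) simp
    also have "\<dots> = (e' / (T+1)) * (T+1)" by (simp only: distrib_left mult_1_right)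
    also have "\<dots> = e'" using T by simp
    finally show ?thesis by simp
  qed
  then have "\<bar>G T - G 0\<bar> \<le> 0" by (rule field_le_epsilon)
  then show ?thesis by simp
qed

text \<open>Subtracting the integral of \<open>k\<close> leaves a curve with dominated increments
  and zero derivative almost everywhere, hence a constant. Continuity of \<open>k\<close> thus
  removes the exceptional null set and also yields the one-sided derivative at 0.\<close>

lemma absolutely_continuous_derivative:
  fixes F k m :: "real \<Rightarrow> real"
  assumes m: "\<And>T. T > 0 \<Longrightarrow> set_integrable lborel {0..T} m"
    and inc: "\<And>T. T > 0 \<Longrightarrow> \<exists>C. \<forall>s t. 0 \<le> s \<and> s \<le> t \<and> t \<le> T \<longrightarrow> \<bar>F t - F s\<bar> \<le> C * (LINT r:{s..t}|lborel. m r)"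
    and ae: "AE t in lborel. t > 0 \<longrightarrow> (F has_real_derivative k t) (at t)"
    and k: "continuous_on {0..} k"
    and t: "0 \<le> t"
  shows "(F has_real_derivative k t) (at t within {0..})"
proof -
  have eq: "F t = F 0 + integral {0..t} k" if T: "0 \<le> t" for t
  proof -
    define T where "T = t + 1"
    have Tp: "T > 0" "t < T" using that by (auto simp: T_def)
    obtain C where C: "\<And>s t. 0 \<le> s \<Longrightarrow> s \<le> t \<Longrightarrow> t \<le> T \<Longrightarrow> \<bar>F t - F s\<bar> \<le> C * (LINT r:{s..t}|lborel. m r)"
      using inc[OF Tp(1)] by blast
    have kc: "continuous_on {0..T} k" using k by (rule continuous_on_subset) auto
    then have "compact (k ` {0..T})" by (intro compact_continuous_image) auto
    then obtain B where B: "\<And>r. r \<in> {0..T} \<Longrightarrow> \<bar>k r\<bar> \<le> B"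
      using compact_imp_bounded bounded_iff by (metis imageI real_norm_def)
    have B0: "B \<ge> 0" using B[of 0] Tp by auto
    \<comment> \<open>One majorant for the increments of \<open>F\<close> and of the integral of
      \<open>k\<close>: \<open>C\<close> may have either sign, \<open>B\<close> bounds
      \<open>k\<close> on the compact interval, and the indicator makes the whole integrable over
      the line.\<close>
    define M where "M = (\<lambda>r. indicator {0..T} r * (\<bar>C\<bar> * \<bar>m r\<bar> + B))"
    define G where "G = (\<lambda>s. F s - integral {0..s} k)"
    have ki: "k integrable_on {a..b}" if "0 \<le> a" "b \<le> T" for a b
      using that by (intro integrable_continuous_interval continuous_on_subset[OF kc]) auto
    have mi: "set_integrable lborel {a..b} m" if "0 \<le> a" "b \<le> T" for a b
      using that by (intro set_integrable_subset[OF m[OF Tp(1)]]) auto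
    have Mi: "set_integrable lborel {a..b} (\<lambda>r. \<bar>C\<bar> * \<bar>m r\<bar> + B)" if "0 \<le> a" "b \<le> T" for a b
      by (intro set_integral_add set_integrable_mult_right set_integrable_abs mi that)
         (auto simp: set_integrable_def integrable_indicator_iff emeasure_lborel_Icc_eq)
    have "G t = G 0"
    proof (rule absolutely_continuous_zero_derivative[OF T, where M = M])
      show "integrable lborel M"
        using Mi[of 0 T] by (simp add: M_def set_integrable_def)
      show "0 \<le> M r" for r using B0 by (simp add: M_def)
      show "\<bar>G b - G a\<bar> \<le> (LINT r:{a..b}|lborel. M r)" if ab: "0 \<le> a" "a \<le> b" "b \<le> t" for a b
      proof -
        have bT: "b \<le> T" using ab Tp by simp
        have "integral {0..a} k + integral {a..b} k = integral {0..b} k"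
          using ab bT by (intro Henstock_Kurzweil_Integration.integral_combine ki) auto
        then have "\<bar>G b - G a\<bar> \<le> \<bar>F b - F a\<bar> + \<bar>integral {a..b} k\<bar>" by (simp add: G_def)
        also have "\<bar>F b - F a\<bar> \<le> C * (LINT r:{a..b}|lborel. m r)" using C ab bT by simp
        also have "\<dots> \<le> \<bar>C\<bar> * \<bar>LINT r:{a..b}|lborel. m r\<bar>" by (metis abs_ge_self abs_mult)
        also have "\<bar>LINT r:{a..b}|lborel. m r\<bar> \<le> (LINT r:{a..b}|lborel. \<bar>m r\<bar>)"
          using set_integral_norm_bound[OF mi[of a b]] ab bT by simp
        also have "\<bar>integral {a..b} k\<bar> \<le> B * (b - a)"
          using integral_bound[of a b k B] continuous_on_subset[OF kc, of "{a..b}"] ab bT B by auto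
        also have "B * (b - a) = (LINT r:{a..b}|lborel. B)"
          using ab by (simp add: set_lebesgue_integral_def)
        also have "\<bar>C\<bar> * (LINT r:{a..b}|lborel. \<bar>m r\<bar>) + (LINT r:{a..b}|lborel. B) = (LINT r:{a..b}|lborel. \<bar>C\<bar> * \<bar>m r\<bar> + B)"
          using mi[of a b] ab bT
          by (subst set_integral_add) (auto intro!: set_integrable_mult_right set_integrable_abs
              simp: set_integrable_def[of _ _ "\<lambda>_. B"] integrable_indicator_iff emeasure_lborel_Icc_eq)
        also have "\<dots> = (LINT r:{a..b}|lborel. M r)"
          unfolding set_lebesgue_integral_def M_def using ab bT
          by (intro Bochner_Integration.integral_cong) (auto simp: indicator_def)
        finally show ?thesis by (simp add: mult_left_mono)
      qed
      show "AE r in lborel. 0 < r \<and> r < t \<longrightarrow> (G has_real_derivative 0) (at r)"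
        using ae
      proof (rule eventually_mono, intro impI)
        fix r assume r: "0 < r \<longrightarrow> (F has_real_derivative k r) (at r)" "0 < r \<and> r < t"
        have "((\<lambda>u. integral {0..u} k) has_real_derivative k r) (at r within {0..T})"
          using r Tp by (intro integral_has_real_derivative kc) auto
        then have "((\<lambda>u. integral {0..u} k) has_real_derivative k r) (at r)"
          using r Tp by (subst (asm) at_within_interior) auto
        then show "(G has_real_derivative 0) (at r)"
          unfolding G_def using r by (auto intro!: derivative_eq_intros)
      qed
    qed
    then show ?thesis by (simp add: G_def)
  qed
  have "((\<lambda>u. integral {0..u} k) has_real_derivative k t) (at t within {0..t+1})"
    using t by (intro integral_has_real_derivative continuous_on_subset[OF k]) auto
  then have "((\<lambda>u. F 0 + integral {0..u} k) has_real_derivative k t) (at t within {0..t+1})"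
    by (auto intro!: derivative_eq_intros)
  then have "(F has_real_derivative k t) (at t within {0..t+1})"
    by (rule has_field_derivative_transform_within[where d=1]) (use t in \<open>auto simp: eq[symmetric]\<close>)
  moreover have "at t within {0..t+1} = at t within {0..}"
    by (rule at_within_nhd[where S="{..<t+1}"]) auto
  ultimately show ?thesis by simp
qed

text \<open>A one-sided Dini criterion, suited to increments estimated with data frozen at the later
  time \<open>t\<close>. Tilting \<open>F\<close> by a small slope \<open>e\<close>, one looks at
  the first point where the tilted function reaches its final value: immediately to the left of it
  the function is smaller, against the hypothesis.\<close>

lemma nonincreasing_left_derivative:
  fixes F :: "real \<Rightarrow> real"
  assumes cont: "continuous_on {a..b} F" and ab: "a \<le> b"
    and left: "\<And>t e. a < t \<Longrightarrow> t \<le> b \<Longrightarrow> 0 < e \<Longrightarrow>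
       \<exists>d>0. \<forall>s. a \<le> s \<longrightarrow> t - d < s \<longrightarrow> s < t \<longrightarrow> F t - F s \<le> e * (t - s)"
  shows "F b \<le> F a"
proof -
  have key: "F b \<le> F a + e * (b - a)" if e: "e > 0" for e
  proof (rule ccontr)
    assume n: "\<not> ?thesis"
    define G where "G = (\<lambda>t. F t - e * (t - a))"
    have Gc: "continuous_on {a..b} G" unfolding G_def by (intro continuous_intros cont)
    have Gab: "G a < G b" using n by (simp add: G_def)
    define S where "S = {t\<in>{a..b}. G b \<le> G t}"
    have "closed S" unfolding S_def
      using continuous_on_closed_Collect_le[OF continuous_on_const Gc, of "G b"] by simp
    moreover have "bounded S" by (rule bounded_subset[of "{a..b}"]) (auto simp: S_def)
    ultimately have cS: "compact S" by (simp add: compact_eq_bounded_closed)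
    have bS: "b \<in> S" using ab by (auto simp: S_def)
    obtain t where t: "t \<in> S" "\<And>s. s \<in> S \<Longrightarrow> t \<le> s"
      using compact_attains_inf[OF cS] bS by auto
    have "a \<le> t" "t \<le> b" "G b \<le> G t" using t(1) by (simp_all add: S_def)
    moreover have "t \<noteq> a" using \<open>G b \<le> G t\<close> Gab by force
    ultimately have "t \<noteq> a" "a \<le> t" "t \<le> b" by auto
    then have at: "a < t" "t \<le> b" by auto
    obtain d where d: "d > 0" "\<And>s. a \<le> s \<Longrightarrow> t - d < s \<Longrightarrow> s < t \<Longrightarrow> F t - F s \<le> e * (t - s)"
      using left[OF at e] by blast
    define s where "s = max a (t - d/2)"
    have s: "a \<le> s" "t - d < s" "s < t" using d at by (auto simp: s_def)
    have "s \<notin> S" using t(2)[of s] s by linarith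
    then have "G s < G b" using s at by (simp add: S_def)
    moreover have "G b \<le> G t" using t by (auto simp: S_def)
    moreover have "G t \<le> G s" using d(2)[OF s] by (simp add: G_def algebra_simps)
    ultimately show False by simp
  qed
  have "F b \<le> F a + e'" if "e' > 0" for e'
  proof -
    have "F b \<le> F a + (e' / (b - a + 1)) * (b - a)" using that ab by (intro key) simp
    also have "(e' / (b - a + 1)) * (b - a) \<le> e'" using ab that by (simp add: field_simps)
    finally show ?thesis by simp
  qed
  then show ?thesis by (rule field_le_epsilon)
qed

text \<open>Dominated convergence of difference quotients. The Lipschitz bound is required only
  against the base point \<open>t\<close> and within \<open>\<delta>\<close>, so the majorant
  \<open>B\<close> may depend on \<open>t\<close>.\<close>

lemma has_real_derivative_lebesgue_integral:
  fixes u :: "real \<Rightarrow> 'b \<Rightarrow> real"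
  assumes int: "\<And>s. s \<in> S \<Longrightarrow> integrable M (u s)" and t: "t \<in> S"
    and d: "\<And>x. x \<in> space M \<Longrightarrow> ((\<lambda>s. u s x) has_real_derivative u' x) (at t within S)"
    and \<delta>: "0 < \<delta>"
    and lip: "\<And>s x. s \<in> S \<Longrightarrow> \<bar>s - t\<bar> < \<delta> \<Longrightarrow> x \<in> space M \<Longrightarrow> \<bar>u s x - u t x\<bar> \<le> \<bar>s - t\<bar> * B x"
    and B: "integrable M B"
    and u': "u' \<in> borel_measurable M"
  shows "((\<lambda>s. \<integral>x. u s x \<partial>M) has_real_derivative (\<integral>x. u' x \<partial>M)) (at t within S)"
  unfolding has_field_derivative_iff tendsto_at_iff_sequentially comp_def
proof (intro allI impI)
  fix X :: "nat \<Rightarrow> real" assume X: "\<forall>i. X i \<in> S - {t}" "X \<longlonglongrightarrow> t"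
  have "eventually (\<lambda>i. \<bar>X i - t\<bar> < \<delta>) sequentially"
    using X(2) \<delta> by (auto simp: tendsto_iff dist_real_def)
  then obtain N where N: "\<And>i. i \<ge> N \<Longrightarrow> \<bar>X i - t\<bar> < \<delta>" by (auto simp: eventually_sequentially)
  have "(\<lambda>i. \<integral>x. (u (X (i+N)) x - u t x) / (X (i+N) - t) \<partial>M) \<longlonglongrightarrow> (\<integral>x. u' x \<partial>M)"
  proof (rule integral_dominated_convergence[where w=B])
    show "u' \<in> borel_measurable M" "integrable M B" by fact+
    show "(\<lambda>x. (u (X (i+N)) x - u t x) / (X (i+N) - t)) \<in> borel_measurable M" for i
      using X int t by (intro borel_measurable_divide borel_measurable_diff borel_measurable_integrable) auto
    show "AE x in M. (\<lambda>i. (u (X (i+N)) x - u t x) / (X (i+N) - t)) \<longlonglongrightarrow> u' x"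
    proof (rule AE_I2)
      fix x assume "x \<in> space M"
      from d[OF this] have "(\<lambda>i. (u (X i) x - u t x) / (X i - t)) \<longlonglongrightarrow> u' x"
        unfolding has_field_derivative_iff tendsto_at_iff_sequentially comp_def using X by auto
      then show "(\<lambda>i. (u (X (i+N)) x - u t x) / (X (i+N) - t)) \<longlonglongrightarrow> u' x"
        by (rule LIMSEQ_ignore_initial_segment)
    qed
    show "AE x in M. norm ((u (X (i+N)) x - u t x) / (X (i+N) - t)) \<le> B x" for i
    proof (rule AE_I2)
      fix x assume x: "x \<in> space M"
      have "X (i+N) \<noteq> t" "X (i+N) \<in> S" using X by auto
      with lip[OF _ N x, of "i+N" ] show "norm ((u (X (i+N)) x - u t x) / (X (i+N) - t)) \<le> B x"
        by (simp add: abs_divide divide_simps mult.commute)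
    qed
  qed
  then have "(\<lambda>i. ((\<integral>x. u (X (i+N)) x \<partial>M) - (\<integral>x. u t x \<partial>M)) / (X (i+N) - t)) \<longlonglongrightarrow> (\<integral>x. u' x \<partial>M)"
    using X int t by (subst (asm) integral_divide_zero, subst (asm) Bochner_Integration.integral_diff) auto
  then show "(\<lambda>i. ((\<integral>x. u (X i) x \<partial>M) - (\<integral>x. u t x \<partial>M)) / (X i - t)) \<longlonglongrightarrow> (\<integral>x. u' x \<partial>M)"
    by (rule LIMSEQ_offset)
qed

section \<open>Smooth functions of compact support\<close>

lemma C_k_Suc_imp: "C_k (Suc k) f \<Longrightarrow> C_k k f"
proof (induction k arbitrary: f)
  case 0
  then show ?case
    by (auto intro!: continuous_at_imp_continuous_on differentiable_imp_continuous_within)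
next
  case (Suc k)
  then show ?case by (metis C_k.simps(2))
qed

lemma C_k_const: "C_k k (\<lambda>x::'a::euclidean_space. c)"
proof (induction k arbitrary: c)
  case (Suc k)
  then show ?case by simp
qed simp

text \<open>Derivatives are unique, so any explicit \<open>D\<close> replaces
  \<open>frechet_derivative\<close>; the closure properties of \<open>C_k\<close> then become plain
  differentiation rules.\<close>

lemma C_k_SucI:
  assumes "\<And>x. (f has_derivative D x) (at x)" "\<And>i. i \<in> Basis \<Longrightarrow> C_k k (\<lambda>x. D x i)"
  shows "C_k (Suc k) f"
proof -
  have "frechet_derivative f (at x) = D x" for x
    using frechet_derivative_at[OF assms(1)[of x]] by simp
  then show ?thesis using assms by (auto simp: differentiable_def)
qed

lemma C_k_has_derivative:
  assumes "C_k (Suc k) f"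
  shows "(f has_derivative frechet_derivative f (at x)) (at x)"
  using assms frechet_derivative_works by auto

lemma C_k_affine: "C_k k (\<lambda>x::'a::euclidean_space. x \<bullet> a + c)"
proof (cases k)
  case (Suc n)
  have "((\<lambda>x::'a. x \<bullet> a + c) has_derivative (\<lambda>h. h \<bullet> a)) (at x)" for x
    by (auto intro!: derivative_eq_intros)
  then show ?thesis unfolding Suc
    by (rule C_k_SucI) (rule C_k_const)
qed (auto intro!: continuous_intros)

lemma C_k_add: "C_k k f \<Longrightarrow> C_k k g \<Longrightarrow> C_k k (\<lambda>x. f x + g x)"
proof (induction k arbitrary: f g)
  case (Suc k)
  have "((\<lambda>x. f x + g x) has_derivative
      (\<lambda>h. frechet_derivative f (at x) h + frechet_derivative g (at x) h)) (at x)" for x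
    by (intro has_derivative_add C_k_has_derivative[OF Suc.prems(1)] C_k_has_derivative[OF Suc.prems(2)])
  then show ?case
    by (rule C_k_SucI) (use Suc in auto)
qed (auto intro!: continuous_intros)

lemma C_k_mult: "C_k k f \<Longrightarrow> C_k k g \<Longrightarrow> C_k k (\<lambda>x. f x * g x)"
proof (induction k arbitrary: f g)
  case (Suc k)
  have "((\<lambda>x. f x * g x) has_derivative
      (\<lambda>h. f x * frechet_derivative g (at x) h + frechet_derivative f (at x) h * g x)) (at x)" for x
    by (intro has_derivative_mult C_k_has_derivative[OF Suc.prems(1)] C_k_has_derivative[OF Suc.prems(2)])
  then show ?case
  proof (rule C_k_SucI)
    fix i :: 'a assume i: "i \<in> Basis"
    show "C_k k (\<lambda>x. f x * frechet_derivative g (at x) i + frechet_derivative f (at x) i * g x)"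
      using Suc.prems i by (intro C_k_add Suc.IH C_k_Suc_imp[of k f] C_k_Suc_imp[of k g]) auto
  qed
qed (auto intro!: continuous_intros)

lemma C_k_cmult: "C_k k f \<Longrightarrow> C_k k (\<lambda>x. c * f x)"
  by (intro C_k_mult C_k_const)

lemma C_k_compose: "C_k k h \<Longrightarrow> C_k k f \<Longrightarrow> C_k k (\<lambda>x. h (f x))"
  for h :: "real \<Rightarrow> real"
proof (induction k arbitrary: f h)
  case 0
  then show ?case by (auto intro: continuous_on_compose2)
next
  case (Suc k)
  let ?h = "\<lambda>z. frechet_derivative h (at z) 1"
  have lin: "frechet_derivative h (at z) y = ?h z * y" for z y
  proof -
    have "h differentiable at z" using Suc.prems(1) by simp
    from linear_scale[OF linear_frechet_derivative[OF this], of y 1]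
    show ?thesis by (simp only: real_scaleR_def mult_1_right mult_1_left mult.commute)
  qed
  have "((\<lambda>x. h (f x)) has_derivative
      (\<lambda>i. ?h (f x) * frechet_derivative f (at x) i)) (at x)" for x
    using has_derivative_compose[OF C_k_has_derivative[OF Suc.prems(2)] C_k_has_derivative[OF Suc.prems(1)], of x]
    by (subst (asm) lin)
  then show ?case
  proof (rule C_k_SucI)
    fix i :: 'a assume i: "i \<in> Basis"
    have "C_k k ?h" using Suc.prems(1) by simp
    then show "C_k k (\<lambda>x. ?h (f x) * frechet_derivative f (at x) i)"
      by (rule C_k_mult[OF Suc.IH[OF _ C_k_Suc_imp[OF Suc.prems(2)]]]) (use Suc.prems(2) i in simp)
  qed
qed

lemma C_k_dist_square: "C_k k (\<lambda>x::'a::euclidean_space. (norm (x - c))\<^sup>2)"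
proof (cases k)
  case (Suc n)
  have "((\<lambda>x::'a. (norm (x - c))\<^sup>2) has_derivative (\<lambda>h. 2 * (h \<bullet> (x - c)))) (at x)" for x
    unfolding power2_norm_eq_inner
    by (auto intro!: derivative_eq_intros simp: inner_commute algebra_simps)
  then show ?thesis unfolding Suc
  proof (rule C_k_SucI)
    fix i :: 'a
    have "(\<lambda>x. 2 * (i \<bullet> (x - c))) = (\<lambda>x. x \<bullet> (2 *\<^sub>R i) + (- 2 * (i \<bullet> c)))"
      by (auto simp: inner_diff_right inner_commute algebra_simps)
    then show "C_k n (\<lambda>x. 2 * (i \<bullet> (x - c)))" by (metis C_k_affine)
  qed
qed (auto intro!: continuous_intros)

lemma poly_exp_tendsto_0: "((\<lambda>y. poly p y * exp (- y)) \<longlongrightarrow> (0::real)) at_top"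
proof -
  have "((\<lambda>y. \<Sum>i\<le>degree p. coeff p i * (y ^ i / exp y)) \<longlongrightarrow> (\<Sum>i\<le>degree p. coeff p i * 0)) at_top"
    by (intro tendsto_sum tendsto_mult tendsto_const tendsto_power_div_exp_0)
  then show ?thesis
    by (simp add: poly_altdef exp_minus sum_distrib_right divide_inverse mult.assoc)
qed

text \<open>The polynomial is arbitrary because this family is closed under differentiation: one
  derivative computation then gives smoothness of all its members by induction.\<close>

definition flat_exp :: "real poly \<Rightarrow> real \<Rightarrow> real" where
  "flat_exp p z = (if z > 0 then poly p (1 / z) * exp (- (1 / z)) else 0)"

lemma flat_exp_tendsto: "((\<lambda>h. flat_exp p h) \<longlongrightarrow> 0) (at 0)"
proof -
  have "((\<lambda>h. poly p (inverse h) * exp (- inverse h)) \<longlongrightarrow> 0) (at_right 0)"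
    by (rule filterlim_compose[OF poly_exp_tendsto_0 filterlim_inverse_at_top_right])
  then have "((\<lambda>h. flat_exp p h) \<longlongrightarrow> 0) (at_right 0)"
    by (rule Lim_transform_eventually)
       (auto simp: flat_exp_def inverse_eq_divide eventually_at_filter)
  moreover have "((\<lambda>h. flat_exp p h) \<longlongrightarrow> 0) (at_left 0)"
    by (rule Lim_transform_eventually[OF tendsto_const])
       (auto simp: flat_exp_def eventually_at_filter)
  ultimately show ?thesis by (simp add: filterlim_split_at)
qed

text \<open>From the chain rule: differentiating p(1/z) exp(-1/z) produces the factor 1/z^2, encoded
  by the polynomial \<open>[:0, 0, 1:]\<close>, and the difference of p and its derivative.\<close>

definition flat_exp_deriv :: "real poly \<Rightarrow> real poly" where
  "flat_exp_deriv p = [:0, 0, 1:] * (p - pderiv p)"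

lemma flat_exp_has_derivative:
  "(flat_exp p has_real_derivative flat_exp (flat_exp_deriv p) z) (at z)"
proof (cases z "0::real" rule: linorder_cases)
  case less
  have "((\<lambda>z. 0) has_real_derivative 0) (at z)" by simp
  then have "(flat_exp p has_real_derivative 0) (at z)"
    by (rule DERIV_cong_ev[THEN iffD1, rotated -1])
       (use less eventually_nhds_in_open[of "{..<0}" z] in \<open>auto simp: flat_exp_def elim!: eventually_mono\<close>)
  then show ?thesis using less by (simp add: flat_exp_def)
next
  case greater
  have "((\<lambda>z. poly p (1 / z) * exp (- (1 / z))) has_real_derivative
     (poly (pderiv p) (1 / z) * (- (1 / z^2))) * exp (- (1 / z)) + poly p (1 / z) * (exp (- (1 / z)) * (1 / z^2))) (at z)"
    using greater
    by (auto intro!: derivative_eq_intros DERIV_chain2[OF poly_DERIV] simp: power2_eq_square field_simps)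
  then have "(flat_exp p has_real_derivative
     (poly (pderiv p) (1 / z) * (- (1 / z^2))) * exp (- (1 / z)) + poly p (1 / z) * (exp (- (1 / z)) * (1 / z^2))) (at z)"
    by (rule DERIV_cong_ev[THEN iffD1, rotated -1])
       (use greater eventually_nhds_in_open[of "{0<..}" z] in \<open>auto simp: flat_exp_def elim!: eventually_mono\<close>)
  then show ?thesis using greater
    by (simp add: flat_exp_def flat_exp_deriv_def power2_eq_square field_simps)
next
  case equal
  \<comment> \<open>Dividing by \<open>h\<close> multiplies by \<open>1 / h\<close>, so the
    difference quotient at 0 is again a member of the family, with the polynomial shifted by one
    degree.\<close>
  have "(\<lambda>h. flat_exp (pCons 0 p) h) \<midarrow>0\<rightarrow> 0" by (rule flat_exp_tendsto)
  then have "(\<lambda>h. (flat_exp p (0 + h) - flat_exp p 0) / h) \<midarrow>0\<rightarrow> 0"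
    by (rule Lim_transform_eventually) (auto simp: flat_exp_def eventually_at_filter)
  then show ?thesis unfolding equal by (simp add: DERIV_def flat_exp_def)
qed

lemma C_k_flat_exp: "C_k k (flat_exp p)"
proof (induction k arbitrary: p)
  case 0
  show ?case
    by (auto intro!: continuous_at_imp_continuous_on DERIV_isCont flat_exp_has_derivative)
next
  case (Suc k)
  have "(flat_exp p has_derivative (\<lambda>h. flat_exp (flat_exp_deriv p) z * h)) (at z)" for z
    using flat_exp_has_derivative by (simp add: has_field_derivative_def)
  then show ?case
    by (rule C_k_SucI) (use Suc in \<open>auto intro: Suc\<close>)
qed

text \<open>The function exp(-1/z), cut off at 0. It is nondecreasing with values between 0 and 1;
  compact support arises only after composition with one minus a rescaled squared distance.\<close>

definition bump :: "real \<Rightarrow> real" where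
  "bump = flat_exp 1"

definition bump' :: "real \<Rightarrow> real" where
  "bump' = flat_exp (flat_exp_deriv 1)"

lemma bump_has_derivative: "(bump has_real_derivative bump' z) (at z)"
  unfolding bump_def bump'_def by (rule flat_exp_has_derivative)

lemma bump_nonneg: "0 \<le> bump z" and bump_le_1: "bump z \<le> 1" and bump_pos_iff: "0 < bump z \<longleftrightarrow> 0 < z"
  and bump'_nonneg: "0 \<le> bump' z" and bump_eq_0: "z \<le> 0 \<Longrightarrow> bump z = 0"
  by (auto simp: bump_def bump'_def flat_exp_def flat_exp_deriv_def)

lemma continuous_bump [continuous_intros]:
  "continuous_on S f \<Longrightarrow> continuous_on S (\<lambda>x. bump (f x))"
  "continuous_on S f \<Longrightarrow> continuous_on S (\<lambda>x. bump' (f x))"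
  using C_k_flat_exp[of 0] unfolding bump_def bump'_def
  by (auto intro: continuous_on_compose2)

lemma C_k_bump: "C_k k bump"
  unfolding bump_def by (rule C_k_flat_exp)

lemma gradient_eq:
  assumes "GDERIV f x :> D"
  shows "gradient f x = D"
  unfolding gradient_def
proof (rule the_equality)
  fix D' assume "GDERIV f x :> D'" 
  then have "(\<lambda>h. h \<bullet> D') = (\<lambda>h. h \<bullet> D)"
    using assms unfolding gderiv_def by (rule has_derivative_unique)
  then have "h \<bullet> D' = h \<bullet> D" for h by (rule fun_cong)
  from this[of "D' - D"] have "(D' - D) \<bullet> (D' - D) = 0" by (simp add: inner_diff_right)
  then show "D' = D" by simp
qed (rule assms)

lemma C_k_GDERIV:
  fixes f :: "'a::euclidean_space \<Rightarrow> real"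
  assumes "C_k 1 f"
  shows "GDERIV f x :> gradient f x" "continuous_on UNIV (gradient f)"
proof -
  let ?G = "\<lambda>x. \<Sum>i\<in>Basis. frechet_derivative f (at x) i *\<^sub>R i"
  have d: "(f has_derivative frechet_derivative f (at x)) (at x)" for x
    using C_k_has_derivative[of 0 f] assms by simp
  have "frechet_derivative f (at x) h = h \<bullet> ?G x" for x h
  proof -
    have l: "linear (frechet_derivative f (at x))" using d has_derivative_linear by blast
    have "frechet_derivative f (at x) h = frechet_derivative f (at x) (\<Sum>i\<in>Basis. (h \<bullet> i) *\<^sub>R i)"
      by (simp add: euclidean_representation)
    also have "\<dots> = (\<Sum>i\<in>Basis. (h \<bullet> i) * frechet_derivative f (at x) i)"
      by (simp add: linear_sum[OF l] linear_scale[OF l])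
    finally show ?thesis by (simp add: inner_sum_right mult.commute)
  qed
  then have "frechet_derivative f (at x) = (\<lambda>h. h \<bullet> ?G x)" for x by blast
  then have G: "GDERIV f x :> ?G x" for x
    unfolding gderiv_def using d[of x] by metis
  then have e: "gradient f = ?G" by (intro ext gradient_eq)
  then show "GDERIV f x :> gradient f x" using G by simp
  show "continuous_on UNIV (gradient f)"
    unfolding e using assms by (intro continuous_intros) auto
qed

section \<open>Flows of Lipschitz fields\<close>

text \<open>Gronwall for the squared norm, which unlike the norm is differentiable at 0: exp(-2 L t)
  times the squared norm of \<open>w\<close> does not increase.\<close>

lemma norm_le_exp_of_inner_le:
  fixes w :: "real \<Rightarrow> 'a::real_inner"
  assumes d: "\<And>t. 0 \<le> t \<Longrightarrow> t \<le> T \<Longrightarrow> (w has_vector_derivative w' t) (at t within {0..T})"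
    and le: "\<And>t. 0 \<le> t \<Longrightarrow> t \<le> T \<Longrightarrow> w t \<bullet> w' t \<le> L * (w t \<bullet> w t)"
    and t: "0 \<le> t" "t \<le> T"
  shows "norm (w t) \<le> exp (L * t) * norm (w 0)"
proof -
  define h where "h = (\<lambda>s. exp (- 2 * L * s) * (w s \<bullet> w s))"
  have hd: "(h has_real_derivative exp (- 2 * L * s) * (2 * (w s \<bullet> w' s) - 2 * L * (w s \<bullet> w s))) (at s within {0..T})"
    if "0 \<le> s" "s \<le> T" for s
    unfolding h_def using d[OF that]
    unfolding has_real_derivative_iff_has_vector_derivative
    by (auto intro!: derivative_eq_intros simp: has_vector_derivative_def has_field_derivative_def
        inner_commute algebra_simps)
  have "h t \<le> h 0"
  proof (rule DERIV_nonpos_imp_decreasing_open[OF t(1)])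
    fix s assume s: "0 < s" "s < t"
    have "(h has_real_derivative exp (- 2 * L * s) * (2 * (w s \<bullet> w' s) - 2 * L * (w s \<bullet> w s))) (at s)"
      using hd[of s] s t at_within_Icc_at[of 0 s T] by auto
    moreover have "exp (- 2 * L * s) * (2 * (w s \<bullet> w' s) - 2 * L * (w s \<bullet> w s)) \<le> 0"
      using le[of s] s t by (intro mult_nonneg_nonpos) auto
    ultimately show "\<exists>y. (h has_real_derivative y) (at s) \<and> y \<le> 0" by blast
  next
    have "continuous_on {0..T} h"
      using hd by (auto simp: continuous_on_eq_continuous_within intro!: DERIV_continuous)
    then show "continuous_on {0..t} h" by (rule continuous_on_subset) (use t in auto)
  qed
  then have "exp (- 2 * L * t) * (norm (w t))\<^sup>2 \<le> (norm (w 0))\<^sup>2"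
    by (simp add: h_def power2_norm_eq_inner)
  then have le2: "exp (2 * L * t) * (exp (- 2 * L * t) * (norm (w t))\<^sup>2) \<le> exp (2 * L * t) * (norm (w 0))\<^sup>2"
    by (intro mult_left_mono) auto
  have e1: "exp (2 * L * t) * (exp (- 2 * L * t) * (norm (w t))\<^sup>2) = (norm (w t))\<^sup>2"
    by (simp add: mult.assoc[symmetric] exp_add[symmetric])
  have e2: "exp (2 * L * t) * (norm (w 0))\<^sup>2 = (exp (L * t) * norm (w 0))\<^sup>2"
    by (simp add: power_mult_distrib exp_double[symmetric] mult.assoc)
  have "(norm (w t))\<^sup>2 \<le> (exp (L * t) * norm (w 0))\<^sup>2"
    using le2 unfolding e1 e2 .
  then show ?thesis by (rule power2_le_imp_le) auto
qed

locale lipschitz_field =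
  fixes b :: "real \<Rightarrow> 'a::euclidean_space \<Rightarrow> 'a" and L :: real
  assumes L_pos: "0 < L"
    and lipschitz: "\<And>t x y. 0 \<le> t \<Longrightarrow> norm (b t x - b t y) \<le> L * norm (x - y)"
    and continuous_time: "\<And>x. continuous_on {0..} (\<lambda>t. b t x)"
begin

text \<open>Joint continuity follows from continuity in time at each fixed point because the
  Lipschitz constant in space is the same for all times.\<close>

lemma continuous_field: "continuous_on ({0..} \<times> UNIV) (\<lambda>(t, x). b t x)"
  unfolding continuous_on_def
proof
  fix q :: "real \<times> 'a" assume q: "q \<in> {0..} \<times> UNIV"
  obtain t x where qtx: "q = (t, x)" by (cases q)
  have t: "0 \<le> t" using q qtx by simp
  let ?F = "at (t, x) within {0..} \<times> UNIV"
  have snd: "(snd \<longlongrightarrow> x) ?F"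
    by (auto intro!: tendsto_eq_intros)
  have ev: "eventually (\<lambda>p. fst p \<in> {0..}) ?F"
    unfolding eventually_at_filter by (rule always_eventually) auto
  have "continuous_on ({0..} \<times> UNIV) (\<lambda>p::real \<times> 'a. b (fst p) x)"
    by (rule continuous_on_compose2[OF continuous_time]) (auto intro!: continuous_intros)
  then have "((\<lambda>p. b (fst p) x) \<longlongrightarrow> b t x) ?F"
    using t by (auto simp: continuous_on_def)
  moreover have "((\<lambda>p. b (fst p) (snd p) - b (fst p) x) \<longlongrightarrow> 0) ?F"
  proof (rule Lim_null_comparison)
    show "eventually (\<lambda>p. norm (b (fst p) (snd p) - b (fst p) x) \<le> L * norm (snd p - x)) ?F"
      using ev by (rule eventually_mono) (auto intro: lipschitz)
    show "((\<lambda>p. L * norm (snd p - x)) \<longlongrightarrow> 0) ?F"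
      by (rule tendsto_eq_intros snd refl | simp)+
  qed
  ultimately have "((\<lambda>p. b (fst p) x + (b (fst p) (snd p) - b (fst p) x)) \<longlongrightarrow> b t x + 0) ?F"
    by (rule tendsto_add)
  then show "((\<lambda>(t, x). b t x) \<longlongrightarrow> (case q of (t, x) \<Rightarrow> b t x)) (at q within {0..} \<times> UNIV)"
    by (simp add: case_prod_beta' qtx)
qed

lemma continuous_field_compose:
  assumes "S \<subseteq> {0..}" "continuous_on S x"
  shows "continuous_on S (\<lambda>t. b t (x t))"
proof -
  have "continuous_on S (\<lambda>t. (t, x t))" by (intro continuous_intros assms)
  from continuous_on_compose2[OF continuous_field this] assms(1) show ?thesis by auto
qed

definition solution :: "real \<Rightarrow> (real \<Rightarrow> 'a) \<Rightarrow> bool" where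
  "solution T x \<longleftrightarrow> (\<forall>t\<in>{0..T}. (x has_vector_derivative b t (x t)) (at t within {0..T}))"

lemma solution_diff_le:
  assumes x: "solution T x" and y: "solution T y" and t: "0 \<le> t" "t \<le> T"
  shows "norm (x t - y t) \<le> exp (L * t) * norm (x 0 - y 0)"
proof (rule norm_le_exp_of_inner_le[where w = "\<lambda>t. x t - y t"])
  show "((\<lambda>t. x t - y t) has_vector_derivative (b t (x t) - b t (y t))) (at t within {0..T})"
    if "0 \<le> t" "t \<le> T" for t
    using x y that by (auto simp: solution_def intro!: derivative_eq_intros)
  show "(x t - y t) \<bullet> (b t (x t) - b t (y t)) \<le> L * ((x t - y t) \<bullet> (x t - y t))" if "0 \<le> t" "t \<le> T" for t
  proof -
    have "(x t - y t) \<bullet> (b t (x t) - b t (y t)) \<le> norm (x t - y t) * norm (b t (x t) - b t (y t))"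
      by (rule norm_cauchy_schwarz)
    also have "\<dots> \<le> norm (x t - y t) * (L * norm (x t - y t))"
      using lipschitz[OF that(1)] by (intro mult_left_mono) auto
    finally show ?thesis by (simp add: power2_norm_eq_inner[symmetric] power2_eq_square algebra_simps)
  qed
qed (use t in auto)

lemma solution_unique:
  assumes "solution T x" "solution T y" "x 0 = y 0" "0 \<le> t" "t \<le> T"
  shows "x t = y t"
  using solution_diff_le[OF assms(1,2,4,5)] assms(3) by simp

text \<open>Picard iteration for the rescaled unknown exp(-2 L t) x(t). With the weight rate twice
  the Lipschitz constant the integral operator contracts by 1/2 on all of [0, T] at once, so no
  local solutions have to be glued.\<close>

lemma solution_exists:
  assumes T: "0 \<le> T"
  shows "\<exists>x. solution T x \<and> x 0 = x0"
proof -
  \<comment> \<open>Clamping time makes the iterates bounded continuous functions on the whole line,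
    that is, elements of a complete space.\<close>
  define c where "c = (\<lambda>t. max 0 (min t T))"
  have c: "0 \<le> c t" "c t \<le> T" "t \<in> {0..T} \<Longrightarrow> c t = t" for t using T by (auto simp: c_def)
  have cc: "continuous_on UNIV c" unfolding c_def by (intro continuous_intros)
  \<comment> \<open>\<open>y\<close> stands for the rescaled curve; the exponential undoes the
    weight before the field is evaluated.\<close>
  define g where "g = (\<lambda>(y :: real \<Rightarrow>\<^sub>C 'a) r. b r (exp (2 * L * r) *\<^sub>R apply_bcontfun y r))"
  define \<Phi> where "\<Phi> = (\<lambda>(y :: real \<Rightarrow>\<^sub>C 'a) t. exp (- (2 * L * c t)) *\<^sub>R (x0 + integral {0..c t} (g y)))"
  have gc: "continuous_on {0..T} (g y)" for y
    unfolding g_def by (intro continuous_field_compose continuous_intros) auto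
  have gi: "g y integrable_on {0..u}" if "u \<le> T" for y u
    using that by (intro integrable_continuous_interval continuous_on_subset[OF gc]) auto
  have \<Phi>b: "\<Phi> y \<in> bcontfun" for y
  proof -
    have I: "continuous_on {0..T} (\<lambda>u. exp (- (2 * L * u)) *\<^sub>R (x0 + integral {0..u} (g y)))"
      by (intro continuous_intros indefinite_integral_continuous_1 gi) auto
    have "continuous_on UNIV (\<Phi> y)" unfolding \<Phi>_def
      by (rule continuous_on_compose2[OF I cc]) (use c in auto)
    moreover have "bounded ((\<lambda>u. exp (- (2 * L * u)) *\<^sub>R (x0 + integral {0..u} (g y))) ` {0..T})"
      by (intro compact_imp_bounded compact_continuous_image I) auto
    then have "bounded (range (\<Phi> y))"
      by (rule bounded_subset) (use c in \<open>auto simp: \<Phi>_def\<close>)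
    ultimately show ?thesis by (auto simp: bcontfun_def)
  qed
  define F where "F = (\<lambda>y. Bcontfun (\<Phi> y))"
  have F: "apply_bcontfun (F y) = \<Phi> y" for y
    unfolding F_def by (rule Bcontfun_inverse[OF \<Phi>b])
  have contr: "dist (F y) (F z) \<le> (1/2) * dist y z" for y z
  proof (rule dist_bound)
    fix t
    let ?u = "c t"
    let ?D = "dist y z"
    have D0: "0 \<le> ?D" by simp
    have "((\<lambda>r. L * exp (2 * L * r) * ?D) has_integral (exp (2 * L * ?u) * ?D / 2 - exp (2 * L * 0) * ?D / 2)) {0..?u}"
      using c(1)[of t]
      by (intro fundamental_theorem_of_calculus)
         (auto intro!: derivative_eq_intros simp: has_real_derivative_iff_has_vector_derivative[symmetric])
    then have hi: "((\<lambda>r. L * exp (2 * L * r) * ?D) has_integral ((exp (2 * L * ?u) - 1) * ?D / 2)) {0..?u}"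
      by (simp add: algebra_simps diff_divide_distrib)
    have bd: "norm (g y r - g z r) \<le> L * exp (2 * L * r) * ?D" if "r \<in> {0..?u}" for r
    proof -
      have "norm (g y r - g z r) \<le> L * norm (exp (2 * L * r) *\<^sub>R y r - exp (2 * L * r) *\<^sub>R z r)"
        unfolding g_def using that by (intro lipschitz) auto
      also have "norm (exp (2 * L * r) *\<^sub>R y r - exp (2 * L * r) *\<^sub>R z r) = exp (2 * L * r) * dist (y r) (z r)"
        by (simp add: scaleR_diff_right[symmetric] dist_norm)
      also have "\<dots> \<le> exp (2 * L * r) * ?D" by (intro mult_left_mono dist_bounded) auto
      finally show ?thesis using L_pos by (simp add: mult.assoc)
    qed
    have "norm (integral {0..?u} (\<lambda>r. g y r - g z r)) \<le> integral {0..?u} (\<lambda>r. L * exp (2 * L * r) * ?D)"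
      using gi[OF c(2)] hi bd
      by (intro integral_norm_bound_integral integrable_diff) auto
    also have "\<dots> = (exp (2 * L * ?u) - 1) * ?D / 2" using hi by (rule integral_unique)
    finally have *: "norm (integral {0..?u} (g y) - integral {0..?u} (g z)) \<le> (exp (2 * L * ?u) - 1) * ?D / 2"
      using gi[OF c(2)] by (simp add: Henstock_Kurzweil_Integration.integral_diff)
    have "dist (\<Phi> y t) (\<Phi> z t) = exp (- (2 * L * ?u)) * norm (integral {0..?u} (g y) - integral {0..?u} (g z))"
      by (simp add: \<Phi>_def dist_norm scaleR_diff_right[symmetric])
    also have "\<dots> \<le> exp (- (2 * L * ?u)) * ((exp (2 * L * ?u) - 1) * ?D / 2)"
      by (intro mult_left_mono *) auto
    also have "\<dots> = (exp (- (2 * L * ?u)) * (exp (2 * L * ?u) - 1)) * (?D / 2)" by simp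
    also have "exp (- (2 * L * ?u)) * (exp (2 * L * ?u) - 1) = 1 - exp (- (2 * L * ?u))"
      by (simp add: right_diff_distrib exp_add[symmetric])
    also have "(1 - exp (- (2 * L * ?u))) * (?D / 2) \<le> 1 * (?D / 2)" by (intro mult_right_mono) auto
    finally show "dist (apply_bcontfun (F y) t) (apply_bcontfun (F z) t) \<le> (1/2) * dist y z"
      by (simp add: F)
  qed
  obtain y where y: "F y = y"
    using banach_fix_type[of "1/2" F] contr by auto
  define x where "x = (\<lambda>t. exp (2 * L * t) *\<^sub>R apply_bcontfun y t)"
  have xe: "x t = x0 + integral {0..t} (g y)" if "t \<in> {0..T}" for t
  proof -
    have "apply_bcontfun y t = \<Phi> y t" using F[of y] y by simp
    then show ?thesis using c(3)[OF that] by (simp add: x_def \<Phi>_def exp_add[symmetric])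
  qed
  have "solution T x" unfolding solution_def
  proof
    fix t assume t: "t \<in> {0..T}"
    have "((\<lambda>u. integral {0..u} (g y)) has_vector_derivative g y t) (at t within {0..T})"
      by (rule integral_has_vector_derivative[OF gc t])
    then have "((\<lambda>u. x0 + integral {0..u} (g y)) has_vector_derivative g y t) (at t within {0..T})"
      by (auto intro!: derivative_eq_intros)
    then have "(x has_vector_derivative g y t) (at t within {0..T})"
      by (rule has_vector_derivative_transform[OF t xe, rotated]) auto
    then show "(x has_vector_derivative b t (x t)) (at t within {0..T})" by (simp add: g_def x_def)
  qed
  moreover have "x 0 = x0" using xe[of 0] T by simp
  ultimately show ?thesis by blast
qed

lemma solution_subinterval: "solution T x \<Longrightarrow> S \<le> T \<Longrightarrow> solution S x"
  unfolding solution_def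
  by (metis atLeastAtMost_iff atLeastatMost_subset_iff has_vector_derivative_within_subset order_refl order_trans)

text \<open>The horizon of the chosen solution is \<open>t\<close> itself, so no global solution is
  needed; uniqueness makes the choices for different horizons agree.\<close>

definition flow_map :: "real \<Rightarrow> 'a \<Rightarrow> 'a" where
  "flow_map t x0 = (SOME x. solution t x \<and> x 0 = x0) t"

lemma flow_map_eq:
  assumes x: "solution T x" and t: "0 \<le> t" "t \<le> T"
  shows "flow_map t (x 0) = x t"
proof -
  define y where "y = (SOME y. solution t y \<and> y 0 = x 0)"
  have ys: "solution t y \<and> y 0 = x 0"
    unfolding y_def using someI_ex[OF solution_exists[OF t(1), of "x 0"]] .
  have "y t = x t" by (rule solution_unique[of t]) (use ys solution_subinterval[OF x t(2)] t in auto)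
  then show ?thesis by (simp add: flow_map_def y_def)
qed

lemma flow_map_solution: "solution T (\<lambda>t. flow_map t x0)"
proof (cases "0 \<le> T")
  case True
  obtain x where x: "solution T x" "x 0 = x0" using solution_exists[OF True] by blast
  have e: "flow_map t x0 = x t" if "t \<in> {0..T}" for t using flow_map_eq[OF x(1), of t] x(2) that by simp
  show ?thesis unfolding solution_def
  proof
    fix t assume t: "t \<in> {0..T}"
    have "(x has_vector_derivative b t (x t)) (at t within {0..T})" using x t by (auto simp: solution_def)
    then have "((\<lambda>t. flow_map t x0) has_vector_derivative b t (x t)) (at t within {0..T})"
      by (rule has_vector_derivative_transform[OF t e, rotated]) auto
    then show "((\<lambda>t. flow_map t x0) has_vector_derivative b t (flow_map t x0)) (at t within {0..T})"
      using e[OF t] by simp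
  qed
qed (auto simp: solution_def)

lemma flow_map_0 [simp]: "flow_map 0 x = x"
proof -
  obtain z where "solution 0 z" "z 0 = x" using solution_exists[of 0] by blast
  then show ?thesis using flow_map_eq[of 0 z 0] by simp
qed

lemma flow_map_has_derivative:
  assumes "0 \<le> t"
  shows "((\<lambda>t. flow_map t x) has_vector_derivative b t (flow_map t x)) (at t within {0..})"
proof -
  have "((\<lambda>t. flow_map t x) has_vector_derivative b t (flow_map t x)) (at t within {0..t+1})"
    using flow_map_solution[of "t+1" x] assms by (auto simp: solution_def)
  moreover have "at t within {0..t+1} = at t within {0..}"
    by (rule at_within_nhd[where S="{..<t+1}"]) auto
  ultimately show ?thesis by simp
qed

lemma flow_map_continuous_time: "continuous_on {0..} (\<lambda>t. flow_map t x)"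
  using flow_map_has_derivative
  by (auto simp: continuous_on_eq_continuous_within intro!: has_vector_derivative_continuous)

lemma flow_map_lipschitz:
  assumes "0 \<le> t"
  shows "norm (flow_map t x - flow_map t y) \<le> exp (L * t) * norm (x - y)"
  using solution_diff_le[OF flow_map_solution flow_map_solution assms order_refl, of x y] by simp

lemma flow_map_continuous: "0 \<le> t \<Longrightarrow> continuous_on S (flow_map t)"
  by (rule lipschitz_on_continuous_on[of "exp (L * t)"], rule lipschitz_onI)
     (auto simp: dist_norm flow_map_lipschitz)

text \<open>Time reversal: the field run backwards from \<open>T\<close> is again Lipschitz. The
  \<open>max\<close> keeps its time argument nonnegative, where the assumptions on \<open>b\<close>
  hold.\<close>

lemma flow_map_surj:
  assumes T: "0 \<le> T"
  obtains x where "solution T x" "x T = y"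
proof -
  interpret R: lipschitz_field "\<lambda>t x. - b (max 0 (T - t)) x" L
  proof
    fix t x y
    show "norm (- b (max 0 (T - t)) x - - b (max 0 (T - t)) y) \<le> L * norm (x - y)"
      using lipschitz[of "max 0 (T - t)" x y] by (simp add: norm_minus_commute)
    have "continuous_on {0..} (\<lambda>t. b (max 0 (T - t)) x)"
      by (rule continuous_on_compose2[OF continuous_time]) (auto intro!: continuous_intros)
    then show "continuous_on {0..} (\<lambda>t. - b (max 0 (T - t)) x)" by (intro continuous_intros)
  qed (rule L_pos)
  obtain z where z: "R.solution T z" "z 0 = y" using R.solution_exists[OF T] by blast
  have "solution T (\<lambda>t. z (T - t))" unfolding solution_def
  proof
    fix t assume t: "t \<in> {0..T}"
    have "(z has_vector_derivative - b t (z (T - t))) (at (T - t) within {0..T})"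
      using z(1) t by (auto simp: R.solution_def dest!: bspec[of _ _ "T - t"])
    then have "(z has_vector_derivative - b t (z (T - t))) (at (T - t) within (\<lambda>s. T - s) ` {0..T})"
      by simp
    moreover have "((\<lambda>s. T - s) has_vector_derivative - 1) (at t within {0..T})"
      by (auto intro!: derivative_eq_intros)
    ultimately have "(z \<circ> (\<lambda>s. T - s) has_vector_derivative (- 1) *\<^sub>R (- b t (z (T - t)))) (at t within {0..T})"
      by (intro vector_diff_chain_within)
    then show "((\<lambda>t. z (T - t)) has_vector_derivative b t (z (T - t))) (at t within {0..T})"
      by (simp add: comp_def)
  qed
  moreover have "(\<lambda>t. z (T - t)) T = y" using z by simp
  ultimately show ?thesis by (rule that)
qed

end

section \<open>Uniqueness of weak transport\<close>

lemma test_functionI: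
  fixes f :: "'a::euclidean_space \<Rightarrow> real"
  assumes "\<And>k. C_k k f" "\<And>x. R < norm x \<Longrightarrow> f x = 0"
  shows "test_function f"
proof -
  have "{x. f x \<noteq> 0} \<subseteq> cball 0 R" using assms(2) by (force simp: not_less[symmetric])
  then have "bounded {x. f x \<noteq> 0}" by (rule bounded_subset[OF bounded_cball])
  then show ?thesis unfolding test_function_def using assms(1) by (simp add: compact_closure)
qed

text \<open>Smooth time-dependent functions that do not increase along trajectories. Being 1 outside
  a compact set, one minus such a function is an admissible test function at each time. The class is
  closed under products, so barriers of single balls combine into barriers of unions.\<close>

definition barrier :: "(real \<Rightarrow> 'a::euclidean_space \<Rightarrow> 'a) \<Rightarrow> (real \<Rightarrow> 'a \<Rightarrow> real) \<Rightarrow> (real \<Rightarrow> 'a \<Rightarrow> real) \<Rightarrow> (real \<Rightarrow> 'a \<Rightarrow> 'a) \<Rightarrow> bool" where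
  "barrier b \<Psi> \<Psi>' G \<longleftrightarrow>
     (\<forall>t\<ge>0. \<forall>k. C_k k (\<Psi> t)) \<and>
     (\<forall>T. \<exists>R. \<forall>t\<in>{0..T}. \<forall>x. R < norm x \<longrightarrow> \<Psi> t x = 1) \<and>
     (\<forall>t x. 0 \<le> \<Psi> t x \<and> \<Psi> t x \<le> 1) \<and>
     (\<forall>t\<ge>0. \<forall>x. ((\<lambda>s. \<Psi> s x) has_real_derivative \<Psi>' t x) (at t within {0..})) \<and>
     (\<forall>t\<ge>0. \<forall>x. GDERIV (\<Psi> t) x :> G t x) \<and>
     continuous_on ({0..} \<times> UNIV) (\<lambda>(t, x). \<Psi> t x) \<and>
     continuous_on ({0..} \<times> UNIV) (\<lambda>(t, x). \<Psi>' t x) \<and>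
     continuous_on ({0..} \<times> UNIV) (\<lambda>(t, x). G t x) \<and>
     (\<forall>t\<ge>0. \<forall>x. \<Psi>' t x + G t x \<bullet> b t x \<le> 0)"

lemma barrierD:
  assumes "barrier b \<Psi> \<Psi>' G"
  shows "0 \<le> t \<Longrightarrow> C_k k (\<Psi> t)"
    and "\<exists>R. \<forall>t\<in>{0..T}. \<forall>x. R < norm x \<longrightarrow> \<Psi> t x = 1"
    and "0 \<le> \<Psi> t x" and "\<Psi> t x \<le> 1"
    and "0 \<le> t \<Longrightarrow> ((\<lambda>s. \<Psi> s x) has_real_derivative \<Psi>' t x) (at t within {0..})"
    and "0 \<le> t \<Longrightarrow> GDERIV (\<Psi> t) x :> G t x"
    and "continuous_on ({0..} \<times> UNIV) (\<lambda>(t, x). \<Psi> t x)"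
    and "continuous_on ({0..} \<times> UNIV) (\<lambda>(t, x). \<Psi>' t x)"
    and "continuous_on ({0..} \<times> UNIV) (\<lambda>(t, x). G t x)"
    and "0 \<le> t \<Longrightarrow> \<Psi>' t x + G t x \<bullet> b t x \<le> 0"
proof -
  note A = assms[unfolded barrier_def]
  note c1 = A[THEN conjunct1]
  note c2 = A[THEN conjunct2, THEN conjunct1]
  note c3 = A[THEN conjunct2, THEN conjunct2, THEN conjunct1]
  note c4 = A[THEN conjunct2, THEN conjunct2, THEN conjunct2, THEN conjunct1]
  note c5 = A[THEN conjunct2, THEN conjunct2, THEN conjunct2, THEN conjunct2, THEN conjunct1]
  note c6 = A[THEN conjunct2, THEN conjunct2, THEN conjunct2, THEN conjunct2, THEN conjunct2, THEN conjunct1]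
  note c7 = A[THEN conjunct2, THEN conjunct2, THEN conjunct2, THEN conjunct2, THEN conjunct2, THEN conjunct2, THEN conjunct1]
  note c8 = A[THEN conjunct2, THEN conjunct2, THEN conjunct2, THEN conjunct2, THEN conjunct2, THEN conjunct2, THEN conjunct2, THEN conjunct1]
  note c9 = A[THEN conjunct2, THEN conjunct2, THEN conjunct2, THEN conjunct2, THEN conjunct2, THEN conjunct2, THEN conjunct2, THEN conjunct2]
  show "0 \<le> t \<Longrightarrow> C_k k (\<Psi> t)" using c1 by blast
  show "\<exists>R. \<forall>t\<in>{0..T}. \<forall>x. R < norm x \<longrightarrow> \<Psi> t x = 1" using c2 by (rule spec)
  show "0 \<le> \<Psi> t x" and "\<Psi> t x \<le> 1" using c3 by blast+
  show "0 \<le> t \<Longrightarrow> ((\<lambda>s. \<Psi> s x) has_real_derivative \<Psi>' t x) (at t within {0..})" using c4 by blast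
  show "0 \<le> t \<Longrightarrow> GDERIV (\<Psi> t) x :> G t x" using c5 by blast
  show "0 \<le> t \<Longrightarrow> \<Psi>' t x + G t x \<bullet> b t x \<le> 0" using c9 by blast
  show "continuous_on ({0..} \<times> UNIV) (\<lambda>(t, x). \<Psi> t x)" "continuous_on ({0..} \<times> UNIV) (\<lambda>(t, x). \<Psi>' t x)"
    "continuous_on ({0..} \<times> UNIV) (\<lambda>(t, x). G t x)" by (fact c6, fact c7, fact c8)
qed

lemma barrier_1: "barrier b (\<lambda>t x. 1) (\<lambda>t x. 0) (\<lambda>t x. 0)"
  by (auto simp: barrier_def C_k_const GDERIV_const)

text \<open>By the product rule the transport derivative of the product is a combination of two
  nonpositive terms with the nonnegative factors \<open>\<Phi>\<close> and \<open>\<Psi>\<close> as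
  coefficients.\<close>

lemma barrier_mult:
  assumes "barrier b \<Psi> \<Psi>' G" "barrier b \<Phi> \<Phi>' H"
  shows "barrier b (\<lambda>t x. \<Psi> t x * \<Phi> t x) (\<lambda>t x. \<Psi>' t x * \<Phi> t x + \<Psi> t x * \<Phi>' t x)
     (\<lambda>t x. \<Psi> t x *\<^sub>R H t x + \<Phi> t x *\<^sub>R G t x)"
  unfolding barrier_def
proof (intro conjI allI impI)
  note D = barrierD[OF assms(1)] and E = barrierD[OF assms(2)]
  show "C_k k (\<lambda>x. \<Psi> t x * \<Phi> t x)" if "0 \<le> t" for t k
    by (intro C_k_mult D(1)[OF that] E(1)[OF that])
  show "\<exists>R. \<forall>t\<in>{0..T}. \<forall>x. R < norm x \<longrightarrow> \<Psi> t x * \<Phi> t x = 1" for T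
  proof -
    obtain R where R: "\<forall>t\<in>{0..T}. \<forall>x. R < norm x \<longrightarrow> \<Psi> t x = 1" using D(2) by blast
    obtain S where S: "\<forall>t\<in>{0..T}. \<forall>x. S < norm x \<longrightarrow> \<Phi> t x = 1" using E(2) by blast
    show ?thesis by (intro exI[of _ "max R S"]) (use R S in auto)
  qed
  show "0 \<le> \<Psi> t x * \<Phi> t x" "\<Psi> t x * \<Phi> t x \<le> 1" for t x
    using mult_mono[OF D(4)[of t x] E(4)[of t x]] D(3)[of t x] E(3)[of t x] by auto
  show "((\<lambda>s. \<Psi> s x * \<Phi> s x) has_real_derivative \<Psi>' t x * \<Phi> t x + \<Psi> t x * \<Phi>' t x) (at t within {0..})"
    if "0 \<le> t" for t x
    using DERIV_mult[OF D(5)[OF that] E(5)[OF that]] by (simp add: algebra_simps)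
  show "GDERIV (\<lambda>x. \<Psi> t x * \<Phi> t x) x :> \<Psi> t x *\<^sub>R H t x + \<Phi> t x *\<^sub>R G t x" if "0 \<le> t" for t x
    by (rule GDERIV_mult[OF D(6)[OF that] E(6)[OF that]])
  note c = D(7-9)[unfolded case_prod_beta'] E(7-9)[unfolded case_prod_beta']
  show "continuous_on ({0..} \<times> UNIV) (\<lambda>(t, x). \<Psi> t x * \<Phi> t x)"
    "continuous_on ({0..} \<times> UNIV) (\<lambda>(t, x). \<Psi>' t x * \<Phi> t x + \<Psi> t x * \<Phi>' t x)"
    "continuous_on ({0..} \<times> UNIV) (\<lambda>(t, x). \<Psi> t x *\<^sub>R H t x + \<Phi> t x *\<^sub>R G t x)"
    unfolding case_prod_beta' by (intro continuous_intros c)+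
  show "\<Psi>' t x * \<Phi> t x + \<Psi> t x * \<Phi>' t x + (\<Psi> t x *\<^sub>R H t x + \<Phi> t x *\<^sub>R G t x) \<bullet> b t x \<le> 0" if "0 \<le> t" for t x
  proof -
    have "\<Phi> t x * (\<Psi>' t x + G t x \<bullet> b t x) \<le> 0" "\<Psi> t x * (\<Phi>' t x + H t x \<bullet> b t x) \<le> 0"
      using D(10)[OF that] E(10)[OF that] D(3) E(3) by (auto intro: mult_nonneg_nonpos)
    then show ?thesis by (simp add: algebra_simps)
  qed
qed

lemma barrier_prod:
  assumes "finite I" "\<And>i. i \<in> I \<Longrightarrow> \<exists>\<Psi>' G. barrier b (\<Psi> i) \<Psi>' G"
  shows "\<exists>\<Psi>' G. barrier b (\<lambda>t x. \<Prod>i\<in>I. \<Psi> i t x) \<Psi>' G"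
  using assms
proof (induction I)
  case empty
  then show ?case using barrier_1 by auto
next
  case (insert i I)
  then obtain A B C D where "barrier b (\<Psi> i) A B" "barrier b (\<lambda>t x. \<Prod>i\<in>I. \<Psi> i t x) C D" by blast
  from barrier_mult[OF this] insert(1,2) show ?case by auto
qed

lemma barrier_power:
  assumes "\<exists>\<Psi>' G. barrier b \<Psi> \<Psi>' G"
  shows "\<exists>\<Psi>' G. barrier b (\<lambda>t x. \<Psi> t x ^ m) \<Psi>' G"
  using barrier_prod[of "{..<m}" b "\<lambda>_. \<Psi>"] assms by simp

context lipschitz_field
begin

text \<open>A ball around a trajectory whose radius grows like \<open>exp (L t)\<close> retains whatever the field
  transports: the rescaled distance to the centre decreases along every other trajectory.\<close>

lemma barrier_ball:
  fixes x0 :: 'a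
  assumes r: "0 < r"
  defines "c \<equiv> \<lambda>t. flow_map t x0"
  shows "\<exists>\<Psi>' G. barrier b (\<lambda>t x. 1 - bump (1 - exp (- 2 * L * t) / r\<^sup>2 * (norm (x - c t))\<^sup>2)) \<Psi>' G"
proof -
  let ?k = "\<lambda>t. exp (- 2 * L * t) / r\<^sup>2"
  let ?\<rho> = "\<lambda>t x. ?k t * (norm (x - c t))\<^sup>2"
  let ?P = "\<lambda>t x. bump' (1 - ?\<rho> t x) * (?k t * (- 2 * L * (norm (x - c t))\<^sup>2 - 2 * ((x - c t) \<bullet> b t (c t))))"
  let ?G = "\<lambda>t x. (bump' (1 - ?\<rho> t x) * (2 * ?k t)) *\<^sub>R (x - c t)"
  have cd: "(c has_vector_derivative b t (c t)) (at t within {0..})" if "0 \<le> t" for t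
    unfolding c_def by (rule flow_map_has_derivative[OF that])
  have cc: "continuous_on {0..} c" unfolding c_def by (rule flow_map_continuous_time)
  have cc': "continuous_on ({0..} \<times> UNIV) (\<lambda>p::real \<times> 'a. c (fst p))"
    by (rule continuous_on_compose2[OF cc]) (auto intro!: continuous_intros)
  have bc: "continuous_on ({0..} \<times> UNIV) (\<lambda>p::real \<times> 'a. b (fst p) (c (fst p)))"
    by (rule continuous_on_compose2[OF continuous_field_compose[OF order_refl cc]]) (auto intro!: continuous_intros)
  have "barrier b (\<lambda>t x. 1 - bump (1 - ?\<rho> t x)) ?P ?G"
    unfolding barrier_def
  proof (intro conjI allI impI)
    show "C_k k (\<lambda>x. 1 - bump (1 - ?\<rho> t x))" for t k
    proof -
      have "C_k k (\<lambda>x. 1 + (- 1) * bump (1 + (- ?k t) * (norm (x - c t))\<^sup>2))"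
        by (intro C_k_add C_k_const C_k_cmult C_k_compose[OF C_k_bump] C_k_dist_square)
      then show ?thesis by simp
    qed
    show "\<exists>R. \<forall>t\<in>{0..T}. \<forall>x. R < norm x \<longrightarrow> 1 - bump (1 - ?\<rho> t x) = 1" for T
    proof -
      have "compact (c ` {0..T})"
        by (intro compact_continuous_image continuous_on_subset[OF cc]) auto
      then obtain B where B: "\<And>t. t \<in> {0..T} \<Longrightarrow> norm (c t) \<le> B"
        using compact_imp_bounded bounded_iff by (metis imageI)
      show ?thesis
      proof (intro exI[of _ "B + r * exp (L * T)"] ballI allI impI)
        fix t and x :: 'a assume t: "t \<in> {0..T}" and x: "B + r * exp (L * T) < norm x"
        have "norm x \<le> norm (x - c t) + norm (c t)" by (metis diff_add_cancel norm_triangle_ineq)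
        then have "r * exp (L * T) \<le> norm (x - c t)" using x B[OF t] by simp
        moreover have "r * exp (L * t) \<le> r * exp (L * T)" using r t L_pos by simp
        ultimately have "r * exp (L * t) \<le> norm (x - c t)" by simp
        then have "(r * exp (L * t))\<^sup>2 \<le> (norm (x - c t))\<^sup>2" using r by (intro power_mono) auto
        then have "?k t * (r * exp (L * t))\<^sup>2 \<le> ?\<rho> t x" by (intro mult_left_mono) auto
        \<comment> \<open>The weight is normalised so that the rescaled squared distance equals 1
          exactly at radius \<open>r * exp (L * t)\<close>.\<close>
        moreover have "?k t * (r * exp (L * t))\<^sup>2 = 1"
          using r by (simp add: power_mult_distrib exp_double[symmetric] exp_minus mult.assoc)
        ultimately show "1 - bump (1 - ?\<rho> t x) = 1" by (simp add: bump_eq_0)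
      qed
    qed
    show "0 \<le> 1 - bump (1 - ?\<rho> t x)" "1 - bump (1 - ?\<rho> t x) \<le> 1" for t x
      using bump_nonneg bump_le_1 by auto
    show "((\<lambda>s. 1 - bump (1 - ?\<rho> s x)) has_real_derivative ?P t x) (at t within {0..})" if t: "0 \<le> t" for t x
    proof -
      have n: "((\<lambda>s. (norm (x - c s))\<^sup>2) has_real_derivative - 2 * ((x - c t) \<bullet> b t (c t))) (at t within {0..})"
        unfolding power2_norm_eq_inner using cd[OF t]
        by (auto intro!: derivative_eq_intros simp: has_vector_derivative_def has_field_derivative_def
            inner_commute algebra_simps)
      have "((\<lambda>s. ?\<rho> s x) has_real_derivative
          ?k t * (- 2 * L * (norm (x - c t))\<^sup>2 - 2 * ((x - c t) \<bullet> b t (c t)))) (at t within {0..})"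
      proof -
        have "((\<lambda>s. exp (- 2 * L * s)) has_real_derivative (- 2 * L) * exp (- 2 * L * t)) (at t within {0..})"
          by (auto intro!: derivative_eq_intros)
        from DERIV_cdivide[OF this, of "r\<^sup>2"]
        have "(?k has_real_derivative (- 2 * L) * ?k t) (at t within {0..})" by simp
        from DERIV_mult[OF this n] show ?thesis by (simp add: algebra_simps)
      qed
      from DERIV_diff[OF DERIV_const[of 1] this] have "((\<lambda>s. 1 - ?\<rho> s x) has_real_derivative
          - (?k t * (- 2 * L * (norm (x - c t))\<^sup>2 - 2 * ((x - c t) \<bullet> b t (c t))))) (at t within {0..})"
        by simp
      from DERIV_diff[OF DERIV_const[of 1] DERIV_chain2[OF bump_has_derivative this]]
      show ?thesis by simp
    qed
    show "GDERIV (\<lambda>x. 1 - bump (1 - ?\<rho> t x)) x :> ?G t x" if t: "0 \<le> t" for t x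
    proof -
      have "((\<lambda>x. 1 - ?\<rho> t x) has_derivative (\<lambda>h. - (?k t * (2 * ((x - c t) \<bullet> h))))) (at x)"
        unfolding power2_norm_eq_inner
        by (rule derivative_eq_intros refl | simp add: inner_commute)+
      from has_derivative_compose[OF this, of bump "(*) (bump' (1 - ?\<rho> t x))"]
      have "((\<lambda>x. bump (1 - ?\<rho> t x)) has_derivative (\<lambda>h. bump' (1 - ?\<rho> t x) * (- (?k t * (2 * ((x - c t) \<bullet> h)))))) (at x)"
        using bump_has_derivative[of "1 - ?\<rho> t x"] by (simp add: has_field_derivative_def)
      from has_derivative_diff[OF has_derivative_const[of 1] this]
      show ?thesis unfolding gderiv_def by (simp add: inner_commute algebra_simps)
    qed
    show "continuous_on ({0..} \<times> UNIV) (\<lambda>(t, x). 1 - bump (1 - ?\<rho> t x))"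
      "continuous_on ({0..} \<times> UNIV) (\<lambda>(t, x). ?P t x)"
      "continuous_on ({0..} \<times> UNIV) (\<lambda>(t, x). ?G t x)"
      unfolding case_prod_beta' using r
      by (intro continuous_intros cc' bc; simp)+
    show "?P t x + ?G t x \<bullet> b t x \<le> 0" if t: "0 \<le> t" for t x
    proof -
      \<comment> \<open>The decay of the weight contributes -2 L times the squared distance, just
        enough to absorb twice the Lipschitz bound of the relative velocity.\<close>
      have "(x - c t) \<bullet> (b t x - b t (c t)) \<le> norm (x - c t) * (L * norm (x - c t))"
        by (rule order_trans[OF norm_cauchy_schwarz]) (intro mult_left_mono lipschitz t norm_ge_zero)
      then have "- 2 * L * (norm (x - c t))\<^sup>2 + 2 * ((x - c t) \<bullet> (b t x - b t (c t))) \<le> 0"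
        by (simp add: power2_eq_square algebra_simps)
      then have "bump' (1 - ?\<rho> t x) * ?k t * (- 2 * L * (norm (x - c t))\<^sup>2 + 2 * ((x - c t) \<bullet> (b t x - b t (c t)))) \<le> 0"
        using bump'_nonneg by (intro mult_nonneg_nonpos mult_nonneg_nonneg) auto
      moreover have "B * (k * (m - 2 * i)) + B * (2 * k) * j = B * k * (m + 2 * (j - i))" for B k m i j :: real
        by (simp add: algebra_simps)
      ultimately show ?thesis by (simp only: inner_scaleR_left inner_diff_right)
    qed
  qed
  then show ?thesis by blast
qed

end

locale weak_transport = lipschitz_field b L for b :: "real \<Rightarrow> 'a::euclidean_space \<Rightarrow> 'a" and L +
  fixes \<mu> :: "real \<Rightarrow> 'a measure"
  assumes prob: "\<And>t. 0 \<le> t \<Longrightarrow> prob_space (\<mu> t)" and sets: "\<And>t. 0 \<le> t \<Longrightarrow> sets (\<mu> t) = sets borel"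
    and weak: "\<And>\<psi> t. test_function \<psi> \<Longrightarrow> 0 \<le> t \<Longrightarrow>
      ((\<lambda>s. \<integral>x. \<psi> x \<partial>\<mu> s) has_real_derivative (\<integral>x. gradient \<psi> x \<bullet> b t x \<partial>\<mu> t)) (at t within {0..})"
    and weak_continuous: "\<And>\<psi>. test_function \<psi> \<Longrightarrow>
      continuous_on {0..} (\<lambda>t. \<integral>x. gradient \<psi> x \<bullet> b t x \<partial>\<mu> t)"
begin

lemma integrable_bounded:
  assumes "0 \<le> t" "continuous_on UNIV f" "\<And>x. \<bar>f x :: real\<bar> \<le> B"
  shows "integrable (\<mu> t) f"
proof -
  interpret prob_space "\<mu> t" by (rule prob[OF assms(1)])
  have "f \<in> borel_measurable (\<mu> t)"
    using borel_measurable_continuous_onI[OF assms(2)] sets[OF assms(1)] by (simp cong: measurable_cong_sets)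
  then show ?thesis by (intro integrable_const_bound[of _ B]) (use assms(3) in auto)
qed

lemma integral_abs_le:
  assumes "0 \<le> t" "\<And>x. \<bar>f x :: real\<bar> \<le> B"
  shows "\<bar>\<integral>x. f x \<partial>\<mu> t\<bar> \<le> B"
proof -
  interpret prob_space "\<mu> t" by (rule prob[OF assms(1)])
  have B: "0 \<le> B" using assms(2)[of undefined] by simp
  show ?thesis
  proof (cases "integrable (\<mu> t) f")
    case True
    have "\<bar>\<integral>x. f x \<partial>\<mu> t\<bar> \<le> (\<integral>x. \<bar>f x\<bar> \<partial>\<mu> t)" by (rule integral_abs_bound)
    also have "\<dots> \<le> (\<integral>x. B \<partial>\<mu> t)" by (intro integral_mono integrable_abs True) (use assms in auto)
    finally show ?thesis by (simp add: prob_space)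
  \<comment> \<open>A non-integrable function has integral 0 by convention, and the bound covers
    this value as well.\<close>
  qed (use B in \<open>simp add: not_integrable_integral_eq\<close>)
qed

text \<open>Function and measure move together. An increment from \<open>s\<close> to
  \<open>t\<close> is split by way of the integral of \<open>\<Psi> s\<close> against
  \<open>\<mu> t\<close>: in one part only the function moves, in the other only the measure, where
  the weak equation applies to the fixed test function 1 - \<open>\<Psi> s\<close>. As
  \<open>s\<close> approaches \<open>t\<close> from the left, the two rates add up to the integral
  of a nonpositive function.\<close>

lemma barrier_nonincreasing:
  assumes bar: "barrier b \<Psi> \<Psi>' G" and T: "0 \<le> T"
  shows "(\<integral>x. \<Psi> T x \<partial>\<mu> T) \<le> (\<integral>x. \<Psi> 0 x \<partial>\<mu> 0)"
proof -
  note D = barrierD[OF bar]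
  note smooth = D(1) and P01 = D(3,4) and P'd = D(5) and Gd = D(6)
  have Pc: "continuous_on UNIV (\<Psi> t)" if "0 \<le> t" for t using smooth[OF that, of 0] by simp
  obtain R where R: "\<And>t x. t \<in> {0..T} \<Longrightarrow> R < norm x \<Longrightarrow> \<Psi> t x = 1" using D(2) by meson
  define K where "K = {0..T} \<times> cball (0::'a) R"
  have cK: "compact K" unfolding K_def by (intro compact_Times) auto
  have KS: "K \<subseteq> {0..} \<times> UNIV" by (auto simp: K_def)
  have bnd: "\<exists>C>0. \<forall>t\<in>{0..T}. \<forall>x\<in>cball 0 R. norm (h t x) \<le> C"
    if "continuous_on ({0..} \<times> UNIV) (\<lambda>(t, x). h t x)" for h :: "real \<Rightarrow> 'a \<Rightarrow> 'c::real_normed_vector"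
  proof -
    have "bounded ((\<lambda>(t, x). h t x) ` K)"
      by (intro compact_imp_bounded compact_continuous_image continuous_on_subset[OF that KS] cK)
    then show ?thesis unfolding bounded_pos K_def by fastforce
  qed
  obtain K1 where K1: "K1 > 0" "\<And>t x. t \<in> {0..T} \<Longrightarrow> x \<in> cball 0 R \<Longrightarrow> \<bar>\<Psi>' t x\<bar> \<le> K1"
    using bnd[OF D(8)] by auto
  obtain K2 where K2: "K2 > 0" "\<And>t x. t \<in> {0..T} \<Longrightarrow> x \<in> cball 0 R \<Longrightarrow> norm (G t x) \<le> K2"
    using bnd[OF D(9)] by auto
  obtain K3 where K3: "K3 > 0" "\<And>t x. t \<in> {0..T} \<Longrightarrow> x \<in> cball 0 R \<Longrightarrow> norm (b t x) \<le> K3"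
    using bnd[OF continuous_field] by auto
  \<comment> \<open>Outside the ball of radius \<open>R\<close> the barrier is locally constant, so
    all estimates on its gradient reduce to the compact set \<open>K\<close>.\<close>
  have G0: "G t x = 0" if t: "t \<in> {0..T}" and x: "R < norm x" for t x
  proof -
    have "\<forall>\<^sub>F y in nhds x. y \<in> - cball 0 R"
      by (rule eventually_nhds_in_open) (use x in auto)
    then have "\<forall>\<^sub>F y in nhds x. \<Psi> t y = 1" by (rule eventually_mono) (use R[OF t] in auto)
    then have ev: "\<forall>\<^sub>F y in at x. 1 = \<Psi> t y" by (auto simp: eventually_at_filter elim: eventually_mono)
    have "((\<lambda>y::'a. 1::real) has_derivative (\<lambda>h. 0)) (at x)" by simp
    from has_derivative_transform_eventually[OF this ev] R[OF t x]
    have "GDERIV (\<Psi> t) x :> 0" unfolding gderiv_def by simp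
    from gradient_eq[OF this] gradient_eq[OF Gd[of t x]] t show ?thesis by simp
  qed
  have lipT: "\<bar>\<Psi> s x - \<Psi> t x\<bar> \<le> K1 * \<bar>s - t\<bar>" if "s \<in> {0..T}" "t \<in> {0..T}" for s t x
  proof (cases "norm x \<le> R")
    case True
    have "norm (\<Psi> s x - \<Psi> t x) \<le> K1 * norm (s - t)"
    proof (rule field_differentiable_bound[where S = "{0..T}" and f' = "\<lambda>t. \<Psi>' t x"])
      show "((\<lambda>t. \<Psi> t x) has_field_derivative \<Psi>' z x) (at z within {0..T})" if "z \<in> {0..T}" for z
        using P'd[of z x] that by (auto intro: has_field_derivative_subset)
    qed (use K1 True that in auto)
    then show ?thesis by simp
  qed (use R that K1 in auto)
  define F where "F = (\<lambda>t. \<integral>x. \<Psi> t x \<partial>\<mu> t)"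
  have Pi: "integrable (\<mu> t) (\<Psi> s)" if "0 \<le> t" "0 \<le> s" for s t
    by (rule integrable_bounded[where B=1]) (use that Pc P01 in auto)
  have tst: "test_function (\<lambda>x. 1 - \<Psi> s x)" if "s \<in> {0..T}" for s
  proof (rule test_functionI)
    have "C_k k (\<lambda>x. 1 + (- 1) * \<Psi> s x)" for k
      by (intro C_k_add C_k_const C_k_cmult smooth) (use that in auto)
    then show "C_k k (\<lambda>x. 1 - \<Psi> s x)" for k by simp
  qed (use R that in auto)
  have grad: "gradient (\<lambda>x. 1 - \<Psi> s x) = (\<lambda>x. - G s x)" if "0 \<le> s" for s
    using GDERIV_diff[OF GDERIV_const Gd[OF that], of 1] by (intro ext gradient_eq) simp
  have eqP: "(\<integral>x. \<Psi> s x \<partial>\<mu> t) = 1 - (\<integral>x. 1 - \<Psi> s x \<partial>\<mu> t)" if "0 \<le> s" "0 \<le> t" for s t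
  proof -
    interpret prob_space "\<mu> t" by (rule prob[OF that(2)])
    show ?thesis using Pi that by (subst Bochner_Integration.integral_diff) (auto simp: prob_space)
  qed
  \<comment> \<open>Mean value theorem for the weak equation with the test function frozen at time
    \<open>s\<close>; the rate appears at an unknown intermediate time \<open>r\<close>.\<close>
  have mv: "\<exists>r. s < r \<and> r < t \<and> (\<integral>x. \<Psi> s x \<partial>\<mu> t) - (\<integral>x. \<Psi> s x \<partial>\<mu> s) = (t - s) * (\<integral>x. G s x \<bullet> b r x \<partial>\<mu> r)"
    if st: "0 \<le> s" "s < t" "t \<le> T" for s t
  proof -
    let ?f = "\<lambda>t. \<integral>x. 1 - \<Psi> s x \<partial>\<mu> t"
    have d: "(?f has_real_derivative (\<integral>x. - G s x \<bullet> b r x \<partial>\<mu> r)) (at r within {0..})" if "0 \<le> r" for r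
      using weak[OF tst that, of s] st grad[of s] by simp
    have "\<exists>z\<in>{s<..<t}. ?f t - ?f s = (t - s) * (\<integral>x. - G s x \<bullet> b z x \<partial>\<mu> z)"
    proof (subst mult.commute, rule mvt_simple[OF st(2)])
      fix r assume "s \<le> r" "r \<le> t"
      then have "(?f has_real_derivative (\<integral>x. - G s x \<bullet> b r x \<partial>\<mu> r)) (at r within {s..t})"
        using d[of r] st by (auto intro: has_field_derivative_subset)
      then show "(?f has_derivative (*) (\<integral>x. - G s x \<bullet> b r x \<partial>\<mu> r)) (at r within {s..t})"
        by (simp add: has_field_derivative_def)
    qed
    then show ?thesis using eqP[of s t] eqP[of s s] st by (auto simp: algebra_simps)
  qed
  have Gb: "\<bar>G s x \<bullet> b r x\<bar> \<le> K2 * K3" if "s \<in> {0..T}" "r \<in> {0..T}" for s r x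
  proof (cases "norm x \<le> R")
    case True
    have "\<bar>G s x \<bullet> b r x\<bar> \<le> norm (G s x) * norm (b r x)" by (rule Cauchy_Schwarz_ineq2)
    also have "\<dots> \<le> K2 * K3" using K2 K3 True that by (intro mult_mono) (auto simp: less_imp_le)
    finally show ?thesis .
  next
    case False
    then show ?thesis using G0[OF that(1)] K2 K3 by simp
  qed
  have Fc: "continuous_on {0..T} F"
  proof (rule lipschitz_on_continuous_on[of "K1 + K2 * K3"], rule lipschitz_onI)
    have main: "\<bar>F t - F s\<bar> \<le> (K1 + K2 * K3) * (t - s)" if st: "0 \<le> s" "s < t" "t \<le> T" for s t
    proof -
      have "F t - F s = (\<integral>x. \<Psi> t x - \<Psi> s x \<partial>\<mu> t) + ((\<integral>x. \<Psi> s x \<partial>\<mu> t) - (\<integral>x. \<Psi> s x \<partial>\<mu> s))"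
        unfolding F_def using Pi st by (subst Bochner_Integration.integral_diff) auto
      moreover have "\<bar>\<integral>x. \<Psi> t x - \<Psi> s x \<partial>\<mu> t\<bar> \<le> K1 * (t - s)"
        using st lipT[of t s] by (intro integral_abs_le) auto
      moreover obtain r where r: "s < r" "r < t" "(\<integral>x. \<Psi> s x \<partial>\<mu> t) - (\<integral>x. \<Psi> s x \<partial>\<mu> s) = (t - s) * (\<integral>x. G s x \<bullet> b r x \<partial>\<mu> r)"
        using mv[OF st] by blast
      moreover have "\<bar>(t - s) * (\<integral>x. G s x \<bullet> b r x \<partial>\<mu> r)\<bar> \<le> (t - s) * (K2 * K3)"
        unfolding abs_mult using st r integral_abs_le[of r "\<lambda>x. G s x \<bullet> b r x", OF _ Gb]
        by (intro mult_mono) auto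
      ultimately show ?thesis by (simp add: algebra_simps)
    qed
    show "dist (F s) (F t) \<le> (K1 + K2 * K3) * dist s t" if "s \<in> {0..T}" "t \<in> {0..T}" for s t
      using main[of s t] main[of t s] that
      by (cases s t rule: linorder_cases) (auto simp: dist_real_def abs_minus_commute)
    show "0 \<le> K1 + K2 * K3" using K1 K2 K3 by simp
  qed
  have "F T \<le> F 0"
  proof (rule nonincreasing_left_derivative[OF Fc T])
    fix t e :: real assume t: "0 < t" "t \<le> T" and e: "0 < e"
    \<comment> \<open>First part of the splitting: the measure is frozen at \<open>\<mu> t\<close>
      and the function is differentiated under the integral.\<close>
    have "\<exists>d>0. \<forall>s. 0 \<le> s \<longrightarrow> t - d < s \<longrightarrow> s < t \<longrightarrow> \<bar>((\<integral>x. \<Psi> t x \<partial>\<mu> t) - (\<integral>x. \<Psi> s x \<partial>\<mu> t)) - (t - s) * (\<integral>x. \<Psi>' t x \<partial>\<mu> t)\<bar> \<le> e / 3 * (t - s)"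
    proof -
      interpret prob_space "\<mu> t" by (rule prob) (use t in auto)
      have m: "\<Psi>' t \<in> borel_measurable (\<mu> t)"
      proof -
        have "continuous_on UNIV (\<lambda>x. case (t, x) of (t, x) \<Rightarrow> \<Psi>' t x)"
          by (rule continuous_on_compose2[where g="\<lambda>(t, x). \<Psi>' t x" and t="{0..} \<times> UNIV"]) (use D(8) t in \<open>auto intro!: continuous_intros\<close>)
        then show ?thesis using sets[of t] t borel_measurable_continuous_onI[of "\<Psi>' t"] by (simp cong: measurable_cong_sets)
      qed
      have "((\<lambda>s. \<integral>x. \<Psi> s x \<partial>\<mu> t) has_real_derivative (\<integral>x. \<Psi>' t x \<partial>\<mu> t)) (at t within {0..T})"
      proof (rule has_real_derivative_lebesgue_integral[where B="\<lambda>_. K1" and \<delta>=1])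
        show "((\<lambda>s. \<Psi> s x) has_real_derivative \<Psi>' t x) (at t within {0..T})" for x
          using P'd[of t x] t by (auto intro: has_field_derivative_subset)
      qed (use m Pi lipT t in \<open>auto simp: mult.commute\<close>)
      then have "\<forall>e'>0. \<exists>d>0. \<forall>s\<in>{0..T}. \<bar>s - t\<bar> < d \<longrightarrow>
          \<bar>(\<integral>x. \<Psi> s x \<partial>\<mu> t) - (\<integral>x. \<Psi> t x \<partial>\<mu> t) - (\<integral>x. \<Psi>' t x \<partial>\<mu> t) * (s - t)\<bar> \<le> e' * \<bar>s - t\<bar>"
        unfolding has_field_derivative_def has_derivative_within_alt real_norm_def by (elim conjE)
      from this[rule_format, of "e / 3"] obtain d where d: "d > 0" "\<And>s. s \<in> {0..T} \<Longrightarrow> \<bar>s - t\<bar> < d \<Longrightarrow>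
          \<bar>(\<integral>x. \<Psi> s x \<partial>\<mu> t) - (\<integral>x. \<Psi> t x \<partial>\<mu> t) - (\<integral>x. \<Psi>' t x \<partial>\<mu> t) * (s - t)\<bar> \<le> e / 3 * \<bar>s - t\<bar>"
        using e by auto
      show ?thesis
      proof (intro exI[of _ d] conjI d(1) allI impI)
        fix s assume s: "0 \<le> s" "t - d < s" "s < t"
        have eq: "(\<integral>x. \<Psi> t x \<partial>\<mu> t) - (\<integral>x. \<Psi> s x \<partial>\<mu> t) - (t - s) * (\<integral>x. \<Psi>' t x \<partial>\<mu> t) =
            - ((\<integral>x. \<Psi> s x \<partial>\<mu> t) - (\<integral>x. \<Psi> t x \<partial>\<mu> t) - (\<integral>x. \<Psi>' t x \<partial>\<mu> t) * (s - t))"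
          by (simp add: algebra_simps)
        have ab: "\<bar>s - t\<bar> = t - s" using s by simp
        show "\<bar>((\<integral>x. \<Psi> t x \<partial>\<mu> t) - (\<integral>x. \<Psi> s x \<partial>\<mu> t)) - (t - s) * (\<integral>x. \<Psi>' t x \<partial>\<mu> t)\<bar> \<le> e / 3 * (t - s)"
          unfolding eq abs_minus_cancel using d(2)[of s] s t unfolding ab by auto
      qed
    qed
    then obtain d1 where d1: "d1 > 0" "\<And>s. 0 \<le> s \<Longrightarrow> t - d1 < s \<Longrightarrow> s < t \<Longrightarrow> \<bar>((\<integral>x. \<Psi> t x \<partial>\<mu> t) - (\<integral>x. \<Psi> s x \<partial>\<mu> t)) - (t - s) * (\<integral>x. \<Psi>' t x \<partial>\<mu> t)\<bar> \<le> e / 3 * (t - s)"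
      by blast
    have uc: "uniformly_continuous_on K (\<lambda>(t, x). G t x)"
      by (intro compact_uniformly_continuous continuous_on_subset[OF _ KS] cK) (rule D(9))
    \<comment> \<open>The tolerance e is spent in thirds: on the time derivative of
      \<open>\<Psi>\<close>, on replacing \<open>G s\<close> by \<open>G t\<close>, and on replacing
      the intermediate time \<open>r\<close> by \<open>t\<close>. The factor \<open>K3\<close>
      offsets the bound on the velocity in the second one.\<close>
    have e': "0 < e / (3 * K3)" using e K3(1) by simp
    obtain d2 where d2: "d2 > 0" "\<And>p q. p \<in> K \<Longrightarrow> q \<in> K \<Longrightarrow> dist q p < d2 \<Longrightarrow> dist (case q of (t, x) \<Rightarrow> G t x) (case p of (t, x) \<Rightarrow> G t x) < e / (3 * K3)"
      using uc[unfolded uniformly_continuous_on_def, rule_format, OF e'] by blast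
    have GG: "norm (G s x - G t x) \<le> e / (3 * K3)" if "0 \<le> s" "s < t" "t - d2 < s" for s x
    proof (cases "norm x \<le> R")
      case True
      then show ?thesis using d2(2)[of "(t, x)" "(s, x)"] that t
        by (auto simp: K_def dist_norm norm_prod_def)
    next
      case False
      then show ?thesis using G0[of s x] G0[of t x] that t e K3 by auto
    qed
    have Gbc: "continuous_on {0..} (\<lambda>r. \<integral>x. G t x \<bullet> b r x \<partial>\<mu> r)"
      using continuous_on_minus[OF weak_continuous[OF tst[of t]]] t grad[of t] by simp
    then obtain d3 where d3: "d3 > 0" "\<And>r. 0 \<le> r \<Longrightarrow> \<bar>r - t\<bar> < d3 \<Longrightarrow> \<bar>(\<integral>x. G t x \<bullet> b r x \<partial>\<mu> r) - (\<integral>x. G t x \<bullet> b t x \<partial>\<mu> t)\<bar> < e / 3"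
      unfolding continuous_on_iff dist_real_def using t e by (metis atLeast_iff less_imp_le divide_pos_pos zero_less_numeral)
    have Gi: "integrable (\<mu> r) (\<lambda>x. G s x \<bullet> b r x)" if "s \<in> {0..T}" "r \<in> {0..T}" for s r
    proof (rule integrable_bounded[OF _ _ Gb[OF that]])
      have cp: "continuous_on UNIV (\<lambda>x::'a. (s::real, x))" for s by (intro continuous_intros)
      have "continuous_on UNIV (G s)" using continuous_on_compose2[OF D(9) cp[of s]] that by auto
      moreover have "continuous_on UNIV (b r)" using continuous_on_compose2[OF continuous_field cp[of r]] that by auto
      ultimately show "continuous_on UNIV (\<lambda>x. G s x \<bullet> b r x)" by (auto intro!: continuous_intros)
    qed (use that in auto)
    show "\<exists>d>0. \<forall>s. 0 \<le> s \<longrightarrow> t - d < s \<longrightarrow> s < t \<longrightarrow> F t - F s \<le> e * (t - s)"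
    proof (intro exI[of _ "min d1 (min d2 d3)"] conjI allI impI)
      show "0 < min d1 (min d2 d3)" using d1 d2 d3 by simp
      fix s assume s: "0 \<le> s" "t - min d1 (min d2 d3) < s" "s < t"
      obtain r where r: "s < r" "r < t" "(\<integral>x. \<Psi> s x \<partial>\<mu> t) - (\<integral>x. \<Psi> s x \<partial>\<mu> s) = (t - s) * (\<integral>x. G s x \<bullet> b r x \<partial>\<mu> r)"
        using mv[of s t] s t by auto
      have rT: "r \<in> {0..T}" "s \<in> {0..T}" "t \<in> {0..T}" using r s t by auto
      have i1: "\<bar>\<integral>x. G s x \<bullet> b r x - G t x \<bullet> b r x \<partial>\<mu> r\<bar> \<le> e / 3"
      proof (rule integral_abs_le)
        fix x
        show "\<bar>G s x \<bullet> b r x - G t x \<bullet> b r x\<bar> \<le> e / 3"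
        proof (cases "norm x \<le> R")
          case True
          have "\<bar>(G s x - G t x) \<bullet> b r x\<bar> \<le> norm (G s x - G t x) * norm (b r x)" by (rule Cauchy_Schwarz_ineq2)
          also have "\<dots> \<le> e / (3 * K3) * K3" using GG[of s x] K3(2)[of r x] True s rT K3(1) e
            by (intro mult_mono) auto
          also have "\<dots> = e / 3" using K3(1) by simp
          finally show ?thesis by (simp add: inner_diff_left)
        next
          case False
          then show ?thesis using G0[of s x] G0[of t x] rT e by simp
        qed
      qed (use rT in auto)
      have "(\<integral>x. G s x \<bullet> b r x - G t x \<bullet> b r x \<partial>\<mu> r) = (\<integral>x. G s x \<bullet> b r x \<partial>\<mu> r) - (\<integral>x. G t x \<bullet> b r x \<partial>\<mu> r)"
        by (rule Bochner_Integration.integral_diff[OF Gi[OF rT(2,1)] Gi[OF rT(3,1)]])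
      with i1 have i1': "(\<integral>x. G s x \<bullet> b r x \<partial>\<mu> r) \<le> (\<integral>x. G t x \<bullet> b r x \<partial>\<mu> r) + e / 3"
        by linarith
      have i2: "(\<integral>x. G t x \<bullet> b r x \<partial>\<mu> r) \<le> (\<integral>x. G t x \<bullet> b t x \<partial>\<mu> t) + e / 3"
      proof -
        have "0 \<le> r" "\<bar>r - t\<bar> < d3" using r s by auto
        from d3(2)[OF this] show ?thesis by linarith
      qed
      have i3: "(\<integral>x. \<Psi>' t x \<partial>\<mu> t) + (\<integral>x. G t x \<bullet> b t x \<partial>\<mu> t) \<le> 0"
      proof -
        have ip: "integrable (\<mu> t) (\<Psi>' t)"
        proof (rule integrable_bounded[where B=K1])
          have "continuous_on UNIV (\<lambda>x. case (t, x) of (t, x) \<Rightarrow> \<Psi>' t x)"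
            by (rule continuous_on_compose2[where g="\<lambda>(t, x). \<Psi>' t x" and t="{0..} \<times> UNIV"]) (use D(8) t in \<open>auto intro!: continuous_intros\<close>)
          then show "continuous_on UNIV (\<Psi>' t)" by simp
          show "\<bar>\<Psi>' t x\<bar> \<le> K1" for x
          proof (cases "norm x \<le> R")
            case False
            \<comment> \<open>The derivative is taken from the left because \<open>R\<close> serves
              times up to \<open>T\<close> only and \<open>t\<close> may be
              \<open>T\<close>.\<close>
            have "((\<lambda>s. \<Psi> s x) has_real_derivative \<Psi>' t x) (at t within {0..t})"
              using P'd[of t x] t by (auto intro: has_field_derivative_subset)
            moreover have "((\<lambda>s. \<Psi> s x) has_real_derivative 0) (at t within {0..t})"
              by (rule has_field_derivative_transform_within[where f="\<lambda>_. 1" and d=1]) (use False R t in auto)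
            moreover have "at t within {0..t} \<noteq> bot" using t by (simp add: trivial_limit_within islimpt_Icc)
            ultimately have "\<Psi>' t x = 0" by (metis has_field_derivative_unique)
            then show ?thesis using K1 by simp
          qed (use K1 t in auto)
        qed (use t in auto)
        have "(\<integral>x. \<Psi>' t x + G t x \<bullet> b t x \<partial>\<mu> t) \<le> 0"
        proof -
          have "0 \<le> - (\<Psi>' t x + G t x \<bullet> b t x)" for x using D(10)[of t x] t by linarith
          then have "0 \<le> (\<integral>x. - (\<Psi>' t x + G t x \<bullet> b t x) \<partial>\<mu> t)" by (rule Bochner_Integration.integral_nonneg)
          then show ?thesis by (simp only: Bochner_Integration.integral_minus neg_0_le_iff_le)
        qed
        then show ?thesis using ip Gi[OF rT(3) rT(3)] by simp
      qed
      have "F t - F s = ((\<integral>x. \<Psi> t x \<partial>\<mu> t) - (\<integral>x. \<Psi> s x \<partial>\<mu> t)) + (t - s) * (\<integral>x. G s x \<bullet> b r x \<partial>\<mu> r)"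
        using r(3) by (simp add: F_def)
      also have "\<dots> \<le> ((t - s) * (\<integral>x. \<Psi>' t x \<partial>\<mu> t) + e / 3 * (t - s)) + (t - s) * ((\<integral>x. G t x \<bullet> b t x \<partial>\<mu> t) + e / 3 + e / 3)"
      proof (intro add_mono mult_left_mono)
        have "t - d1 < s" using s by auto
        from d1(2)[OF s(1) this s(3)]
        show "(\<integral>x. \<Psi> t x \<partial>\<mu> t) - (\<integral>x. \<Psi> s x \<partial>\<mu> t) \<le> (t - s) * (\<integral>x. \<Psi>' t x \<partial>\<mu> t) + e / 3 * (t - s)"
          by linarith
        show "(\<integral>x. G s x \<bullet> b r x \<partial>\<mu> r) \<le> (\<integral>x. G t x \<bullet> b t x \<partial>\<mu> t) + e / 3 + e / 3"
          using i1' i2 by linarith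
      qed (use s in auto)
      also have "\<dots> = (t - s) * ((\<integral>x. \<Psi>' t x \<partial>\<mu> t) + (\<integral>x. G t x \<bullet> b t x \<partial>\<mu> t)) + e * (t - s)"
        by (simp add: field_simps)
      also have "\<dots> \<le> e * (t - s)"
        using i3 s by (simp add: mult_nonneg_nonpos)
      finally show "F t - F s \<le> e * (t - s)" .
    qed
  qed
  then show ?thesis by (simp add: F_def)
qed

text \<open>The product of the ball barriers is smaller than 1 exactly on the union of the balls, so
  its powers decrease to the indicator of the complement. Each power is a barrier, and the mass of
  the complement inherits the monotonicity in the limit.\<close>

lemma measure_union_balls_le:
  assumes I: "finite I" and r: "0 < r" and t: "0 \<le> t"
  shows "measure (\<mu> 0) (\<Union>x\<in>I. ball x r) \<le> measure (\<mu> t) (\<Union>x\<in>I. ball (flow_map t x) (r * exp (L * t)))"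
proof -
  define \<psi> where "\<psi> = (\<lambda>y t x. 1 - bump (1 - exp (- 2 * L * t) / r\<^sup>2 * (norm (x - flow_map t y))\<^sup>2))"
  define \<Psi> where "\<Psi> = (\<lambda>t x. \<Prod>y\<in>I. \<psi> y t x)"
  define U where "U = (\<lambda>t. \<Union>y\<in>I. ball (flow_map t y) (r * exp (L * t)))"
  have bar: "\<exists>\<Psi>' G. barrier b (\<lambda>t x. \<Psi> t x ^ m) \<Psi>' G" for m
    unfolding \<Psi>_def \<psi>_def by (intro barrier_power barrier_prod[OF I] barrier_ball[OF r])
  have le: "(\<integral>x. \<Psi> t x ^ m \<partial>\<mu> t) \<le> (\<integral>x. \<Psi> 0 x ^ m \<partial>\<mu> 0)" for m
    using bar[of m] barrier_nonincreasing[OF _ t] by blast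
  have \<psi>01: "0 \<le> \<psi> y s x" "\<psi> y s x \<le> 1" for y s x
    using bump_nonneg bump_le_1 by (auto simp: \<psi>_def)
  have \<psi>lt: "\<psi> y s x < 1 \<longleftrightarrow> x \<in> ball (flow_map s y) (r * exp (L * s))" for y s x
  proof -
    have "\<psi> y s x < 1 \<longleftrightarrow> exp (- 2 * L * s) / r\<^sup>2 * (norm (x - flow_map s y))\<^sup>2 < 1"
      by (simp add: \<psi>_def bump_pos_iff)
    also have "\<dots> \<longleftrightarrow> (norm (x - flow_map s y))\<^sup>2 < (r * exp (L * s))\<^sup>2"
      using r by (simp add: power_mult_distrib exp_double[symmetric] exp_minus field_simps)
    also have "\<dots> \<longleftrightarrow> norm (x - flow_map s y) < r * exp (L * s)"
      using r power2_less_imp_less[of "norm (x - flow_map s y)" "r * exp (L * s)"]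
        power_strict_mono[of "norm (x - flow_map s y)" "r * exp (L * s)" 2] by auto
    finally show ?thesis by (simp add: dist_norm norm_minus_commute)
  qed
  have \<Psi>01: "0 \<le> \<Psi> s x" "\<Psi> s x \<le> 1" for s x
    using \<psi>01 by (auto simp: \<Psi>_def intro: prod_nonneg prod_le_1)
  have \<Psi>1: "\<Psi> s x = 1" if "x \<notin> U s" for s x
    unfolding \<Psi>_def using that \<psi>lt[of _ s x] \<psi>01[of _ s x] by (intro prod.neutral) (fastforce simp: U_def less_le)
  have \<Psi>lt: "\<Psi> s x < 1" if xU: "x \<in> U s" for s x
  proof -
    obtain y where yy: "y \<in> I" "x \<in> ball (flow_map s y) (r * exp (L * s))" using xU by (auto simp: U_def)
    then have y: "y \<in> I" "\<psi> y s x < 1" using \<psi>lt by auto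
    have "\<Psi> s x = \<psi> y s x * (\<Prod>y\<in>I - {y}. \<psi> y s x)" unfolding \<Psi>_def using I y by (simp add: prod.remove)
    also have "\<dots> \<le> \<psi> y s x * 1" using \<psi>01 by (intro mult_left_mono prod_le_1) auto
    finally show ?thesis using y by simp
  qed
  have lim: "(\<lambda>m. \<integral>x. \<Psi> s x ^ m \<partial>\<mu> s) \<longlonglongrightarrow> 1 - measure (\<mu> s) (U s)" if s: "0 \<le> s" for s
  proof -
    interpret prob_space "\<mu> s" by (rule prob[OF s])
    have sp: "space (\<mu> s) = UNIV" using sets_eq_imp_space_eq[OF sets[OF s]] by simp
    have Um: "U s \<in> sets (\<mu> s)" unfolding sets[OF s] U_def by (intro borel_open open_UN) auto
    obtain \<Psi>' G where b1: "barrier b (\<lambda>t x. \<Psi> t x ^ 1) \<Psi>' G" using bar[of 1] by blast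
    have "continuous_on UNIV (\<Psi> s)"
    proof -
      have "C_k 0 (\<lambda>x. \<Psi> s x ^ 1)" using barrierD(1)[OF b1 s] .
      then show ?thesis by simp
    qed
    then have m[measurable]: "\<Psi> s \<in> borel_measurable (\<mu> s)"
      using borel_measurable_continuous_onI sets[OF s] by (simp cong: measurable_cong_sets)
    have "(\<lambda>m. \<integral>x. \<Psi> s x ^ m \<partial>\<mu> s) \<longlonglongrightarrow> (\<integral>x. indicator (- U s) x \<partial>\<mu> s)"
    proof (rule integral_dominated_convergence[where w="\<lambda>_. 1"])
      show "AE x in \<mu> s. (\<lambda>m. \<Psi> s x ^ m) \<longlonglongrightarrow> indicator (- U s) x"
      proof (rule AE_I2)
        fix x
        show "(\<lambda>m. \<Psi> s x ^ m) \<longlonglongrightarrow> indicator (- U s) x"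
          using \<Psi>1[of x s] \<Psi>lt[of x s] \<Psi>01[of s x] by (cases "x \<in> U s") (auto intro: LIMSEQ_power_zero)
      qed
      show "AE x in \<mu> s. norm (\<Psi> s x ^ m) \<le> 1" for m
        using \<Psi>01 by (auto simp: power_abs intro!: power_le_one)
      show "indicator (- U s) \<in> borel_measurable (\<mu> s)" using Um sp
        by (metis Compl_eq_Diff_UNIV borel_measurable_indicator sets.compl_sets)
    qed auto
    moreover have "(\<integral>x. indicator (- U s) x \<partial>\<mu> s) = 1 - measure (\<mu> s) (U s)"
      using prob_compl[OF Um] sp Um by (simp add: Compl_eq_Diff_UNIV)
    ultimately show ?thesis by simp
  qed
  have "1 - measure (\<mu> t) (U t) \<le> 1 - measure (\<mu> 0) (U 0)"
    by (rule LIMSEQ_le[OF lim[OF t] lim[OF order_refl]]) (use le in auto)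
  then show ?thesis by (simp add: U_def)
qed

text \<open>Cover \<open>K\<close> by finitely many balls of radius 1/(n+1) centred in
  \<open>K\<close>. The transported balls lie in a closed neighbourhood of the image of
  \<open>K\<close> whose width tends to 0, and continuity from above finishes.\<close>

lemma measure_compact_le:
  assumes K: "compact K" and t: "0 \<le> t"
  shows "measure (\<mu> 0) K \<le> measure (\<mu> t) (flow_map t ` K)"
proof -
  interpret M0: prob_space "\<mu> 0" by (rule prob) simp
  interpret Mt: prob_space "\<mu> t" by (rule prob[OF t])
  let ?E = "exp (L * t)"
  define A where "A = (\<lambda>n::nat. {y. infdist y (flow_map t ` K) \<le> ?E / real (Suc n)})"
  have cFK: "compact (flow_map t ` K)" by (intro compact_continuous_image flow_map_continuous t K)
  show ?thesis
  proof (cases "K = {}")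
    case False
    have Ac: "closed (A n)" for n
      unfolding A_def by (intro closed_Collect_le continuous_intros)
    have le: "measure (\<mu> 0) K \<le> measure (\<mu> t) (A n)" for n
    proof -
      let ?d = "1 / real (Suc n)"
      have "K \<subseteq> (\<Union>x\<in>K. ball x ?d)" by auto
      then obtain I where I: "I \<subseteq> K" "finite I" "K \<subseteq> (\<Union>x\<in>I. ball x ?d)"
        using compactE_image[OF K, of K "\<lambda>x. ball x ?d"] by auto
      have "measure (\<mu> 0) K \<le> measure (\<mu> 0) (\<Union>x\<in>I. ball x ?d)"
        by (intro M0.finite_measure_mono I) (auto simp: sets intro!: borel_open)
      also have "\<dots> \<le> measure (\<mu> t) (\<Union>x\<in>I. ball (flow_map t x) (?d * ?E))"
        by (rule measure_union_balls_le[OF I(2) _ t]) simp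
      also have "\<dots> \<le> measure (\<mu> t) (A n)"
      proof (rule Mt.finite_measure_mono)
        show "(\<Union>x\<in>I. ball (flow_map t x) (?d * ?E)) \<subseteq> A n"
        proof safe
          fix x y assume "x \<in> I" "y \<in> ball (flow_map t x) (?d * ?E)"
          then have "infdist y (flow_map t ` K) \<le> dist y (flow_map t x)" "dist y (flow_map t x) < ?d * ?E"
            using I(1) by (auto intro!: infdist_le simp: dist_commute)
          then show "y \<in> A n" by (simp add: A_def)
        qed
        show "A n \<in> Mt.events" using Ac by (simp add: sets[OF t] borel_closed)
      qed
      finally show ?thesis .
    qed
    have "(\<lambda>n. measure (\<mu> t) (A n)) \<longlonglongrightarrow> measure (\<mu> t) (\<Inter>n. A n)"
    proof (rule Mt.finite_Lim_measure_decseq)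
      show "range A \<subseteq> Mt.events" using Ac by (auto simp: sets[OF t] intro: borel_closed)
      show "decseq A" unfolding decseq_def A_def
        by (auto elim!: order_trans intro!: divide_left_mono)
    qed
    moreover have "(\<Inter>n. A n) = flow_map t ` K"
    proof (intro equalityI subsetI)
      fix y assume "y \<in> (\<Inter>n. A n)"
      then have b: "infdist y (flow_map t ` K) \<le> ?E / real (Suc n)" for n by (auto simp: A_def)
      have "(\<lambda>n. ?E / real (Suc n)) \<longlonglongrightarrow> 0"
        using tendsto_mult_right_zero[OF LIMSEQ_inverse_real_of_nat, of ?E] by (simp add: divide_inverse)
      then have "infdist y (flow_map t ` K) \<le> 0"
        by (rule LIMSEQ_le_const) (use b in auto)
      then have "infdist y (flow_map t ` K) = 0" using infdist_nonneg[of y] by (metis antisym)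
      then show "y \<in> flow_map t ` K"
        using in_closed_iff_infdist_zero[OF compact_imp_closed[OF cFK]] False by auto
    next
      fix y assume "y \<in> flow_map t ` K"
      then have "infdist y (flow_map t ` K) = 0" by simp
      then show "y \<in> (\<Inter>n. A n)" by (simp add: A_def)
    qed
    ultimately show ?thesis using LIMSEQ_le_const[of _ _ "measure (\<mu> 0) K"] le by fastforce
  qed simp
qed

text \<open>Inner regularity extends the inequality from compact sets to Borel sets. Applied to a
  set and to its complement it forces equality, since both measures have mass one.\<close>

theorem distr_flow_map:
  assumes t: "0 \<le> t"
  shows "\<mu> t = distr (\<mu> 0) borel (flow_map t)"
proof -
  interpret M0: prob_space "\<mu> 0" by (rule prob) simp
  interpret Mt: prob_space "\<mu> t" by (rule prob[OF t])
  have fm[measurable]: "flow_map t \<in> borel_measurable borel"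
    by (intro borel_measurable_continuous_onI flow_map_continuous t)
  have fm': "flow_map t \<in> measurable (\<mu> 0) borel" using fm sets[of 0] by (simp cong: measurable_cong_sets)
  interpret D: prob_space "distr (\<mu> 0) borel (flow_map t)" by (rule M0.prob_space_distr[OF fm'])
  have sp0: "space (\<mu> 0) = UNIV" using sets_eq_imp_space_eq[OF sets[of 0]] by simp
  have spt: "space (\<mu> t) = UNIV" using sets_eq_imp_space_eq[OF sets[OF t]] by simp
  have le: "measure (distr (\<mu> 0) borel (flow_map t)) A \<le> measure (\<mu> t) A" if A: "A \<in> sets borel" for A
  proof -
    let ?B = "flow_map t -` A"
    have B: "?B \<in> sets borel" using measurable_sets[OF fm A] by simp
    have "emeasure (\<mu> 0) ?B = (SUP K \<in> {K. K \<subseteq> ?B \<and> compact K}. emeasure (\<mu> 0) K)"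
      by (rule inner_regular[OF _ _ B]) (auto simp: sets)
    also have "\<dots> \<le> emeasure (\<mu> t) A"
    proof (rule SUP_least)
      fix K assume K: "K \<in> {K. K \<subseteq> ?B \<and> compact K}"
      have "measure (\<mu> 0) K \<le> measure (\<mu> t) (flow_map t ` K)" using K by (intro measure_compact_le t) auto
      also have "\<dots> \<le> measure (\<mu> t) A"
        using K A by (intro Mt.finite_measure_mono) (auto simp: sets[OF t])
      finally show "emeasure (\<mu> 0) K \<le> emeasure (\<mu> t) A"
        by (simp add: M0.emeasure_eq_measure Mt.emeasure_eq_measure)
    qed
    finally have "measure (\<mu> 0) ?B \<le> measure (\<mu> t) A"
      by (simp add: M0.emeasure_eq_measure Mt.emeasure_eq_measure)
    then show ?thesis using A fm' by (simp add: measure_distr sp0)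
  qed
  show ?thesis
  proof (rule measure_eqI)
    show "sets (\<mu> t) = sets (distr (\<mu> 0) borel (flow_map t))" using sets[OF t] by simp
    fix A assume "A \<in> sets (\<mu> t)"
    then have A: "A \<in> sets borel" using sets[OF t] by simp
    have "measure (distr (\<mu> 0) borel (flow_map t)) (- A) = 1 - measure (distr (\<mu> 0) borel (flow_map t)) A"
      using D.prob_compl[of A] A by (simp add: Compl_eq_Diff_UNIV)
    moreover have "measure (\<mu> t) (- A) = 1 - measure (\<mu> t) A"
      using Mt.prob_compl[of A] A by (simp add: Compl_eq_Diff_UNIV spt sets[OF t])
    ultimately have "measure (\<mu> t) A = measure (distr (\<mu> 0) borel (flow_map t)) A"
      using le[OF A] le[of "- A"] A by (simp add: borel_comp)
    then show "emeasure (\<mu> t) A = emeasure (distr (\<mu> 0) borel (flow_map t)) A"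
      by (simp add: Mt.emeasure_eq_measure D.emeasure_eq_measure)
  qed
qed

end

section \<open>Potentials of the ReLU network\<close>

text \<open>If the derivative is controlled by the positive part alone, Gronwall run forwards and
  backwards from \<open>t0\<close> keeps the positive part at 0; then the derivative vanishes and
  \<open>w\<close> is constant. The backward direction is needed to trace points of the cone back to
  their initial values.\<close>

lemma constant_sign_conserved:
  fixes w :: "real \<Rightarrow> real"
  assumes d: "\<And>t. t \<in> {0..T} \<Longrightarrow> (w has_real_derivative w' t) (at t within {0..T})"
    and le: "\<And>t. t \<in> {0..T} \<Longrightarrow> \<bar>w' t\<bar> \<le> k * max (w t) 0"
    and t0: "t0 \<in> {0..T}" "w t0 \<le> 0" and t: "t \<in> {0..T}"
  shows "w t = w t0"
proof -
  \<comment> \<open>The square of the positive part is differentiable everywhere, the positive part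
    itself is not.\<close>
  have m2: "((\<lambda>z::real. (max z 0)\<^sup>2) has_real_derivative 2 * max z 0) (at z)" for z
  proof (cases z "0::real" rule: linorder_cases)
    case less
    have "((\<lambda>z::real. 0) has_real_derivative 2 * max z 0) (at z)" using less by simp
    then show ?thesis
      by (rule has_field_derivative_transform_within_open[of _ _ _ "{..<0}"]) (use less in auto)
  next
    case greater
    have "((\<lambda>z::real. z\<^sup>2) has_real_derivative 2 * max z 0) (at z)"
      using greater by (auto intro!: derivative_eq_intros)
    then show ?thesis
      by (rule has_field_derivative_transform_within_open[of _ _ _ "{0<..}"]) (use greater in auto)
  next
    case equal
    have "((\<lambda>h::real. (max h 0)\<^sup>2 / h) \<longlongrightarrow> 0) (at 0)"
    proof (rule Lim_null_comparison)
      show "\<forall>\<^sub>F h in at 0. norm ((max h 0)\<^sup>2 / h) \<le> \<bar>h\<bar>"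
        by (rule always_eventually) (auto simp: max_def power2_eq_square)
      show "((\<lambda>h. \<bar>h::real\<bar>) \<longlongrightarrow> 0) (at 0)" by (intro tendsto_rabs_zero tendsto_ident_at)
    qed
    then show ?thesis using equal by (simp add: DERIV_def)
  qed
  \<comment> \<open>The sign of \<open>\<kappa>\<close> selects the direction of time: with -2k the
    function decreases, with 2k it increases.\<close>
  define h where "h = (\<lambda>\<kappa> s. exp (\<kappa> * s) * (max (w s) 0)\<^sup>2)"
  have hd: "(h \<kappa> has_real_derivative exp (\<kappa> * s) * (\<kappa> * (max (w s) 0)\<^sup>2 + 2 * max (w s) 0 * w' s)) (at s within {0..T})"
    if "s \<in> {0..T}" for \<kappa> s
  proof -
    have "((\<lambda>s. (max (w s) 0)\<^sup>2) has_real_derivative 2 * max (w s) 0 * w' s) (at s within {0..T})"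
      by (rule DERIV_chain2[OF m2 d[OF that]])
    moreover have "((\<lambda>s. exp (\<kappa> * s)) has_real_derivative \<kappa> * exp (\<kappa> * s)) (at s within {0..T})"
      by (auto intro!: derivative_eq_intros)
    ultimately have "((\<lambda>s. exp (\<kappa> * s) * (max (w s) 0)\<^sup>2) has_real_derivative
        exp (\<kappa> * s) * (2 * max (w s) 0 * w' s) + \<kappa> * exp (\<kappa> * s) * (max (w s) 0)\<^sup>2) (at s within {0..T})"
      by (rule DERIV_mult'[rotated])
    then show ?thesis unfolding h_def by (simp add: algebra_simps)
  qed
  have hc: "continuous_on {0..T} (h \<kappa>)" for \<kappa>
    unfolding continuous_on_eq_continuous_within using DERIV_continuous[OF hd] by blast
  have hat: "(h \<kappa> has_real_derivative exp (\<kappa> * s) * (\<kappa> * (max (w s) 0)\<^sup>2 + 2 * max (w s) 0 * w' s)) (at s)"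
    if "0 < s" "s < T" for \<kappa> s
    using hd[of s \<kappa>] that at_within_Icc_at[of 0 s T] by auto
  have w'b: "\<bar>2 * max (w s) 0 * w' s\<bar> \<le> 2 * k * (max (w s) 0)\<^sup>2" if "s \<in> {0..T}" for s
  proof -
    have "\<bar>2 * max (w s) 0 * w' s\<bar> = 2 * max (w s) 0 * \<bar>w' s\<bar>" by (simp add: abs_mult)
    also have "\<dots> \<le> 2 * max (w s) 0 * (k * max (w s) 0)" by (intro mult_left_mono le that) auto
    finally show ?thesis by (simp add: power2_eq_square algebra_simps)
  qed
  have hge: "h \<kappa> s \<ge> 0" for \<kappa> s by (simp add: h_def)
  have neg: "w s \<le> 0" if s: "s \<in> {0..T}" for s
  proof (cases "t0 \<le> s")
    case True
    have "h (- (2 * k)) s \<le> h (- (2 * k)) t0"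
    proof (rule DERIV_nonpos_imp_decreasing_open[OF True])
      fix r assume r: "t0 < r" "r < s"
      have "r \<in> {0..T}" using r t0 s by auto
      from w'b[OF this] have "exp (- (2 * k) * r) * (- (2 * k) * (max (w r) 0)\<^sup>2 + 2 * max (w r) 0 * w' r) \<le> 0"
        by (intro mult_nonneg_nonpos) auto
      then show "\<exists>y. (h (- (2 * k)) has_real_derivative y) (at r) \<and> y \<le> 0"
        using hat[of r "- (2 * k)"] r t0 s by auto
    qed (use continuous_on_subset[OF hc] t0 s in auto)
    also have "h (- (2 * k)) t0 = 0" using t0 by (simp add: h_def)
    finally have "h (- (2 * k)) s = 0" using hge by (metis antisym)
    then show ?thesis by (simp add: h_def max_def split: if_splits)
  next
    case False
    have "h (2 * k) s \<le> h (2 * k) t0"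
    proof (rule DERIV_nonneg_imp_increasing_open[where f = "h (2 * k)" and a = s and b = t0])
      show "s \<le> t0" using False by simp
    next
      fix r assume r: "s < r" "r < t0"
      have "r \<in> {0..T}" using r t0 s by auto
      from w'b[OF this] have "exp (2 * k * r) * (2 * k * (max (w r) 0)\<^sup>2 + 2 * max (w r) 0 * w' r) \<ge> 0"
        by (intro mult_nonneg_nonneg) auto
      then show "\<exists>y. (h (2 * k) has_real_derivative y) (at r) \<and> 0 \<le> y"
        using hat[of r "2 * k"] r t0 s by auto
    qed (use continuous_on_subset[OF hc] t0 s in auto)
    also have "h (2 * k) t0 = 0" using t0 by (simp add: h_def)
    finally have "h (2 * k) s = 0" using hge by (metis antisym)
    then show ?thesis by (simp add: h_def max_def split: if_splits)
  qed
  have "(w has_real_derivative 0) (at s within {0..T})" if "s \<in> {0..T}" for s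
  proof -
    have "w' s = 0" using le[OF that] neg[OF that] by (simp add: max_def split: if_splits)
    then show ?thesis using d[OF that] by simp
  qed
  then show ?thesis
    by (metis has_field_derivative_zero_constant convex_real_interval(5) t t0(1))
qed

lemma borel_measurable_fst' [measurable (raw)]:
  fixes f :: "'c \<Rightarrow> 'a::topological_space \<times> 'b::topological_space"
  shows "f \<in> borel_measurable M \<Longrightarrow> (\<lambda>x. fst (f x)) \<in> borel_measurable M"
  by (rule measurable_compose[OF _ borel_measurable_continuous_onI]) (auto intro!: continuous_intros)

lemma borel_measurable_snd' [measurable (raw)]:
  fixes f :: "'c \<Rightarrow> 'a::topological_space \<times> 'b::topological_space"
  shows "f \<in> borel_measurable M \<Longrightarrow> (\<lambda>x. snd (f x)) \<in> borel_measurable M"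
  by (rule measurable_compose[OF _ borel_measurable_continuous_onI]) (auto intro!: continuous_intros)

declare scaleR_Pair [simp del]

lemma relu_measurable [measurable]: "relu \<in> borel_measurable borel"
  unfolding relu_def[abs_def] by measurable

lemma relu'_measurable [measurable]: "relu' \<in> borel_measurable borel"
  unfolding relu'_def[abs_def] by measurable

text \<open>The parameter \<open>\<theta> = (a, u)\<close> with \<open>u = (w, b)\<close> acts on a data point \<open>x\<close> through
  \<open>w \<bullet> x + b = u \<bullet> (x, 1)\<close>.\<close>

lemma phi_eq: "phi \<theta> x = fst \<theta> * relu (snd \<theta> \<bullet> (x, 1))"
  by (cases \<theta>) (simp add: inner_Pair)

lemma grad_phi_eq:
  "grad_phi \<theta> x = (relu (snd \<theta> \<bullet> (x, 1)), (fst \<theta> * relu' (snd \<theta> \<bullet> (x, 1))) *\<^sub>R (x, 1))"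
  by (cases \<theta>) (simp add: inner_Pair scaleR_Pair)

lemma phi_measurable [measurable (raw)]:
  assumes [measurable]: "f \<in> borel_measurable M" "g \<in> borel_measurable M"
  shows "(\<lambda>z. phi (f z) (g z)) \<in> borel_measurable M"
  unfolding phi_eq by measurable

lemma grad_phi_measurable [measurable (raw)]:
  assumes [measurable]: "f \<in> borel_measurable M" "g \<in> borel_measurable M"
  shows "(\<lambda>z. grad_phi (f z) (g z)) \<in> borel_measurable M"
  unfolding grad_phi_eq by measurable

lemma norm_param: "(norm (\<theta> :: real \<times> 'b::real_inner))\<^sup>2 = (fst \<theta>)\<^sup>2 + (norm (snd \<theta>))\<^sup>2"
  by (cases \<theta>) (simp add: norm_Pair)

lemma abs_fst_le: "\<bar>fst \<theta>\<bar> \<le> norm (\<theta> :: real \<times> 'b::real_inner)"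
  and norm_snd_le': "norm (snd \<theta>) \<le> norm (\<theta> :: real \<times> 'b::real_inner)"
  using norm_fst_le[of "fst \<theta>" "snd \<theta>"] norm_snd_le[of "snd \<theta>" "fst \<theta>"] by auto

lemma Theta_eq: "Theta = {\<theta>. \<bar>fst \<theta>\<bar> < norm (snd \<theta>)}"
proof -
  have st: "a\<^sup>2 < (norm w)\<^sup>2 + b\<^sup>2 \<longleftrightarrow> \<bar>a\<bar> < norm (w, b)" for a b :: real and w :: "real ^ 'n"
  proof -
    have "a\<^sup>2 < (norm w)\<^sup>2 + b\<^sup>2 \<longleftrightarrow> \<bar>a\<bar>\<^sup>2 < (norm (w, b))\<^sup>2" by (simp add: norm_Pair)
    also have "\<dots> \<longleftrightarrow> \<bar>a\<bar> < norm (w, b)"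
      using power2_less_imp_less[of "\<bar>a\<bar>" "norm (w, b)"] power_strict_mono[of "\<bar>a\<bar>" "norm (w, b)" 2] by auto
    finally show ?thesis .
  qed
  show ?thesis by (auto simp: Theta_def st)
qed

lemma closure_Theta: "closure Theta = {\<theta> :: 'n::finite param. \<bar>fst \<theta>\<bar> \<le> norm (snd \<theta>)}"
proof
  have "closed {\<theta> :: 'n param. \<bar>fst \<theta>\<bar> \<le> norm (snd \<theta>)}"
    by (intro closed_Collect_le continuous_intros)
  then show "closure Theta \<subseteq> {\<theta> :: 'n param. \<bar>fst \<theta>\<bar> \<le> norm (snd \<theta>)}"
    by (intro closure_minimal) (auto simp: Theta_eq)
  show "{\<theta> :: 'n param. \<bar>fst \<theta>\<bar> \<le> norm (snd \<theta>)} \<subseteq> closure Theta"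
  proof
    fix \<theta> :: "'n param" assume \<theta>: "\<theta> \<in> {\<theta>. \<bar>fst \<theta>\<bar> \<le> norm (snd \<theta>)}"
    \<comment> \<open>Lengthening the inner weights along their own direction moves a boundary point
      into the open cone; at zero inner weights any unit vector will do.\<close>
    define v where "v = (if snd \<theta> = 0 then (0, 1) else sgn (snd \<theta>))"
    have nv: "norm v = 1" by (auto simp: v_def norm_sgn)
    have add: "norm (snd \<theta> + e *\<^sub>R v) = norm (snd \<theta>) + e" if "0 < e" for e
    proof (cases "snd \<theta> = 0")
      case True then show ?thesis using nv that by simp
    next
      case False
      then have "snd \<theta> + e *\<^sub>R v = (1 + e / norm (snd \<theta>)) *\<^sub>R snd \<theta>"
        by (simp add: v_def sgn_div_norm scaleR_add_left divide_inverse)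
      then have "norm (snd \<theta> + e *\<^sub>R v) = \<bar>1 + e / norm (snd \<theta>)\<bar> * norm (snd \<theta>)" by simp
      also have "\<dots> = norm (snd \<theta>) + e" using that False by (simp add: field_simps)
      finally show ?thesis .
    qed
    show "\<theta> \<in> closure Theta" unfolding closure_approachable
    proof (intro allI impI)
      fix e :: real assume e: "0 < e"
      let ?y = "(fst \<theta>, snd \<theta> + (e/2) *\<^sub>R v)"
      have "?y \<in> Theta" using \<theta> add[of "e/2"] e by (simp add: Theta_eq)
      moreover have "dist ?y \<theta> < e"
      proof -
        have "?y - \<theta> = (0, (e/2) *\<^sub>R v)" by (cases \<theta>) simp
        then show ?thesis using nv e by (simp add: dist_norm norm_Pair)
      qed
      ultimately show "\<exists>y\<in>Theta. dist y \<theta> < e" by blast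
    qed
  qed
qed

lemma open_Theta: "open Theta"
  unfolding Theta_eq by (intro open_Collect_less continuous_intros)

lemma Theta_subset: "Theta \<subseteq> closure Theta" by (rule closure_subset)

lemma scale_closure_Theta: "\<theta> \<in> closure Theta \<Longrightarrow> 0 \<le> r \<Longrightarrow> r *\<^sub>R \<theta> \<in> closure Theta"
  by (auto simp: closure_Theta abs_mult mult_left_mono)

lemma scale_Theta: "\<theta> \<in> Theta \<Longrightarrow> 0 < r \<Longrightarrow> r *\<^sub>R \<theta> \<in> Theta"
  by (auto simp: Theta_eq abs_mult)

lemma zero_closure_Theta: "0 \<in> closure Theta"
  by (auto simp: closure_Theta)

lemma relu_scale: "0 \<le> r \<Longrightarrow> relu (r * z) = r * relu z"
  by (cases "r = 0") (auto simp: relu_def max_def zero_le_mult_iff mult_le_0_iff)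

lemma relu_nonneg: "0 \<le> relu z" and relu_abs_le: "relu z \<le> \<bar>z\<bar>" and relu_lipschitz: "\<bar>relu z - relu z'\<bar> \<le> \<bar>z - z'\<bar>"
  and relu'_nonneg: "0 \<le> relu' z" and relu'_le: "relu' z \<le> 1" and relu'_mult: "relu' z * z = relu z"
  by (auto simp: relu_def relu'_def max_def)

text \<open>The first-order remainder vanishes unless the activation switches between the two
  points. Hence all nonsmoothness is carried by inputs at which the activation differs.\<close>

lemma relu_remainder: "\<bar>relu z' - relu z - relu' z * (z' - z)\<bar> \<le> \<bar>z' - z\<bar> * \<bar>relu' z' - relu' z\<bar>"
  by (auto simp: relu_def relu'_def max_def)

lemma phi_scale: "0 \<le> r \<Longrightarrow> phi (r *\<^sub>R \<theta>) x = r\<^sup>2 * phi \<theta> x"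
  by (simp add: phi_eq relu_scale power2_eq_square)

lemma grad_phi_scale: "0 \<le> r \<Longrightarrow> grad_phi (r *\<^sub>R \<theta>) x = r *\<^sub>R grad_phi \<theta> x"
  by (cases "r = 0") (simp add: grad_phi_eq relu_def zero_prod_def, auto simp: grad_phi_eq relu_scale relu'_def zero_less_mult_iff scaleR_Pair)

text \<open>Euler's identity, separately for the outer weight and for the inner weights, in each of
  which \<open>phi\<close> is homogeneous of degree one. Equality of the two separate products is
  what conserves the difference of the squared norms of the two layers.\<close>

lemma inner_grad_phi:
  "fst \<theta> * fst (grad_phi \<theta> x) = phi \<theta> x" "snd \<theta> \<bullet> snd (grad_phi \<theta> x) = phi \<theta> x"
  "\<theta> \<bullet> grad_phi \<theta> x = 2 * phi \<theta> x"
proof -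
  show 1: "fst \<theta> * fst (grad_phi \<theta> x) = phi \<theta> x" by (simp add: phi_eq grad_phi_eq)
  show 2: "snd \<theta> \<bullet> snd (grad_phi \<theta> x) = phi \<theta> x"
    by (simp only: phi_eq grad_phi_eq snd_conv inner_scaleR_right mult.assoc relu'_mult)
  show "\<theta> \<bullet> grad_phi \<theta> x = 2 * phi \<theta> x"
    using 1 2 by (simp add: inner_prod_def)
qed

lemma inner_aug_le: "\<bar>u \<bullet> (x, 1::real)\<bar> \<le> norm u * norm (x, 1::real)"
  by (rule Cauchy_Schwarz_ineq2)

lemma phi_le: "\<bar>phi \<theta> x\<bar> \<le> (norm \<theta>)\<^sup>2 * norm (x, 1::real)"
proof -
  have "\<bar>phi \<theta> x\<bar> = \<bar>fst \<theta>\<bar> * relu (snd \<theta> \<bullet> (x, 1))" by (simp add: phi_eq abs_mult relu_nonneg)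
  also have "\<dots> \<le> norm \<theta> * (norm \<theta> * norm (x, 1::real))"
  proof (intro mult_mono abs_fst_le)
    show "relu (snd \<theta> \<bullet> (x, 1)) \<le> norm \<theta> * norm (x, 1::real)"
      by (rule order_trans[OF relu_abs_le order_trans[OF inner_aug_le]]) (simp add: mult_right_mono norm_snd_le')
  qed (auto simp: relu_nonneg)
  finally show ?thesis by (simp add: power2_eq_square)
qed

lemma phi_diff_le: "\<bar>phi \<theta> x - phi \<theta>' x\<bar> \<le> (norm \<theta> + norm \<theta>') * norm (\<theta> - \<theta>') * norm (x, 1::real)"
proof -
  let ?z = "snd \<theta> \<bullet> (x, 1::real)" and ?z' = "snd \<theta>' \<bullet> (x, 1::real)" and ?q = "norm (x, 1::real)"
  have eq: "phi \<theta> x - phi \<theta>' x = fst (\<theta> - \<theta>') * relu ?z + fst \<theta>' * (relu ?z - relu ?z')"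
    by (simp add: phi_eq algebra_simps)
  have "\<bar>phi \<theta> x - phi \<theta>' x\<bar> \<le> \<bar>fst (\<theta> - \<theta>')\<bar> * \<bar>relu ?z\<bar> + \<bar>fst \<theta>'\<bar> * \<bar>relu ?z - relu ?z'\<bar>"
    unfolding eq abs_mult[symmetric] by (rule abs_triangle_ineq)
  also have "\<bar>fst (\<theta> - \<theta>')\<bar> * \<bar>relu ?z\<bar> \<le> norm (\<theta> - \<theta>') * (norm \<theta> * ?q)"
  proof (intro mult_mono abs_fst_le)
    have "\<bar>relu ?z\<bar> \<le> \<bar>?z\<bar>" using relu_nonneg relu_abs_le by (simp add: abs_of_nonneg)
    also have "\<dots> \<le> norm \<theta> * ?q" by (rule order_trans[OF inner_aug_le]) (simp add: mult_right_mono norm_snd_le')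
    finally show "\<bar>relu ?z\<bar> \<le> norm \<theta> * ?q" .
  qed auto
  also have "\<bar>fst \<theta>'\<bar> * \<bar>relu ?z - relu ?z'\<bar> \<le> norm \<theta>' * (norm (\<theta> - \<theta>') * ?q)"
  proof (intro mult_mono abs_fst_le)
    have "\<bar>relu ?z - relu ?z'\<bar> \<le> \<bar>snd (\<theta> - \<theta>') \<bullet> (x, 1)\<bar>"
      using relu_lipschitz[of ?z ?z'] by (simp add: inner_diff_left)
    also have "\<dots> \<le> norm (\<theta> - \<theta>') * ?q" by (rule order_trans[OF inner_aug_le]) (simp only: mult_right_mono norm_snd_le' norm_ge_zero)
    finally show "\<bar>relu ?z - relu ?z'\<bar> \<le> norm (\<theta> - \<theta>') * ?q" .
  qed auto
  finally show ?thesis by (simp add: algebra_simps)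
qed

lemma norm_grad_phi_le: "norm (grad_phi \<theta> x) \<le> norm \<theta> * norm (x, 1::real)"
proof (rule power2_le_imp_le)
  let ?z = "snd \<theta> \<bullet> (x, 1::real)" and ?q = "norm (x, 1::real)"
  have "\<bar>relu ?z\<bar> \<le> norm (snd \<theta>) * ?q"
    using order_trans[OF relu_abs_le inner_aug_le] relu_nonneg by (simp add: abs_of_nonneg)
  then have 1: "(relu ?z)\<^sup>2 \<le> (norm (snd \<theta>) * ?q)\<^sup>2" by (rule abs_le_square_iff[THEN iffD1, OF order_trans]) simp
  have "\<bar>fst \<theta>\<bar> * relu' ?z \<le> \<bar>fst \<theta>\<bar> * 1" by (intro mult_left_mono relu'_le) auto
  then have "norm ((fst \<theta> * relu' ?z) *\<^sub>R (x, 1::real)) \<le> \<bar>fst \<theta>\<bar> * ?q"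
    unfolding norm_scaleR abs_mult using relu'_nonneg[of ?z] by (intro mult_right_mono) auto
  then have 2: "(norm ((fst \<theta> * relu' ?z) *\<^sub>R (x, 1::real)))\<^sup>2 \<le> (\<bar>fst \<theta>\<bar> * ?q)\<^sup>2" by (intro power_mono) auto
  have "(norm (grad_phi \<theta> x))\<^sup>2 = (relu ?z)\<^sup>2 + (norm ((fst \<theta> * relu' ?z) *\<^sub>R (x, 1::real)))\<^sup>2"
    unfolding grad_phi_eq norm_param by simp
  also have "\<dots> \<le> (norm (snd \<theta>) * ?q)\<^sup>2 + (\<bar>fst \<theta>\<bar> * ?q)\<^sup>2" using 1 2 by (rule add_mono)
  also have "\<dots> = (norm \<theta> * ?q)\<^sup>2" unfolding power_mult_distrib norm_param by (simp add: algebra_simps)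
  finally show "(norm (grad_phi \<theta> x))\<^sup>2 \<le> (norm \<theta> * ?q)\<^sup>2" .
qed simp

text \<open>The gradient is Lipschitz up to a jump where the activations of the two parameters
  differ, and the height of the jump carries the factor \<bar>a\<bar>. For fixed x the jump cannot
  be bounded by the distance; only its average over the data can.\<close>

lemma norm_grad_phi_diff_le:
  "norm (grad_phi \<theta> x - grad_phi \<theta>' x) \<le> 2 * norm (\<theta> - \<theta>') * norm (x, 1::real)
     + \<bar>fst \<theta>'\<bar> * (\<bar>relu' (snd \<theta> \<bullet> (x, 1)) - relu' (snd \<theta>' \<bullet> (x, 1))\<bar> * norm (x, 1::real))"
proof -
  let ?z = "snd \<theta> \<bullet> (x, 1::real)" and ?z' = "snd \<theta>' \<bullet> (x, 1::real)" and ?q = "norm (x, 1::real)"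
  let ?A = "relu ?z - relu ?z'" and ?B = "fst \<theta> * relu' ?z - fst \<theta>' * relu' ?z'"
  have "grad_phi \<theta> x - grad_phi \<theta>' x = (?A, ?B *\<^sub>R (x, 1))"
    by (simp add: grad_phi_eq scaleR_diff_left)
  then have "norm (grad_phi \<theta> x - grad_phi \<theta>' x) \<le> \<bar>?A\<bar> + \<bar>?B\<bar> * ?q"
    using norm_Pair_le[of ?A "?B *\<^sub>R (x, 1::real)"] by simp
  moreover have "\<bar>?A\<bar> \<le> norm (\<theta> - \<theta>') * ?q"
  proof -
    have "\<bar>?A\<bar> \<le> \<bar>snd (\<theta> - \<theta>') \<bullet> (x, 1)\<bar>"
      using relu_lipschitz[of ?z ?z'] by (simp add: inner_diff_left)
    also have "\<dots> \<le> norm (\<theta> - \<theta>') * ?q" by (rule order_trans[OF inner_aug_le]) (simp only: mult_right_mono norm_snd_le' norm_ge_zero)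
    finally show ?thesis .
  qed
  moreover have "\<bar>?B\<bar> \<le> norm (\<theta> - \<theta>') + \<bar>fst \<theta>'\<bar> * \<bar>relu' ?z - relu' ?z'\<bar>"
  proof -
    have "?B = (fst \<theta> - fst \<theta>') * relu' ?z + fst \<theta>' * (relu' ?z - relu' ?z')" by (simp add: algebra_simps)
    then have "\<bar>?B\<bar> \<le> \<bar>(fst \<theta> - fst \<theta>') * relu' ?z\<bar> + \<bar>fst \<theta>' * (relu' ?z - relu' ?z')\<bar>"
      by (metis abs_triangle_ineq)
    also have "\<dots> = \<bar>fst (\<theta> - \<theta>')\<bar> * relu' ?z + \<bar>fst \<theta>'\<bar> * \<bar>relu' ?z - relu' ?z'\<bar>"
      using relu'_nonneg[of ?z] by (simp add: abs_mult)
    also have "\<bar>fst (\<theta> - \<theta>')\<bar> * relu' ?z \<le> norm (\<theta> - \<theta>') * 1"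
      by (intro mult_mono abs_fst_le relu'_le relu'_nonneg norm_ge_zero)
    finally show ?thesis by simp
  qed
  then have "\<bar>?B\<bar> * ?q \<le> (norm (\<theta> - \<theta>') + \<bar>fst \<theta>'\<bar> * \<bar>relu' ?z - relu' ?z'\<bar>) * ?q"
    by (intro mult_right_mono) auto
  ultimately show ?thesis by (simp add: algebra_simps)
qed

lemma phi_remainder:
  "\<bar>phi \<theta>' x - phi \<theta> x - grad_phi \<theta> x \<bullet> (\<theta>' - \<theta>)\<bar> \<le> (norm (\<theta>' - \<theta>))\<^sup>2 * norm (x, 1::real)
     + \<bar>fst \<theta>\<bar> * norm (\<theta>' - \<theta>) * (\<bar>relu' (snd \<theta>' \<bullet> (x, 1)) - relu' (snd \<theta> \<bullet> (x, 1))\<bar> * norm (x, 1::real))"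
proof -
  let ?z = "snd \<theta> \<bullet> (x, 1::real)" and ?z' = "snd \<theta>' \<bullet> (x, 1::real)" and ?q = "norm (x, 1::real)"
  let ?D = "norm (\<theta>' - \<theta>)"
  have zz: "\<bar>?z' - ?z\<bar> \<le> ?D * ?q"
  proof -
    have "\<bar>?z' - ?z\<bar> = \<bar>snd (\<theta>' - \<theta>) \<bullet> (x, 1)\<bar>" by (simp add: inner_diff_left)
    also have "\<dots> \<le> ?D * ?q" by (rule order_trans[OF inner_aug_le]) (simp only: mult_right_mono norm_snd_le' norm_ge_zero)
    finally show ?thesis .
  qed
  have in_eq: "grad_phi \<theta> x \<bullet> (\<theta>' - \<theta>) = relu ?z * (fst \<theta>' - fst \<theta>) + fst \<theta> * (relu' ?z * (?z' - ?z))"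
    unfolding grad_phi_eq inner_prod_def[of "(_, _)"]
    by (simp add: inner_diff_right inner_commute[of "(x, 1)"] algebra_simps)
  have eq: "phi \<theta>' x - phi \<theta> x - grad_phi \<theta> x \<bullet> (\<theta>' - \<theta>) =
      fst (\<theta>' - \<theta>) * (relu ?z' - relu ?z) + fst \<theta> * (relu ?z' - relu ?z - relu' ?z * (?z' - ?z))"
    unfolding in_eq by (simp add: phi_eq algebra_simps)
  have "\<bar>phi \<theta>' x - phi \<theta> x - grad_phi \<theta> x \<bullet> (\<theta>' - \<theta>)\<bar> \<le>
      \<bar>fst (\<theta>' - \<theta>)\<bar> * \<bar>relu ?z' - relu ?z\<bar> + \<bar>fst \<theta>\<bar> * \<bar>relu ?z' - relu ?z - relu' ?z * (?z' - ?z)\<bar>"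
    unfolding eq abs_mult[symmetric] by (rule abs_triangle_ineq)
  also have "\<dots> \<le> ?D * (?D * ?q) + \<bar>fst \<theta>\<bar> * (?D * ?q * \<bar>relu' ?z' - relu' ?z\<bar>)"
  proof (rule add_mono)
    have "\<bar>relu ?z' - relu ?z\<bar> \<le> ?D * ?q" using relu_lipschitz[of ?z' ?z] zz by linarith
    then show "\<bar>fst (\<theta>' - \<theta>)\<bar> * \<bar>relu ?z' - relu ?z\<bar> \<le> ?D * (?D * ?q)"
      by (rule mult_mono[OF abs_fst_le]) auto
    have "\<bar>relu ?z' - relu ?z - relu' ?z * (?z' - ?z)\<bar> \<le> ?D * ?q * \<bar>relu' ?z' - relu' ?z\<bar>"
      using relu_remainder[of ?z' ?z] mult_right_mono[OF zz, of "\<bar>relu' ?z' - relu' ?z\<bar>"] by linarith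
    then show "\<bar>fst \<theta>\<bar> * \<bar>relu ?z' - relu ?z - relu' ?z * (?z' - ?z)\<bar> \<le> \<bar>fst \<theta>\<bar> * (?D * ?q * \<bar>relu' ?z' - relu' ?z\<bar>)"
      by (rule mult_left_mono) simp
  qed
  finally show ?thesis by (simp add: power2_eq_square algebra_simps)
qed

section \<open>Averaged estimates for potentials of bounded residuals\<close>

locale relu_data =
  fixes P :: "((real ^ 'n::finite) \<times> real) measure"
  assumes data: "data_assms P"
begin

lemma sets_P [measurable_cong]: "sets P = sets borel"
  using data by (simp add: data_assms_def)

lemma space_P [simp]: "space P = UNIV"
  using sets_eq_imp_space_eq[OF sets_P] by simp

sublocale prob_space P
  using data by (simp add: data_assms_def)

text \<open>This is sqrt(1 + |x|^2), the weight in the Lipschitz hypothesis on half-spaces.\<close>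

abbreviation q :: "(real ^ 'n) \<times> real \<Rightarrow> real" where
  "q p \<equiv> norm (fst p, 1::real)"

lemma integrable_q: "integrable P q"
proof (rule Bochner_Integration.integrable_bound)
  have "integrable P (\<lambda>(x, y). norm x + \<bar>y\<bar>)" using data by (simp add: data_assms_def)
  then show "integrable P (\<lambda>p. (case p of (x, y) \<Rightarrow> norm x + \<bar>y\<bar>) + 1)" by simp
  show "AE p in P. norm (q p) \<le> norm ((case p of (x, y) \<Rightarrow> norm x + \<bar>y\<bar>) + 1)"
  proof (rule AE_I2)
    fix p :: "(real ^ 'n) \<times> real"
    show "norm (q p) \<le> norm ((case p of (x, y) \<Rightarrow> norm x + \<bar>y\<bar>) + 1)"
      using norm_Pair_le[of "fst p" "1::real"] by (cases p) auto
  qed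
qed measurable

definition moment :: real where
  "moment = (\<integral>p. q p \<partial>P)"

lemma moment_nonneg: "0 \<le> moment"
  unfolding moment_def by simp

text \<open>The weighted indicator of the inputs that activate exactly one of the two
  neurons.\<close>

abbreviation switch :: "(real ^ 'n) \<times> real \<Rightarrow> (real ^ 'n) \<times> real \<Rightarrow> (real ^ 'n) \<times> real \<Rightarrow> real" where
  "switch u u' p \<equiv> \<bar>relu' (u \<bullet> (fst p, 1)) - relu' (u' \<bullet> (fst p, 1))\<bar> * q p"

lemma integrable_switch: "integrable P (switch u u')"
proof (rule Bochner_Integration.integrable_bound[OF integrable_q])
  show "AE p in P. norm (switch u u' p) \<le> norm (q p)"
    by (rule AE_I2) (auto simp: relu'_def)
qed measurable

lemma switch_scale: "0 < r \<Longrightarrow> 0 < r' \<Longrightarrow> switch (r *\<^sub>R u) (r' *\<^sub>R u') p = switch u u' p"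
  by (auto simp: relu'_def zero_less_mult_iff)

lemma integral_switch_le_moment: "(\<integral>p. switch u u' p \<partial>P) \<le> moment"
  unfolding moment_def
  by (intro integral_mono integrable_switch integrable_q) (auto simp: relu'_def)

lemma switch_sphere: "\<exists>K. \<forall>u u'. norm u = 1 \<and> norm u' = 1 \<longrightarrow> (\<integral>p. switch u u' p \<partial>P) \<le> K * norm (u - u')"
proof -
  obtain K where K: "\<forall>w b w' b'. (w, b) \<in> sphere 0 1 \<and> (w', b') \<in> sphere 0 1 \<longrightarrow>
        (\<integral>x. \<bar>indicator {x. w \<bullet> x + b > 0} x - indicator {x. w' \<bullet> x + b' > 0} x\<bar>
           \<partial>density (marginal P) (\<lambda>x. ennreal (sqrt (1 + (norm x)\<^sup>2))))
        \<le> K * dist (w, b) (w', b')"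
    using data unfolding data_assms_def by blast
  have "(\<integral>p. switch u u' p \<partial>P) \<le> K * norm (u - u')" if u: "norm u = 1" "norm u' = 1" for u u' :: "(real ^ 'n) \<times> real"
  proof -
    obtain w b where wb: "u = (w, b)" by (cases u)
    obtain w' b' where wb': "u' = (w', b')" by (cases u')
    let ?f = "\<lambda>x. \<bar>indicator {x. w \<bullet> x + b > 0} x - indicator {x. w' \<bullet> x + b' > 0} x :: real\<bar>"
    have fm[measurable]: "?f \<in> borel_measurable borel" by measurable
    have mm: "sets (marginal P) = sets borel" by (simp add: marginal_def)
    have "(\<integral>x. ?f x \<partial>density (marginal P) (\<lambda>x. ennreal (sqrt (1 + (norm x)\<^sup>2)))) =
        (\<integral>x. sqrt (1 + (norm x)\<^sup>2) *\<^sub>R ?f x \<partial>marginal P)"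
      by (rule integral_density) (auto simp: marginal_def)
    also have "\<dots> = (\<integral>p. sqrt (1 + (norm (fst p))\<^sup>2) *\<^sub>R ?f (fst p) \<partial>P)"
      unfolding marginal_def by (rule integral_distr) measurable
    also have "\<dots> = (\<integral>p. switch u u' p \<partial>P)"
      by (intro Bochner_Integration.integral_cong)
         (auto simp: wb wb' norm_Pair inner_Pair relu'_def indicator_def add.commute)
    finally have eq: "(\<integral>x. ?f x \<partial>density (marginal P) (\<lambda>x. ennreal (sqrt (1 + (norm x)\<^sup>2)))) = (\<integral>p. switch u u' p \<partial>P)" .
    have "(w, b) \<in> sphere 0 1 \<and> (w', b') \<in> sphere 0 1" using u by (simp add: wb wb')
    from K[rule_format, OF this, unfolded eq] show ?thesis by (simp only: wb wb' dist_norm)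
  qed
  then show ?thesis by blast
qed

text \<open>Activation depends only on the direction of the weights, so the hypothesis on the sphere
  extends by normalisation; the factor \<open>norm u\<close> turns the distance of directions back
  into a distance of vectors.\<close>

lemma switch_lipschitz_exists: "\<exists>K\<ge>0. \<forall>u u'. norm u * (\<integral>p. switch u u' p \<partial>P) \<le> K * norm (u - u')"
proof -
  obtain K where K: "\<And>u u'. norm u = 1 \<Longrightarrow> norm u' = 1 \<Longrightarrow> (\<integral>p. switch u u' p \<partial>P) \<le> K * norm (u - u')"
    using switch_sphere by blast
  \<comment> \<open>Comparing the normalised vectors costs the distance of \<open>u\<close> and
    \<open>u'\<close> twice, hence \<open>2 * \<bar>K\<bar>\<close>; \<open>moment\<close> serves
    the case \<open>u' = 0\<close>, where there is no direction.\<close>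
  define K' where "K' = 2 * \<bar>K\<bar> + moment"
  have "norm u * (\<integral>p. switch u u' p \<partial>P) \<le> K' * norm (u - u')" for u u' :: "(real ^ 'n) \<times> real"
  proof -
    consider "u = 0" | "u \<noteq> 0" "u' = 0" | "u \<noteq> 0" "u' \<noteq> 0" by blast
    then show ?thesis
    proof cases
      case 1
      then show ?thesis using moment_nonneg by (simp add: K'_def)
    next
      case 2
      have "norm u * (\<integral>p. switch u u' p \<partial>P) \<le> norm u * moment"
        by (intro mult_left_mono integral_switch_le_moment) auto
      also have "\<dots> \<le> norm u * K'" by (intro mult_left_mono) (auto simp: K'_def)
      finally show ?thesis using 2 by (simp add: mult.commute)
    next
      case 3
      let ?v = "sgn u" and ?v' = "sgn u'"
      have "switch u u' = switch (norm u *\<^sub>R ?v) (norm u' *\<^sub>R ?v')" using 3 by (simp add: sgn_div_norm)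
      also have "\<dots> = switch ?v ?v'" using 3 by (intro ext switch_scale) auto
      finally have "(\<integral>p. switch u u' p \<partial>P) \<le> K * norm (?v - ?v')" using K[of ?v ?v'] 3 by (simp add: norm_sgn)
      also have "\<dots> \<le> \<bar>K\<bar> * norm (?v - ?v')" by (intro mult_right_mono) auto
      finally have "norm u * (\<integral>p. switch u u' p \<partial>P) \<le> norm u * (\<bar>K\<bar> * norm (?v - ?v'))"
        by (intro mult_left_mono) auto
      also have "\<dots> = \<bar>K\<bar> * norm (norm u *\<^sub>R ?v - norm u *\<^sub>R ?v')"
        by (simp add: scaleR_diff_right[symmetric])
      also have "norm (norm u *\<^sub>R ?v - norm u *\<^sub>R ?v') \<le> norm (u - u') + norm (u' - norm u *\<^sub>R ?v')"
        using 3 norm_triangle_ineq[of "u - u'" "u' - norm u *\<^sub>R ?v'"] by (simp add: sgn_div_norm)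
      also have "norm (u' - norm u *\<^sub>R ?v') \<le> norm (u - u')"
      proof -
        have "norm u' *\<^sub>R ?v' = u'" using 3 by (simp add: sgn_div_norm)
        then have "u' - norm u *\<^sub>R ?v' = (norm u' - norm u) *\<^sub>R ?v'" by (simp add: scaleR_diff_left)
        then have "norm (u' - norm u *\<^sub>R ?v') = \<bar>norm u' - norm u\<bar>" using 3 by (simp add: norm_sgn)
        also have "\<dots> \<le> norm (u - u')" by (metis norm_minus_commute norm_triangle_ineq3)
        finally show ?thesis .
      qed
      finally have "norm u * (\<integral>p. switch u u' p \<partial>P) \<le> \<bar>K\<bar> * (norm (u - u') + norm (u - u'))"
        by (simp add: mult_left_mono)
      also have "\<dots> \<le> K' * norm (u - u')" using moment_nonneg by (simp add: K'_def algebra_simps)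
      finally show ?thesis .
    qed
  qed
  moreover have "0 \<le> K'" using moment_nonneg by (simp add: K'_def)
  ultimately show ?thesis by blast
qed

definition switch_const :: real where
  "switch_const = (SOME K. 0 \<le> K \<and> (\<forall>u u'. norm u * (\<integral>p. switch u u' p \<partial>P) \<le> K * norm (u - u')))"

lemma switch_const_nonneg: "0 \<le> switch_const"
  and switch_const: "norm u * (\<integral>p. switch u u' p \<partial>P) \<le> switch_const * norm (u - u')"
proof -
  have "0 \<le> switch_const \<and> (\<forall>u u'. norm u * (\<integral>p. switch u u' p \<partial>P) \<le> switch_const * norm (u - u'))"
    unfolding switch_const_def using switch_lipschitz_exists by (rule someI_ex)
  then show "0 \<le> switch_const" "norm u * (\<integral>p. switch u u' p \<partial>P) \<le> switch_const * norm (u - u')"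
    by blast+
qed

text \<open>A measure on parameters enters potentials and gradients only through such a factor. All
  constants below depend on it through \<open>C\<close> alone and are therefore uniform in the
  measure and in time.\<close>

definition residual :: "real \<Rightarrow> ((real ^ 'n) \<times> real \<Rightarrow> real) \<Rightarrow> bool" where
  "residual C \<rho> \<longleftrightarrow> \<rho> \<in> borel_measurable P \<and> (\<forall>p. \<bar>\<rho> p\<bar> \<le> C)"

definition pot :: "((real ^ 'n) \<times> real \<Rightarrow> real) \<Rightarrow> 'n param \<Rightarrow> real" where
  "pot \<rho> \<theta> = (\<integral>p. \<rho> p * phi \<theta> (fst p) \<partial>P)"

definition pgrad :: "((real ^ 'n) \<times> real \<Rightarrow> real) \<Rightarrow> 'n param \<Rightarrow> 'n param" where
  "pgrad \<rho> \<theta> = (\<integral>p. \<rho> p *\<^sub>R grad_phi \<theta> (fst p) \<partial>P)"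

lemma residual_abs_le: "residual C \<rho> \<Longrightarrow> \<bar>\<rho> p\<bar> \<le> C"
  by (simp only: residual_def)

lemma residual_nonneg: "residual C \<rho> \<Longrightarrow> 0 \<le> C"
  using residual_abs_le[of C \<rho> undefined] by linarith

lemma integrable_residual:
  fixes f :: "(real ^ 'n) \<times> real \<Rightarrow> 'c::{banach, second_countable_topology}"
  assumes \<rho>: "residual C \<rho>" and f: "f \<in> borel_measurable P" and le: "\<And>p. norm (f p) \<le> B * q p"
  shows "integrable P (\<lambda>p. \<rho> p *\<^sub>R f p)"
proof (rule Bochner_Integration.integrable_bound)
  show "integrable P (\<lambda>p. C * B * q p)" by (intro integrable_mult_right integrable_q)
  show "(\<lambda>p. \<rho> p *\<^sub>R f p) \<in> borel_measurable P" using \<rho> f by (auto simp: residual_def)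
  show "AE p in P. norm (\<rho> p *\<^sub>R f p) \<le> norm (C * B * q p)"
  proof (rule AE_I2)
    fix p
    have "norm (\<rho> p *\<^sub>R f p) \<le> C * (B * q p)" unfolding norm_scaleR
      using \<rho> le[of p] by (intro mult_mono) (auto intro: residual_abs_le[OF \<rho>] residual_nonneg[OF \<rho>])
    then show "norm (\<rho> p *\<^sub>R f p) \<le> norm (C * B * q p)" by (simp add: mult.assoc)
  qed
qed

lemma norm_integral_residual_le:
  fixes f :: "(real ^ 'n) \<times> real \<Rightarrow> 'c::{banach, second_countable_topology}"
  assumes \<rho>: "residual C \<rho>" and g: "integrable P g" and le: "\<And>p. norm (f p) \<le> g p"
  shows "norm (\<integral>p. \<rho> p *\<^sub>R f p \<partial>P) \<le> C * (\<integral>p. g p \<partial>P)"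
proof -
  have le': "norm (\<rho> p *\<^sub>R f p) \<le> C * g p" for p
    unfolding norm_scaleR using \<rho> le[of p]
    by (intro mult_mono) (auto intro: residual_abs_le[OF \<rho>] residual_nonneg[OF \<rho>])
  have "norm (\<integral>p. \<rho> p *\<^sub>R f p \<partial>P) \<le> (\<integral>p. C * g p \<partial>P)"
  proof (cases "integrable P (\<lambda>p. \<rho> p *\<^sub>R f p)")
    case True
    then show ?thesis using g le' by (intro Bochner_Integration.integral_norm_bound_integral) auto
  next
    \<comment> \<open>Neither measurability nor integrability of \<open>f\<close> is assumed: the
      integral of a non-integrable function is 0.\<close>
    case False
    have "0 \<le> (\<integral>p. C * g p \<partial>P)"
      by (rule integral_nonneg_AE, rule AE_I2, rule order_trans[OF norm_ge_zero le'])
    then show ?thesis using False by (simp add: not_integrable_integral_eq)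
  qed
  then show ?thesis by simp
qed

end

context relu_data
begin

lemma integrable_pot: "residual C \<rho> \<Longrightarrow> integrable P (\<lambda>p. \<rho> p * phi \<theta> (fst p))"
  using integrable_residual[where f = "\<lambda>p. phi \<theta> (fst p)" and B = "(norm \<theta>)\<^sup>2"]
  by (simp add: phi_le phi_measurable[OF borel_measurable_const borel_measurable_fst'] measurable_ident_sets sets_P)

lemma integrable_pgrad: "residual C \<rho> \<Longrightarrow> integrable P (\<lambda>p. \<rho> p *\<^sub>R grad_phi \<theta> (fst p))"
  by (rule integrable_residual[where B = "norm \<theta>"]) (auto simp: norm_grad_phi_le)

lemma pot_le:
  assumes "residual C \<rho>"
  shows "\<bar>pot \<rho> \<theta>\<bar> \<le> C * moment * (norm \<theta>)\<^sup>2"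
proof -
  have "norm (\<integral>p. \<rho> p *\<^sub>R phi \<theta> (fst p) \<partial>P) \<le> C * (\<integral>p. (norm \<theta>)\<^sup>2 * q p \<partial>P)"
    by (rule norm_integral_residual_le[OF assms]) (auto intro: integrable_mult_right integrable_q phi_le)
  then show ?thesis by (simp add: pot_def moment_def algebra_simps)
qed

lemma pgrad_le:
  assumes "residual C \<rho>"
  shows "norm (pgrad \<rho> \<theta>) \<le> C * moment * norm \<theta>"
proof -
  have "norm (pgrad \<rho> \<theta>) \<le> C * (\<integral>p. norm \<theta> * q p \<partial>P)"
    unfolding pgrad_def
    by (rule norm_integral_residual_le[OF assms]) (auto intro: integrable_mult_right integrable_q norm_grad_phi_le)
  then show ?thesis by (simp add: moment_def algebra_simps)
qed

lemma pot_scale: "0 \<le> r \<Longrightarrow> pot \<rho> (r *\<^sub>R \<theta>) = r\<^sup>2 * pot \<rho> \<theta>"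
proof -
  assume "0 \<le> r"
  then have "(\<lambda>p. \<rho> p * phi (r *\<^sub>R \<theta>) (fst p)) = (\<lambda>p. r\<^sup>2 * (\<rho> p * phi \<theta> (fst p)))" by (intro ext) (simp add: phi_scale mult.left_commute)
  then show ?thesis unfolding pot_def by simp
qed

lemma pgrad_scale: "0 \<le> r \<Longrightarrow> pgrad \<rho> (r *\<^sub>R \<theta>) = r *\<^sub>R pgrad \<rho> \<theta>"
proof -
  assume "0 \<le> r"
  then have e: "(\<lambda>p. \<rho> p *\<^sub>R grad_phi (r *\<^sub>R \<theta>) (fst p)) = (\<lambda>p. r *\<^sub>R (\<rho> p *\<^sub>R grad_phi \<theta> (fst p)))"
    by (intro ext) (simp add: grad_phi_scale mult.commute)
  show ?thesis unfolding pgrad_def e by (rule integral_scaleR_right)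
qed

lemma pot_odd: "pot \<rho> (- a, u) = - pot \<rho> (a, u)"
  unfolding pot_def by (simp add: phi_eq)

lemma inner_pgrad:
  assumes "residual C \<rho>"
  shows "\<theta> \<bullet> pgrad \<rho> \<theta> = 2 * pot \<rho> \<theta>"
    and "fst \<theta> * fst (pgrad \<rho> \<theta>) = pot \<rho> \<theta>" and "snd \<theta> \<bullet> snd (pgrad \<rho> \<theta>) = pot \<rho> \<theta>"
proof -
  note i = integrable_pgrad[OF assms, of \<theta>]
  show "\<theta> \<bullet> pgrad \<rho> \<theta> = 2 * pot \<rho> \<theta>"
    unfolding pgrad_def pot_def using i
    by (simp add: integral_inner_right[symmetric] inner_grad_phi mult.left_commute[of _ 2])
  have f: "fst \<theta> * fst (pgrad \<rho> \<theta>) = (fst \<theta>, 0) \<bullet> pgrad \<rho> \<theta>" 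
    and s: "snd \<theta> \<bullet> snd (pgrad \<rho> \<theta>) = (0, snd \<theta>) \<bullet> pgrad \<rho> \<theta>"
    by (simp_all add: inner_prod_def)
  have f': "(fst \<theta>, 0) \<bullet> grad_phi \<theta> x = phi \<theta> x" and s': "(0, snd \<theta>) \<bullet> grad_phi \<theta> x = phi \<theta> x" for x
    using inner_grad_phi(1,2)[of \<theta> x] by (simp_all add: inner_prod_def)
  show "fst \<theta> * fst (pgrad \<rho> \<theta>) = pot \<rho> \<theta>" unfolding f
    unfolding pgrad_def pot_def using i by (simp add: integral_inner_right[symmetric] f')
  show "snd \<theta> \<bullet> snd (pgrad \<rho> \<theta>) = pot \<rho> \<theta>" unfolding s
    unfolding pgrad_def pot_def using i by (simp add: integral_inner_right[symmetric] s')
qed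

text \<open>The derivative in the outer weight averages \<open>relu\<close> of the inner weights and
  does not see the outer weight. A bound by \<open>norm (snd \<theta>)\<close> instead of
  \<open>norm \<theta>\<close> is needed outside the cone, where the outer weight is the larger
  one.\<close>

lemma fst_pgrad_le:
  assumes "residual C \<rho>"
  shows "\<bar>fst (pgrad \<rho> \<theta>)\<bar> \<le> C * moment * norm (snd \<theta>)"
proof -
  have i1: "(1, 0) \<bullet> z = fst z" for z :: "'n param" by (simp add: inner_prod_def)
  have "fst (pgrad \<rho> \<theta>) = (1, 0) \<bullet> pgrad \<rho> \<theta>" by (rule i1[symmetric])
  also have "\<dots> = (\<integral>p. (1, 0) \<bullet> (\<rho> p *\<^sub>R grad_phi \<theta> (fst p)) \<partial>P)"
    unfolding pgrad_def by (rule integral_inner_right[symmetric]) (rule integrable_pgrad[OF assms])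
  also have "\<dots> = (\<integral>p. \<rho> p *\<^sub>R relu (snd \<theta> \<bullet> (fst p, 1)) \<partial>P)"
    by (simp add: i1 grad_phi_eq)
  finally have e: "fst (pgrad \<rho> \<theta>) = (\<integral>p. \<rho> p *\<^sub>R relu (snd \<theta> \<bullet> (fst p, 1)) \<partial>P)" .
  have "norm (\<integral>p. \<rho> p *\<^sub>R relu (snd \<theta> \<bullet> (fst p, 1)) \<partial>P) \<le> C * (\<integral>p. norm (snd \<theta>) * q p \<partial>P)"
  proof (rule norm_integral_residual_le[OF assms])
    show "norm (relu (snd \<theta> \<bullet> (fst p, 1))) \<le> norm (snd \<theta>) * q p" for p
      using order_trans[OF relu_abs_le inner_aug_le] relu_nonneg by (simp add: abs_of_nonneg)
  qed (auto intro: integrable_mult_right integrable_q)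
  then show ?thesis unfolding e by (simp add: moment_def algebra_simps)
qed

text \<open>\<open>2 * moment\<close> pays for the Lipschitz part of the gradient difference,
  \<open>switch_const\<close> for the averaged jumps.\<close>

definition grad_lipschitz_const :: real where
  "grad_lipschitz_const = 2 * moment + switch_const"

lemma grad_lipschitz_const_nonneg: "0 \<le> grad_lipschitz_const"
  unfolding grad_lipschitz_const_def using moment_nonneg switch_const_nonneg by simp

text \<open>It suffices that one of the points lies in the cone: there \<bar>a\<bar> \<le>
  \<open>norm u\<close> turns the height of the jump into the factor that
  \<open>switch_const\<close> demands.\<close>

lemma pgrad_lipschitz:
  assumes \<rho>: "residual C \<rho>" and \<theta>: "\<theta>' \<in> closure Theta"
  shows "norm (pgrad \<rho> \<theta> - pgrad \<rho> \<theta>') \<le> C * grad_lipschitz_const * norm (\<theta> - \<theta>')"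
proof -
  let ?g = "\<lambda>p. 2 * norm (\<theta> - \<theta>') * q p + \<bar>fst \<theta>'\<bar> * switch (snd \<theta>) (snd \<theta>') p"
  have gi: "integrable P ?g"
    by (intro Bochner_Integration.integrable_add integrable_mult_right integrable_q integrable_switch)
  have "pgrad \<rho> \<theta> - pgrad \<rho> \<theta>' = (\<integral>p. \<rho> p *\<^sub>R (grad_phi \<theta> (fst p) - grad_phi \<theta>' (fst p)) \<partial>P)"
    unfolding pgrad_def scaleR_diff_right
    by (rule Bochner_Integration.integral_diff[symmetric]) (rule integrable_pgrad[OF \<rho>])+
  also have "norm \<dots> \<le> C * (\<integral>p. ?g p \<partial>P)"
    by (rule norm_integral_residual_le[OF \<rho> gi norm_grad_phi_diff_le])
  finally have le1: "norm (pgrad \<rho> \<theta> - pgrad \<rho> \<theta>') \<le> C * (\<integral>p. ?g p \<partial>P)" .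
  have "(\<integral>p. ?g p \<partial>P) = 2 * norm (\<theta> - \<theta>') * moment + \<bar>fst \<theta>'\<bar> * (\<integral>p. switch (snd \<theta>) (snd \<theta>') p \<partial>P)"
    unfolding moment_def using integrable_q integrable_switch
    by (subst Bochner_Integration.integral_add) (auto intro: integrable_mult_right)
  also have "\<bar>fst \<theta>'\<bar> * (\<integral>p. switch (snd \<theta>) (snd \<theta>') p \<partial>P) \<le> norm (snd \<theta>') * (\<integral>p. switch (snd \<theta>') (snd \<theta>) p \<partial>P)"
    unfolding abs_minus_commute[of "relu' (snd \<theta>' \<bullet> _)"] using \<theta>
    by (intro mult_right_mono) (auto simp: closure_Theta)
  also have "\<dots> \<le> switch_const * norm (snd \<theta>' - snd \<theta>)" by (rule switch_const)
  also have "\<dots> \<le> switch_const * norm (\<theta> - \<theta>')"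
    using norm_snd_le'[of "\<theta>' - \<theta>"] switch_const_nonneg by (intro mult_left_mono) (auto simp: norm_minus_commute)
  finally have "(\<integral>p. ?g p \<partial>P) \<le> grad_lipschitz_const * norm (\<theta> - \<theta>')"
    by (simp add: grad_lipschitz_const_def algebra_simps)
  from order_trans[OF le1 mult_left_mono[OF this residual_nonneg[OF \<rho>]]]
  show ?thesis by (simp add: mult.assoc)
qed

text \<open>The Taylor remainder of \<open>phi\<close> splits into a quadratic term and distance
  times switching; averaging yields a second factor of the distance from the switching, again by way
  of the cone inequality at the base point.\<close>

lemma pot_remainder:
  assumes \<rho>: "residual C \<rho>" and \<theta>: "\<theta> \<in> closure Theta"
  shows "\<bar>pot \<rho> \<theta>' - pot \<rho> \<theta> - pgrad \<rho> \<theta> \<bullet> (\<theta>' - \<theta>)\<bar> \<le> C * grad_lipschitz_const * (norm (\<theta>' - \<theta>))\<^sup>2"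
proof -
  let ?D = "norm (\<theta>' - \<theta>)"
  let ?g = "\<lambda>p. ?D\<^sup>2 * q p + \<bar>fst \<theta>\<bar> * ?D * switch (snd \<theta>') (snd \<theta>) p"
  have gi: "integrable P ?g"
    by (intro Bochner_Integration.integrable_add integrable_mult_right integrable_q integrable_switch)
  have "pgrad \<rho> \<theta> \<bullet> (\<theta>' - \<theta>) = (\<integral>p. \<rho> p * (grad_phi \<theta> (fst p) \<bullet> (\<theta>' - \<theta>)) \<partial>P)"
    unfolding pgrad_def using integrable_pgrad[OF \<rho>, of \<theta>] by (simp add: integral_inner_left[symmetric])
  moreover have "integrable P (\<lambda>p. \<rho> p * (grad_phi \<theta> (fst p) \<bullet> (\<theta>' - \<theta>)))"
    using integrable_inner_left[OF integrable_pgrad[OF \<rho>, of \<theta>], of "\<theta>' - \<theta>"] by simp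
  ultimately have eq: "pot \<rho> \<theta>' - pot \<rho> \<theta> - pgrad \<rho> \<theta> \<bullet> (\<theta>' - \<theta>) =
      (\<integral>p. \<rho> p *\<^sub>R (phi \<theta>' (fst p) - phi \<theta> (fst p) - grad_phi \<theta> (fst p) \<bullet> (\<theta>' - \<theta>)) \<partial>P)"
    unfolding pot_def using integrable_pot[OF \<rho>] by (simp add: right_diff_distrib)
  have "norm (phi \<theta>' (fst p) - phi \<theta> (fst p) - grad_phi \<theta> (fst p) \<bullet> (\<theta>' - \<theta>)) \<le> ?g p" for p
    unfolding real_norm_def by (rule phi_remainder)
  from norm_integral_residual_le[OF \<rho> gi this]
  have le1: "\<bar>pot \<rho> \<theta>' - pot \<rho> \<theta> - pgrad \<rho> \<theta> \<bullet> (\<theta>' - \<theta>)\<bar> \<le> C * (\<integral>p. ?g p \<partial>P)"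
    unfolding eq[symmetric] real_norm_def .
  have g_eq: "(\<integral>p. ?g p \<partial>P) = ?D\<^sup>2 * moment + ?D * (\<bar>fst \<theta>\<bar> * (\<integral>p. switch (snd \<theta>') (snd \<theta>) p \<partial>P))"
    unfolding moment_def using integrable_q integrable_switch
    by (subst Bochner_Integration.integral_add) (auto intro: integrable_mult_right)
  have "\<bar>fst \<theta>\<bar> * (\<integral>p. switch (snd \<theta>') (snd \<theta>) p \<partial>P) \<le> norm (snd \<theta>) * (\<integral>p. switch (snd \<theta>) (snd \<theta>') p \<partial>P)"
    unfolding abs_minus_commute[of "relu' (snd \<theta> \<bullet> _)"] using \<theta>
    by (intro mult_right_mono) (auto simp: closure_Theta)
  also have "\<dots> \<le> switch_const * norm (snd \<theta> - snd \<theta>')" by (rule switch_const)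
  also have "\<dots> \<le> switch_const * ?D"
    using norm_snd_le'[of "\<theta> - \<theta>'"] switch_const_nonneg by (intro mult_left_mono) (auto simp: norm_minus_commute)
  finally have "?D * (\<bar>fst \<theta>\<bar> * (\<integral>p. switch (snd \<theta>') (snd \<theta>) p \<partial>P)) \<le> ?D * (switch_const * ?D)"
    by (rule mult_left_mono) simp
  moreover have "0 \<le> ?D\<^sup>2 * moment" using moment_nonneg by simp
  ultimately have "(\<integral>p. ?g p \<partial>P) \<le> grad_lipschitz_const * ?D\<^sup>2"
    unfolding g_eq by (simp add: grad_lipschitz_const_def power2_eq_square algebra_simps)
  from order_trans[OF le1 mult_left_mono[OF this residual_nonneg[OF \<rho>]]]
  show ?thesis by (simp add: mult.assoc)
qed

text \<open>Dependence on the residual in a weighted L1 norm; this is the source of time continuity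
  of the velocity.\<close>

lemma pgrad_diff_le:
  assumes \<rho>: "residual C \<rho>" and \<rho>': "residual C \<rho>'"
  shows "norm (pgrad \<rho> \<theta> - pgrad \<rho>' \<theta>) \<le> norm \<theta> * (\<integral>p. \<bar>\<rho> p - \<rho>' p\<bar> * q p \<partial>P)"
proof -
  have m: "\<rho> \<in> borel_measurable P" "\<rho>' \<in> borel_measurable P" using assms by (auto simp: residual_def)
  have d: "\<bar>\<rho> p - \<rho>' p\<bar> \<le> 2 * C" for p using residual_abs_le[OF \<rho>, of p] residual_abs_le[OF \<rho>', of p] by linarith
  have i: "integrable P (\<lambda>p. \<bar>\<rho> p - \<rho>' p\<bar> * q p)"
  proof (rule Bochner_Integration.integrable_bound[of _ "\<lambda>p. 2 * C * q p"])
    show "AE p in P. norm (\<bar>\<rho> p - \<rho>' p\<bar> * q p) \<le> norm (2 * C * q p)"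
      using residual_nonneg[OF \<rho>] d by (intro AE_I2) (simp add: abs_mult mult_right_mono)
  qed (use m integrable_q in auto)
  have "pgrad \<rho> \<theta> - pgrad \<rho>' \<theta> = (\<integral>p. (\<rho> p - \<rho>' p) *\<^sub>R grad_phi \<theta> (fst p) \<partial>P)"
    unfolding pgrad_def scaleR_diff_left
    by (rule Bochner_Integration.integral_diff[symmetric]) (rule integrable_pgrad, fact)+
  also have "norm \<dots> \<le> (\<integral>p. norm \<theta> * (\<bar>\<rho> p - \<rho>' p\<bar> * q p) \<partial>P)"
  proof (rule Bochner_Integration.integral_norm_bound_integral)
    show "integrable P (\<lambda>p. (\<rho> p - \<rho>' p) *\<^sub>R grad_phi \<theta> (fst p))"
      unfolding scaleR_diff_left by (intro Bochner_Integration.integrable_diff integrable_pgrad[OF \<rho>] integrable_pgrad[OF \<rho>'])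
    show "integrable P (\<lambda>p. norm \<theta> * (\<bar>\<rho> p - \<rho>' p\<bar> * q p))" using i by simp
    show "norm ((\<rho> p - \<rho>' p) *\<^sub>R grad_phi \<theta> (fst p)) \<le> norm \<theta> * (\<bar>\<rho> p - \<rho>' p\<bar> * q p)" for p
      using mult_left_mono[OF norm_grad_phi_le[of \<theta> "fst p"], of "\<bar>\<rho> p - \<rho>' p\<bar>"] by (simp add: mult.left_commute)
  qed
  finally show ?thesis by simp
qed

end

text \<open>The gradient is Lipschitz only on the cone \<open>closure Theta\<close>; composing with this retraction
  onto the cone yields a globally Lipschitz field.\<close>

definition clamp_cone :: "('n::finite) param \<Rightarrow> 'n param" where
  "clamp_cone \<theta> = (max (- norm (snd \<theta>)) (min (norm (snd \<theta>)) (fst \<theta>)), snd \<theta>)"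

lemma clamp_real:
  fixes a u :: real
  assumes "0 \<le> u"
  shows "\<bar>max (- u) (min u a)\<bar> \<le> u" "\<bar>max (- u) (min u a)\<bar> \<le> \<bar>a\<bar>"
    "\<bar>a\<bar> \<le> u \<Longrightarrow> max (- u) (min u a) = a" "u < \<bar>a\<bar> \<Longrightarrow> \<bar>a - max (- u) (min u a)\<bar> = \<bar>a\<bar> - u"
  using assms by linarith+

lemma clamp_real_lipschitz:
  fixes a u :: real
  assumes "0 \<le> u" "0 \<le> u'" "\<bar>u - u'\<bar> \<le> d" "\<bar>a - a'\<bar> \<le> d"
  shows "\<bar>max (- u) (min u a) - max (- u') (min u' a')\<bar> \<le> d"
  using assms by linarith

lemma clamp_cone_in: "clamp_cone \<theta> \<in> closure Theta"
  by (simp add: clamp_cone_def closure_Theta clamp_real(1))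

lemma clamp_cone_id: "\<theta> \<in> closure Theta \<Longrightarrow> clamp_cone \<theta> = \<theta>"
  by (simp add: clamp_cone_def closure_Theta clamp_real(3))

lemma clamp_cone_lipschitz: "norm (clamp_cone \<theta> - clamp_cone \<theta>') \<le> 2 * norm (\<theta> - \<theta>')"
proof -
  have n: "\<bar>norm (snd \<theta>) - norm (snd \<theta>')\<bar> \<le> norm (\<theta> - \<theta>')"
    using norm_triangle_ineq3[of "snd \<theta>" "snd \<theta>'"] norm_snd_le'[of "\<theta> - \<theta>'"] by simp
  have f: "\<bar>fst \<theta> - fst \<theta>'\<bar> \<le> norm (\<theta> - \<theta>')" using abs_fst_le[of "\<theta> - \<theta>'"] by simp
  have "clamp_cone \<theta> - clamp_cone \<theta>' = (fst (clamp_cone \<theta>) - fst (clamp_cone \<theta>'), snd (\<theta> - \<theta>'))"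
    by (simp add: clamp_cone_def)
  then have "norm (clamp_cone \<theta> - clamp_cone \<theta>') \<le> norm (fst (clamp_cone \<theta>) - fst (clamp_cone \<theta>')) + norm (snd (\<theta> - \<theta>'))"
    by (simp only: norm_Pair_le)
  also have "norm (fst (clamp_cone \<theta>) - fst (clamp_cone \<theta>')) = \<bar>fst (clamp_cone \<theta>) - fst (clamp_cone \<theta>')\<bar>"
    by (rule real_norm_def)
  also have "\<bar>fst (clamp_cone \<theta>) - fst (clamp_cone \<theta>')\<bar> \<le> norm (\<theta> - \<theta>')"
    unfolding clamp_cone_def fst_conv by (rule clamp_real_lipschitz[OF norm_ge_zero norm_ge_zero n f])
  finally show ?thesis using norm_snd_le'[of "\<theta> - \<theta>'"] by simp
qed

lemma clamp_cone_norm: "norm (clamp_cone \<theta>) \<le> norm \<theta>"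
proof (rule power2_le_imp_le)
  have "\<bar>fst (clamp_cone \<theta>)\<bar> \<le> \<bar>fst \<theta>\<bar>" by (simp add: clamp_cone_def clamp_real(2))
  then have "(fst (clamp_cone \<theta>))\<^sup>2 \<le> (fst \<theta>)\<^sup>2" by (rule abs_le_square_iff[THEN iffD1])
  then show "(norm (clamp_cone \<theta>))\<^sup>2 \<le> (norm \<theta>)\<^sup>2"
    unfolding norm_param by (simp add: clamp_cone_def)
qed simp

lemma clamp_cone_scale: "0 \<le> r \<Longrightarrow> clamp_cone (r *\<^sub>R \<theta>) = r *\<^sub>R clamp_cone \<theta>"
  by (simp add: clamp_cone_def prod_eq_iff max_mult_distrib_left min_mult_distrib_left)

lemma continuous_clamp_cone: "continuous_on UNIV clamp_cone"
  unfolding clamp_cone_def[abs_def] by (intro continuous_intros)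

context relu_data
begin

text \<open>The left side is the rate of a^2 - |u|^2 along the clamped field. By the separate Euler
  identities the field has rate zero at the clamped point, so only the displacement
  \<open>fst \<theta>\<close> minus its clamped value contributes. It vanishes in the cone and is
  \<bar>a\<bar> - |u| outside, whence the bound by the positive part of a^2 - |u|^2.\<close>

lemma cone_defect_le:
  assumes \<rho>: "residual C \<rho>"
  shows "\<bar>2 * fst \<theta> * fst (- pgrad \<rho> (clamp_cone \<theta>)) - 2 * (snd \<theta> \<bullet> snd (- pgrad \<rho> (clamp_cone \<theta>)))\<bar>
     \<le> (2 * C * moment) * max ((fst \<theta>)\<^sup>2 - (norm (snd \<theta>))\<^sup>2) 0"
proof -
  let ?c = "clamp_cone \<theta>" and ?u = "norm (snd \<theta>)"
  let ?h = "fst (pgrad \<rho> ?c)"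
  have sc: "snd ?c = snd \<theta>" by (simp add: clamp_cone_def)
  have "snd \<theta> \<bullet> snd (pgrad \<rho> ?c) = fst ?c * ?h"
    using inner_pgrad(2,3)[OF \<rho>, of ?c] sc by simp
  then have "2 * fst \<theta> * fst (- pgrad \<rho> ?c) - 2 * (snd \<theta> \<bullet> snd (- pgrad \<rho> ?c)) = - 2 * ((fst \<theta> - fst ?c) * ?h)"
    by (simp add: algebra_simps)
  then have "\<bar>2 * fst \<theta> * fst (- pgrad \<rho> ?c) - 2 * (snd \<theta> \<bullet> snd (- pgrad \<rho> ?c))\<bar> = 2 * (\<bar>fst \<theta> - fst ?c\<bar> * \<bar>?h\<bar>)"
    by (simp add: abs_mult)
  also have "\<dots> \<le> 2 * (\<bar>fst \<theta> - fst ?c\<bar> * (C * moment * ?u))"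
    using fst_pgrad_le[OF \<rho>, of ?c] unfolding sc by (intro mult_left_mono) auto
  also have "\<dots> = (2 * C * moment) * (\<bar>fst \<theta> - fst ?c\<bar> * ?u)" by simp
  also have "\<dots> \<le> (2 * C * moment) * max ((fst \<theta>)\<^sup>2 - ?u\<^sup>2) 0"
  proof (rule mult_left_mono)
    show "\<bar>fst \<theta> - fst ?c\<bar> * ?u \<le> max ((fst \<theta>)\<^sup>2 - ?u\<^sup>2) 0"
    proof (cases "\<bar>fst \<theta>\<bar> \<le> ?u")
      case True
      then show ?thesis using clamp_cone_id[of \<theta>] by (simp add: closure_Theta)
    next
      case False
      have "\<bar>fst \<theta> - fst ?c\<bar> = \<bar>fst \<theta>\<bar> - ?u"
        using False clamp_real(4)[of ?u "fst \<theta>"] by (simp add: clamp_cone_def)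
      then have "\<bar>fst \<theta> - fst ?c\<bar> * ?u \<le> (\<bar>fst \<theta>\<bar> - ?u) * (\<bar>fst \<theta>\<bar> + ?u)"
        using False by (simp add: mult_left_mono)
      also have "\<dots> = (fst \<theta>)\<^sup>2 - ?u\<^sup>2" by (simp add: algebra_simps power2_eq_square[symmetric])
      finally show ?thesis by simp
    qed
    show "0 \<le> 2 * C * moment" using residual_nonneg[OF \<rho>] moment_nonneg by simp
  qed
  finally show ?thesis .
qed

end

section \<open>Measures on the cone and the Wasserstein distance\<close>

lemma P2D:
  assumes "\<pi> \<in> P2"
  shows P2_sets: "sets \<pi> = sets (restrict_space borel (closure Theta))" and P2_space: "space \<pi> = closure Theta"
    and P2_prob: "prob_space \<pi>" and P2_integrable: "integrable \<pi> (\<lambda>\<theta>. (norm \<theta>)\<^sup>2)"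
proof -
  have s: "\<pi> \<in> space (prob_algebra (restrict_space borel (closure Theta)))" and i: "integrable \<pi> (\<lambda>\<theta>. (norm \<theta>)\<^sup>2)"
    using assms by (auto simp: P2_def)
  show "integrable \<pi> (\<lambda>\<theta>. (norm \<theta>)\<^sup>2)" by (rule i)
  show "sets \<pi> = sets (restrict_space borel (closure Theta))" "prob_space \<pi>" using s by (auto simp: space_prob_algebra)
  from sets_eq_imp_space_eq[OF this(1)] show "space \<pi> = closure Theta" by (simp add: space_restrict_space)
qed

lemma P2_measurable:
  assumes "\<pi> \<in> P2" "f \<in> borel \<rightarrow>\<^sub>M M"
  shows "f \<in> \<pi> \<rightarrow>\<^sub>M M"
  using measurable_restrict_space1[OF assms(2), of "closure Theta"] P2_sets[OF assms(1)]
  by (simp cong: measurable_cong_sets)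

lemma P2I:
  assumes "sets \<pi> = sets (restrict_space borel (closure Theta))" "prob_space \<pi>" "integrable \<pi> (\<lambda>\<theta>. (norm \<theta>)\<^sup>2)"
  shows "\<pi> \<in> P2"
  using assms by (auto simp: P2_def space_prob_algebra)

definition second_moment :: "('n::finite) param measure \<Rightarrow> real" where
  "second_moment \<pi> = (\<integral>\<theta>. (norm \<theta>)\<^sup>2 \<partial>\<pi>)"

lemma second_moment_nonneg: "0 \<le> second_moment \<pi>"
  by (simp add: second_moment_def)

lemma P2_integrable_quadratic:
  fixes f :: "'n::finite param \<Rightarrow> real"
  assumes \<pi>: "\<pi> \<in> P2" and f: "f \<in> borel_measurable \<pi>" and le: "\<And>\<theta>. \<theta> \<in> closure Theta \<Longrightarrow> \<bar>f \<theta>\<bar> \<le> A + B * (norm \<theta>)\<^sup>2"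
  shows "integrable \<pi> f"
proof (rule Bochner_Integration.integrable_bound[OF _ f])
  interpret prob_space \<pi> by (rule P2_prob[OF \<pi>])
  show "integrable \<pi> (\<lambda>\<theta>. A + B * (norm \<theta>)\<^sup>2)" using P2_integrable[OF \<pi>] by simp
  show "AE \<theta> in \<pi>. norm (f \<theta>) \<le> norm (A + B * (norm \<theta>)\<^sup>2)"
    using le P2_space[OF \<pi>] by (intro AE_I2) fastforce
qed

text \<open>Cauchy-Schwarz recovered from Young's inequality with a free weight. The choice k =
  x/(2a) also covers b = 0, where an optimal weight does not exist.\<close>

lemma square_le_of_scaled_bounds:
  fixes x a b :: real
  assumes "\<And>k. 0 < k \<Longrightarrow> x \<le> k * a + b / k" "0 < a" "0 \<le> b" "0 \<le> x"
  shows "x\<^sup>2 \<le> 4 * a * b"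
proof (cases "x = 0")
  case False
  then have x: "0 < x" using assms(4) by simp
  have "x \<le> (x / (2 * a)) * a + b / (x / (2 * a))" using x assms(2) by (intro assms(1)) simp
  then have "x / 2 \<le> 2 * a * b / x" using x assms(2) by (simp add: field_simps)
  then show ?thesis using x by (simp add: field_simps power2_eq_square)
qed (use assms in simp)

lemma coupling_measurable:
  assumes \<pi>: "\<pi> \<in> P2" "\<pi>' \<in> P2" and \<gamma>: "\<gamma> \<in> couplings \<pi> \<pi>'"
  shows "fst \<in> \<gamma> \<rightarrow>\<^sub>M \<pi>" "snd \<in> \<gamma> \<rightarrow>\<^sub>M \<pi>'" "fst \<in> borel_measurable \<gamma>" "snd \<in> borel_measurable \<gamma>"
    "distr \<gamma> \<pi> fst = \<pi>" "distr \<gamma> \<pi>' snd = \<pi>'"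
proof -
  have s: "sets \<gamma> = sets (\<pi> \<Otimes>\<^sub>M \<pi>')" and d: "distr \<gamma> \<pi> fst = \<pi>" "distr \<gamma> \<pi>' snd = \<pi>'"
    using \<gamma> by (auto simp: couplings_def)
  show f: "fst \<in> \<gamma> \<rightarrow>\<^sub>M \<pi>" "snd \<in> \<gamma> \<rightarrow>\<^sub>M \<pi>'" using s by (simp_all cong: measurable_cong_sets)
  have id: "(\<lambda>x. x) \<in> \<pi> \<rightarrow>\<^sub>M borel" "(\<lambda>x. x) \<in> \<pi>' \<rightarrow>\<^sub>M borel" by (rule P2_measurable[OF \<pi>(1)], simp, rule P2_measurable[OF \<pi>(2)], simp)
  show "fst \<in> borel_measurable \<gamma>" "snd \<in> borel_measurable \<gamma>"
    using measurable_compose[OF f(1) id(1)] measurable_compose[OF f(2) id(2)] by simp_all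
  show "distr \<gamma> \<pi> fst = \<pi>" "distr \<gamma> \<pi>' snd = \<pi>'" by fact+
qed

lemma coupling_integrable:
  assumes \<pi>: "\<pi> \<in> P2" "\<pi>' \<in> P2" and \<gamma>: "\<gamma> \<in> couplings \<pi> \<pi>'"
  shows "f \<in> borel_measurable \<pi> \<Longrightarrow> integrable \<pi> f \<Longrightarrow> integrable \<gamma> (\<lambda>z. f (fst z) :: real)"
    and "f \<in> borel_measurable \<pi>' \<Longrightarrow> integrable \<pi>' f \<Longrightarrow> integrable \<gamma> (\<lambda>z. f (snd z))"
    and "f \<in> borel_measurable \<pi> \<Longrightarrow> (\<integral>z. f (fst z) \<partial>\<gamma>) = (\<integral>x. f x \<partial>\<pi>)"
    and "f \<in> borel_measurable \<pi>' \<Longrightarrow> (\<integral>z. f (snd z) \<partial>\<gamma>) = (\<integral>x. f x \<partial>\<pi>')"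
proof -
  note m = coupling_measurable[OF \<pi> \<gamma>]
  show "f \<in> borel_measurable \<pi> \<Longrightarrow> integrable \<pi> f \<Longrightarrow> integrable \<gamma> (\<lambda>z. f (fst z) :: real)"
    using integrable_distr_eq[OF m(1), of f] m(5) by simp
  show "f \<in> borel_measurable \<pi>' \<Longrightarrow> integrable \<pi>' f \<Longrightarrow> integrable \<gamma> (\<lambda>z. f (snd z))"
    using integrable_distr_eq[OF m(2), of f] m(6) by simp
  show "f \<in> borel_measurable \<pi> \<Longrightarrow> (\<integral>z. f (fst z) \<partial>\<gamma>) = (\<integral>x. f x \<partial>\<pi>)"
    using integral_distr[OF m(1), of f] m(5) by simp
  show "f \<in> borel_measurable \<pi>' \<Longrightarrow> (\<integral>z. f (snd z) \<partial>\<gamma>) = (\<integral>x. f x \<partial>\<pi>')"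
    using integral_distr[OF m(2), of f] m(6) by simp
qed

text \<open>Its finite cost keeps the infimum in \<open>wasserstein2\<close> finite, so that
  \<open>enn2real\<close> does not send it to 0.\<close>

lemma product_coupling:
  assumes "\<pi> \<in> P2" "\<pi>' \<in> P2"
  shows "\<pi> \<Otimes>\<^sub>M \<pi>' \<in> couplings \<pi> \<pi>'"
proof -
  interpret p: prob_space \<pi> by (rule P2_prob[OF assms(1)])
  interpret p': prob_space \<pi>' by (rule P2_prob[OF assms(2)])
  interpret pair_prob_space \<pi> \<pi>' ..
  have "distr (\<pi> \<Otimes>\<^sub>M \<pi>') \<pi> fst = \<pi>"
  proof (rule measure_eqI)
    fix A assume A: "A \<in> sets (distr (\<pi> \<Otimes>\<^sub>M \<pi>') \<pi> fst)"
    have "fst -` A \<inter> space (\<pi> \<Otimes>\<^sub>M \<pi>') = A \<times> space \<pi>'"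
      using sets.sets_into_space A by (auto simp: space_pair_measure)
    then show "emeasure (distr (\<pi> \<Otimes>\<^sub>M \<pi>') \<pi> fst) A = emeasure \<pi> A"
      using A by (simp add: emeasure_distr p'.emeasure_pair_measure_Times p'.emeasure_space_1)
  qed simp
  moreover have "distr (\<pi> \<Otimes>\<^sub>M \<pi>') \<pi>' snd = \<pi>'"
  proof (rule measure_eqI)
    fix A assume A: "A \<in> sets (distr (\<pi> \<Otimes>\<^sub>M \<pi>') \<pi>' snd)"
    have "snd -` A \<inter> space (\<pi> \<Otimes>\<^sub>M \<pi>') = space \<pi> \<times> A"
      using sets.sets_into_space A by (auto simp: space_pair_measure)
    then show "emeasure (distr (\<pi> \<Otimes>\<^sub>M \<pi>') \<pi>' snd) A = emeasure \<pi>' A"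
      using A by (simp add: emeasure_distr p'.emeasure_pair_measure_Times p.emeasure_space_1)
  qed simp
  ultimately show ?thesis by (simp add: couplings_def)
qed

text \<open>The bridge from the metric to integrals, for integrands whose local Lipschitz constant
  grows linearly: squared norms, features, and test gradients paired with the velocity are of this
  kind. It is Cauchy-Schwarz on an arbitrary coupling followed by the infimum; optimal couplings and
  the triangle inequality do not enter.\<close>

theorem wasserstein2_integral_bound:
  fixes G :: "'n::finite param \<Rightarrow> real"
  assumes \<pi>: "\<pi> \<in> P2" "\<pi>' \<in> P2" and G: "G \<in> borel_measurable borel" and K: "0 < K"
    and le: "\<And>x y. x \<in> closure Theta \<Longrightarrow> y \<in> closure Theta \<Longrightarrow> \<bar>G x - G y\<bar> \<le> K * ((1 + norm x + norm y) * norm (x - y))"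
  shows "\<bar>(\<integral>\<theta>. G \<theta> \<partial>\<pi>) - (\<integral>\<theta>. G \<theta> \<partial>\<pi>')\<bar> \<le> K * sqrt (3 * (1 + second_moment \<pi> + second_moment \<pi>')) * wasserstein2 \<pi> \<pi>'"
proof -
  interpret p: prob_space \<pi> by (rule P2_prob[OF \<pi>(1)])
  interpret p': prob_space \<pi>' by (rule P2_prob[OF \<pi>(2)])
  define \<Delta> where "\<Delta> = \<bar>(\<integral>\<theta>. G \<theta> \<partial>\<pi>) - (\<integral>\<theta>. G \<theta> \<partial>\<pi>')\<bar>"
  \<comment> \<open>Bounds the integral of (1 + |x| + |y|)^2 under any coupling; the 3 comes from
    squaring a sum of three terms.\<close>
  define S where "S = 3 * (1 + second_moment \<pi> + second_moment \<pi>')"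
  have S: "0 < S" using second_moment_nonneg[of \<pi>] second_moment_nonneg[of \<pi>'] by (simp add: S_def)
  have Gm: "G \<in> borel_measurable \<pi>" "G \<in> borel_measurable \<pi>'" using \<pi> G by (auto intro: P2_measurable)
  have Gb: "\<bar>G \<theta>\<bar> \<le> (\<bar>G 0\<bar> + K) + (2 * K) * (norm \<theta>)\<^sup>2" if "\<theta> \<in> closure Theta" for \<theta>
  proof -
    have "\<bar>G \<theta> - G 0\<bar> \<le> K * ((1 + norm \<theta>) * norm \<theta>)" using le[OF that zero_closure_Theta] by simp
    also have "\<dots> \<le> K * (1 + 2 * (norm \<theta>)\<^sup>2)"
    proof (intro mult_left_mono)
      have "0 \<le> (norm \<theta> - 1)\<^sup>2" by simp
      then have "2 * norm \<theta> \<le> 1 + (norm \<theta>)\<^sup>2" by (simp add: power2_eq_square algebra_simps)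
      moreover have "(1 + norm \<theta>) * norm \<theta> = norm \<theta> + (norm \<theta>)\<^sup>2" by (simp add: power2_eq_square algebra_simps)
      ultimately show "(1 + norm \<theta>) * norm \<theta> \<le> 1 + 2 * (norm \<theta>)\<^sup>2"
        using norm_ge_zero[of \<theta>] zero_le_power2[of "norm \<theta>"] by linarith
    qed (use K in simp)
    finally show ?thesis by (simp add: algebra_simps)
  qed
  have Gi: "integrable \<pi> G" "integrable \<pi>' G" by (rule P2_integrable_quadratic[OF _ _ Gb]; use \<pi> Gm in simp)+
  have nm: "(\<lambda>\<theta>. (norm \<theta>)\<^sup>2) \<in> borel_measurable \<pi>" "(\<lambda>\<theta>. (norm \<theta>)\<^sup>2) \<in> borel_measurable \<pi>'"
    by (rule P2_measurable, fact, measurable)+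
  \<comment> \<open>The lower bound on the cost is proved for every coupling; finiteness is recorded
    for the passage through \<open>enn2real\<close>.\<close>
  have key: "ennreal (\<Delta>\<^sup>2 / (K\<^sup>2 * S)) \<le> (\<integral>\<^sup>+ z. ennreal ((dist (fst z) (snd z))\<^sup>2) \<partial>\<gamma>)
      \<and> (\<integral>\<^sup>+ z. ennreal ((dist (fst z) (snd z))\<^sup>2) \<partial>\<gamma>) < \<infinity>" if \<gamma>: "\<gamma> \<in> couplings \<pi> \<pi>'" for \<gamma>
  proof -
    note m = coupling_measurable[OF \<pi> \<gamma>] and ci = coupling_integrable[OF \<pi> \<gamma>]
    note [measurable] = m(3,4)
    have sp: "fst z \<in> closure Theta" "snd z \<in> closure Theta" if "z \<in> space \<gamma>" for z
      using measurable_space[OF m(1) that] measurable_space[OF m(2) that] P2_space \<pi> by auto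
    have p\<gamma>: "prob_space \<gamma>"
    proof (rule prob_spaceI)
      have "emeasure (distr \<gamma> \<pi> fst) (space \<pi>) = emeasure \<gamma> (space \<gamma>)"
        using measurable_space[OF m(1)] by (subst emeasure_distr[OF m(1)]) (auto intro!: arg_cong[where f="emeasure \<gamma>"])
      then show "emeasure \<gamma> (space \<gamma>) = 1" using m(5) p.emeasure_space_1 by simp
    qed
    interpret g: prob_space \<gamma> by (rule p\<gamma>)
    have fi: "integrable \<gamma> (\<lambda>z. (norm (fst z))\<^sup>2)" "integrable \<gamma> (\<lambda>z. (norm (snd z))\<^sup>2)"
      using ci(1)[OF nm(1) P2_integrable[OF \<pi>(1)]] ci(2)[OF nm(2) P2_integrable[OF \<pi>(2)]] by auto
    have di: "integrable \<gamma> (\<lambda>z. (norm (fst z - snd z))\<^sup>2)"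
    proof (rule Bochner_Integration.integrable_bound)
      show "integrable \<gamma> (\<lambda>z. 2 * (norm (fst z))\<^sup>2 + 2 * (norm (snd z))\<^sup>2)" using fi by simp
      show "AE z in \<gamma>. norm ((norm (fst z - snd z))\<^sup>2) \<le> norm (2 * (norm (fst z))\<^sup>2 + 2 * (norm (snd z))\<^sup>2)"
      proof (rule AE_I2)
        fix z
        have "(norm (fst z - snd z))\<^sup>2 \<le> (norm (fst z) + norm (snd z))\<^sup>2"
          by (intro power_mono norm_triangle_ineq4) auto
        also have "\<dots> \<le> 2 * (norm (fst z))\<^sup>2 + 2 * (norm (snd z))\<^sup>2"
          using sum_squares_bound[of "norm (fst z)" "norm (snd z)"] by (simp add: power2_sum)
        finally show "norm ((norm (fst z - snd z))\<^sup>2) \<le> norm (2 * (norm (fst z))\<^sup>2 + 2 * (norm (snd z))\<^sup>2)" by simp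
      qed
    qed measurable
    have si: "integrable \<gamma> (\<lambda>z. (1 + norm (fst z) + norm (snd z))\<^sup>2)"
      and sle: "(\<integral>z. (1 + norm (fst z) + norm (snd z))\<^sup>2 \<partial>\<gamma>) \<le> S"
    proof -
      have b: "(1 + norm (fst z) + norm (snd z))\<^sup>2 \<le> 3 * (1 + (norm (fst z))\<^sup>2 + (norm (snd z))\<^sup>2)" for z :: "'n param \<times> 'n param"
        using sum_squares_bound[of 1 "norm (fst z)"] sum_squares_bound[of 1 "norm (snd z)"] sum_squares_bound[of "norm (fst z)" "norm (snd z)"]
        by (simp add: power2_eq_square algebra_simps)
      have i3: "integrable \<gamma> (\<lambda>z. 3 * (1 + (norm (fst z))\<^sup>2 + (norm (snd z))\<^sup>2))" using fi by simp
      show si: "integrable \<gamma> (\<lambda>z. (1 + norm (fst z) + norm (snd z))\<^sup>2)"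
        by (rule Bochner_Integration.integrable_bound[OF i3]) (use b in \<open>auto intro!: AE_I2\<close>)
      have "(\<integral>z. (1 + norm (fst z) + norm (snd z))\<^sup>2 \<partial>\<gamma>) \<le> (\<integral>z. 3 * (1 + (norm (fst z))\<^sup>2 + (norm (snd z))\<^sup>2) \<partial>\<gamma>)"
        by (intro integral_mono si i3 b)
      also have "\<dots> = S" using fi ci(3)[OF nm(1)] ci(4)[OF nm(2)] g.prob_space by (simp add: S_def second_moment_def)
      finally show "(\<integral>z. (1 + norm (fst z) + norm (snd z))\<^sup>2 \<partial>\<gamma>) \<le> S" .
    qed
    define I where "I = (\<integral>z. (norm (fst z - snd z))\<^sup>2 \<partial>\<gamma>)"
    have I0: "0 \<le> I" by (simp add: I_def)
    have nnI: "(\<integral>\<^sup>+ z. ennreal ((dist (fst z) (snd z))\<^sup>2) \<partial>\<gamma>) = ennreal I"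
      unfolding I_def dist_norm by (rule nn_integral_eq_integral[OF di]) simp
    have GI: "integrable \<gamma> (\<lambda>z. G (fst z))" "integrable \<gamma> (\<lambda>z. G (snd z))" using ci(1)[OF Gm(1) Gi(1)] ci(2)[OF Gm(2) Gi(2)] .
    \<comment> \<open>Young's inequality with weight \<open>k\<close> separates the growth factor
      from the distance, so that each is integrated on its own.\<close>
    have "\<Delta> \<le> k * (K * S / 2) + (K * I / 2) / k" if k: "0 < k" for k
    proof -
      have "\<Delta> = \<bar>\<integral>z. G (fst z) - G (snd z) \<partial>\<gamma>\<bar>"
        using GI ci(3)[OF Gm(1)] ci(4)[OF Gm(2)] by (simp add: \<Delta>_def)
      also have "\<dots> \<le> (\<integral>z. k * (K / 2) * (1 + norm (fst z) + norm (snd z))\<^sup>2 + (K / 2) / k * (norm (fst z - snd z))\<^sup>2 \<partial>\<gamma>)"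
        unfolding real_norm_def[symmetric]
      proof (rule Bochner_Integration.integral_norm_bound_integral)
        show "integrable \<gamma> (\<lambda>z. k * (K / 2) * (1 + norm (fst z) + norm (snd z))\<^sup>2 + (K / 2) / k * (norm (fst z - snd z))\<^sup>2)"
          using si di by (intro Bochner_Integration.integrable_add integrable_mult_right) auto
        fix z assume z: "z \<in> space \<gamma>"
        let ?s = "1 + norm (fst z) + norm (snd z)" and ?d = "norm (fst z - snd z)"
        have "2 * k * (s * d) \<le> k\<^sup>2 * s\<^sup>2 + d\<^sup>2" for s d :: real
        proof -
          have "0 \<le> (k * s - d)\<^sup>2" by simp
          then show ?thesis by (simp add: power2_diff power_mult_distrib algebra_simps)
        qed
        from this[of ?s ?d]
        have "2 * k * (?s * ?d) \<le> k\<^sup>2 * ?s\<^sup>2 + ?d\<^sup>2" .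
        then have "?s * ?d \<le> (k\<^sup>2 * ?s\<^sup>2 + ?d\<^sup>2) / (2 * k)" using k by (simp add: field_simps)
        also have "\<dots> = k / 2 * ?s\<^sup>2 + ?d\<^sup>2 / (2 * k)" using k by (simp add: field_simps power2_eq_square)
        finally have "K * (?s * ?d) \<le> K * (k / 2 * ?s\<^sup>2 + ?d\<^sup>2 / (2 * k))" using K by (intro mult_left_mono) auto
        also have "\<dots> = k * (K / 2) * ?s\<^sup>2 + (K / 2) / k * ?d\<^sup>2" by (simp add: algebra_simps)
        finally show "norm (G (fst z) - G (snd z)) \<le> k * (K / 2) * ?s\<^sup>2 + (K / 2) / k * ?d\<^sup>2"
          using le[OF sp[OF z]] by simp
      qed (use GI in simp)
      also have "\<dots> = k * (K / 2) * (\<integral>z. (1 + norm (fst z) + norm (snd z))\<^sup>2 \<partial>\<gamma>) + (K / 2) / k * I"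
        unfolding I_def using si di by (subst Bochner_Integration.integral_add) auto
      also have "k * (K / 2) * (\<integral>z. (1 + norm (fst z) + norm (snd z))\<^sup>2 \<partial>\<gamma>) \<le> k * (K / 2) * S"
        using sle k K by (intro mult_left_mono) auto
      finally show ?thesis by simp
    qed
    then have "\<Delta>\<^sup>2 \<le> 4 * (K * S / 2) * (K * I / 2)"
      by (rule square_le_of_scaled_bounds) (use K S I0 in \<open>auto simp: \<Delta>_def\<close>)
    then have "\<Delta>\<^sup>2 / (K\<^sup>2 * S) \<le> I" using K S by (simp add: field_simps power2_eq_square)
    then show ?thesis unfolding nnI by (auto intro: ennreal_leI)
  qed
  let ?W = "INF \<gamma>\<in>couplings \<pi> \<pi>'. \<integral>\<^sup>+ z. ennreal ((dist (fst z) (snd z))\<^sup>2) \<partial>\<gamma>"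
  have fin: "?W < \<infinity>"
    using key[OF product_coupling[OF \<pi>]] INF_lower[OF product_coupling[OF \<pi>], of "\<lambda>\<gamma>. \<integral>\<^sup>+ z. ennreal ((dist (fst z) (snd z))\<^sup>2) \<partial>\<gamma>"]
    by (auto intro: le_less_trans)
  have "ennreal (\<Delta>\<^sup>2 / (K\<^sup>2 * S)) \<le> ?W" by (rule INF_greatest) (use key in blast)
  then have "enn2real (ennreal (\<Delta>\<^sup>2 / (K\<^sup>2 * S))) \<le> enn2real ?W" using fin by (intro enn2real_mono) auto
  then have "\<Delta>\<^sup>2 / (K\<^sup>2 * S) \<le> enn2real ?W" using S by simp
  then have "\<Delta>\<^sup>2 \<le> K\<^sup>2 * S * enn2real ?W" using K S by (simp add: field_simps)
  then have "sqrt (\<Delta>\<^sup>2) \<le> sqrt (K\<^sup>2 * S * enn2real ?W)" by (rule real_sqrt_le_mono)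
  then have "\<Delta> \<le> K * sqrt S * wasserstein2 \<pi> \<pi>'"
    using K by (simp add: \<Delta>_def wasserstein2_def real_sqrt_mult)
  then show ?thesis by (simp add: \<Delta>_def S_def)
qed

section \<open>Convexity of the risk\<close>

locale mean_field = relu_data P for P :: "((real ^ 'n::finite) \<times> real) measure" +
  fixes l :: "real \<Rightarrow> real \<Rightarrow> real"
  assumes loss: "loss_assms l"
    and integrable_loss_0: "integrable P (\<lambda>(x, y). l 0 y)"
begin

lemma loss_nonneg: "0 \<le> l y y'"
  using loss by (simp add: loss_assms_def)

lemma loss_continuous: "continuous_on UNIV (\<lambda>(y, y'). l y y')"
  using loss by (simp add: loss_assms_def)

lemma loss_measurable [measurable (raw)]:
  assumes [measurable]: "f \<in> borel_measurable M" "g \<in> borel_measurable M"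
  shows "(\<lambda>z. l (f z) (g z)) \<in> borel_measurable M"
proof -
  have "(\<lambda>z. (f z, g z)) \<in> borel_measurable M" by measurable
  from measurable_compose[OF this borel_measurable_continuous_onI[OF loss_continuous]]
  show ?thesis by simp
qed

lemma loss_DERIV: "((\<lambda>z. l z y') has_real_derivative D1 l y y') (at y)"
proof -
  have "(\<lambda>y. l y y') C1_differentiable_on UNIV" using loss by (simp add: loss_assms_def)
  then have "(\<lambda>z. l z y') differentiable at y" by (simp add: C1_differentiable_on_eq)
  then show ?thesis unfolding D1_def
    by (metis DERIV_deriv_iff_real_differentiable)
qed

lemma D1_continuous: "continuous_on UNIV (\<lambda>y. D1 l y y')"
proof -
  have "(\<lambda>y. l y y') C1_differentiable_on UNIV" using loss by (simp add: loss_assms_def)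
  then have "continuous_on UNIV (\<lambda>x. vector_derivative (\<lambda>y. l y y') (at x))" by (simp add: C1_differentiable_on_eq)
  moreover have "vector_derivative (\<lambda>y. l y y') (at x) = D1 l x y'" for x
    using loss_DERIV[of y' x] by (simp add: has_real_derivative_iff_has_vector_derivative vector_derivative_at)
  ultimately show ?thesis by simp
qed

text \<open>The derivative is continuous in the first argument only; joint measurability comes from
  difference quotients of the jointly continuous loss.\<close>

lemma D1_measurable [measurable (raw)]:
  assumes [measurable]: "f \<in> borel_measurable M" "g \<in> borel_measurable M"
  shows "(\<lambda>z. D1 l (f z) (g z)) \<in> borel_measurable M"
proof (rule borel_measurable_LIMSEQ_real)
  show "(\<lambda>n. (l (f z + inverse (real (Suc n))) (g z) - l (f z) (g z)) / inverse (real (Suc n))) \<longlonglongrightarrow> D1 l (f z) (g z)"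
    if "z \<in> space M" for z
    using loss_DERIV[of "g z" "f z"] LIMSEQ_inverse_real_of_nat unfolding DERIV_def tendsto_at_iff_sequentially comp_def
    by auto
qed measurable

definition loss_const :: real where
  "loss_const = (SOME C. \<forall>y y'. \<bar>D1 l y y'\<bar> \<le> C)"

lemma D1_le: "\<bar>D1 l y y'\<bar> \<le> loss_const"
proof -
  have "\<exists>C. \<forall>y y'. \<bar>D1 l y y'\<bar> \<le> C" using loss by (simp add: loss_assms_def)
  from someI_ex[OF this] show ?thesis unfolding loss_const_def by blast
qed

lemma loss_const_nonneg: "0 \<le> loss_const"
  using D1_le[of 0 0] by linarith

lemma loss_tangent: "D1 l y y' * (z - y) \<le> l z y' - l y y'"
proof -
  have "convex_on UNIV (\<lambda>y. l y y')" using loss by (simp add: loss_assms_def)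
  from convex_on_imp_above_tangent[OF this, of y z "D1 l y y'"] loss_DERIV[of y' y]
  show ?thesis by (simp add: algebra_simps)
qed

lemma loss_lipschitz: "\<bar>l z y' - l y y'\<bar> \<le> loss_const * \<bar>z - y\<bar>"
proof -
  have "norm (l z y' - l y y') \<le> loss_const * norm (z - y)"
    by (rule field_differentiable_bound[where S = UNIV and f' = "\<lambda>y. D1 l y y'"])
       (use loss_DERIV D1_le in \<open>auto intro: has_field_derivative_at_within\<close>)
  then show ?thesis by simp
qed

definition res :: "(real ^ 'n \<Rightarrow> real) \<Rightarrow> (real ^ 'n) \<times> real \<Rightarrow> real" where
  "res f p = D1 l (f (fst p)) (snd p)"

lemma residual_res: "f \<in> borel_measurable borel \<Longrightarrow> residual loss_const (res f)"
  unfolding residual_def res_def[abs_def] using D1_le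
  by (auto intro!: D1_measurable measurable_compose[of fst])

lemma integrable_loss:
  assumes f: "f \<in> borel_measurable borel" and i: "integrable P (\<lambda>p. f (fst p))"
  shows "integrable P (\<lambda>p. l (f (fst p)) (snd p))"
proof (rule Bochner_Integration.integrable_bound)
  show "integrable P (\<lambda>p. l 0 (snd p) + loss_const * \<bar>f (fst p)\<bar>)"
    using integrable_loss_0 i by (auto simp: case_prod_beta')
  have "(\<lambda>p::(real ^ 'n) \<times> real. f (fst p)) \<in> borel_measurable P"
    by (rule measurable_compose[OF _ f]) measurable
  then show "(\<lambda>p. l (f (fst p)) (snd p)) \<in> borel_measurable P" by measurable
  show "AE p in P. norm (l (f (fst p)) (snd p)) \<le> norm (l 0 (snd p) + loss_const * \<bar>f (fst p)\<bar>)"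
  proof (rule AE_I2)
    fix p :: "(real ^ 'n) \<times> real"
    have "\<bar>l (f (fst p)) (snd p) - l 0 (snd p)\<bar> \<le> loss_const * \<bar>f (fst p)\<bar>"
      using loss_lipschitz[of "f (fst p)" "snd p" 0] by simp
    then show "norm (l (f (fst p)) (snd p)) \<le> norm (l 0 (snd p) + loss_const * \<bar>f (fst p)\<bar>)"
      using loss_nonneg[of "f (fst p)" "snd p"] loss_nonneg[of 0 "snd p"] by simp
  qed
qed

lemma integrable_phi:
  assumes \<pi>: "\<pi> \<in> P2"
  shows "integrable \<pi> (\<lambda>\<theta>. phi \<theta> x)"
proof (rule P2_integrable_quadratic[OF \<pi>, where A=0 and B="norm (x, 1::real)"])
  show "(\<lambda>\<theta>. phi \<theta> x) \<in> borel_measurable \<pi>" by (rule P2_measurable[OF \<pi>]) measurable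
  show "\<bar>phi \<theta> x\<bar> \<le> 0 + norm (x, 1::real) * (norm \<theta>)\<^sup>2" for \<theta>
    using phi_le[of \<theta> x] by (simp add: mult.commute)
qed

lemma network_le:
  fixes \<pi> :: "'n param measure"
  assumes \<pi>: "\<pi> \<in> P2"
  shows "\<bar>network \<pi> x\<bar> \<le> second_moment \<pi> * norm (x, 1::real)"
proof -
  have "norm (network \<pi> x) \<le> (\<integral>\<theta>. (norm \<theta>)\<^sup>2 * norm (x, 1::real) \<partial>\<pi>)"
    unfolding network_def
    by (rule Bochner_Integration.integral_norm_bound_integral)
       (use integrable_phi[OF \<pi>] P2_integrable[OF \<pi>] phi_le in auto)
  then show ?thesis by (simp add: second_moment_def)
qed

lemma network_measurable:
  fixes \<pi> :: "'n param measure"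
  assumes \<pi>: "\<pi> \<in> P2"
  shows "network \<pi> \<in> borel_measurable borel"
proof -
  interpret p: prob_space \<pi> by (rule P2_prob[OF \<pi>])
  have [measurable]: "snd \<in> (borel :: (real ^ 'n) measure) \<Otimes>\<^sub>M \<pi> \<rightarrow>\<^sub>M borel"
    using measurable_compose[OF measurable_snd P2_measurable[OF \<pi> measurable_ident]] by (simp add: comp_def)
  have "(\<lambda>(x, \<theta>). phi \<theta> x) \<in> borel_measurable ((borel :: (real ^ 'n) measure) \<Otimes>\<^sub>M \<pi>)"
    unfolding case_prod_beta' by measurable
  then show ?thesis unfolding network_def[abs_def] by (rule p.borel_measurable_lebesgue_integral)
qed

lemma network_measurable_P [measurable]: "\<pi> \<in> P2 \<Longrightarrow> (\<lambda>p. network \<pi> (fst p)) \<in> borel_measurable P"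
  by (rule measurable_compose[OF _ network_measurable]) measurable

lemma integrable_network: "\<pi> \<in> P2 \<Longrightarrow> integrable P (\<lambda>p. network \<pi> (fst p))"
  by (rule Bochner_Integration.integrable_bound[of _ "\<lambda>p. second_moment \<pi> * q p"])
     (auto intro!: AE_I2 integrable_q order_trans[OF network_le])

lemma risk_eq: "risk l P \<pi> = (\<integral>p. l (network \<pi> (fst p)) (snd p) \<partial>P)"
  by (simp add: risk_def case_prod_beta')

lemma delta_risk_eq: "delta_risk l P \<pi> = pot (res (network \<pi>))"
  by (simp add: delta_risk_def[abs_def] pot_def[abs_def] res_def case_prod_beta')

lemma grad_delta_risk_eq: "grad_delta_risk l P \<pi> = pgrad (res (network \<pi>))"
  by (simp add: grad_delta_risk_def[abs_def] pgrad_def[abs_def] res_def case_prod_beta')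

lemma risk_nonneg: "0 \<le> risk l P \<pi>"
  unfolding risk_eq by (intro Bochner_Integration.integral_nonneg loss_nonneg)

lemma continuous_pot_cone: "residual C \<rho> \<Longrightarrow> continuous_on UNIV (\<lambda>\<theta>. pgrad \<rho> (clamp_cone \<theta>))"
proof -
  assume \<rho>: "residual C \<rho>"
  have "continuous_on (closure Theta) (pgrad \<rho>)"
    by (rule lipschitz_on_continuous_on[of "C * grad_lipschitz_const"], rule lipschitz_onI)
       (use pgrad_lipschitz[OF \<rho>] residual_nonneg[OF \<rho>] grad_lipschitz_const_nonneg in \<open>auto simp: dist_norm\<close>)
  then show ?thesis
    by (rule continuous_on_compose2[OF _ continuous_clamp_cone]) (auto simp: clamp_cone_in)
qed

lemma pot_clamp_measurable: "residual C \<rho> \<Longrightarrow> (\<lambda>\<theta>. pot \<rho> (clamp_cone \<theta>)) \<in> borel_measurable borel"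
proof -
  assume \<rho>: "residual C \<rho>"
  \<comment> \<open>By Euler's identity the potential is half the product of the parameter with its
    gradient, so it inherits regularity from the gradient.\<close>
  have "(\<lambda>\<theta>. clamp_cone \<theta> \<bullet> pgrad \<rho> (clamp_cone \<theta>) / 2) \<in> borel_measurable borel"
    by (intro borel_measurable_continuous_onI continuous_intros continuous_pot_cone[OF \<rho>] continuous_clamp_cone) simp
  then show ?thesis by (simp add: inner_pgrad(1)[OF \<rho>])
qed

lemma pot_measurable:
  assumes \<rho>: "residual C \<rho>" and \<pi>: "\<pi> \<in> P2"
  shows "pot \<rho> \<in> borel_measurable \<pi>"
proof -
  have "(\<lambda>\<theta>. pot \<rho> (clamp_cone \<theta>)) \<in> borel_measurable \<pi>" by (rule P2_measurable[OF \<pi> pot_clamp_measurable[OF \<rho>]])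
  then show ?thesis by (rule measurable_cong[THEN iffD1, rotated]) (simp add: P2_space[OF \<pi>] clamp_cone_id)
qed

lemma integrable_pot_P2:
  assumes \<rho>: "residual C \<rho>" and \<pi>: "\<pi> \<in> P2"
  shows "integrable \<pi> (pot \<rho>)"
  by (rule P2_integrable_quadratic[OF \<pi> pot_measurable[OF \<rho> \<pi>], where A=0 and B="C * moment"])
     (use pot_le[OF \<rho>] in simp)

text \<open>Fubini: pairing the residual with the network output is the same as pairing the
  potential with the parameter measure. The product is dominated by
  \<open>C * second_moment \<pi> * q p\<close>.\<close>

lemma integral_network:
  assumes \<rho>: "residual C \<rho>" and \<pi>: "\<pi> \<in> P2"
  shows "(\<integral>p. \<rho> p * network \<pi> (fst p) \<partial>P) = (\<integral>\<theta>. pot \<rho> \<theta> \<partial>\<pi>)"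
proof -
  interpret p: prob_space \<pi> by (rule P2_prob[OF \<pi>])
  interpret pp: pair_prob_space P \<pi> ..
  have [measurable]: "snd \<in> P \<Otimes>\<^sub>M \<pi> \<rightarrow>\<^sub>M borel"
    using measurable_compose[OF measurable_snd P2_measurable[OF \<pi> measurable_ident]] by (simp add: comp_def)
  have [measurable]: "fst \<in> P \<Otimes>\<^sub>M \<pi> \<rightarrow>\<^sub>M borel"
    using measurable_fst[of P \<pi>] sets_P by (simp cong: measurable_cong_sets)
  have [measurable]: "\<rho> \<in> borel_measurable borel" using \<rho> sets_P by (simp add: residual_def cong: measurable_cong_sets)
  let ?f = "\<lambda>z. \<rho> (fst z) * phi (snd z) (fst (fst z))"
  have fm[measurable]: "?f \<in> borel_measurable (P \<Otimes>\<^sub>M \<pi>)" by measurable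
  have n: "(\<integral>\<theta>. norm (?f (p, \<theta>)) \<partial>\<pi>) = \<bar>\<rho> p\<bar> * (\<integral>\<theta>. \<bar>phi \<theta> (fst p)\<bar> \<partial>\<pi>)" for p
    by (simp add: abs_mult)
  have "integrable (P \<Otimes>\<^sub>M \<pi>) ?f"
  proof (rule pp.Fubini_integrable[OF fm])
    show "integrable P (\<lambda>p. \<integral>\<theta>. norm (?f (p, \<theta>)) \<partial>\<pi>)"
    proof (rule Bochner_Integration.integrable_bound[of _ "\<lambda>p. C * second_moment \<pi> * q p"])
      show "(\<lambda>p. \<integral>\<theta>. norm (?f (p, \<theta>)) \<partial>\<pi>) \<in> borel_measurable P"
        by (rule p.borel_measurable_lebesgue_integral) measurable
      show "AE p in P. norm (\<integral>\<theta>. norm (?f (p, \<theta>)) \<partial>\<pi>) \<le> norm (C * second_moment \<pi> * q p)"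
      proof (rule AE_I2)
        fix p
        have "(\<integral>\<theta>. \<bar>phi \<theta> (fst p)\<bar> \<partial>\<pi>) \<le> (\<integral>\<theta>. (norm \<theta>)\<^sup>2 * q p \<partial>\<pi>)"
          using integrable_phi[OF \<pi>] P2_integrable[OF \<pi>] phi_le by (intro integral_mono) auto
        then have "\<bar>\<rho> p\<bar> * (\<integral>\<theta>. \<bar>phi \<theta> (fst p)\<bar> \<partial>\<pi>) \<le> C * (second_moment \<pi> * q p)"
          using residual_abs_le[OF \<rho>, of p] residual_nonneg[OF \<rho>] by (intro mult_mono) (auto simp: second_moment_def)
        then show "norm (\<integral>\<theta>. norm (?f (p, \<theta>)) \<partial>\<pi>) \<le> norm (C * second_moment \<pi> * q p)"
          unfolding n using residual_nonneg[OF \<rho>] second_moment_nonneg[of \<pi>] by (simp add: mult.assoc)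
      qed
    qed (use integrable_q in simp)
    show "AE p in P. integrable \<pi> (\<lambda>\<theta>. ?f (p, \<theta>))"
      using integrable_phi[OF \<pi>] by (intro AE_I2) simp
  qed
  then have "(\<integral>\<theta>. (\<integral>p. \<rho> p * phi \<theta> (fst p) \<partial>P) \<partial>\<pi>) = (\<integral>p. (\<integral>\<theta>. \<rho> p * phi \<theta> (fst p) \<partial>\<pi>) \<partial>P)"
    by (intro pp.Fubini_integral) (simp add: case_prod_beta')
  then show ?thesis by (simp add: pot_def[abs_def] network_def)
qed

text \<open>The network output is linear in the measure, so convexity of the loss in the output
  makes the risk convex in the measure. The tangent inequality is integrated pointwise and rewritten
  by \<open>integral_network\<close>.\<close>

lemma risk_tangent:
  assumes \<pi>: "\<pi> \<in> P2" and \<pi>': "\<pi>' \<in> P2"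
  shows "(\<integral>\<theta>. delta_risk l P \<pi> \<theta> \<partial>\<pi>') - (\<integral>\<theta>. delta_risk l P \<pi> \<theta> \<partial>\<pi>) \<le> risk l P \<pi>' - risk l P \<pi>"
proof -
  let ?\<rho> = "res (network \<pi>)"
  have \<rho>: "residual loss_const ?\<rho>" by (rule residual_res[OF network_measurable[OF \<pi>]])
  have i: "integrable P (\<lambda>p. ?\<rho> p * network \<pi>'' (fst p))" if "\<pi>'' \<in> P2" for \<pi>''
  proof -
    have "integrable P (\<lambda>p. ?\<rho> p *\<^sub>R network \<pi>'' (fst p))"
      by (rule integrable_residual[OF \<rho>, where B = "second_moment \<pi>''"]) (use that network_le in auto)
    then show ?thesis by simp
  qed
  have "(\<integral>\<theta>. delta_risk l P \<pi> \<theta> \<partial>\<pi>') - (\<integral>\<theta>. delta_risk l P \<pi> \<theta> \<partial>\<pi>) =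
      (\<integral>p. ?\<rho> p * network \<pi>' (fst p) - ?\<rho> p * network \<pi> (fst p) \<partial>P)"
    unfolding delta_risk_eq using i \<pi> \<pi>' by (simp add: integral_network[OF \<rho>])
  also have "\<dots> \<le> (\<integral>p. l (network \<pi>' (fst p)) (snd p) - l (network \<pi> (fst p)) (snd p) \<partial>P)"
  proof (rule integral_mono)
    show "integrable P (\<lambda>p. l (network \<pi>' (fst p)) (snd p) - l (network \<pi> (fst p)) (snd p))"
      by (intro Bochner_Integration.integrable_diff integrable_loss network_measurable integrable_network \<pi> \<pi>')
    show "?\<rho> p * network \<pi>' (fst p) - ?\<rho> p * network \<pi> (fst p) \<le> l (network \<pi>' (fst p)) (snd p) - l (network \<pi> (fst p)) (snd p)" for p
      using loss_tangent[of "network \<pi> (fst p)" "snd p" "network \<pi>' (fst p)"]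
      by (simp add: res_def right_diff_distrib)
  qed (use i \<pi> \<pi>' in auto)
  also have "\<dots> = risk l P \<pi>' - risk l P \<pi>"
    unfolding risk_eq
    by (intro Bochner_Integration.integral_diff integrable_loss network_measurable integrable_network \<pi> \<pi>')
  finally show ?thesis .
qed

text \<open>\<open>clamp_cone\<close> only makes the atoms land in the restricted space; it does
  nothing to atoms already in the cone.\<close>

definition atomic :: "'n param pmf \<Rightarrow> 'n param measure" where
  "atomic p = distr (measure_pmf p) (restrict_space borel (closure Theta)) clamp_cone"

lemma atomic_integral:
  fixes f :: "'n param \<Rightarrow> real"
  assumes "f \<in> borel_measurable borel"
  shows "(\<integral>\<theta>. f \<theta> \<partial>atomic p) = (\<integral>\<theta>. f (clamp_cone \<theta>) \<partial>measure_pmf p)"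
  unfolding atomic_def
  by (rule integral_distr) (auto simp: space_restrict_space clamp_cone_in intro: measurable_restrict_space1 assms)

lemma atomic_P2:
  assumes "finite (set_pmf p)"
  shows "atomic p \<in> P2"
proof (rule P2I)
  have c: "clamp_cone \<in> measure_pmf p \<rightarrow>\<^sub>M restrict_space borel (closure Theta)"
    by (auto simp: space_restrict_space clamp_cone_in)
  show "prob_space (atomic p)" unfolding atomic_def by (rule measure_pmf.prob_space_distr[OF c])
  have "(\<lambda>\<theta>::'n param. (norm \<theta>)\<^sup>2) \<in> borel_measurable (restrict_space borel (closure Theta))"
    by (rule measurable_restrict_space1) measurable
  then show "integrable (atomic p) (\<lambda>\<theta>. (norm \<theta>)\<^sup>2)"
    unfolding atomic_def by (subst integrable_distr_eq[OF c]) (auto intro: integrable_measure_pmf_finite assms)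
qed (simp add: atomic_def)

text \<open>The tangent inequality tested with the Dirac measure at the zero parameter, where every
  potential vanishes; the risk at \<open>\<pi>\<close> is dropped because it is nonnegative.\<close>

lemma integral_delta_risk_ge:
  assumes \<pi>: "\<pi> \<in> P2"
  shows "- (\<integral>\<theta>. delta_risk l P \<pi> \<theta> \<partial>\<pi>) \<le> risk l P (atomic (return_pmf 0))"
proof -
  have \<rho>: "residual loss_const (res (network \<pi>))" by (rule residual_res[OF network_measurable[OF \<pi>]])
  have a: "atomic (return_pmf 0) \<in> P2" by (rule atomic_P2) simp
  have "(\<integral>\<theta>. delta_risk l P \<pi> \<theta> \<partial>atomic (return_pmf 0)) = (\<integral>\<theta>. pot (res (network \<pi>)) (clamp_cone \<theta>) \<partial>atomic (return_pmf 0))"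
    unfolding delta_risk_eq
    by (rule Bochner_Integration.integral_cong) (auto simp: P2_space[OF a] clamp_cone_id)
  also have "\<dots> = pot (res (network \<pi>)) 0"
    by (subst atomic_integral[OF pot_clamp_measurable[OF \<rho>]]) (simp add: clamp_cone_id zero_closure_Theta)
  also have "\<dots> = 0" using pot_le[OF \<rho>, of 0] by simp
  finally show ?thesis using risk_tangent[OF \<pi> a] risk_nonneg[of \<pi>] by linarith
qed

end

section \<open>The gradient flow as a transport\<close>

lemma gradient_zero_outside:
  fixes f :: "'a::euclidean_space \<Rightarrow> real"
  assumes f: "\<And>x. R < norm x \<Longrightarrow> f x = 0" and x: "R < norm x"
  shows "gradient f x = 0"
proof -
  have "\<forall>\<^sub>F y in nhds x. y \<in> - cball 0 R"
    by (rule eventually_nhds_in_open) (use x in auto)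
  then have "\<forall>\<^sub>F y in nhds x. f y = 0" by (rule eventually_mono) (use f in auto)
  then have ev: "\<forall>\<^sub>F y in at x. 0 = f y" by (auto simp: eventually_at_filter elim: eventually_mono)
  have "((\<lambda>y::'a. 0::real) has_derivative (\<lambda>h. 0)) (at x)" by simp
  from has_derivative_transform_eventually[OF this ev] f[OF x]
  have "GDERIV f x :> 0" unfolding gderiv_def by simp
  then show ?thesis by (rule gradient_eq)
qed

lemma C_1_compact_support_bounds:
  fixes f :: "'a::euclidean_space \<Rightarrow> real"
  assumes f: "C_k 1 f" and supp: "\<And>x. R < norm x \<Longrightarrow> f x = 0"
  shows "\<exists>B\<ge>0. (\<forall>x. norm (gradient f x) \<le> B) \<and> (\<forall>x y. \<bar>f x - f y\<bar> \<le> B * norm (x - y))"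
proof -
  have "compact (gradient f ` cball 0 R)"
    by (intro compact_continuous_image continuous_on_subset[OF C_k_GDERIV(2)[OF f]]) auto
  then obtain B where B: "\<And>x. x \<in> cball 0 R \<Longrightarrow> norm (gradient f x) \<le> B"
    using compact_imp_bounded bounded_iff by (metis imageI)
  have le: "norm (gradient f x) \<le> \<bar>B\<bar>" for x
  proof (cases "norm x \<le> R")
    case True
    then show ?thesis using B[of x] by simp
  next
    case False
    have "gradient f x = 0" by (rule gradient_zero_outside[of R]) (use supp False in auto)
    then show ?thesis by simp
  qed
  have "\<bar>f x - f y\<bar> \<le> \<bar>B\<bar> * norm (x - y)" for x y
  proof -
    have "norm (f x - f y) \<le> \<bar>B\<bar> * norm (x - y)"
    proof (rule differentiable_bound[where S = UNIV and f' = "\<lambda>x h. h \<bullet> gradient f x"])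
      show "(f has_derivative (\<lambda>h. h \<bullet> gradient f x)) (at x within UNIV)" for x
        using C_k_GDERIV(1)[OF f, of x] by (simp add: gderiv_def)
      show "onorm (\<lambda>h. h \<bullet> gradient f x) \<le> \<bar>B\<bar>" for x
      proof (rule onorm_le)
        fix h
        have "norm (h \<bullet> gradient f x) \<le> norm h * norm (gradient f x)" by (simp add: Cauchy_Schwarz_ineq2)
        also have "\<dots> \<le> norm h * \<bar>B\<bar>" by (intro mult_left_mono le) auto
        finally show "norm (h \<bullet> gradient f x) \<le> \<bar>B\<bar> * norm h" by (simp add: mult.commute)
      qed
    qed auto
    then show ?thesis by simp
  qed
  with le show ?thesis by (intro exI[of _ "\<bar>B\<bar>"]) auto
qed

lemma test_function_support:
  assumes "test_function f"
  obtains R where "\<And>x. R < norm x \<Longrightarrow> f x = 0"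
proof -
  have "bounded {x. f x \<noteq> 0}"
    using assms unfolding test_function_def
    by (meson bounded_subset closure_subset compact_imp_bounded)
  then obtain R where "\<And>x. f x \<noteq> 0 \<Longrightarrow> norm x \<le> R" by (auto simp: bounded_iff)
  then show ?thesis using that[of R] by force
qed

text \<open>The bounds for compactly supported C^1 functions are applied to the function and to each
  of its partial derivatives.\<close>

lemma test_function_bounds:
  fixes \<psi> :: "'a::euclidean_space \<Rightarrow> real"
  assumes "test_function \<psi>"
  shows "\<exists>B\<ge>0. (\<forall>x. norm (gradient \<psi> x) \<le> B) \<and> (\<forall>x y. \<bar>\<psi> x - \<psi> y\<bar> \<le> B * norm (x - y))
    \<and> (\<forall>x y. norm (gradient \<psi> x - gradient \<psi> y) \<le> B * norm (x - y))"
proof -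
  have C: "C_k k \<psi>" for k using assms by (simp add: test_function_def)
  have C1: "C_k 1 \<psi>" by (rule C)
  obtain R where R: "\<And>x. R < norm x \<Longrightarrow> \<psi> x = 0" using test_function_support[OF assms] by blast
  obtain B where B: "B \<ge> 0" "\<forall>x. norm (gradient \<psi> x) \<le> B" "\<forall>x y. \<bar>\<psi> x - \<psi> y\<bar> \<le> B * norm (x - y)"
    using C_1_compact_support_bounds[OF C1 R] by blast
  have fd: "frechet_derivative \<psi> (at x) i = gradient \<psi> x \<bullet> i" for x i
  proof -
    have "(\<psi> has_derivative (\<lambda>h. h \<bullet> gradient \<psi> x)) (at x)"
      using C_k_GDERIV(1)[OF C1, of x] by (simp add: gderiv_def)
    from frechet_derivative_at[OF this] show ?thesis by (metis inner_commute)
  qed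
  have "\<exists>D\<ge>0. \<forall>x y. \<bar>gradient \<psi> x \<bullet> i - gradient \<psi> y \<bullet> i\<bar> \<le> D * norm (x - y)" if i: "i \<in> Basis" for i
  proof -
    have "C_k (Suc 1) \<psi>" by (rule C)
    then have "C_k 1 (\<lambda>x. gradient \<psi> x \<bullet> i)" using i by (simp only: C_k.simps(2) fd)
    moreover have "gradient \<psi> x \<bullet> i = 0" if "R < norm x" for x
    proof -
      have "gradient \<psi> x = 0" by (rule gradient_zero_outside[of R]) (use R that in auto)
      then show ?thesis by simp
    qed
    ultimately show ?thesis using C_1_compact_support_bounds[of "\<lambda>x. gradient \<psi> x \<bullet> i" R] by blast
  qed
  then obtain D where D: "\<And>i. i \<in> Basis \<Longrightarrow> D i \<ge> 0 \<and> (\<forall>x y. \<bar>gradient \<psi> x \<bullet> i - gradient \<psi> y \<bullet> i\<bar> \<le> D i * norm (x - y))"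
    by metis
  have G: "norm (gradient \<psi> x - gradient \<psi> y) \<le> (\<Sum>i\<in>Basis. D i) * norm (x - y)" for x y
  proof -
    have "norm (gradient \<psi> x - gradient \<psi> y) \<le> (\<Sum>i\<in>Basis. \<bar>(gradient \<psi> x - gradient \<psi> y) \<bullet> i\<bar>)" by (rule norm_le_l1)
    also have "\<dots> \<le> (\<Sum>i\<in>Basis. D i * norm (x - y))"
      by (rule sum_mono) (use D in \<open>simp add: inner_diff_left\<close>)
    finally show ?thesis by (simp add: sum_distrib_right)
  qed
  have S: "0 \<le> (\<Sum>i\<in>Basis. D i)" by (rule sum_nonneg) (use D in simp)
  show ?thesis
  proof (intro exI[of _ "B + (\<Sum>i\<in>Basis. D i)"] conjI allI)
    show "0 \<le> B + (\<Sum>i\<in>Basis. D i)" using B(1) S by simp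
    show "norm (gradient \<psi> x) \<le> B + (\<Sum>i\<in>Basis. D i)" for x using B(2)[rule_format, of x] S by simp
    fix x y
    show "\<bar>\<psi> x - \<psi> y\<bar> \<le> (B + (\<Sum>i\<in>Basis. D i)) * norm (x - y)"
      using B(3)[rule_format, of x y] mult_nonneg_nonneg[OF S norm_ge_zero[of "x - y"]] by (simp add: distrib_right)
    show "norm (gradient \<psi> x - gradient \<psi> y) \<le> (B + (\<Sum>i\<in>Basis. D i)) * norm (x - y)"
      using G[of x y] mult_nonneg_nonneg[OF B(1) norm_ge_zero[of "x - y"]] by (simp add: distrib_right)
  qed
qed

locale flow_setting = mean_field P l
  for P :: "((real ^ 'n::finite) \<times> real) measure" and l +
  fixes flow :: "real \<Rightarrow> 'n param measure" and m :: "real \<Rightarrow> real"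
  assumes flow_P2: "\<And>t. 0 \<le> t \<Longrightarrow> flow t \<in> P2"
    and m_integrable: "\<And>T. 0 < T \<Longrightarrow> set_integrable lborel {0..T} m"
    and wasserstein2_le: "\<And>s t. 0 \<le> s \<Longrightarrow> s \<le> t \<Longrightarrow> wasserstein2 (flow s) (flow t) \<le> (LINT r:{s..t}|lborel. m r)"
    and flow_weak: "\<And>\<psi>. test_function \<psi> \<Longrightarrow> AE t in lborel. t > 0 \<longrightarrow>
           ((\<lambda>s. \<integral>\<theta>. \<psi> \<theta> \<partial>flow s) has_real_derivative
              - (\<integral>\<theta>. gradient \<psi> \<theta> \<bullet> grad_delta_risk l P (flow t) \<theta> \<partial>flow t)) (at t)"
begin

abbreviation N :: "real \<Rightarrow> real" where
  "N t \<equiv> second_moment (flow t)"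

lemma wasserstein2_nonneg: "0 \<le> wasserstein2 \<pi> \<pi>'"
  by (simp add: wasserstein2_def)

lemma m_interval: "0 \<le> s \<Longrightarrow> t \<le> T \<Longrightarrow> 0 < T \<Longrightarrow> set_integrable lborel {s..t} m"
  by (rule set_integrable_subset[OF m_integrable[of T]]) auto

text \<open>A bound independent of the dynamics. The Wasserstein estimate for the squared norm has
  the unknown second moment at time \<open>t\<close> on both sides, under a square root on the
  right, so it can be absorbed.\<close>

lemma N_bounded:
  assumes T: "0 < T"
  shows "\<exists>B\<ge>0. \<forall>t\<in>{0..T}. N t \<le> B"
proof -
  define W where "W = (LINT r:{0..T}|lborel. \<bar>m r\<bar>)"
  have "N t \<le> 1 + 3 * N 0 + 3 * W\<^sup>2" if t: "t \<in> {0..T}" for t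
  proof -
    let ?w = "wasserstein2 (flow 0) (flow t)" and ?s = "sqrt (3 * (1 + N 0 + N t))"
    have P: "flow 0 \<in> P2" "flow t \<in> P2" using flow_P2 t by auto
    have "\<bar>(\<integral>\<theta>. (norm \<theta>)\<^sup>2 \<partial>flow 0) - (\<integral>\<theta>. (norm \<theta>)\<^sup>2 \<partial>flow t)\<bar> \<le> 1 * ?s * ?w"
    proof (rule wasserstein2_integral_bound[OF P])
      fix x y :: "'n param"
      have "\<bar>(norm x)\<^sup>2 - (norm y)\<^sup>2\<bar> = (norm x + norm y) * \<bar>norm x - norm y\<bar>"
        by (simp add: power2_eq_square square_diff_square_factored abs_mult)
      also have "\<dots> \<le> (1 + norm x + norm y) * norm (x - y)"
        by (intro mult_mono norm_triangle_ineq3) auto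
      finally show "\<bar>(norm x)\<^sup>2 - (norm y)\<^sup>2\<bar> \<le> 1 * ((1 + norm x + norm y) * norm (x - y))" by simp
    qed auto
    then have a: "N t \<le> N 0 + ?s * ?w" by (simp add: second_moment_def)
    have s2: "?s\<^sup>2 = 3 * (1 + N 0 + N t)" using second_moment_nonneg[of "flow 0"] second_moment_nonneg[of "flow t"] by simp
    \<comment> \<open>The weight 3 leaves the coefficient 1/2 in front of \<open>N t\<close> on the
      right, which is then moved to the left.\<close>
    have "0 \<le> (?s - 3 * ?w)\<^sup>2" by simp
    then have "6 * (?s * ?w) \<le> ?s\<^sup>2 + 9 * ?w\<^sup>2" by (simp add: power2_diff power_mult_distrib)
    moreover have "nt \<le> 1 + 3 * n0 + 3 * w2" if "6 * z \<le> 3 * (1 + n0 + nt) + 9 * w2" "nt \<le> n0 + z"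
      for z n0 nt w2 :: real using that by (simp add: distrib_left)
    ultimately have b: "N t \<le> 1 + 3 * N 0 + 3 * ?w\<^sup>2" using a unfolding s2 by blast
    have "?w \<le> (LINT r:{0..t}|lborel. m r)" using wasserstein2_le[of 0 t] t by simp
    also have "\<dots> \<le> (LINT r:{0..t}|lborel. \<bar>m r\<bar>)"
      using set_integral_norm_bound[OF m_interval[of 0 t T]] t T by simp
    also have "\<dots> \<le> W" unfolding W_def set_lebesgue_integral_def
    proof (rule integral_mono)
      show "integrable lborel (\<lambda>r. indicator {0..t} r *\<^sub>R \<bar>m r\<bar>)" "integrable lborel (\<lambda>r. indicator {0..T} r *\<^sub>R \<bar>m r\<bar>)"
        using set_integrable_abs[OF m_interval[of 0 t T]] set_integrable_abs[OF m_integrable[OF T]] t T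
        by (auto simp: set_integrable_def)
    qed (use t in \<open>auto simp: indicator_def\<close>)
    finally have "?w\<^sup>2 \<le> W\<^sup>2" using wasserstein2_nonneg by (intro power_mono) auto
    then show ?thesis using b by linarith
  qed
  moreover have "0 \<le> 1 + 3 * N 0 + 3 * W\<^sup>2" using second_moment_nonneg[of "flow 0"] by simp
  ultimately show ?thesis by blast
qed

lemma flow_increment:
  assumes G: "G \<in> borel_measurable borel" and K: "0 < K"
    and le: "\<And>x y. x \<in> closure Theta \<Longrightarrow> y \<in> closure Theta \<Longrightarrow> \<bar>G x - G y\<bar> \<le> K * ((1 + norm x + norm y) * norm (x - y))"
    and T: "0 < T"
  shows "\<exists>C. \<forall>s t. 0 \<le> s \<and> s \<le> t \<and> t \<le> T \<longrightarrow>
    \<bar>(\<integral>\<theta>. G \<theta> \<partial>flow t) - (\<integral>\<theta>. G \<theta> \<partial>flow s)\<bar> \<le> C * (LINT r:{s..t}|lborel. m r)"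
proof -
  obtain B where B: "B \<ge> 0" "\<And>t. t \<in> {0..T} \<Longrightarrow> N t \<le> B" using N_bounded[OF T] by blast
  show ?thesis
  proof (intro exI[of _ "K * sqrt (3 * (1 + B + B))"] allI impI, elim conjE)
    fix s t assume st: "0 \<le> s" "s \<le> t" "t \<le> T"
    have "\<bar>(\<integral>\<theta>. G \<theta> \<partial>flow t) - (\<integral>\<theta>. G \<theta> \<partial>flow s)\<bar> = \<bar>(\<integral>\<theta>. G \<theta> \<partial>flow s) - (\<integral>\<theta>. G \<theta> \<partial>flow t)\<bar>"
      by (rule abs_minus_commute)
    also have "\<dots> \<le> K * sqrt (3 * (1 + N s + N t)) * wasserstein2 (flow s) (flow t)"
      by (rule wasserstein2_integral_bound[OF _ _ G K le]) (use flow_P2 st in auto)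
    also have "\<dots> \<le> K * sqrt (3 * (1 + B + B)) * (LINT r:{s..t}|lborel. m r)"
    proof (rule mult_mono)
      show "K * sqrt (3 * (1 + N s + N t)) \<le> K * sqrt (3 * (1 + B + B))"
        using B(2)[of s] B(2)[of t] st K by (intro mult_left_mono real_sqrt_le_mono) auto
      show "wasserstein2 (flow s) (flow t) \<le> (LINT r:{s..t}|lborel. m r)" by (rule wasserstein2_le) (use st in auto)
    qed (use K B wasserstein2_nonneg in auto)
    finally show "\<bar>(\<integral>\<theta>. G \<theta> \<partial>flow t) - (\<integral>\<theta>. G \<theta> \<partial>flow s)\<bar> \<le> K * sqrt (3 * (1 + B + B)) * (LINT r:{s..t}|lborel. m r)" .
  qed
qed

text \<open>\<open>m\<close> need not be bounded; its indefinite integral is nevertheless continuous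
  and serves as modulus.\<close>

lemma continuous_of_increment:
  fixes F :: "real \<Rightarrow> real"
  assumes inc: "\<And>T. 0 < T \<Longrightarrow> \<exists>C. \<forall>s t. 0 \<le> s \<and> s \<le> t \<and> t \<le> T \<longrightarrow> \<bar>F t - F s\<bar> \<le> C * (LINT r:{s..t}|lborel. m r)"
  shows "continuous_on {0..} F"
  unfolding continuous_on_def
proof
  fix t :: real assume t: "t \<in> {0..}"
  define T where "T = t + 1"
  have T: "0 < T" "t < T" using t by (auto simp: T_def)
  obtain C where C: "\<And>a b. 0 \<le> a \<Longrightarrow> a \<le> b \<Longrightarrow> b \<le> T \<Longrightarrow> \<bar>F b - F a\<bar> \<le> C * (LINT r:{a..b}|lborel. m r)"
    using inc[OF T(1)] by blast
  have mi: "m integrable_on {0..T}" by (rule set_borel_integral_eq_integral(1)[OF m_integrable[OF T(1)]])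
  define \<Phi> where "\<Phi> = (\<lambda>s. integral {0..s} m)"
  have \<Phi>c: "continuous_on {0..T} \<Phi>" unfolding \<Phi>_def by (rule indefinite_integral_continuous_1[OF mi])
  have \<Phi>d: "(LINT r:{a..b}|lborel. m r) = \<Phi> b - \<Phi> a" if "0 \<le> a" "a \<le> b" "b \<le> T" for a b
  proof -
    have "(LINT r:{a..b}|lborel. m r) = integral {a..b} m"
      by (rule set_borel_integral_eq_integral(2)[OF m_interval[OF that(1,3) T(1)]])
    moreover have "integral {0..a} m + integral {a..b} m = integral {0..b} m"
      using that by (intro Henstock_Kurzweil_Integration.integral_combine integrable_on_subinterval[OF mi]) auto
    ultimately show ?thesis by (simp add: \<Phi>_def)
  qed
  have le: "\<bar>F s - F t\<bar> \<le> \<bar>C\<bar> * \<bar>\<Phi> s - \<Phi> t\<bar>" if "s \<in> {0..T}" for s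
  proof (cases "s \<le> t")
    case True
    have "\<bar>F s - F t\<bar> \<le> C * (\<Phi> t - \<Phi> s)" using C[of s t] \<Phi>d[of s t] that T True by (simp add: abs_minus_commute)
    also have "\<dots> \<le> \<bar>C\<bar> * \<bar>\<Phi> s - \<Phi> t\<bar>" by (metis abs_ge_self abs_minus_commute abs_mult)
    finally show ?thesis .
  next
    case False
    have "\<bar>F s - F t\<bar> \<le> C * (\<Phi> s - \<Phi> t)" using C[of t s] \<Phi>d[of t s] that T t False by simp
    also have "\<dots> \<le> \<bar>C\<bar> * \<bar>\<Phi> s - \<Phi> t\<bar>" by (metis abs_ge_self abs_mult)
    finally show ?thesis .
  qed
  have at: "at t within {0..} = at t within {0..T}"
    by (rule at_within_nhd[where S = "{..<T}"]) (use T in auto)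
  have "((\<lambda>s. F s - F t) \<longlongrightarrow> 0) (at t within {0..T})"
  proof (rule Lim_null_comparison)
    show "\<forall>\<^sub>F s in at t within {0..T}. norm (F s - F t) \<le> \<bar>C\<bar> * \<bar>\<Phi> s - \<Phi> t\<bar>"
      unfolding eventually_at_filter using le by (intro always_eventually) auto
    have "(\<Phi> \<longlongrightarrow> \<Phi> t) (at t within {0..T})" using \<Phi>c t T by (auto simp: continuous_on_def)
    then have "((\<lambda>s. \<Phi> s - \<Phi> t) \<longlongrightarrow> 0) (at t within {0..T})" by (simp add: LIM_zero_iff)
    from tendsto_mult_right_zero[OF tendsto_rabs_zero[OF this], of "\<bar>C\<bar>"]
    show "((\<lambda>s. \<bar>C\<bar> * \<bar>\<Phi> s - \<Phi> t\<bar>) \<longlongrightarrow> 0) (at t within {0..T})" .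
  qed
  then show "(F \<longlongrightarrow> F t) (at t within {0..})" unfolding at by (simp add: LIM_zero_iff)
qed

lemma flow_continuous:
  assumes "G \<in> borel_measurable borel" "0 < K"
    and "\<And>x y. x \<in> closure Theta \<Longrightarrow> y \<in> closure Theta \<Longrightarrow> \<bar>G x - G y\<bar> \<le> K * ((1 + norm x + norm y) * norm (x - y))"
  shows "continuous_on {0..} (\<lambda>t. \<integral>\<theta>. G \<theta> \<partial>flow t)"
  by (rule continuous_of_increment, rule flow_increment[OF assms])

lemma network_continuous: "continuous_on {0..} (\<lambda>t. network (flow t) x)"
  unfolding network_def
proof (rule flow_continuous[where K = "norm (x, 1::real)"])
  show "(\<lambda>\<theta>. phi \<theta> x) \<in> borel_measurable borel" by measurable
  show "0 < norm (x, 1::real)" by (simp add: prod_eq_iff)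
  fix \<theta> \<theta>' :: "'n param"
  have "\<bar>phi \<theta> x - phi \<theta>' x\<bar> \<le> ((norm \<theta> + norm \<theta>') * norm (\<theta> - \<theta>')) * norm (x, 1::real)" by (rule phi_diff_le)
  also have "\<dots> \<le> ((1 + norm \<theta> + norm \<theta>') * norm (\<theta> - \<theta>')) * norm (x, 1::real)"
    by (intro mult_right_mono) auto
  finally show "\<bar>phi \<theta> x - phi \<theta>' x\<bar> \<le> norm (x, 1::real) * ((1 + norm \<theta> + norm \<theta>') * norm (\<theta> - \<theta>'))"
    by (simp add: mult.commute)
qed

definition \<rho> :: "real \<Rightarrow> (real ^ 'n) \<times> real \<Rightarrow> real" where
  "\<rho> t = res (network (flow t))"

lemma residual_\<rho>: "0 \<le> t \<Longrightarrow> residual loss_const (\<rho> t)"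
  unfolding \<rho>_def by (intro residual_res network_measurable flow_P2)

lemma delta_risk_flow: "delta_risk l P (flow t) = pot (\<rho> t)"
  by (simp add: delta_risk_eq \<rho>_def)

lemma grad_delta_risk_flow: "grad_delta_risk l P (flow t) = pgrad (\<rho> t)"
  by (simp add: grad_delta_risk_eq \<rho>_def)

text \<open>A single modulus for all parameters: between times \<open>s\<close> and \<open>t\<close>
  the gradient at \<theta> changes by at most \<open>norm \<theta> * \<omega> s t\<close>.\<close>

definition \<omega> :: "real \<Rightarrow> real \<Rightarrow> real" where
  "\<omega> s t = (\<integral>p. \<bar>\<rho> s p - \<rho> t p\<bar> * q p \<partial>P)"

lemma \<omega>_nonneg: "0 \<le> \<omega> s t"
  unfolding \<omega>_def by simp

text \<open>Network outputs are continuous in time at every input and the derivative of the loss is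
  continuous in its first argument; the integrable weight dominates since residuals are
  bounded.\<close>

lemma \<omega>_tendsto:
  assumes t: "0 \<le> t"
  shows "((\<lambda>s. \<omega> s t) \<longlongrightarrow> 0) (at t within {0..})"
  unfolding tendsto_at_iff_sequentially comp_def
proof (intro allI impI)
  fix X :: "nat \<Rightarrow> real" assume X: "\<forall>i. X i \<in> {0..} - {t}" "X \<longlonglongrightarrow> t"
  have m: "\<rho> s \<in> borel_measurable P" if "0 \<le> s" for s using residual_\<rho>[OF that] by (simp add: residual_def)
  have "(\<lambda>i. \<omega> (X i) t) \<longlonglongrightarrow> (\<integral>p. 0 \<partial>P)"
    unfolding \<omega>_def
  proof (rule integral_dominated_convergence[where w = "\<lambda>p. 2 * loss_const * q p"])
    show "(\<lambda>p. \<bar>\<rho> (X i) p - \<rho> t p\<bar> * q p) \<in> borel_measurable P" for i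
      using m[of "X i"] m[OF t] X by auto
    show "integrable P (\<lambda>p. 2 * loss_const * q p)" using integrable_q by simp
    show "AE p in P. (\<lambda>i. \<bar>\<rho> (X i) p - \<rho> t p\<bar> * q p) \<longlonglongrightarrow> 0"
    proof (rule AE_I2)
      fix p :: "(real ^ 'n) \<times> real"
      have "(\<lambda>i. network (flow (X i)) (fst p)) \<longlonglongrightarrow> network (flow t) (fst p)"
        using network_continuous[of "fst p"] X t unfolding continuous_on_sequentially comp_def by auto
      then have "(\<lambda>i. \<rho> (X i) p) \<longlonglongrightarrow> \<rho> t p"
        unfolding \<rho>_def res_def using D1_continuous[of "snd p"] unfolding continuous_on_sequentially comp_def by auto
      then have "(\<lambda>i. \<rho> (X i) p - \<rho> t p) \<longlonglongrightarrow> 0" by (simp add: LIM_zero_iff)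
      from tendsto_mult_left_zero[OF tendsto_rabs_zero[OF this], of "q p"]
      show "(\<lambda>i. \<bar>\<rho> (X i) p - \<rho> t p\<bar> * q p) \<longlonglongrightarrow> 0" .
    qed
    show "AE p in P. norm (\<bar>\<rho> (X i) p - \<rho> t p\<bar> * q p) \<le> 2 * loss_const * q p" for i
    proof (rule AE_I2)
      fix p :: "(real ^ 'n) \<times> real"
      have "\<bar>\<rho> (X i) p - \<rho> t p\<bar> \<le> 2 * loss_const"
        using residual_abs_le[OF residual_\<rho>[of "X i"], of p] residual_abs_le[OF residual_\<rho>[OF t], of p] X by fastforce
      then show "norm (\<bar>\<rho> (X i) p - \<rho> t p\<bar> * q p) \<le> 2 * loss_const * q p"
        by (simp add: abs_mult mult_right_mono)
    qed
  qed simp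
  then show "(\<lambda>i. \<omega> (X i) t) \<longlonglongrightarrow> 0" by simp
qed

lemma pgrad_diff_\<omega>: "0 \<le> s \<Longrightarrow> 0 \<le> t \<Longrightarrow> norm (pgrad (\<rho> s) \<theta> - pgrad (\<rho> t) \<theta>) \<le> norm \<theta> * \<omega> s t"
  unfolding \<omega>_def by (rule pgrad_diff_le[OF residual_\<rho> residual_\<rho>])

lemma pgrad_continuous_time: "continuous_on {0..} (\<lambda>t. pgrad (\<rho> t) \<theta>)"
  unfolding continuous_on_def
proof
  fix t :: real assume t: "t \<in> {0..}"
  have "((\<lambda>s. pgrad (\<rho> s) \<theta> - pgrad (\<rho> t) \<theta>) \<longlongrightarrow> 0) (at t within {0..})"
  proof (rule Lim_null_comparison)
    show "\<forall>\<^sub>F s in at t within {0..}. norm (pgrad (\<rho> s) \<theta> - pgrad (\<rho> t) \<theta>) \<le> norm \<theta> * \<omega> s t"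
      unfolding eventually_at_filter using t by (intro always_eventually) (auto intro!: pgrad_diff_\<omega>)
    show "((\<lambda>s. norm \<theta> * \<omega> s t) \<longlongrightarrow> 0) (at t within {0..})"
      by (rule tendsto_mult_right_zero[OF \<omega>_tendsto]) (use t in simp)
  qed
  then show "((\<lambda>t. pgrad (\<rho> t) \<theta>) \<longlongrightarrow> pgrad (\<rho> t) \<theta>) (at t within {0..})" by (simp add: LIM_zero_iff)
qed

definition velocity :: "real \<Rightarrow> 'n param \<Rightarrow> 'n param" where
  "velocity t \<theta> = - pgrad (\<rho> t) (clamp_cone \<theta>)"

lemma velocity_cone: "\<theta> \<in> closure Theta \<Longrightarrow> velocity t \<theta> = - pgrad (\<rho> t) \<theta>"
  by (simp add: velocity_def clamp_cone_id)

text \<open>The leading factor 2 is the Lipschitz constant of \<open>clamp_cone\<close>; the summand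
  1 makes the constant strictly positive, as \<open>lipschitz_field\<close> demands.\<close>

definition lip_const :: real where
  "lip_const = 2 * (loss_const * grad_lipschitz_const) + loss_const * moment + 1"

lemma velocity_lipschitz:
  assumes t: "0 \<le> t"
  shows "norm (velocity t x - velocity t y) \<le> lip_const * norm (x - y)"
proof -
  have L: "0 \<le> loss_const * grad_lipschitz_const" using loss_const_nonneg grad_lipschitz_const_nonneg by simp
  have "norm (velocity t x - velocity t y) = norm (pgrad (\<rho> t) (clamp_cone x) - pgrad (\<rho> t) (clamp_cone y))"
    by (simp add: velocity_def norm_minus_commute)
  also have "\<dots> \<le> loss_const * grad_lipschitz_const * norm (clamp_cone x - clamp_cone y)"
    by (rule pgrad_lipschitz[OF residual_\<rho>[OF t] clamp_cone_in])
  also have "\<dots> \<le> loss_const * grad_lipschitz_const * (2 * norm (x - y))"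
    by (intro mult_left_mono clamp_cone_lipschitz L)
  also have "\<dots> \<le> lip_const * norm (x - y)"
    using mult_nonneg_nonneg[OF mult_nonneg_nonneg[OF loss_const_nonneg moment_nonneg] norm_ge_zero[of "x - y"]]
    by (simp add: lip_const_def algebra_simps)
  finally show ?thesis .
qed

sublocale field: lipschitz_field velocity lip_const
proof
  show "0 < lip_const"
    using loss_const_nonneg grad_lipschitz_const_nonneg moment_nonneg by (simp add: lip_const_def add_nonneg_pos)
  show "norm (velocity t x - velocity t y) \<le> lip_const * norm (x - y)" if "0 \<le> t" for t x y
    by (rule velocity_lipschitz[OF that])
  show "continuous_on {0..} (\<lambda>t. velocity t x)" for x
    unfolding velocity_def by (intro continuous_intros pgrad_continuous_time)
qed

lemma velocity_le: "0 \<le> t \<Longrightarrow> norm (velocity t x) \<le> loss_const * moment * norm x"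
proof -
  assume t: "0 \<le> t"
  have "norm (velocity t x) \<le> loss_const * moment * norm (clamp_cone x)"
    unfolding velocity_def norm_minus_cancel by (rule pgrad_le[OF residual_\<rho>[OF t]])
  also have "\<dots> \<le> loss_const * moment * norm x"
    using loss_const_nonneg moment_nonneg by (intro mult_left_mono clamp_cone_norm) auto
  finally show ?thesis .
qed

text \<open>A bounded Lipschitz gradient paired with a Lipschitz velocity of linear growth falls
  exactly into the class of \<open>wasserstein2_integral_bound\<close>.\<close>

lemma weak_rate_lipschitz:
  assumes t: "0 \<le> t" and \<psi>: "test_function \<psi>"
  shows "\<exists>K>0. \<forall>x y. \<bar>gradient \<psi> x \<bullet> velocity t x - gradient \<psi> y \<bullet> velocity t y\<bar> \<le> K * ((1 + norm x + norm y) * norm (x - y))"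
proof -
  obtain B where B: "B \<ge> 0" "\<And>x. norm (gradient \<psi> x) \<le> B" "\<And>x y. norm (gradient \<psi> x - gradient \<psi> y) \<le> B * norm (x - y)"
    using test_function_bounds[OF \<psi>] by blast
  define K where "K = B * lip_const + B * (loss_const * moment) + 1"
  have c0: "0 \<le> loss_const * moment" using loss_const_nonneg moment_nonneg by simp
  have "\<bar>gradient \<psi> x \<bullet> velocity t x - gradient \<psi> y \<bullet> velocity t y\<bar> \<le> K * ((1 + norm x + norm y) * norm (x - y))" for x y
  proof -
    have eq: "gradient \<psi> x \<bullet> velocity t x - gradient \<psi> y \<bullet> velocity t y =
        gradient \<psi> x \<bullet> (velocity t x - velocity t y) + (gradient \<psi> x - gradient \<psi> y) \<bullet> velocity t y"
      by (simp add: inner_diff_left inner_diff_right)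
    have "norm (gradient \<psi> x) * norm (velocity t x - velocity t y) \<le> B * (lip_const * norm (x - y))"
      by (intro mult_mono B velocity_lipschitz t norm_ge_zero)
    then have a: "\<bar>gradient \<psi> x \<bullet> (velocity t x - velocity t y)\<bar> \<le> B * (lip_const * norm (x - y))"
      using Cauchy_Schwarz_ineq2 order_trans by blast
    have "norm (gradient \<psi> x - gradient \<psi> y) * norm (velocity t y) \<le> (B * norm (x - y)) * (loss_const * moment * norm y)"
      by (intro mult_mono B velocity_le t norm_ge_zero mult_nonneg_nonneg)
    then have b: "\<bar>(gradient \<psi> x - gradient \<psi> y) \<bullet> velocity t y\<bar> \<le> (B * norm (x - y)) * (loss_const * moment * norm y)"
      using Cauchy_Schwarz_ineq2 order_trans by blast
    have "B * (lip_const * norm (x - y)) = B * lip_const * norm (x - y)"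
      "(B * norm (x - y)) * (loss_const * moment * norm y) = B * (loss_const * moment) * (norm y * norm (x - y))" by simp_all
    then have 1: "\<bar>gradient \<psi> x \<bullet> velocity t x - gradient \<psi> y \<bullet> velocity t y\<bar> \<le>
        B * lip_const * norm (x - y) + B * (loss_const * moment) * (norm y * norm (x - y))"
      unfolding eq using a b by linarith
    define M where "M = (1 + norm x + norm y) * norm (x - y)"
    have n: "norm (x - y) \<le> M" "norm y * norm (x - y) \<le> M" "0 \<le> M"
      by (simp_all add: M_def distrib_right)
    have "B * lip_const * norm (x - y) \<le> B * lip_const * M"
      using B(1) field.L_pos by (intro mult_left_mono n) auto
    moreover have "B * (loss_const * moment) * (norm y * norm (x - y)) \<le> B * (loss_const * moment) * M"
      using B(1) c0 by (intro mult_left_mono n) auto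
    moreover have "K * M = B * lip_const * M + B * (loss_const * moment) * M + M"
      by (simp add: K_def distrib_right)
    ultimately show ?thesis using 1 n(3) unfolding M_def[symmetric] by linarith
  qed
  moreover have "0 < K" using B(1) c0 field.L_pos by (simp add: K_def add_nonneg_pos)
  ultimately show ?thesis by blast
qed

lemma velocity_continuous: "0 \<le> t \<Longrightarrow> continuous_on UNIV (velocity t)"
  by (rule lipschitz_on_continuous_on[of lip_const], rule lipschitz_onI)
     (use velocity_lipschitz field.L_pos in \<open>auto simp: dist_norm less_imp_le\<close>)

lemma gradient_continuous: "test_function \<psi> \<Longrightarrow> continuous_on UNIV (gradient \<psi>)"
  using C_k_GDERIV(2)[of \<psi>] by (simp add: test_function_def)

lemma weak_rate_measurable:
  "0 \<le> t \<Longrightarrow> test_function \<psi> \<Longrightarrow> (\<lambda>\<theta>. gradient \<psi> \<theta> \<bullet> velocity t \<theta>) \<in> borel_measurable borel"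
  by (intro borel_measurable_continuous_onI continuous_intros velocity_continuous gradient_continuous)

text \<open>Measure and velocity both move. With the velocity frozen at \<open>t\<close> the
  Wasserstein continuity of the flow applies; the remaining change of the velocity is bounded by
  \<open>\<omega> s t\<close> times a moment that is bounded near \<open>t\<close>.\<close>

lemma weak_rate_continuous:
  assumes \<psi>: "test_function \<psi>"
  shows "continuous_on {0..} (\<lambda>t. \<integral>\<theta>. gradient \<psi> \<theta> \<bullet> velocity t \<theta> \<partial>flow t)"
  unfolding continuous_on_def
proof
  fix t :: real assume "t \<in> {0..}"
  then have t: "0 \<le> t" by simp
  let ?k = "\<lambda>r s. \<integral>\<theta>. gradient \<psi> \<theta> \<bullet> velocity r \<theta> \<partial>flow s"
  obtain B where B: "B \<ge> 0" "\<And>x. norm (gradient \<psi> x) \<le> B"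
    using test_function_bounds[OF \<psi>] by blast
  obtain K where K: "K > 0" "\<And>x y. \<bar>gradient \<psi> x \<bullet> velocity t x - gradient \<psi> y \<bullet> velocity t y\<bar> \<le> K * ((1 + norm x + norm y) * norm (x - y))"
    using weak_rate_lipschitz[OF t \<psi>] by blast
  have "continuous_on {0..} (?k t)" by (rule flow_continuous[OF weak_rate_measurable[OF t \<psi>] K])
  then have 1: "((\<lambda>s. ?k t s) \<longlongrightarrow> ?k t t) (at t within {0..})" using t by (auto simp: continuous_on_def)
  obtain BN where BN: "BN \<ge> 0" "\<And>s. s \<in> {0..t+1} \<Longrightarrow> N s \<le> BN" using N_bounded[of "t+1"] t by auto
  have int: "integrable (flow s) (\<lambda>\<theta>. gradient \<psi> \<theta> \<bullet> velocity r \<theta>)" if "0 \<le> s" "0 \<le> r" for s r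
  proof (rule P2_integrable_quadratic[OF flow_P2[OF that(1)], where A = "B * (loss_const * moment)" and B = "B * (loss_const * moment)"])
    show "(\<lambda>\<theta>. gradient \<psi> \<theta> \<bullet> velocity r \<theta>) \<in> borel_measurable (flow s)"
      by (rule P2_measurable[OF flow_P2[OF that(1)] weak_rate_measurable[OF that(2) \<psi>]])
    fix \<theta> :: "'n param"
    have "\<bar>gradient \<psi> \<theta> \<bullet> velocity r \<theta>\<bar> \<le> B * (loss_const * moment * norm \<theta>)"
      by (rule order_trans[OF Cauchy_Schwarz_ineq2]) (intro mult_mono B velocity_le that norm_ge_zero)
    also have "\<dots> = B * (loss_const * moment) * norm \<theta>" by simp
    also have "\<dots> \<le> B * (loss_const * moment) * (1 + (norm \<theta>)\<^sup>2)"
    proof (rule mult_left_mono)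
      have "0 \<le> (norm \<theta> - 1)\<^sup>2" by simp
      then have "2 * norm \<theta> \<le> 1 + (norm \<theta>)\<^sup>2" by (simp add: power2_eq_square algebra_simps)
      then show "norm \<theta> \<le> 1 + (norm \<theta>)\<^sup>2" using norm_ge_zero[of \<theta>] by linarith
    qed (use B loss_const_nonneg moment_nonneg in auto)
    finally show "\<bar>gradient \<psi> \<theta> \<bullet> velocity r \<theta>\<bar> \<le> B * (loss_const * moment) + B * (loss_const * moment) * (norm \<theta>)\<^sup>2"
      by (simp add: distrib_left)
  qed
  have 2: "((\<lambda>s. ?k s s - ?k t s) \<longlongrightarrow> 0) (at t within {0..})"
  proof (rule Lim_null_comparison)
    show "((\<lambda>s. (B * (1 + BN)) * \<omega> s t) \<longlongrightarrow> 0) (at t within {0..})"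
      by (rule tendsto_mult_right_zero[OF \<omega>_tendsto[OF t]])
    have "eventually (\<lambda>s. s \<in> {0..} \<and> s < t + 1) (at t within {0..})"
      using order_tendstoD(2)[OF tendsto_ident_at, of t "t + 1" "{0..}"]
      by (auto simp: eventually_at_filter elim: eventually_mono)
    then show "\<forall>\<^sub>F s in at t within {0..}. norm (?k s s - ?k t s) \<le> (B * (1 + BN)) * \<omega> s t"
    proof (rule eventually_mono)
      fix s assume "s \<in> {0..} \<and> s < t + 1"
      then have s: "0 \<le> s" "s \<in> {0..t+1}" by auto
      interpret p: prob_space "flow s" by (rule P2_prob[OF flow_P2[OF s(1)]])
      have eq: "?k s s - ?k t s = (\<integral>\<theta>. gradient \<psi> \<theta> \<bullet> velocity s \<theta> - gradient \<psi> \<theta> \<bullet> velocity t \<theta> \<partial>flow s)"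
        using int s t by simp
      have "norm (?k s s - ?k t s) \<le> (\<integral>\<theta>. B * \<omega> s t * (1 + (norm \<theta>)\<^sup>2) \<partial>flow s)"
        unfolding eq
      proof (rule Bochner_Integration.integral_norm_bound_integral)
        show "integrable (flow s) (\<lambda>\<theta>. B * \<omega> s t * (1 + (norm \<theta>)\<^sup>2))"
          using P2_integrable[OF flow_P2[OF s(1)]] by simp
        fix \<theta> :: "'n param" 
        have "norm (gradient \<psi> \<theta> \<bullet> velocity s \<theta> - gradient \<psi> \<theta> \<bullet> velocity t \<theta>) \<le> norm (gradient \<psi> \<theta>) * norm (velocity s \<theta> - velocity t \<theta>)"
          unfolding inner_diff_right[symmetric] real_norm_def by (rule Cauchy_Schwarz_ineq2)
        also have "\<dots> \<le> B * (norm (clamp_cone \<theta>) * \<omega> s t)"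
          using pgrad_diff_\<omega>[OF s(1) t, of "clamp_cone \<theta>"] B
          by (intro mult_mono) (auto simp: velocity_def norm_minus_commute)
        also have "\<dots> \<le> B * ((1 + (norm \<theta>)\<^sup>2) * \<omega> s t)"
        proof (intro mult_left_mono mult_right_mono \<omega>_nonneg B(1))
          have "0 \<le> (norm \<theta> - 1)\<^sup>2" by simp
          then have "2 * norm \<theta> \<le> 1 + (norm \<theta>)\<^sup>2" by (simp add: power2_eq_square algebra_simps)
          then show "norm (clamp_cone \<theta>) \<le> 1 + (norm \<theta>)\<^sup>2" using norm_ge_zero[of \<theta>] clamp_cone_norm[of \<theta>] by linarith
        qed
        finally show "norm (gradient \<psi> \<theta> \<bullet> velocity s \<theta> - gradient \<psi> \<theta> \<bullet> velocity t \<theta>) \<le> B * \<omega> s t * (1 + (norm \<theta>)\<^sup>2)"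
          by (simp add: mult_ac)
      qed (use int s t in simp)
      also have "\<dots> = B * \<omega> s t * (1 + N s)"
        using P2_integrable[OF flow_P2[OF s(1)]] p.prob_space by (simp add: second_moment_def)
      also have "\<dots> \<le> B * \<omega> s t * (1 + BN)"
        using BN(2)[OF s(2)] B(1) \<omega>_nonneg[of s t] by (intro mult_left_mono) auto
      finally show "norm (?k s s - ?k t s) \<le> (B * (1 + BN)) * \<omega> s t" by (simp add: mult_ac)
    qed
  qed
  from tendsto_add[OF 1 2] show "((\<lambda>t. ?k t t) \<longlongrightarrow> ?k t t) (at t within {0..})" by simp
qed

text \<open>Since the right-hand side is continuous in time, the equation holds at every time,
  one-sidedly at 0, and no null set depending on \<open>\<psi>\<close> remains.\<close>

lemma flow_weak_derivative:
  assumes \<psi>: "test_function \<psi>" and t: "0 \<le> t"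
  shows "((\<lambda>s. \<integral>\<theta>. \<psi> \<theta> \<partial>flow s) has_real_derivative (\<integral>\<theta>. gradient \<psi> \<theta> \<bullet> velocity t \<theta> \<partial>flow t)) (at t within {0..})"
proof (rule absolutely_continuous_derivative[OF m_integrable _ _ weak_rate_continuous[OF \<psi>] t])
  obtain B where B: "B \<ge> 0" "\<And>x y. \<bar>\<psi> x - \<psi> y\<bar> \<le> B * norm (x - y)"
    using test_function_bounds[OF \<psi>] by blast
  show "\<exists>C. \<forall>s t. 0 \<le> s \<and> s \<le> t \<and> t \<le> T \<longrightarrow> \<bar>(\<integral>\<theta>. \<psi> \<theta> \<partial>flow t) - (\<integral>\<theta>. \<psi> \<theta> \<partial>flow s)\<bar> \<le> C * (LINT r:{s..t}|lborel. m r)"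
    if "0 < T" for T
  proof (rule flow_increment[OF _ _ _ that, where K = "B + 1"])
    have "C_k 0 \<psi>" using \<psi> unfolding test_function_def by blast
    then show "\<psi> \<in> borel_measurable borel" by (intro borel_measurable_continuous_onI) simp
    fix x y :: "'n param"
    have "\<bar>\<psi> x - \<psi> y\<bar> \<le> B * norm (x - y)" by (rule B(2))
    also have "\<dots> \<le> (B + 1) * ((1 + norm x + norm y) * norm (x - y))"
    proof (rule mult_mono)
      have "1 * norm (x - y) \<le> (1 + norm x + norm y) * norm (x - y)" by (intro mult_right_mono) auto
      then show "norm (x - y) \<le> (1 + norm x + norm y) * norm (x - y)" by simp
    qed (use B(1) in auto)
    finally show "\<bar>\<psi> x - \<psi> y\<bar> \<le> (B + 1) * ((1 + norm x + norm y) * norm (x - y))" .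
  qed (use B(1) in auto)
  show "AE t in lborel. 0 < t \<longrightarrow> ((\<lambda>s. \<integral>\<theta>. \<psi> \<theta> \<partial>flow s) has_real_derivative (\<integral>\<theta>. gradient \<psi> \<theta> \<bullet> velocity t \<theta> \<partial>flow t)) (at t)"
    using flow_weak[OF \<psi>]
  proof (rule eventually_mono, intro impI)
    fix t :: real
    assume a: "0 < t \<longrightarrow> ((\<lambda>s. \<integral>\<theta>. \<psi> \<theta> \<partial>flow s) has_real_derivative
        - (\<integral>\<theta>. gradient \<psi> \<theta> \<bullet> grad_delta_risk l P (flow t) \<theta> \<partial>flow t)) (at t)" and t: "0 < t"
    \<comment> \<open>The flow lives on the cone, where clamping is the identity and the field is
      the true negative gradient.\<close>
    have "(\<integral>\<theta>. gradient \<psi> \<theta> \<bullet> velocity t \<theta> \<partial>flow t) = (\<integral>\<theta>. - (gradient \<psi> \<theta> \<bullet> grad_delta_risk l P (flow t) \<theta>) \<partial>flow t)"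
      by (rule Bochner_Integration.integral_cong)
         (use t in \<open>auto simp: P2_space[OF flow_P2] velocity_cone grad_delta_risk_flow\<close>)
    then show "((\<lambda>s. \<integral>\<theta>. \<psi> \<theta> \<partial>flow s) has_real_derivative (\<integral>\<theta>. gradient \<psi> \<theta> \<bullet> velocity t \<theta> \<partial>flow t)) (at t)"
      using a t by simp
  qed
qed auto

text \<open>The flow measures live on the sigma-algebra restricted to the cone; the transport theory
  is set on the whole Euclidean space.\<close>

definition \<mu> :: "real \<Rightarrow> 'n param measure" where
  "\<mu> t = distr (flow t) borel (\<lambda>\<theta>. \<theta>)"

lemma \<mu>_integral:
  fixes f :: "'n param \<Rightarrow> real"
  assumes "0 \<le> t" "f \<in> borel_measurable borel"
  shows "(\<integral>\<theta>. f \<theta> \<partial>\<mu> t) = (\<integral>\<theta>. f \<theta> \<partial>flow t)"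
  unfolding \<mu>_def
  by (rule integral_distr[OF _ assms(2)]) (rule P2_measurable[OF flow_P2[OF assms(1)] measurable_ident_sets[OF refl]])

sublocale transport: weak_transport velocity lip_const \<mu>
proof (rule weak_transport.intro[OF field.lipschitz_field_axioms weak_transport_axioms.intro])
  show "prob_space (\<mu> t)" if "0 \<le> t" for t
    unfolding \<mu>_def
    by (rule prob_space.prob_space_distr[OF P2_prob[OF flow_P2[OF that]]])
       (rule P2_measurable[OF flow_P2[OF that] measurable_ident_sets[OF refl]])
  show "sets (\<mu> t) = sets borel" if "0 \<le> t" for t by (simp add: \<mu>_def)
next
  fix \<psi> :: "'n param \<Rightarrow> real" assume \<psi>: "test_function \<psi>"
  have "C_k 0 \<psi>" using \<psi> unfolding test_function_def by blast
  then have \<psi>m: "\<psi> \<in> borel_measurable borel" by (intro borel_measurable_continuous_onI) simp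
  show "((\<lambda>s. \<integral>x. \<psi> x \<partial>\<mu> s) has_real_derivative (\<integral>x. gradient \<psi> x \<bullet> velocity t x \<partial>\<mu> t)) (at t within {0..})"
    if t: "0 \<le> t" for t
    unfolding \<mu>_integral[OF t weak_rate_measurable[OF t \<psi>]]
    by (rule has_field_derivative_transform_within[OF flow_weak_derivative[OF \<psi> t], of 1])
       (use t \<mu>_integral[OF _ \<psi>m] in auto)
  show "continuous_on {0..} (\<lambda>t. \<integral>x. gradient \<psi> x \<bullet> velocity t x \<partial>\<mu> t)"
    by (rule continuous_on_eq[OF weak_rate_continuous[OF \<psi>]])
       (use \<mu>_integral[OF _ weak_rate_measurable[OF _ \<psi>]] in auto)
qed

lemma flow_integral:
  fixes f :: "'n param \<Rightarrow> real"
  assumes t: "0 \<le> t" and f: "f \<in> borel_measurable borel"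
  shows "(\<integral>\<theta>. f \<theta> \<partial>flow t) = (\<integral>\<theta>. f (field.flow_map t \<theta>) \<partial>flow 0)"
proof -
  have fm: "field.flow_map t \<in> borel_measurable borel"
    by (intro borel_measurable_continuous_onI field.flow_map_continuous t)
  have "(\<integral>\<theta>. f \<theta> \<partial>flow t) = (\<integral>\<theta>. f \<theta> \<partial>distr (\<mu> 0) borel (field.flow_map t))"
    using \<mu>_integral[OF t f] transport.distr_flow_map[OF t] by simp
  also have "\<dots> = (\<integral>\<theta>. f (field.flow_map t \<theta>) \<partial>\<mu> 0)"
    by (rule integral_distr) (use fm f in \<open>auto simp: \<mu>_def\<close>)
  also have "\<dots> = (\<integral>\<theta>. f (field.flow_map t \<theta>) \<partial>flow 0)"
    by (rule \<mu>_integral) (use measurable_compose[OF fm f] in auto)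
  finally show ?thesis .
qed

end

lemma at_within_atLeast: "a < s \<Longrightarrow> at s within {a..} = at (s::real)"
  by (rule at_within_nhd[of _ "{a<..}"]) auto

lemma norm_square_DERIV:
  fixes y :: "real \<Rightarrow> 'a::real_inner"
  assumes "(y has_vector_derivative y') (at t within S)"
  shows "((\<lambda>t. (norm (y t))\<^sup>2) has_real_derivative 2 * (y t \<bullet> y')) (at t within S)"
  unfolding power2_norm_eq_inner using assms
  by (auto intro!: derivative_eq_intros simp: has_vector_derivative_def has_field_derivative_def inner_commute algebra_simps)

lemma quadratic_remainder_has_derivative:
  fixes g :: "'a::real_inner \<Rightarrow> real"
  assumes le: "\<And>y. y \<in> S \<Longrightarrow> \<bar>g y - g x - V \<bullet> (y - x)\<bar> \<le> C * (norm (y - x))\<^sup>2"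
  shows "(g has_derivative (\<lambda>h. V \<bullet> h)) (at x within S)"
  unfolding has_derivative_within_alt
proof (intro conjI allI impI)
  show "bounded_linear (\<lambda>h. V \<bullet> h)" by (rule bounded_linear_inner_right)
  fix e :: real assume e: "0 < e"
  show "\<exists>d>0. \<forall>y\<in>S. norm (y - x) < d \<longrightarrow> norm (g y - g x - V \<bullet> (y - x)) \<le> e * norm (y - x)"
  proof (intro exI[of _ "e / (\<bar>C\<bar> + 1)"] conjI ballI impI)
    show "0 < e / (\<bar>C\<bar> + 1)" using e by simp
    fix y assume y: "y \<in> S" "norm (y - x) < e / (\<bar>C\<bar> + 1)"
    have "norm (g y - g x - V \<bullet> (y - x)) \<le> C * (norm (y - x))\<^sup>2" using le[OF y(1)] by simp
    also have "\<dots> \<le> (\<bar>C\<bar> + 1) * norm (y - x) * norm (y - x)"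
      by (simp add: power2_eq_square mult_right_mono mult.assoc)
    also have "\<dots> \<le> e * norm (y - x)"
      using y(2) by (intro mult_right_mono) (auto simp: pos_less_divide_eq mult.commute less_imp_le)
    finally show "norm (g y - g x - V \<bullet> (y - x)) \<le> e * norm (y - x)" .
  qed
qed

text \<open>The remainder is needed along the curve only, so a function controlled merely on the
  cone can be differentiated along trajectories that stay there.\<close>

lemma quadratic_remainder_curve_DERIV:
  fixes g :: "'a::real_inner \<Rightarrow> real" and x :: "real \<Rightarrow> 'a"
  assumes x: "(x has_vector_derivative v) (at t within S)"
    and le: "\<And>s. s \<in> S \<Longrightarrow> \<bar>g (x s) - g (x t) - V \<bullet> (x s - x t)\<bar> \<le> C * (norm (x s - x t))\<^sup>2"
  shows "((\<lambda>s. g (x s)) has_real_derivative V \<bullet> v) (at t within S)"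
proof -
  have "(g has_derivative (\<lambda>h. V \<bullet> h)) (at (x t) within x ` S)"
    by (rule quadratic_remainder_has_derivative) (use le in auto)
  from has_derivative_in_compose[OF x[unfolded has_vector_derivative_def] this]
  show ?thesis by (simp add: has_field_derivative_def mult.commute[of "V \<bullet> v"] mult_commute_abs)
qed

section \<open>Trajectories in the cone, second moment and decay of the risk\<close>

context flow_setting
begin

abbreviation X :: "real \<Rightarrow> 'n param \<Rightarrow> 'n param" where
  "X \<equiv> field.flow_map"

lemma velocity_scale: "0 \<le> r \<Longrightarrow> velocity t (r *\<^sub>R \<theta>) = r *\<^sub>R velocity t \<theta>"
  by (simp add: velocity_def clamp_cone_scale pgrad_scale)

lemma X_scale:
  assumes r: "0 \<le> r" and t: "0 \<le> t"
  shows "X t (r *\<^sub>R \<theta>) = r *\<^sub>R X t \<theta>"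
proof -
  have "field.solution t (\<lambda>s. r *\<^sub>R X s \<theta>)" unfolding field.solution_def
  proof
    fix s assume s: "s \<in> {0..t}"
    have "((\<lambda>s. X s \<theta>) has_vector_derivative velocity s (X s \<theta>)) (at s within {0..t})"
      using field.flow_map_solution[of t \<theta>] s by (auto simp: field.solution_def)
    then have "((\<lambda>s. r *\<^sub>R X s \<theta>) has_vector_derivative r *\<^sub>R velocity s (X s \<theta>)) (at s within {0..t})"
      by (auto intro!: derivative_eq_intros)
    then show "((\<lambda>s. r *\<^sub>R X s \<theta>) has_vector_derivative velocity s (r *\<^sub>R X s \<theta>)) (at s within {0..t})"
      by (simp add: velocity_scale[OF r])
  qed
  from field.flow_map_eq[OF this t order_refl] show ?thesis by simp
qed

lemma X_le: "0 \<le> t \<Longrightarrow> norm (X t \<theta>) \<le> exp (lip_const * t) * norm \<theta>"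
  using field.flow_map_lipschitz[of t \<theta> 0] X_scale[of 0 t 0] by simp

text \<open>The imbalance of the two layers, the classical conserved quantity of gradient flow for
  ReLU networks. The cone is its nonpositive set, so conservation means invariance.\<close>

definition defect :: "'n param \<Rightarrow> real" where
  "defect \<theta> = (fst \<theta>)\<^sup>2 - (norm (snd \<theta>))\<^sup>2"

lemma closure_Theta_defect: "\<theta> \<in> closure Theta \<longleftrightarrow> defect \<theta> \<le> 0"
  using abs_le_square_iff[of "fst \<theta>" "norm (snd \<theta>)"] by (auto simp: closure_Theta defect_def)

lemma Theta_defect: "\<theta> \<in> Theta \<longleftrightarrow> defect \<theta> < 0"
  using abs_le_square_iff[of "norm (snd \<theta>)" "fst \<theta>"] by (auto simp: Theta_eq defect_def not_le[symmetric])

text \<open>\<open>cone_defect_le\<close> bounds the rate by the positive part, as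
  \<open>constant_sign_conserved\<close> requires. The known time \<open>t0\<close> is arbitrary, so
  the open cone is invariant backwards in time too.\<close>

lemma defect_conserved:
  assumes x: "field.solution T x" and t0: "t0 \<in> {0..T}" "defect (x t0) \<le> 0" and t: "t \<in> {0..T}"
  shows "defect (x t) = defect (x t0)"
proof (rule constant_sign_conserved[where w = "\<lambda>t. defect (x t)"])
  fix s assume s: "s \<in> {0..T}"
  let ?v = "velocity s (x s)"
  have d: "(x has_derivative (\<lambda>h. h *\<^sub>R ?v)) (at s within {0..T})"
    using x s by (auto simp: field.solution_def has_vector_derivative_def)
  have "((\<lambda>t. fst (x t)) has_real_derivative fst ?v) (at s within {0..T})"
    using has_derivative_fst[OF d] by (simp add: has_field_derivative_def mult_commute_abs)
  then have 1: "((\<lambda>t. (fst (x t))\<^sup>2) has_real_derivative 2 * fst (x s) * fst ?v) (at s within {0..T})"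
    by (auto intro!: derivative_eq_intros)
  have "((\<lambda>t. snd (x t)) has_vector_derivative snd ?v) (at s within {0..T})"
    using has_derivative_snd[OF d] by (simp add: has_vector_derivative_def)
  then have 2: "((\<lambda>t. (norm (snd (x t)))\<^sup>2) has_real_derivative 2 * (snd (x s) \<bullet> snd ?v)) (at s within {0..T})"
    by (rule norm_square_DERIV)
  show "((\<lambda>t. defect (x t)) has_real_derivative (2 * fst (x s) * fst ?v - 2 * (snd (x s) \<bullet> snd ?v))) (at s within {0..T})"
    unfolding defect_def by (rule DERIV_diff[OF 1 2])
  show "\<bar>2 * fst (x s) * fst ?v - 2 * (snd (x s) \<bullet> snd ?v)\<bar> \<le> (2 * loss_const * moment) * max (defect (x s)) 0"
    unfolding velocity_def defect_def by (rule cone_defect_le[OF residual_\<rho>]) (use s in simp)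
qed (use t0 t in auto)

lemma X_defect:
  assumes "\<theta> \<in> closure Theta" "0 \<le> t"
  shows "defect (X t \<theta>) = defect \<theta>"
  using defect_conserved[OF field.flow_map_solution[of t \<theta>], of 0 t] assms by (simp add: closure_Theta_defect)

lemma X_closure_Theta: "\<theta> \<in> closure Theta \<Longrightarrow> 0 \<le> t \<Longrightarrow> X t \<theta> \<in> closure Theta"
  using X_defect by (simp add: closure_Theta_defect)

lemma X_vector_derivative:
  assumes "\<theta> \<in> closure Theta" "0 \<le> t"
  shows "((\<lambda>s. X s \<theta>) has_vector_derivative - pgrad (\<rho> t) (X t \<theta>)) (at t within {0..})"
  using field.flow_map_has_derivative[OF assms(2), of \<theta>] by (simp add: velocity_cone X_closure_Theta assms)

text \<open>Along the flow a function with quadratic Taylor remainder can be integrated against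
  \<open>flow t\<close> and differentiated in time, without any test function.\<close>

lemma flow_integral_DERIV:
  fixes g :: "'n param \<Rightarrow> real"
  assumes gm: "(\<lambda>\<theta>. g (clamp_cone \<theta>)) \<in> borel_measurable borel"
    and Vm: "(\<lambda>\<theta>. V (clamp_cone \<theta>)) \<in> borel_measurable borel"
    and rem: "\<And>\<theta> \<theta>'. \<theta> \<in> closure Theta \<Longrightarrow> \<theta>' \<in> closure Theta \<Longrightarrow> \<bar>g \<theta>' - g \<theta> - V \<theta> \<bullet> (\<theta>' - \<theta>)\<bar> \<le> C * (norm (\<theta>' - \<theta>))\<^sup>2"
    and Vle: "\<And>\<theta>. \<theta> \<in> closure Theta \<Longrightarrow> norm (V \<theta>) \<le> A * norm \<theta>"
    and gle: "\<And>\<theta>. \<theta> \<in> closure Theta \<Longrightarrow> \<bar>g \<theta>\<bar> \<le> A' * (norm \<theta>)\<^sup>2"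
    and t: "0 \<le> t" and A: "0 \<le> A"
  shows "((\<lambda>s. \<integral>\<theta>. g \<theta> \<partial>flow s) has_real_derivative (\<integral>\<theta>. V \<theta> \<bullet> (- pgrad (\<rho> t) \<theta>) \<partial>flow t)) (at t within {0..})"
proof -
  let ?u' = "\<lambda>t \<theta>. V \<theta> \<bullet> (- pgrad (\<rho> t) \<theta>)"
  have sp: "space (flow s) = closure Theta" if "0 \<le> s" for s using P2_space[OF flow_P2[OF that]] .
  have eq: "(\<integral>\<theta>. g \<theta> \<partial>flow s) = (\<integral>\<theta>. g (clamp_cone (X s \<theta>)) \<partial>flow 0)" if s: "0 \<le> s" for s
  proof -
    have "(\<integral>\<theta>. g \<theta> \<partial>flow s) = (\<integral>\<theta>. g (clamp_cone \<theta>) \<partial>flow s)"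
      by (rule Bochner_Integration.integral_cong) (auto simp: sp s clamp_cone_id)
    then show ?thesis using flow_integral[OF s gm] by simp
  qed
  have u'm: "(\<lambda>\<theta>. ?u' t (clamp_cone \<theta>)) \<in> borel_measurable borel"
    using Vm borel_measurable_continuous_onI[OF continuous_pot_cone[OF residual_\<rho>[OF t]]] by simp
  have eq': "(\<integral>\<theta>. ?u' t \<theta> \<partial>flow t) = (\<integral>\<theta>. ?u' t (clamp_cone (X t \<theta>)) \<partial>flow 0)"
  proof -
    have "(\<integral>\<theta>. ?u' t \<theta> \<partial>flow t) = (\<integral>\<theta>. ?u' t (clamp_cone \<theta>) \<partial>flow t)"
      by (rule Bochner_Integration.integral_cong) (auto simp: sp t clamp_cone_id)
    then show ?thesis using flow_integral[OF t u'm] by simp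
  qed
  have Xm: "X s \<in> borel_measurable borel" if "0 \<le> s" for s
    by (intro borel_measurable_continuous_onI field.flow_map_continuous that)
  \<comment> \<open>Growth of trajectories up to time \<open>t + 1\<close>; the margin 1 is the
    \<open>\<delta>\<close> with which the integral is differentiated below.\<close>
  define E where "E = exp (lip_const * (t + 1))"
  have XE: "norm (X s \<theta>) \<le> E * norm \<theta>" if "0 \<le> s" "s \<le> t + 1" for s \<theta>
  proof -
    have "norm (X s \<theta>) \<le> exp (lip_const * s) * norm \<theta>" by (rule X_le[OF that(1)])
    also have "\<dots> \<le> E * norm \<theta>" unfolding E_def
      using that field.L_pos by (intro mult_right_mono) auto
    finally show ?thesis .
  qed
  have der: "((\<lambda>s. g (clamp_cone (X s \<theta>))) has_real_derivative ?u' s (X s \<theta>)) (at s within {0..})"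
    if \<theta>: "\<theta> \<in> closure Theta" and s: "0 \<le> s" for s \<theta>
  proof -
    have "((\<lambda>s. g (X s \<theta>)) has_real_derivative ?u' s (X s \<theta>)) (at s within {0..})"
      by (rule quadratic_remainder_curve_DERIV[OF X_vector_derivative[OF \<theta> s], where C = C])
         (use rem X_closure_Theta[OF \<theta>] s in auto)
    then show ?thesis
      by (rule has_field_derivative_transform_within[where d=1]) (use s in \<open>auto simp: clamp_cone_id X_closure_Theta \<theta>\<close>)
  qed
  have c0: "0 \<le> loss_const * moment" using loss_const_nonneg moment_nonneg by simp
  have "((\<lambda>s. \<integral>\<theta>. g (clamp_cone (X s \<theta>)) \<partial>flow 0) has_real_derivative (\<integral>\<theta>. ?u' t (clamp_cone (X t \<theta>)) \<partial>flow 0)) (at t within {0..})"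
  \<comment> \<open>All integrals are pulled back to the fixed measure \<open>flow 0\<close>, so
    that only the integrand depends on time. Its rate is quadratic in the parameter and thus
    dominated by the second moment.\<close>
  proof (rule has_real_derivative_lebesgue_integral[where B = "\<lambda>\<theta>. A * (loss_const * moment) * E\<^sup>2 * (norm \<theta>)\<^sup>2" and \<delta> = 1])
    show "integrable (flow 0) (\<lambda>\<theta>. g (clamp_cone (X s \<theta>)))" if "s \<in> {0..}" for s
    proof (rule P2_integrable_quadratic[OF flow_P2, where A = 0 and B = "\<bar>A'\<bar> * (exp (lip_const * s))\<^sup>2"])
      have s: "0 \<le> s" using that by simp
      show "(\<lambda>\<theta>. g (clamp_cone (X s \<theta>))) \<in> borel_measurable (flow 0)"
        by (rule P2_measurable[OF flow_P2 measurable_compose[OF Xm[OF s] gm]]) simp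
      fix \<theta> :: "'n param" assume \<theta>: "\<theta> \<in> closure Theta"
      have "\<bar>g (clamp_cone (X s \<theta>))\<bar> \<le> A' * (norm (X s \<theta>))\<^sup>2"
        using gle[OF X_closure_Theta[OF \<theta> s]] by (simp add: clamp_cone_id X_closure_Theta \<theta> s)
      also have "\<dots> \<le> \<bar>A'\<bar> * (exp (lip_const * s) * norm \<theta>)\<^sup>2"
        by (intro mult_mono power_mono X_le s) auto
      finally show "\<bar>g (clamp_cone (X s \<theta>))\<bar> \<le> 0 + \<bar>A'\<bar> * (exp (lip_const * s))\<^sup>2 * (norm \<theta>)\<^sup>2"
        by (simp add: power_mult_distrib mult.assoc)
    qed simp
    show "((\<lambda>s. g (clamp_cone (X s \<theta>))) has_real_derivative ?u' t (clamp_cone (X t \<theta>))) (at t within {0..})" if "\<theta> \<in> space (flow 0)" for \<theta>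
      using der[of \<theta> t] that t by (simp add: sp clamp_cone_id X_closure_Theta)
    show "\<bar>g (clamp_cone (X s \<theta>)) - g (clamp_cone (X t \<theta>))\<bar> \<le> \<bar>s - t\<bar> * (A * (loss_const * moment) * E\<^sup>2 * (norm \<theta>)\<^sup>2)"
      if s: "s \<in> {0..}" "\<bar>s - t\<bar> < 1" and "\<theta> \<in> space (flow 0)" for s \<theta>
    proof -
      have \<theta>: "\<theta> \<in> closure Theta" using that(3) by (simp add: sp)
      have "norm (g (clamp_cone (X s \<theta>)) - g (clamp_cone (X t \<theta>))) \<le> (A * (loss_const * moment) * E\<^sup>2 * (norm \<theta>)\<^sup>2) * norm (s - t)"
      proof (rule field_differentiable_bound[where S = "{0..t+1}" and f' = "\<lambda>s. ?u' s (X s \<theta>)"])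
        fix r assume r: "r \<in> {0..t+1}"
        show "((\<lambda>s. g (clamp_cone (X s \<theta>))) has_field_derivative ?u' r (X r \<theta>)) (at r within {0..t+1})"
          using der[OF \<theta>, of r] r by (auto intro: has_field_derivative_subset)
        have "norm (?u' r (X r \<theta>)) \<le> norm (V (X r \<theta>)) * norm (pgrad (\<rho> r) (X r \<theta>))"
          using Cauchy_Schwarz_ineq2[of "V (X r \<theta>)" "- pgrad (\<rho> r) (X r \<theta>)"] by simp
        also have "\<dots> \<le> (A * norm (X r \<theta>)) * (loss_const * moment * norm (X r \<theta>))"
          using r A by (intro mult_mono Vle X_closure_Theta \<theta> pgrad_le residual_\<rho>) auto
        also have "\<dots> = A * (loss_const * moment) * (norm (X r \<theta>))\<^sup>2" by (simp add: power2_eq_square)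
        also have "\<dots> \<le> A * (loss_const * moment) * (E * norm \<theta>)\<^sup>2"
          using r A c0 by (intro mult_left_mono power_mono XE) auto
        finally show "norm (?u' r (X r \<theta>)) \<le> A * (loss_const * moment) * E\<^sup>2 * (norm \<theta>)\<^sup>2"
          by (simp add: power_mult_distrib mult.assoc)
      qed (use s t in \<open>auto simp: convex_real_interval\<close>)
      then show ?thesis by (simp add: mult.commute)
    qed
    show "integrable (flow 0) (\<lambda>\<theta>. A * (loss_const * moment) * E\<^sup>2 * (norm \<theta>)\<^sup>2)"
      using P2_integrable[OF flow_P2[of 0]] by simp
    show "(\<lambda>\<theta>. ?u' t (clamp_cone (X t \<theta>))) \<in> borel_measurable (flow 0)"
      by (rule P2_measurable[OF flow_P2 measurable_compose[OF Xm[OF t] u'm]]) simp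
  qed (use t in auto)
  then show ?thesis unfolding eq'
    by (rule has_field_derivative_transform_within[where d=1]) (use t eq in auto)
qed

lemma N_DERIV:
  assumes t: "0 \<le> t"
  shows "(N has_real_derivative - 4 * (\<integral>\<theta>. delta_risk l P (flow t) \<theta> \<partial>flow t)) (at t within {0..})"
proof -
  have "((\<lambda>s. \<integral>\<theta>. (norm \<theta>)\<^sup>2 \<partial>flow s) has_real_derivative (\<integral>\<theta>. (2 *\<^sub>R \<theta>) \<bullet> (- pgrad (\<rho> t) \<theta>) \<partial>flow t)) (at t within {0..})"
  proof (rule flow_integral_DERIV[where C = 1 and A = 2 and A' = 1])
    show "(\<lambda>\<theta>::'n param. (norm (clamp_cone \<theta>))\<^sup>2) \<in> borel_measurable borel"
      by (intro borel_measurable_continuous_onI continuous_intros continuous_clamp_cone)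
    show "(\<lambda>\<theta>::'n param. 2 *\<^sub>R clamp_cone \<theta>) \<in> borel_measurable borel"
      by (intro borel_measurable_continuous_onI continuous_intros continuous_clamp_cone)
    show "\<bar>(norm \<theta>')\<^sup>2 - (norm \<theta>)\<^sup>2 - (2 *\<^sub>R \<theta>) \<bullet> (\<theta>' - \<theta>)\<bar> \<le> 1 * (norm (\<theta>' - \<theta>))\<^sup>2" for \<theta> \<theta>' :: "'n param"
    proof -
      have "(norm \<theta>')\<^sup>2 - (norm \<theta>)\<^sup>2 - (2 *\<^sub>R \<theta>) \<bullet> (\<theta>' - \<theta>) = (norm (\<theta>' - \<theta>))\<^sup>2"
        by (simp add: power2_norm_eq_inner inner_diff_left inner_diff_right inner_commute)
      then show ?thesis by simp
    qed
  qed (use t in auto)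
  \<comment> \<open>The 4 is the 2 of the squared norm times the 2 of Euler's identity for degree
    two.\<close>
  moreover have "(2 *\<^sub>R \<theta>) \<bullet> (- pgrad (\<rho> t) \<theta>) = - 4 * pot (\<rho> t) \<theta>" for \<theta>
    using inner_pgrad(1)[OF residual_\<rho>[OF t], of \<theta>] by simp
  ultimately show ?thesis by (simp add: second_moment_def[abs_def] delta_risk_flow)
qed

lemma N_growth:
  assumes t: "0 \<le> t"
  shows "N t \<le> N 0 + 4 * risk l P (atomic (return_pmf 0)) * t"
proof -
  let ?R = "risk l P (atomic (return_pmf 0))"
  have d: "((\<lambda>s. N s - 4 * ?R * s) has_real_derivative - 4 * (\<integral>\<theta>. delta_risk l P (flow s) \<theta> \<partial>flow s) - 4 * ?R) (at s within {0..})"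
    if "0 \<le> s" for s
    using N_DERIV[OF that] by (auto intro!: derivative_eq_intros)
  have "N t - 4 * ?R * t \<le> N 0 - 4 * ?R * 0"
  proof (rule DERIV_nonpos_imp_decreasing_open[OF t, where f = "\<lambda>s. N s - 4 * ?R * s"])
    fix s assume s: "0 < s" "s < t"
    have "at s within {0..} = at s" by (rule at_within_atLeast[OF s(1)])
    then have "((\<lambda>s. N s - 4 * ?R * s) has_real_derivative - 4 * (\<integral>\<theta>. delta_risk l P (flow s) \<theta> \<partial>flow s) - 4 * ?R) (at s)"
      using d[of s] s by simp
    moreover have "- 4 * (\<integral>\<theta>. delta_risk l P (flow s) \<theta> \<partial>flow s) - 4 * ?R \<le> 0"
      using integral_delta_risk_ge[OF flow_P2[of s]] s by simp
    ultimately show "\<exists>y. ((\<lambda>s. N s - 4 * ?R * s) has_real_derivative y) (at s) \<and> y \<le> 0" by blast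
  next
    have "continuous_on {0..} (\<lambda>s. N s - 4 * ?R * s)"
      unfolding continuous_on_eq_continuous_within using DERIV_continuous[OF d] by auto
    then show "continuous_on {0..t} (\<lambda>s. N s - 4 * ?R * s)" by (rule continuous_on_subset) auto
  qed
  then show ?thesis by simp
qed

lemma risk_continuous:
  assumes a: "0 \<le> a"
  shows "continuous_on {a..b} (\<lambda>t. risk l P (flow t))"
  unfolding continuous_on_sequentially comp_def
proof (intro ballI allI impI, elim conjE)
  fix u :: "nat \<Rightarrow> real" and t assume t: "t \<in> {a..b}" and u: "\<forall>n. u n \<in> {a..b}" "u \<longlonglongrightarrow> t"
  obtain B where B: "B \<ge> 0" "\<And>t. t \<in> {0..b+1} \<Longrightarrow> N t \<le> B" using N_bounded[of "b+1"] t a by auto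
  have P: "flow (u n) \<in> P2" "flow t \<in> P2" for n using u t a by (auto intro!: flow_P2 intro: order_trans)
  show "(\<lambda>n. risk l P (flow (u n))) \<longlonglongrightarrow> risk l P (flow t)"
    unfolding risk_eq
  proof (rule integral_dominated_convergence[where w = "\<lambda>p. l 0 (snd p) + loss_const * (B * q p)"])
    show "(\<lambda>p. l (network (flow t) (fst p)) (snd p)) \<in> borel_measurable P"
      by (rule borel_measurable_integrable[OF integrable_loss[OF network_measurable[OF P(2)] integrable_network[OF P(2)]]])
    show "(\<lambda>p. l (network (flow (u n)) (fst p)) (snd p)) \<in> borel_measurable P" for n
      by (rule borel_measurable_integrable[OF integrable_loss[OF network_measurable[OF P(1)] integrable_network[OF P(1)]]])
    show "integrable P (\<lambda>p. l 0 (snd p) + loss_const * (B * q p))"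
      using integrable_loss_0 integrable_q by (auto simp: case_prod_beta')
    show "AE p in P. (\<lambda>n. l (network (flow (u n)) (fst p)) (snd p)) \<longlonglongrightarrow> l (network (flow t) (fst p)) (snd p)"
    proof (rule AE_I2)
      fix p :: "(real ^ 'n) \<times> real"
      have "(\<lambda>n. network (flow (u n)) (fst p)) \<longlonglongrightarrow> network (flow t) (fst p)"
        using network_continuous[of "fst p"] u t a unfolding continuous_on_sequentially comp_def
        by (auto intro: order_trans)
      moreover have "isCont (\<lambda>y. l y (snd p)) y" for y by (rule DERIV_isCont[OF loss_DERIV])
      ultimately show "(\<lambda>n. l (network (flow (u n)) (fst p)) (snd p)) \<longlonglongrightarrow> l (network (flow t) (fst p)) (snd p)"
        using isCont_tendsto_compose by blast
    qed
    show "AE p in P. norm (l (network (flow (u n)) (fst p)) (snd p)) \<le> l 0 (snd p) + loss_const * (B * q p)" for n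
    proof (rule AE_I2)
      fix p :: "(real ^ 'n) \<times> real"
      have un: "u n \<in> {0..b+1}" using u(1)[rule_format, of n] a by auto
      have "\<bar>network (flow (u n)) (fst p)\<bar> \<le> N (u n) * q p" by (rule network_le[OF P(1)])
      also have "\<dots> \<le> B * q p" using B(2)[OF un] by (intro mult_right_mono) auto
      finally have "loss_const * \<bar>network (flow (u n)) (fst p)\<bar> \<le> loss_const * (B * q p)"
        using loss_const_nonneg by (rule mult_left_mono)
      then show "norm (l (network (flow (u n)) (fst p)) (snd p)) \<le> l 0 (snd p) + loss_const * (B * q p)"
        using loss_lipschitz[of "network (flow (u n)) (fst p)" "snd p" 0] loss_nonneg[of "network (flow (u n)) (fst p)" "snd p"]
        by simp
    qed
  qed
qed

text \<open>By convexity the increase of the risk from \<open>s\<close> to \<open>t\<close> is at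
  most the increase of the integral of the potential frozen at \<open>t\<close>. That integral has
  derivative minus the mean squared gradient at \<open>t\<close>, which bounds left difference
  quotients and needs no derivative of the risk.\<close>

lemma risk_antimono:
  assumes ab: "0 \<le> a" "a \<le> b"
  shows "risk l P (flow b) \<le> risk l P (flow a)"
proof (rule nonincreasing_left_derivative[OF risk_continuous[OF ab(1)] ab(2)])
  fix t e :: real assume at: "a < t" "t \<le> b" and e: "0 < e"
  have t: "0 \<le> t" using at ab by simp
  let ?h = "\<lambda>s. \<integral>\<theta>. pot (\<rho> t) \<theta> \<partial>flow s"
  let ?D = "\<integral>\<theta>. pgrad (\<rho> t) \<theta> \<bullet> (- pgrad (\<rho> t) \<theta>) \<partial>flow t"
  note r = residual_\<rho>[OF t]
  have "(?h has_real_derivative ?D) (at t within {0..})"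
  proof (rule flow_integral_DERIV[where V = "pgrad (\<rho> t)" and C = "loss_const * grad_lipschitz_const"
        and A = "loss_const * moment" and A' = "loss_const * moment"])
    show "(\<lambda>\<theta>. pot (\<rho> t) (clamp_cone \<theta>)) \<in> borel_measurable borel" by (rule pot_clamp_measurable[OF r])
    show "(\<lambda>\<theta>. pgrad (\<rho> t) (clamp_cone \<theta>)) \<in> borel_measurable borel"
      by (rule borel_measurable_continuous_onI[OF continuous_pot_cone[OF r]])
  qed (use t pot_remainder[OF r] pgrad_le[OF r] pot_le[OF r] loss_const_nonneg moment_nonneg in auto)
  then have "\<forall>e>0. \<exists>d>0. \<forall>s\<in>{0..}. \<bar>s - t\<bar> < d \<longrightarrow> \<bar>?h s - ?h t - ?D * (s - t)\<bar> \<le> e * \<bar>s - t\<bar>"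
    unfolding has_field_derivative_def has_derivative_within_alt real_norm_def by (elim conjE)
  from this[rule_format, OF e] obtain d where d: "d > 0" "\<And>s. s \<in> {0..} \<Longrightarrow> \<bar>s - t\<bar> < d \<Longrightarrow> \<bar>?h s - ?h t - ?D * (s - t)\<bar> \<le> e * \<bar>s - t\<bar>"
    by blast
  have D0: "?D \<le> 0"
  proof -
    have "0 \<le> (\<integral>\<theta>. pgrad (\<rho> t) \<theta> \<bullet> pgrad (\<rho> t) \<theta> \<partial>flow t)" by (intro Bochner_Integration.integral_nonneg) simp
    then show ?thesis by simp
  qed
  show "\<exists>d>0. \<forall>s. a \<le> s \<longrightarrow> t - d < s \<longrightarrow> s < t \<longrightarrow> risk l P (flow t) - risk l P (flow s) \<le> e * (t - s)"
  proof (intro exI[of _ d] conjI d(1) allI impI)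
    fix s assume s: "a \<le> s" "t - d < s" "s < t"
    have s0: "0 \<le> s" using s ab by simp
    have "risk l P (flow t) - risk l P (flow s) \<le> ?h t - ?h s"
      using risk_tangent[OF flow_P2[OF t] flow_P2[OF s0]] unfolding delta_risk_flow by linarith
    also have "\<dots> \<le> e * (t - s)"
    proof -
      have st: "\<bar>s - t\<bar> = t - s" using s by simp
      have "\<bar>?h s - ?h t - ?D * (s - t)\<bar> \<le> e * (t - s)" using d(2)[of s] s s0 st by simp
      moreover have "?D * (s - t) \<ge> 0" using D0 s by (intro mult_nonpos_nonpos) auto
      ultimately show ?thesis by linarith
    qed
    finally show "risk l P (flow t) - risk l P (flow s) \<le> e * (t - s)" .
  qed
qed

end

section \<open>Limits of potentials\<close>

lemma locally_uniform_limit_compact: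
  assumes f: "locally_uniform_limit S f l F" and K: "compact K" "K \<subseteq> S"
  shows "uniform_limit K f l F"
proof -
  have "\<forall>x\<in>K. \<exists>e>0. uniform_limit (S \<inter> ball x e) f l F"
    using f K(2) unfolding locally_uniform_limit_def by blast
  then obtain e where e: "\<And>x. x \<in> K \<Longrightarrow> 0 < e x \<and> uniform_limit (S \<inter> ball x (e x)) f l F" by metis
  have "K \<subseteq> (\<Union>x\<in>K. ball x (e x))" using e by force
  then obtain I where I: "I \<subseteq> K" "finite I" "K \<subseteq> (\<Union>x\<in>I. ball x (e x))"
    using compactE_image[OF K(1), of K "\<lambda>x. ball x (e x)"] by auto
  have "uniform_limit (\<Union>x\<in>I. S \<inter> ball x (e x)) f l F"
    by (rule uniform_limit_on_UNION[OF I(2)]) (use e I(1) in blast)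
  then show ?thesis by (rule uniform_limit_on_subset) (use I(3) K(2) in auto)
qed

lemma locally_uniform_limitI_cballs:
  fixes S :: "'a::real_normed_vector set"
  assumes "\<And>R. 0 < R \<Longrightarrow> uniform_limit (S \<inter> cball 0 R) f l F"
  shows "locally_uniform_limit S f l F"
  unfolding locally_uniform_limit_def
proof
  fix x assume "x \<in> S"
  have "uniform_limit (S \<inter> ball x 1) f l F"
  proof (rule uniform_limit_on_subset[OF assms[of "norm x + 1"]])
    show "S \<inter> ball x 1 \<subseteq> S \<inter> cball 0 (norm x + 1)"
    proof
      fix y assume "y \<in> S \<inter> ball x 1"
      then have "y \<in> S" "norm (y - x) < 1" by (auto simp: dist_norm norm_minus_commute)
      then show "y \<in> S \<inter> cball 0 (norm x + 1)" using norm_triangle_ineq2[of y x] by auto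
    qed
  qed (simp add: add_nonneg_pos)
  then show "\<exists>e>0. uniform_limit (S \<inter> ball x e) f l F" by (intro exI[of _ 1]) simp
qed

text \<open>The differential inequality is available only while \<open>p\<close> is nonnegative, so
  positivity is propagated first: before a first zero \<open>p\<close> would be nondecreasing from a
  positive value.\<close>

lemma exponential_growth:
  fixes p :: "real \<Rightarrow> real"
  assumes d: "\<And>t. T \<le> t \<Longrightarrow> (p has_real_derivative p' t) (at t within {T..})"
    and le: "\<And>t. T \<le> t \<Longrightarrow> 0 \<le> p t \<Longrightarrow> \<kappa> * p t \<le> p' t"
    and \<kappa>: "0 \<le> \<kappa>" and pT: "0 < p T" and t: "T \<le> t"
  shows "p T * exp (\<kappa> * (t - T)) \<le> p t"
proof -
  have dat: "(p has_real_derivative p' s) (at s)" if "T < s" for s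
    using d[of s] that at_within_atLeast[OF that] by simp
  have pc: "continuous_on {T..} p"
    unfolding continuous_on_eq_continuous_within using DERIV_continuous[OF d] by auto
  have pos: "0 < p t" if t: "T \<le> t" for t
  proof (rule ccontr)
    assume neg: "\<not> 0 < p t"
    define S where "S = {s \<in> {T..t}. p s \<le> 0}"
    have "closed S" unfolding S_def
      using continuous_on_closed_Collect_le[OF continuous_on_subset[OF pc] continuous_on_const, of "{T..t}" 0] by auto
    moreover have "bounded S" by (rule bounded_subset[of "{T..t}"]) (auto simp: S_def)
    ultimately have "compact S" by (simp add: compact_eq_bounded_closed)
    moreover have "S \<noteq> {}" using neg t by (auto simp: S_def)
    ultimately obtain s where s: "s \<in> S" "\<And>r. r \<in> S \<Longrightarrow> s \<le> r" using compact_attains_inf by metis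
    have "p T \<le> p s"
    proof (rule DERIV_nonneg_imp_increasing_open[where f = p])
      show "T \<le> s" using s by (auto simp: S_def)
      fix r assume r: "T < r" "r < s"
      then have "r \<notin> S" using s(2)[of r] by auto
      then have "0 \<le> p r" using r s(1) by (auto simp: S_def)
      then have "0 \<le> p' r" using le[of r] r mult_nonneg_nonneg[OF \<kappa>, of "p r"] by linarith
      then show "\<exists>y. (p has_real_derivative y) (at r) \<and> 0 \<le> y" using dat[OF r(1)] by blast
    qed (use continuous_on_subset[OF pc] in auto)
    then show False using s(1) pT by (auto simp: S_def)
  qed
  have "exp (- \<kappa> * T) * p T \<le> exp (- \<kappa> * t) * p t"
  proof (rule DERIV_nonneg_imp_increasing_open[where f = "\<lambda>s. exp (- \<kappa> * s) * p s", OF t])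
    fix r assume r: "T < r" "r < t"
    have "((\<lambda>s. exp (- \<kappa> * s) * p s) has_real_derivative exp (- \<kappa> * r) * (p' r - \<kappa> * p r)) (at r)"
      using dat[OF r(1)] by (auto intro!: derivative_eq_intros simp: algebra_simps)
    moreover have "0 \<le> exp (- \<kappa> * r) * (p' r - \<kappa> * p r)"
      using le[of r] pos[of r] r by (intro mult_nonneg_nonneg) auto
    ultimately show "\<exists>y. ((\<lambda>s. exp (- \<kappa> * s) * p s) has_real_derivative y) (at r) \<and> 0 \<le> y" by blast
  qed (intro continuous_intros continuous_on_subset[OF pc], auto)
  then have "exp (\<kappa> * t) * (exp (- \<kappa> * T) * p T) \<le> exp (\<kappa> * t) * (exp (- \<kappa> * t) * p t)"
    by (intro mult_left_mono) auto
  moreover have "exp (\<kappa> * t) * (exp (- \<kappa> * t) * p t) = p t"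
    by (simp only: mult.assoc[symmetric] mult_exp_exp) simp
  moreover have "exp (\<kappa> * t) * (exp (- \<kappa> * T) * p T) = p T * exp (\<kappa> * (t - T))"
    by (simp only: mult.assoc[symmetric] mult_exp_exp mult.commute[of "p T"]) (simp add: right_diff_distrib)
  ultimately show ?thesis by linarith
qed

lemma exp_not_le_affine:
  fixes a \<kappa> b d :: real
  assumes "0 < a" "0 < \<kappa>"
  shows "\<exists>y\<ge>0. b + d * y < a * exp (\<kappa> * y)"
proof -
  \<comment> \<open>Coefficient of the quadratic term of the exponential series.\<close>
  define c where "c = a * \<kappa>\<^sup>2 / 2"
  have c: "0 < c" using assms by (simp add: c_def)
  \<comment> \<open>Chosen so that \<open>c * y\<close> equals \<bar>b\<bar> + \<bar>d\<bar> + c;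
    the affine part is then below \<open>c * y * y\<close>.\<close>
  define y where "y = (\<bar>b\<bar> + \<bar>d\<bar>) / c + 1"
  have y1: "1 \<le> y" using c by (simp add: y_def)
  have "b + d * y < \<bar>b\<bar> * y + \<bar>d\<bar> * y + c * y"
  proof -
    have "\<bar>b\<bar> * 1 \<le> \<bar>b\<bar> * y" using y1 by (intro mult_left_mono) auto
    moreover have "d * y \<le> \<bar>d\<bar> * y" using y1 by (intro mult_right_mono) auto
    moreover have "0 < c * y" using c y1 by simp
    ultimately show ?thesis by linarith
  qed
  also have "\<dots> = c * y * y" using c by (simp add: y_def field_simps)
  also have "\<dots> = a * ((\<kappa> * y)\<^sup>2 / 2)" by (simp add: c_def power2_eq_square)
  also have "\<dots> \<le> a * exp (\<kappa> * y)"
  proof (intro mult_left_mono)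
    have "0 \<le> \<kappa> * y" using assms y1 by simp
    from exp_lower_Taylor_quadratic[OF this] \<open>0 \<le> \<kappa> * y\<close> show "(\<kappa> * y)\<^sup>2 / 2 \<le> exp (\<kappa> * y)" by linarith
  qed (use assms in auto)
  finally show ?thesis using y1 by (intro exI[of _ y]) auto
qed

lemma AE_lborel_interval_ex:
  fixes a b :: real
  assumes "AE s in lborel. Q s" "a < b"
  shows "\<exists>s. a < s \<and> s < b \<and> Q s"
proof (rule ccontr)
  assume n: "\<not> ?thesis"
  obtain N where N: "{s \<in> space lborel. \<not> Q s} \<subseteq> N" "emeasure lborel N = 0" "N \<in> sets lborel"
    using AE_E[OF assms(1)] by blast
  have "{a<..<b} \<subseteq> N" using n N(1) by auto
  then have "emeasure lborel {a<..<b} \<le> emeasure lborel N" using N(3) by (intro emeasure_mono) auto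
  then show False using N(2) assms(2) by simp
qed

lemma norm_tangential:
  fixes \<theta> v :: "'a::real_inner"
  assumes "norm \<theta> = 1"
  shows "(norm (tangential \<theta> v))\<^sup>2 = (norm v)\<^sup>2 - (\<theta> \<bullet> v)\<^sup>2"
proof -
  have 1: "\<theta> \<bullet> \<theta> = 1" using assms by (simp add: norm_eq_1)
  have "tangential \<theta> v \<bullet> tangential \<theta> v = v \<bullet> v - 2 * (\<theta> \<bullet> v)\<^sup>2 + (\<theta> \<bullet> v)\<^sup>2 * (\<theta> \<bullet> \<theta>)"
    by (simp add: tangential_def inner_diff_left inner_diff_right inner_commute power2_eq_square algebra_simps)
  then show ?thesis unfolding 1 power2_norm_eq_inner by simp
qed

context flow_setting
begin

text \<open>The ball rather than the sphere, so that \<open>sgn 0 = 0\<close> belongs to it and the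
  zero parameter needs no separate treatment.\<close>

definition unit_cone :: "'n param set" where
  "unit_cone = closure Theta \<inter> cball 0 1"

lemma compact_unit_cone: "compact unit_cone"
  unfolding unit_cone_def by (rule closed_Int_compact) auto

lemma sgn_unit_cone: "\<theta> \<in> closure Theta \<Longrightarrow> sgn \<theta> \<in> unit_cone"
  using scale_closure_Theta[of \<theta> "inverse (norm \<theta>)"]
  by (cases "\<theta> = 0") (simp_all add: unit_cone_def norm_sgn sgn_div_norm[of \<theta>])

lemma unit_cone_subset: "unit_cone \<subseteq> closure Theta"
  by (simp add: unit_cone_def)

lemma norm_sgn_scale: "norm \<theta> *\<^sub>R sgn \<theta> = (\<theta> :: 'n param)"
  by (cases "\<theta> = 0") (simp_all add: sgn_div_norm)

lemma pgrad_sgn: "pgrad r \<theta> = norm \<theta> *\<^sub>R pgrad r (sgn \<theta>)"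
  using pgrad_scale[of "norm \<theta>" r "sgn \<theta>"] by (simp add: norm_sgn_scale)

text \<open>Gradients are homogeneous of degree one, so uniform convergence on the compact
  \<open>unit_cone\<close> is rescaled to every bounded part of the cone; potentials follow by
  Euler's identity.\<close>

lemma cone_uniform_limit:
  fixes F :: "'i filter" and \<tau> :: "'i \<Rightarrow> real" and V V' :: "'n param \<Rightarrow> 'n param" and g :: "'n param \<Rightarrow> real"
  assumes u: "uniform_limit unit_cone (\<lambda>i. pgrad (\<rho> (\<tau> i))) V F"
    and V: "\<And>\<theta>. \<theta> \<in> closure Theta \<Longrightarrow> V' \<theta> = norm \<theta> *\<^sub>R V (sgn \<theta>)"
    and g: "\<And>\<theta>. \<theta> \<in> closure Theta \<Longrightarrow> g \<theta> = (\<theta> \<bullet> V' \<theta>) / 2"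
    and \<tau>: "\<And>i. 0 \<le> \<tau> i"
  shows "locally_uniform_limit (closure Theta) (\<lambda>i. pgrad (\<rho> (\<tau> i))) V' F"
    and "locally_uniform_limit (closure Theta) (\<lambda>i. pot (\<rho> (\<tau> i))) g F"
proof -
  have le: "norm (pgrad (\<rho> (\<tau> i)) \<theta> - V' \<theta>) = norm \<theta> * norm (pgrad (\<rho> (\<tau> i)) (sgn \<theta>) - V (sgn \<theta>))"
    if "\<theta> \<in> closure Theta" for i \<theta>
    unfolding V[OF that] pgrad_sgn[of _ \<theta>] by (simp add: scaleR_diff_right[symmetric])
  have lep: "\<bar>pot (\<rho> (\<tau> i)) \<theta> - g \<theta>\<bar> \<le> norm \<theta> * norm (pgrad (\<rho> (\<tau> i)) \<theta> - V' \<theta>)"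
    if "\<theta> \<in> closure Theta" for i \<theta>
  proof -
    have "pot (\<rho> (\<tau> i)) \<theta> - g \<theta> = (\<theta> \<bullet> (pgrad (\<rho> (\<tau> i)) \<theta> - V' \<theta>)) / 2"
      using inner_pgrad(1)[OF residual_\<rho>[OF \<tau>[of i]], of \<theta>] g[OF that] by (simp add: inner_diff_right diff_divide_distrib)
    then show ?thesis using Cauchy_Schwarz_ineq2[of \<theta> "pgrad (\<rho> (\<tau> i)) \<theta> - V' \<theta>"] by simp
  qed
  have both: "uniform_limit (closure Theta \<inter> cball 0 R) (\<lambda>i. pgrad (\<rho> (\<tau> i))) V' F \<and>
      uniform_limit (closure Theta \<inter> cball 0 R) (\<lambda>i. pot (\<rho> (\<tau> i))) g F" if R: "0 < R" for R
  proof (intro conjI uniform_limitI)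
    fix e :: real assume e: "0 < e"
    have "\<forall>\<^sub>F i in F. \<forall>\<theta>\<in>unit_cone. dist (pgrad (\<rho> (\<tau> i)) \<theta>) (V \<theta>) < e / R"
      using uniform_limitD[OF u, of "e / R"] e R by simp
    then show "\<forall>\<^sub>F i in F. \<forall>\<theta>\<in>closure Theta \<inter> cball 0 R. dist (pgrad (\<rho> (\<tau> i)) \<theta>) (V' \<theta>) < e"
    proof (rule eventually_mono, intro ballI)
      fix i and \<theta> :: "'n param" assume a: "\<forall>\<theta>\<in>unit_cone. dist (pgrad (\<rho> (\<tau> i)) \<theta>) (V \<theta>) < e / R" and \<theta>: "\<theta> \<in> closure Theta \<inter> cball 0 R"
      have "dist (pgrad (\<rho> (\<tau> i)) \<theta>) (V' \<theta>) = norm \<theta> * norm (pgrad (\<rho> (\<tau> i)) (sgn \<theta>) - V (sgn \<theta>))"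
        using le \<theta> by (simp add: dist_norm)
      also have "\<dots> \<le> R * norm (pgrad (\<rho> (\<tau> i)) (sgn \<theta>) - V (sgn \<theta>))" using \<theta> by (intro mult_right_mono) auto
      also have "\<dots> < R * (e / R)" using a sgn_unit_cone[of \<theta>] \<theta> R by (intro mult_strict_left_mono) (auto simp: dist_norm)
      finally show "dist (pgrad (\<rho> (\<tau> i)) \<theta>) (V' \<theta>) < e" using R by simp
    qed
  next
    fix e :: real assume e: "0 < e"
    have "\<forall>\<^sub>F i in F. \<forall>\<theta>\<in>unit_cone. dist (pgrad (\<rho> (\<tau> i)) \<theta>) (V \<theta>) < e / (R * R)"
      using uniform_limitD[OF u, of "e / (R * R)"] e R by simp
    then show "\<forall>\<^sub>F i in F. \<forall>\<theta>\<in>closure Theta \<inter> cball 0 R. dist (pot (\<rho> (\<tau> i)) \<theta>) (g \<theta>) < e"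
    proof (rule eventually_mono, intro ballI)
      fix i and \<theta> :: "'n param" assume a: "\<forall>\<theta>\<in>unit_cone. dist (pgrad (\<rho> (\<tau> i)) \<theta>) (V \<theta>) < e / (R * R)" and \<theta>: "\<theta> \<in> closure Theta \<inter> cball 0 R"
      have "dist (pot (\<rho> (\<tau> i)) \<theta>) (g \<theta>) \<le> norm \<theta> * norm (pgrad (\<rho> (\<tau> i)) \<theta> - V' \<theta>)"
        using lep[of \<theta> i] \<theta> by (simp add: dist_real_def)
      also have "\<dots> = (norm \<theta> * norm \<theta>) * norm (pgrad (\<rho> (\<tau> i)) (sgn \<theta>) - V (sgn \<theta>))" using le \<theta> by simp
      also have "\<dots> \<le> (R * R) * norm (pgrad (\<rho> (\<tau> i)) (sgn \<theta>) - V (sgn \<theta>))"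
        using \<theta> R by (intro mult_right_mono mult_mono) auto
      also have "\<dots> < (R * R) * (e / (R * R))" using a sgn_unit_cone[of \<theta>] \<theta> R by (intro mult_strict_left_mono) (auto simp: dist_norm)
      finally show "dist (pot (\<rho> (\<tau> i)) \<theta>) (g \<theta>) < e" using R by simp
    qed
  qed
  show "locally_uniform_limit (closure Theta) (\<lambda>i. pgrad (\<rho> (\<tau> i))) V' F"
    "locally_uniform_limit (closure Theta) (\<lambda>i. pot (\<rho> (\<tau> i))) g F"
    using both by (auto intro: locally_uniform_limitI_cballs)
qed

lemma Omega_subsequence:
  assumes t: "\<And>n. 0 \<le> t n" "filterlim t at_top sequentially"
  shows "\<exists>r g V. strict_mono r \<and> (g, V) \<in> Omega_lim l P flow \<and>
    uniform_limit unit_cone (\<lambda>n. pgrad (\<rho> (t (r n)))) V sequentially"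
proof -
  let ?c = "loss_const * moment" and ?L = "loss_const * grad_lipschitz_const"
  have c0: "0 \<le> ?c" using loss_const_nonneg moment_nonneg by simp
  have L0: "0 \<le> ?L" using loss_const_nonneg grad_lipschitz_const_nonneg by simp
  have bd: "norm (pgrad (\<rho> (t n)) \<theta>) \<le> ?c" if "\<theta> \<in> unit_cone" for n \<theta>
  proof -
    have "norm (pgrad (\<rho> (t n)) \<theta>) \<le> ?c * norm \<theta>" by (rule pgrad_le[OF residual_\<rho>[OF t(1)]])
    also have "\<dots> \<le> ?c * 1" using that c0 by (intro mult_left_mono) (auto simp: unit_cone_def)
    finally show ?thesis by simp
  qed
  have eq: "\<exists>d. 0 < d \<and> (\<forall>n y. y \<in> unit_cone \<and> norm (x - y) < d \<longrightarrow> norm (pgrad (\<rho> (t n)) x - pgrad (\<rho> (t n)) y) < e)"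
    if "x \<in> unit_cone" "0 < e" for x e
  proof (intro exI[of _ "e / (?L + 1)"] conjI allI impI)
    show "0 < e / (?L + 1)" using that L0 by simp
    fix n y assume y: "y \<in> unit_cone \<and> norm (x - y) < e / (?L + 1)"
    have "norm (pgrad (\<rho> (t n)) x - pgrad (\<rho> (t n)) y) \<le> ?L * norm (x - y)"
      by (rule pgrad_lipschitz[OF residual_\<rho>[OF t(1)]]) (use y unit_cone_subset in auto)
    also have "\<dots> \<le> (?L + 1) * norm (x - y)" by (intro mult_right_mono) auto
    also have "\<dots> < (?L + 1) * (e / (?L + 1))" using y L0 by (intro mult_strict_left_mono) auto
    finally show "norm (pgrad (\<rho> (t n)) x - pgrad (\<rho> (t n)) y) < e" using L0 by simp
  qed
  obtain V0 k where k: "strict_mono (k :: nat \<Rightarrow> nat)"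
    and lim: "\<And>e. 0 < e \<Longrightarrow> \<exists>N. \<forall>n x. n \<ge> N \<and> x \<in> unit_cone \<longrightarrow> norm (pgrad (\<rho> (t (k n))) x - V0 x) < e"
    by (rule Arzela_Ascoli[OF compact_unit_cone, of "\<lambda>n. pgrad (\<rho> (t n))" ?c, OF bd eq]) (assumption | rule that)+
  have u0: "uniform_limit unit_cone (\<lambda>n. pgrad (\<rho> (t (k n)))) V0 sequentially"
  proof (rule uniform_limitI)
    fix e :: real assume "0 < e"
    then obtain N where "\<forall>n x. n \<ge> N \<and> x \<in> unit_cone \<longrightarrow> norm (pgrad (\<rho> (t (k n))) x - V0 x) < e" using lim by blast
    then show "\<forall>\<^sub>F n in sequentially. \<forall>x\<in>unit_cone. dist (pgrad (\<rho> (t (k n))) x) (V0 x) < e"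
      unfolding eventually_sequentially dist_norm by blast
  qed
  \<comment> \<open>\<open>V0\<close> is meaningful only on \<open>unit_cone\<close>;
    \<open>V\<close> is its homogeneous extension, and \<open>restrict\<close> supplies the
    extensionality demanded by \<open>Omega_lim\<close>.\<close>
  define V where "V = restrict (\<lambda>\<theta>. norm \<theta> *\<^sub>R V0 (sgn \<theta>)) (closure Theta)"
  define g where "g = restrict (\<lambda>\<theta>. (\<theta> \<bullet> V \<theta>) / 2) (closure Theta)"
  have lu: "locally_uniform_limit (closure Theta) (\<lambda>n. pgrad (\<rho> (t (k n)))) V sequentially"
    "locally_uniform_limit (closure Theta) (\<lambda>n. pot (\<rho> (t (k n)))) g sequentially"
    using cone_uniform_limit[OF u0, of V g] t(1) by (auto simp: V_def g_def)
  have "filterlim (\<lambda>n. t (k n)) at_top sequentially"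
    using filterlim_compose[OF t(2) filterlim_subseq[OF k]] by (simp add: comp_def)
  then have "(g, V) \<in> Omega_lim l P flow"
    unfolding Omega_lim_def using lu t(1)
    by (auto simp: delta_risk_flow grad_delta_risk_flow g_def V_def intro!: exI[of _ "\<lambda>n. t (k n)"])
  moreover have "uniform_limit unit_cone (\<lambda>n. pgrad (\<rho> (t (k n)))) V sequentially"
    by (rule locally_uniform_limit_compact[OF lu(1) compact_unit_cone unit_cone_subset])
  ultimately show ?thesis using k by blast
qed

lemma Omega_nonempty: "Omega_lim l P flow \<noteq> {}"
  using Omega_subsequence[of real] filterlim_real_sequentially by auto

lemma locally_uniform_limit_pointwise:
  assumes "locally_uniform_limit S f g F" "x \<in> S"
  shows "((\<lambda>i. f i x) \<longlongrightarrow> g x) F"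
proof -
  obtain e where e: "e > 0" "uniform_limit (S \<inter> ball x e) f g F"
    using assms unfolding locally_uniform_limit_def by blast
  show ?thesis by (rule tendsto_uniform_limitI[OF e(2)]) (use assms e in auto)
qed

lemma Omega_limit:
  assumes "(g, V) \<in> Omega_lim l P flow"
  obtains t where "\<And>n. 0 \<le> t n" "filterlim t at_top sequentially"
    "\<And>\<theta>. \<theta> \<in> closure Theta \<Longrightarrow> (\<lambda>n. pot (\<rho> (t n)) \<theta>) \<longlonglongrightarrow> g \<theta>"
    "\<And>\<theta>. \<theta> \<in> closure Theta \<Longrightarrow> (\<lambda>n. pgrad (\<rho> (t n)) \<theta>) \<longlonglongrightarrow> V \<theta>"
proof -
  obtain t where t: "\<And>n. 0 \<le> t n" "filterlim t at_top sequentially"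
    and lu: "locally_uniform_limit (closure Theta) (\<lambda>n. pot (\<rho> (t n))) g sequentially"
      "locally_uniform_limit (closure Theta) (\<lambda>n. pgrad (\<rho> (t n))) V sequentially"
    using assms unfolding Omega_lim_def delta_risk_flow grad_delta_risk_flow by auto
  show thesis
    by (rule that[OF t locally_uniform_limit_pointwise[OF lu(1)] locally_uniform_limit_pointwise[OF lu(2)]])
qed

text \<open>Identities and non-strict estimates with constants independent of time survive pointwise
  limits. The limit is thus treated like a potential, although it need not come from any
  residual.\<close>

lemma Omega_props:
  assumes \<Omega>: "(g, V) \<in> Omega_lim l P flow" and \<theta>: "\<theta> \<in> closure Theta"
  shows "g \<theta> = (\<theta> \<bullet> V \<theta>) / 2"
    and "0 \<le> r \<Longrightarrow> g (r *\<^sub>R \<theta>) = r\<^sup>2 * g \<theta>" and "0 \<le> r \<Longrightarrow> V (r *\<^sub>R \<theta>) = r *\<^sub>R V \<theta>"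
    and "norm (V \<theta>) \<le> loss_const * moment * norm \<theta>"
    and "\<theta>' \<in> closure Theta \<Longrightarrow> norm (V \<theta> - V \<theta>') \<le> loss_const * grad_lipschitz_const * norm (\<theta> - \<theta>')"
    and "\<theta>' \<in> closure Theta \<Longrightarrow> \<bar>g \<theta>' - g \<theta> - V \<theta> \<bullet> (\<theta>' - \<theta>)\<bar> \<le> loss_const * grad_lipschitz_const * (norm (\<theta>' - \<theta>))\<^sup>2"
    and "\<theta> = (a, u) \<Longrightarrow> g (- a, u) = - g \<theta>"
proof -
  obtain t where t: "\<And>n. 0 \<le> t n" and "filterlim t at_top sequentially" and G: "\<And>\<theta>. \<theta> \<in> closure Theta \<Longrightarrow> (\<lambda>n. pot (\<rho> (t n)) \<theta>) \<longlonglongrightarrow> g \<theta>"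
    and W: "\<And>\<theta>. \<theta> \<in> closure Theta \<Longrightarrow> (\<lambda>n. pgrad (\<rho> (t n)) \<theta>) \<longlonglongrightarrow> V \<theta>"
    by (rule Omega_limit[OF \<Omega>]) (assumption | rule that)+
  note r\<rho> = residual_\<rho>[OF t]
  have "(\<lambda>n. \<theta> \<bullet> pgrad (\<rho> (t n)) \<theta> / 2) \<longlonglongrightarrow> (\<theta> \<bullet> V \<theta>) / 2" by (intro tendsto_intros W \<theta>) simp
  then have "(\<lambda>n. pot (\<rho> (t n)) \<theta>) \<longlonglongrightarrow> (\<theta> \<bullet> V \<theta>) / 2" by (simp add: inner_pgrad(1)[OF r\<rho>])
  then show "g \<theta> = (\<theta> \<bullet> V \<theta>) / 2" by (rule LIMSEQ_unique[OF G[OF \<theta>]])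
  show "g (r *\<^sub>R \<theta>) = r\<^sup>2 * g \<theta>" if "0 \<le> r"
  proof -
    have "(\<lambda>n. r\<^sup>2 * pot (\<rho> (t n)) \<theta>) \<longlonglongrightarrow> r\<^sup>2 * g \<theta>" by (rule tendsto_mult[OF tendsto_const G[OF \<theta>]])
    moreover have "(\<lambda>n. r\<^sup>2 * pot (\<rho> (t n)) \<theta>) \<longlonglongrightarrow> g (r *\<^sub>R \<theta>)"
      using G[OF scale_closure_Theta[OF \<theta> that]] by (simp only: pot_scale[OF that])
    ultimately show ?thesis by (rule LIMSEQ_unique[rotated])
  qed
  show "V (r *\<^sub>R \<theta>) = r *\<^sub>R V \<theta>" if "0 \<le> r"
  proof -
    have "(\<lambda>n. r *\<^sub>R pgrad (\<rho> (t n)) \<theta>) \<longlonglongrightarrow> r *\<^sub>R V \<theta>" by (intro tendsto_intros W \<theta>)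
    moreover have "(\<lambda>n. r *\<^sub>R pgrad (\<rho> (t n)) \<theta>) \<longlonglongrightarrow> V (r *\<^sub>R \<theta>)"
      using W[OF scale_closure_Theta[OF \<theta> that]] by (simp only: pgrad_scale[OF that])
    ultimately show ?thesis by (rule LIMSEQ_unique[rotated])
  qed
  show "norm (V \<theta>) \<le> loss_const * moment * norm \<theta>"
    by (rule LIMSEQ_le_const2[OF tendsto_norm[OF W[OF \<theta>]]]) (use pgrad_le[OF r\<rho>] in blast)
  show "norm (V \<theta> - V \<theta>') \<le> loss_const * grad_lipschitz_const * norm (\<theta> - \<theta>')" if "\<theta>' \<in> closure Theta"
    by (rule LIMSEQ_le_const2[OF tendsto_norm[OF tendsto_diff[OF W[OF \<theta>] W[OF that]]]])
       (use pgrad_lipschitz[OF r\<rho> that] in blast)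
  show "\<bar>g \<theta>' - g \<theta> - V \<theta> \<bullet> (\<theta>' - \<theta>)\<bar> \<le> loss_const * grad_lipschitz_const * (norm (\<theta>' - \<theta>))\<^sup>2" if "\<theta>' \<in> closure Theta"
  proof (rule LIMSEQ_le_const2)
    show "(\<lambda>n. \<bar>pot (\<rho> (t n)) \<theta>' - pot (\<rho> (t n)) \<theta> - pgrad (\<rho> (t n)) \<theta> \<bullet> (\<theta>' - \<theta>)\<bar>) \<longlonglongrightarrow> \<bar>g \<theta>' - g \<theta> - V \<theta> \<bullet> (\<theta>' - \<theta>)\<bar>"
      by (intro tendsto_intros W G \<theta> that)
  qed (use pot_remainder[OF r\<rho> \<theta>] in blast)
  show "g (- a, u) = - g \<theta>" if \<theta>': "\<theta> = (a, u)"
  proof -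
    have "(- a, u) \<in> closure Theta" using \<theta> \<theta>' by (simp add: closure_Theta)
    from G[OF this] have "(\<lambda>n. - pot (\<rho> (t n)) \<theta>) \<longlonglongrightarrow> g (- a, u)" by (simp add: pot_odd \<theta>')
    moreover have "(\<lambda>n. - pot (\<rho> (t n)) \<theta>) \<longlonglongrightarrow> - g \<theta>" by (intro tendsto_intros G \<theta>)
    ultimately show ?thesis by (rule LIMSEQ_unique)
  qed
qed

lemma Omega_continuous:
  assumes \<Omega>: "(g, V) \<in> Omega_lim l P flow"
  shows "continuous_on (closure Theta) V" "continuous_on (closure Theta) g"
proof -
  show V: "continuous_on (closure Theta) V"
    by (rule lipschitz_on_continuous_on[of "loss_const * grad_lipschitz_const"], rule lipschitz_onI)
       (use Omega_props(5)[OF \<Omega>] loss_const_nonneg grad_lipschitz_const_nonneg in \<open>auto simp: dist_norm\<close>)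
  have "continuous_on (closure Theta) (\<lambda>\<theta>. (\<theta> \<bullet> V \<theta>) / 2)" by (intro continuous_intros V) simp
  then show "continuous_on (closure Theta) g"
    by (rule continuous_on_eq) (use Omega_props(1)[OF \<Omega>] in simp)
qed

text \<open>Precompactness: otherwise times tending to infinity with a fixed error would have a
  subsequence converging to the same unique limit.\<close>

lemma Omega_singleton_uniform:
  assumes \<Omega>: "Omega_lim l P flow = {(g, V)}"
  shows "uniform_limit unit_cone (\<lambda>t. pgrad (\<rho> t)) V at_top"
proof (rule ccontr)
  assume "\<not> ?thesis"
  then obtain e where e: "e > 0" "\<not> (\<forall>\<^sub>F t in at_top. \<forall>\<theta>\<in>unit_cone. dist (pgrad (\<rho> t) \<theta>) (V \<theta>) < e)"
    unfolding uniform_limit_iff by blast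
  then have "\<exists>t\<ge>real n. \<exists>\<theta>\<in>unit_cone. \<not> dist (pgrad (\<rho> t) \<theta>) (V \<theta>) < e" for n
    unfolding eventually_at_top_linorder by blast
  then obtain t where t: "\<And>n. real n \<le> t n" "\<And>n. \<exists>\<theta>\<in>unit_cone. \<not> dist (pgrad (\<rho> (t n)) \<theta>) (V \<theta>) < e" by metis
  have t0: "0 \<le> t n" for n using t(1)[of n] by (meson of_nat_0_le_iff order_trans)
  have "filterlim t at_top sequentially"
    by (rule filterlim_at_top_mono[OF filterlim_real_sequentially]) (use t(1) in simp)
  from Omega_subsequence[OF t0 this] \<Omega> obtain r where
    "uniform_limit unit_cone (\<lambda>n. pgrad (\<rho> (t (r n)))) V sequentially" by auto
  from uniform_limitD[OF this e(1)] obtain n where "\<forall>\<theta>\<in>unit_cone. dist (pgrad (\<rho> (t (r n))) \<theta>) (V \<theta>) < e"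
    unfolding eventually_sequentially by blast
  then show False using t(2)[of "r n"] by blast
qed

text \<open>By homogeneity the error is relative, so one time \<open>T\<close> serves the entire
  unbounded cone. This is needed because neither trajectories nor supports of the measures are
  bounded.\<close>

lemma Omega_singleton_approx:
  assumes \<Omega>: "Omega_lim l P flow = {(g, V)}" and e: "0 < e"
  shows "\<exists>T\<ge>0. \<forall>t\<ge>T. \<forall>\<theta>\<in>closure Theta. norm (pgrad (\<rho> t) \<theta> - V \<theta>) \<le> e * norm \<theta>"
proof -
  have mem: "(g, V) \<in> Omega_lim l P flow" using \<Omega> by simp
  from uniform_limitD[OF Omega_singleton_uniform[OF \<Omega>] e]
  obtain T where T: "\<And>t \<theta>. T \<le> t \<Longrightarrow> \<theta> \<in> unit_cone \<Longrightarrow> dist (pgrad (\<rho> t) \<theta>) (V \<theta>) < e"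
    unfolding eventually_at_top_linorder by blast
  have "norm (pgrad (\<rho> t) \<theta> - V \<theta>) \<le> e * norm \<theta>" if "max T 0 \<le> t" "\<theta> \<in> closure Theta" for t \<theta>
  proof -
    have s: "sgn \<theta> \<in> unit_cone" by (rule sgn_unit_cone[OF that(2)])
    have "V \<theta> = norm \<theta> *\<^sub>R V (sgn \<theta>)"
      using Omega_props(3)[OF mem, of "sgn \<theta>" "norm \<theta>"] s unit_cone_subset by (auto simp: norm_sgn_scale)
    then have "norm (pgrad (\<rho> t) \<theta> - V \<theta>) = norm \<theta> * norm (pgrad (\<rho> t) (sgn \<theta>) - V (sgn \<theta>))"
      using pgrad_sgn[of "\<rho> t" \<theta>] by (simp add: scaleR_diff_right[symmetric])
    also have "\<dots> \<le> norm \<theta> * e" using T[OF _ s, of t] that(1) by (intro mult_left_mono) (auto simp: dist_norm)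
    finally show ?thesis by (simp add: mult.commute)
  qed
  then show ?thesis by (intro exI[of _ "max T 0"]) auto
qed

end

context flow_setting
begin

text \<open>Suppose the limit potential \<open>g\<close> is negative somewhere. For a regular value \<open>s < 0\<close> the
  function \<open>p = s |\<theta>|\<^sup>2 - g\<close> grows exponentially along every trajectory on which it is positive
  at a late time: on the unit sphere \<open>|V|\<^sup>2 - 4 s g\<close> equals the square of the tangential
  gradient plus \<open>4 g (g - s)\<close>, which is positive on the compact set \<open>g \<le> s\<close>. Omni-directionality
  gives positive mass to such trajectories, so the second moment would grow exponentially,
  contradicting its affine bound.\<close>

lemma Omega_singleton_nonneg:
  assumes \<Omega>: "Omega_lim l P flow = {(g, V)}"
    and ms: "morse_sard l P flow" and omni: "omni_directional (flow 0)"
    and \<theta>0: "\<theta>0 \<in> closure Theta"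
  shows "0 \<le> g \<theta>0"
proof (rule ccontr)
  assume neg: "\<not> 0 \<le> g \<theta>0"
  have mem: "(g, V) \<in> Omega_lim l P flow" using \<Omega> by simp
  note pr = Omega_props[OF mem]
  let ?c = "loss_const * moment"
  have c0: "0 \<le> ?c" using loss_const_nonneg moment_nonneg by simp
  define \<theta>1 where "\<theta>1 = sgn \<theta>0"
  have g0: "g 0 = 0" using pr(1)[OF zero_closure_Theta] by simp
  have \<theta>00: "\<theta>0 \<noteq> 0" using neg g0 by auto
  have \<theta>1: "\<theta>1 \<in> closure Theta" "norm \<theta>1 = 1"
    using sgn_unit_cone[OF \<theta>0] unit_cone_subset \<theta>00 by (auto simp: \<theta>1_def norm_sgn)
  have "g \<theta>0 = (norm \<theta>0)\<^sup>2 * g \<theta>1"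
    using pr(2)[OF \<theta>1(1), of "norm \<theta>0"] by (simp add: \<theta>1_def norm_sgn_scale)
  then have g1: "g \<theta>1 < 0" using neg by (auto simp: zero_le_mult_iff not_le mult_less_0_iff)
  have "AE s in lborel. \<forall>\<theta> \<in> closure Theta. norm \<theta> = 1 \<and> g \<theta> = s \<longrightarrow> tangential \<theta> (V \<theta>) \<noteq> 0"
    using ms mem unfolding morse_sard_def by auto
  from AE_lborel_interval_ex[OF this g1] obtain s where s: "g \<theta>1 < s" "s < 0"
    and reg: "\<And>\<theta>. \<theta> \<in> closure Theta \<Longrightarrow> norm \<theta> = 1 \<Longrightarrow> g \<theta> = s \<Longrightarrow> tangential \<theta> (V \<theta>) \<noteq> 0" by blast
  \<comment> \<open>By Euler's identity this equals the product of V with V - 2 s \<theta>, the rate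
    of s |\<theta>|^2 - g along the limit field -V.\<close>
  define D where "D = (\<lambda>\<theta>. (norm (V \<theta>))\<^sup>2 - 4 * s * g \<theta>)"
  define S where "S = {\<theta> \<in> closure Theta. norm \<theta> = 1 \<and> g \<theta> \<le> s}"
  have Dpos: "0 < D \<theta>" if "\<theta> \<in> S" for \<theta>
  proof -
    have \<theta>: "\<theta> \<in> closure Theta" "norm \<theta> = 1" "g \<theta> \<le> s" using that by (auto simp: S_def)
    have "\<theta> \<bullet> V \<theta> = 2 * g \<theta>" using pr(1)[OF \<theta>(1)] by simp
    then have "D \<theta> = (norm (tangential \<theta> (V \<theta>)))\<^sup>2 + 4 * (g \<theta> * (g \<theta> - s))"
      using norm_tangential[OF \<theta>(2), of "V \<theta>"] by (simp add: D_def power2_eq_square algebra_simps)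
    moreover have "0 \<le> g \<theta> * (g \<theta> - s)" using \<theta>(3) s by (intro mult_nonpos_nonpos) auto
    moreover have "g \<theta> = s \<or> 0 < g \<theta> * (g \<theta> - s)" using \<theta>(3) s by (auto intro: mult_neg_neg)
    moreover have "g \<theta> = s \<Longrightarrow> 0 < (norm (tangential \<theta> (V \<theta>)))\<^sup>2" using reg[OF \<theta>(1,2)] by simp
    ultimately show ?thesis using zero_le_power2[of "norm (tangential \<theta> (V \<theta>))"] by linarith
  qed
  have Sc: "compact S"
  proof -
    have cs: "continuous_on (closure Theta \<inter> sphere 0 1) g"
      by (rule continuous_on_subset[OF Omega_continuous(2)[OF mem]]) auto
    have "closed {\<theta> \<in> closure Theta \<inter> sphere 0 1. g \<theta> \<le> s}"
      by (rule continuous_on_closed_Collect_le[OF cs continuous_on_const]) (auto intro: closed_Int)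
    moreover have "S = {\<theta> \<in> closure Theta \<inter> sphere 0 1. g \<theta> \<le> s}" by (auto simp: S_def)
    moreover have "bounded S" by (rule bounded_subset[of "cball 0 1"]) (auto simp: S_def)
    ultimately show ?thesis by (simp add: compact_eq_bounded_closed)
  qed
  have Dc: "continuous_on S D"
    unfolding D_def
    by (intro continuous_intros continuous_on_subset[OF Omega_continuous(1)[OF mem]] continuous_on_subset[OF Omega_continuous(2)[OF mem]])
       (auto simp: S_def)
  have "\<theta>1 \<in> S" using \<theta>1 s by (simp add: S_def)
  then obtain \<theta>m where \<theta>m: "\<theta>m \<in> S" "\<And>\<theta>. \<theta> \<in> S \<Longrightarrow> D \<theta>m \<le> D \<theta>"
    using continuous_attains_inf[OF Sc _ Dc] by blast
  define d where "d = D \<theta>m"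
  have d: "0 < d" using Dpos[OF \<theta>m(1)] by (simp add: d_def)
  \<comment> \<open>Both sides are homogeneous of degree two, so the minimum over the compact set
    \<open>S\<close> of unit vectors serves all of the cone where the growing function is
    nonnegative.\<close>
  have Dge: "d * (norm \<theta>)\<^sup>2 \<le> D \<theta>" if \<theta>: "\<theta> \<in> closure Theta" and q: "g \<theta> \<le> s * (norm \<theta>)\<^sup>2" for \<theta>
  proof (cases "\<theta> = 0")
    case True
    then show ?thesis using pr(4)[OF \<theta>] g0 by (simp add: D_def)
  next
    case False
    have sg: "sgn \<theta> \<in> closure Theta" "norm (sgn \<theta>) = 1" using sgn_unit_cone[OF \<theta>] unit_cone_subset False by (auto simp: norm_sgn)
    have gs: "g \<theta> = (norm \<theta>)\<^sup>2 * g (sgn \<theta>)" using pr(2)[OF sg(1), of "norm \<theta>"] by (simp add: norm_sgn_scale)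
    have Vs: "V \<theta> = norm \<theta> *\<^sub>R V (sgn \<theta>)" using pr(3)[OF sg(1), of "norm \<theta>"] by (simp add: norm_sgn_scale)
    have "g (sgn \<theta>) \<le> s" using q False unfolding gs by (simp add: mult.commute)
    then have "d \<le> D (sgn \<theta>)" using \<theta>m(2)[of "sgn \<theta>"] sg by (simp add: S_def d_def)
    moreover have "D \<theta> = (norm \<theta>)\<^sup>2 * D (sgn \<theta>)" unfolding D_def gs Vs by (simp add: power_mult_distrib algebra_simps)
    ultimately show ?thesis using mult_right_mono[of d "D (sgn \<theta>)" "(norm \<theta>)\<^sup>2"] by (simp add: mult.commute)
  qed
  \<comment> \<open>\<open>A * norm \<theta>\<close> bounds V - 2 s \<theta>. With
    \<open>\<epsilon> = d / (2 * A)\<close> the error from using the true gradient instead of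
    \<open>V\<close> consumes half of the rate \<open>d\<close>.\<close>
  define A where "A = ?c + 2 * \<bar>s\<bar> + 1"
  have A: "0 < A" using c0 by (simp add: A_def add_nonneg_pos)
  define \<epsilon> where "\<epsilon> = d / (2 * A)"
  have \<epsilon>: "0 < \<epsilon>" using d A by (simp add: \<epsilon>_def)
  obtain T where T: "0 \<le> T" "\<And>t \<theta>. T \<le> t \<Longrightarrow> \<theta> \<in> closure Theta \<Longrightarrow> norm (pgrad (\<rho> t) \<theta> - V \<theta>) \<le> \<epsilon> * norm \<theta>"
    using Omega_singleton_approx[OF \<Omega> \<epsilon>] by blast
  \<comment> \<open>\<open>k\<close> bounds the growing function by the squared norm;
    \<open>\<kappa>\<close> is chosen so that the surviving rate d/2 times the squared norm is at
    least \<open>\<kappa>\<close> times the function.\<close>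
  define k where "k = ?c + 1"
  have k: "0 < k" using c0 by (simp add: k_def)
  define \<kappa> where "\<kappa> = d / (2 * k)"
  have \<kappa>: "0 < \<kappa>" using d k by (simp add: \<kappa>_def)
  define p where "p = (\<lambda>t \<theta>. s * (norm (X t \<theta>))\<^sup>2 - g (X t \<theta>))"
  have ple: "s * (norm \<theta>)\<^sup>2 - g \<theta> \<le> k * (norm \<theta>)\<^sup>2" if "\<theta> \<in> closure Theta" for \<theta>
  proof -
    have "- g \<theta> \<le> \<bar>\<theta> \<bullet> V \<theta>\<bar> / 2" using pr(1)[OF that] by simp
    also have "\<dots> \<le> norm \<theta> * norm (V \<theta>)" using Cauchy_Schwarz_ineq2[of \<theta> "V \<theta>"] by simp
    also have "\<dots> \<le> norm \<theta> * (?c * norm \<theta>)" by (intro mult_left_mono pr(4) that) simp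
    also have "\<dots> \<le> k * (norm \<theta>)\<^sup>2" by (simp add: k_def power2_eq_square algebra_simps)
    finally have "- g \<theta> \<le> k * (norm \<theta>)\<^sup>2" .
    moreover have "s * (norm \<theta>)\<^sup>2 \<le> 0" using s by (intro mult_nonpos_nonneg) auto
    ultimately show ?thesis by linarith
  qed
  have grow: "p T \<theta> * exp (\<kappa> * (t - T)) \<le> p t \<theta>" if \<theta>: "\<theta> \<in> closure Theta" and pT: "0 < p T \<theta>" and t: "T \<le> t" for t \<theta>
  proof (rule exponential_growth[where p = "\<lambda>t. p t \<theta>" and p' = "\<lambda>t. (2 * s) *\<^sub>R X t \<theta> \<bullet> (- pgrad (\<rho> t) (X t \<theta>)) - V (X t \<theta>) \<bullet> (- pgrad (\<rho> t) (X t \<theta>))"])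
    fix r assume r: "T \<le> r"
    have r0: "0 \<le> r" using r T(1) by simp
    have xd: "((\<lambda>t. X t \<theta>) has_vector_derivative - pgrad (\<rho> r) (X r \<theta>)) (at r within {T..})"
      by (rule has_vector_derivative_within_subset[OF X_vector_derivative[OF \<theta> r0]]) (use T(1) in auto)
    have 1: "((\<lambda>t. g (X t \<theta>)) has_real_derivative V (X r \<theta>) \<bullet> (- pgrad (\<rho> r) (X r \<theta>))) (at r within {T..})"
      by (rule quadratic_remainder_curve_DERIV[OF xd, where C = "loss_const * grad_lipschitz_const"])
         (use pr(6) X_closure_Theta[OF \<theta>] r0 T(1) in auto)
    have 2: "((\<lambda>t. s * (norm (X t \<theta>))\<^sup>2) has_real_derivative (2 * s) *\<^sub>R X r \<theta> \<bullet> (- pgrad (\<rho> r) (X r \<theta>))) (at r within {T..})"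
    proof (rule quadratic_remainder_curve_DERIV[OF xd, where g = "\<lambda>\<theta>. s * (norm \<theta>)\<^sup>2" and C = "\<bar>s\<bar>"])
      fix r' 
      have "s * (norm (X r' \<theta>))\<^sup>2 - s * (norm (X r \<theta>))\<^sup>2 - (2 * s) *\<^sub>R X r \<theta> \<bullet> (X r' \<theta> - X r \<theta>) = s * (norm (X r' \<theta> - X r \<theta>))\<^sup>2"
        by (simp add: power2_norm_eq_inner inner_diff_left inner_diff_right inner_commute algebra_simps)
      then show "\<bar>s * (norm (X r' \<theta>))\<^sup>2 - s * (norm (X r \<theta>))\<^sup>2 - (2 * s) *\<^sub>R X r \<theta> \<bullet> (X r' \<theta> - X r \<theta>)\<bar> \<le> \<bar>s\<bar> * (norm (X r' \<theta> - X r \<theta>))\<^sup>2"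
        by (simp add: abs_mult)
    qed
    show "((\<lambda>t. p t \<theta>) has_real_derivative (2 * s) *\<^sub>R X r \<theta> \<bullet> (- pgrad (\<rho> r) (X r \<theta>)) - V (X r \<theta>) \<bullet> (- pgrad (\<rho> r) (X r \<theta>))) (at r within {T..})"
      unfolding p_def by (rule DERIV_diff[OF 2 1])
    assume pr0: "0 \<le> p r \<theta>"
    let ?x = "X r \<theta>" and ?G = "pgrad (\<rho> r) (X r \<theta>)"
    have x: "?x \<in> closure Theta" by (rule X_closure_Theta[OF \<theta> r0])
    have "norm (V ?x - (2 * s) *\<^sub>R ?x) \<le> norm (V ?x) + norm ((2 * s) *\<^sub>R ?x)" by (rule norm_triangle_ineq4)
    also have "\<dots> \<le> A * norm ?x" using pr(4)[OF x] unfolding A_def distrib_right norm_scaleR abs_mult by (simp add: add_increasing2)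
    finally have n: "norm (V ?x - (2 * s) *\<^sub>R ?x) \<le> A * norm ?x" .
    have "\<bar>(V ?x - (2 * s) *\<^sub>R ?x) \<bullet> (?G - V ?x)\<bar> \<le> norm (V ?x - (2 * s) *\<^sub>R ?x) * norm (?G - V ?x)" by (rule Cauchy_Schwarz_ineq2)
    also have "\<dots> \<le> (A * norm ?x) * (\<epsilon> * norm ?x)" using A by (intro mult_mono n T(2)[OF r x]) auto
    also have "\<dots> = d / 2 * (norm ?x)\<^sup>2" using A by (simp add: \<epsilon>_def power2_eq_square)
    finally have e: "- (d / 2 * (norm ?x)\<^sup>2) \<le> (V ?x - (2 * s) *\<^sub>R ?x) \<bullet> (?G - V ?x)" by linarith
    have "d * (norm ?x)\<^sup>2 \<le> D ?x" using pr0 by (intro Dge x) (simp add: p_def)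
    moreover have "D ?x = (V ?x - (2 * s) *\<^sub>R ?x) \<bullet> V ?x"
      using pr(1)[OF x] by (simp add: D_def inner_diff_left power2_norm_eq_inner)
    ultimately have "d / 2 * (norm ?x)\<^sup>2 \<le> (V ?x - (2 * s) *\<^sub>R ?x) \<bullet> ?G" using e by (simp add: inner_diff_right)
    moreover have "(2 * s) *\<^sub>R ?x \<bullet> (- ?G) - V ?x \<bullet> (- ?G) = (V ?x - (2 * s) *\<^sub>R ?x) \<bullet> ?G" by (simp add: inner_diff_left)
    moreover have "\<kappa> * p r \<theta> \<le> \<kappa> * (k * (norm ?x)\<^sup>2)"
      using \<kappa> ple[OF x] by (intro mult_left_mono) (auto simp: p_def)
    moreover have "\<kappa> * (k * (norm ?x)\<^sup>2) = d / 2 * (norm ?x)\<^sup>2" using k by (simp add: \<kappa>_def)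
    ultimately show "\<kappa> * p r \<theta> \<le> (2 * s) *\<^sub>R ?x \<bullet> (- ?G) - V ?x \<bullet> (- ?G)" by linarith
  qed (use \<kappa> pT t in auto)
  have gcl: "continuous_on UNIV (\<lambda>\<theta>. g (clamp_cone \<theta>))"
    by (rule continuous_on_compose2[OF Omega_continuous(2)[OF mem] continuous_clamp_cone]) (auto simp: clamp_cone_in)
  have XT: "continuous_on UNIV (X T)" by (rule field.flow_map_continuous[OF T(1)])
  have gXT: "continuous_on UNIV (\<lambda>\<theta>. g (clamp_cone (X T \<theta>)))" by (rule continuous_on_compose2[OF gcl XT]) auto
  \<comment> \<open>Initial points whose trajectory is in the growth region at time
    \<open>T\<close>. They form a cone since \<open>X T\<close> is homogeneous;
    \<open>clamp_cone\<close> makes the inequality continuous on the whole space, so that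
    \<open>C\<close> is open.\<close>
  define C where "C = Theta \<inter> {\<theta>. g (clamp_cone (X T \<theta>)) < s * (norm (X T \<theta>))\<^sup>2}"
  have C_iff: "\<theta> \<in> C \<longleftrightarrow> \<theta> \<in> Theta \<and> 0 < p T \<theta>" for \<theta>
  proof (cases "\<theta> \<in> Theta")
    case True
    then have "clamp_cone (X T \<theta>) = X T \<theta>" using Theta_subset X_closure_Theta[of \<theta> T] T(1) clamp_cone_id by blast
    then show ?thesis using True by (simp add: C_def p_def)
  qed (simp add: C_def)
  have "open C" unfolding C_def
    by (intro open_Int open_Theta open_Collect_less gXT continuous_intros XT)
  moreover have "C \<subseteq> Theta" by (auto simp: C_def)
  moreover have "r *\<^sub>R \<theta> \<in> C" if "0 < r" "\<theta> \<in> C" for r \<theta>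
  proof -
    have \<theta>: "\<theta> \<in> Theta" "0 < p T \<theta>" using that(2) C_iff by auto
    then have xc: "X T \<theta> \<in> closure Theta" using Theta_subset X_closure_Theta[OF _ T(1)] by blast
    have "p T (r *\<^sub>R \<theta>) = r\<^sup>2 * p T \<theta>"
      unfolding p_def using that(1) T(1) pr(2)[OF xc, of r] by (simp add: X_scale power_mult_distrib algebra_simps)
    then show ?thesis using \<theta> that(1) scale_Theta by (simp add: C_iff)
  qed
  \<comment> \<open>\<open>\<theta>1\<close> may lie on the boundary of the cone, so a nearby point
    of the open cone is traced back to time 0; conservation of the defect keeps its origin in the
    open cone.\<close>
  moreover have "C \<noteq> {}"
  proof -
    have "continuous_on (closure Theta) (\<lambda>\<theta>. g \<theta> - s * (norm \<theta>)\<^sup>2)" by (intro continuous_intros Omega_continuous(2)[OF mem])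
    then have "\<exists>e>0. \<forall>y\<in>closure Theta. dist y \<theta>1 < e \<longrightarrow> dist (g y - s * (norm y)\<^sup>2) (g \<theta>1 - s * (norm \<theta>1)\<^sup>2) < s - g \<theta>1"
      using \<theta>1(1) s(1) unfolding continuous_on_iff by auto
    then obtain e where e: "e > 0" "\<And>y. y \<in> closure Theta \<Longrightarrow> dist y \<theta>1 < e \<Longrightarrow> dist (g y - s * (norm y)\<^sup>2) (g \<theta>1 - s * (norm \<theta>1)\<^sup>2) < s - g \<theta>1"
      by blast
    obtain y where y: "y \<in> Theta" "dist y \<theta>1 < e" using \<theta>1(1) e(1) unfolding closure_approachable by blast
    have yq: "g y < s * (norm y)\<^sup>2"
    proof -
      have "y \<in> closure Theta" using y(1) Theta_subset by blast
      from e(2)[OF this y(2)] show ?thesis using \<theta>1(2) by (simp add: dist_real_def abs_less_iff)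
    qed
    obtain x where x: "field.solution T x" "x T = y" using field.flow_map_surj[OF T(1)] by blast
    have "defect (x T) < 0" using y(1) x(2) by (simp add: Theta_defect)
    moreover from this have "defect (x 0) = defect (x T)" using defect_conserved[OF x(1), of T 0] T(1) by simp
    ultimately have x0: "x 0 \<in> Theta" by (simp add: Theta_defect)
    have "X T (x 0) = y" using field.flow_map_eq[OF x(1) T(1) order_refl] x(2) by simp
    then have "x 0 \<in> C" using x0 yq by (simp add: C_iff p_def)
    then show ?thesis by blast
  qed
  ultimately have "0 < measure (flow 0) C" using omni unfolding omni_directional_def by blast
  interpret f0: prob_space "flow 0" by (rule P2_prob[OF flow_P2]) simp
  have f0s: "space (flow 0) = closure Theta" using P2_space[OF flow_P2[of 0]] by simp
  \<comment> \<open>Integrating the positive part weighs the points of \<open>C\<close> by their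
    value at time \<open>T\<close>; no uniform lower bound on a subset of positive mass is then
    required.\<close>
  let ?w = "\<lambda>\<theta>. max 0 (s * (norm (X T \<theta>))\<^sup>2 - g (clamp_cone (X T \<theta>)))"
  have wc: "continuous_on UNIV ?w" by (intro continuous_intros gXT XT)
  have wm: "?w \<in> borel_measurable (flow 0)"
    by (rule P2_measurable[OF flow_P2 borel_measurable_continuous_onI[OF wc]]) simp
  have weq: "?w \<theta> = max 0 (p T \<theta>)" if "\<theta> \<in> closure Theta" for \<theta>
    using X_closure_Theta[OF that T(1)] by (simp add: p_def clamp_cone_id)
  have wi: "integrable (flow 0) ?w"
  proof (rule P2_integrable_quadratic[OF flow_P2 wm, where A = 0 and B = "k * (exp (lip_const * T))\<^sup>2"])
    fix \<theta> :: "'n param" assume \<theta>: "\<theta> \<in> closure Theta"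
    have "(norm (X T \<theta>))\<^sup>2 \<le> (exp (lip_const * T) * norm \<theta>)\<^sup>2" by (intro power_mono X_le T) auto
    then have "k * (norm (X T \<theta>))\<^sup>2 \<le> k * (exp (lip_const * T) * norm \<theta>)\<^sup>2" using k by (intro mult_left_mono) auto
    then have "p T \<theta> \<le> k * (exp (lip_const * T) * norm \<theta>)\<^sup>2"
      using ple[OF X_closure_Theta[OF \<theta> T(1)]] by (simp add: p_def)
    moreover have "0 \<le> k * (exp (lip_const * T) * norm \<theta>)\<^sup>2" using k by simp
    ultimately show "\<bar>?w \<theta>\<bar> \<le> 0 + k * (exp (lip_const * T))\<^sup>2 * (norm \<theta>)\<^sup>2"
      unfolding weq[OF \<theta>] by (simp add: power_mult_distrib mult.assoc)
  qed simp
  define I where "I = (\<integral>\<theta>. ?w \<theta> \<partial>flow 0)"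
  have "I \<noteq> 0"
  proof
    assume "I = 0"
    then have "AE \<theta> in flow 0. ?w \<theta> = 0"
      unfolding I_def using integral_nonneg_eq_0_iff_AE[OF wi] by simp
    then have "AE \<theta> in flow 0. \<theta> \<notin> C"
    proof (rule AE_mp, intro AE_I2 impI)
      fix \<theta> assume "\<theta> \<in> space (flow 0)" "?w \<theta> = 0"
      then show "\<theta> \<notin> C" using weq[of \<theta>] by (auto simp: C_iff f0s max_def split: if_splits)
    qed
    then have "measure (flow 0) C = 0"
    proof -
      have Cm: "C \<in> sets (flow 0)"
        using \<open>open C\<close> \<open>C \<subseteq> Theta\<close> Theta_subset P2_sets[OF flow_P2[of 0]]
        by (auto simp: sets_restrict_space image_iff intro!: bexI[of _ C])
      have "AE \<theta> in flow 0. \<theta> \<in> C \<longleftrightarrow> \<theta> \<in> {}" using \<open>AE \<theta> in flow 0. \<theta> \<notin> C\<close> by simp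
      from f0.finite_measure_eq_AE[OF this Cm] show ?thesis by simp
    qed
    then show False using \<open>0 < measure (flow 0) C\<close> by simp
  qed
  moreover have "0 \<le> I" unfolding I_def by (rule Bochner_Integration.integral_nonneg) simp
  ultimately have I: "0 < I" by simp
  \<comment> \<open>The second moment dominates the growing function up to \<open>k\<close>, so its
    mean grows at least like the weighted mass of \<open>C\<close>.\<close>
  have low: "I / k * exp (\<kappa> * (t - T)) \<le> N t" if t: "T \<le> t" for t
  proof -
    have t0: "0 \<le> t" using t T(1) by simp
    have Nt: "N t = (\<integral>\<theta>. (norm (X t \<theta>))\<^sup>2 \<partial>flow 0)"
      unfolding second_moment_def by (rule flow_integral[OF t0]) measurable
    have ni: "integrable (flow 0) (\<lambda>\<theta>. (norm (X t \<theta>))\<^sup>2)"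
    proof (rule P2_integrable_quadratic[OF flow_P2, where A = 0 and B = "(exp (lip_const * t))\<^sup>2"])
      show "(\<lambda>\<theta>. (norm (X t \<theta>))\<^sup>2) \<in> borel_measurable (flow 0)"
        by (rule P2_measurable[OF flow_P2]) (auto intro!: borel_measurable_continuous_onI continuous_intros field.flow_map_continuous t0)
      show "\<bar>(norm (X t \<theta>))\<^sup>2\<bar> \<le> 0 + (exp (lip_const * t))\<^sup>2 * (norm \<theta>)\<^sup>2" for \<theta>
        using power_mono[OF X_le[OF t0, of \<theta>], of 2] by (simp add: power_mult_distrib)
    qed simp
    have "I * (exp (\<kappa> * (t - T)) / k) = (\<integral>\<theta>. ?w \<theta> * (exp (\<kappa> * (t - T)) / k) \<partial>flow 0)"
      unfolding I_def by simp
    also have "\<dots> \<le> (\<integral>\<theta>. (norm (X t \<theta>))\<^sup>2 \<partial>flow 0)"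
    proof (rule integral_mono)
      show "integrable (flow 0) (\<lambda>\<theta>. ?w \<theta> * (exp (\<kappa> * (t - T)) / k))" using wi by (rule integrable_mult_left[rotated])
      fix \<theta> assume "\<theta> \<in> space (flow 0)"
      then have \<theta>: "\<theta> \<in> closure Theta" by (simp add: f0s)
      show "?w \<theta> * (exp (\<kappa> * (t - T)) / k) \<le> (norm (X t \<theta>))\<^sup>2"
      proof (cases "0 < p T \<theta>")
        case True
        have "p T \<theta> * exp (\<kappa> * (t - T)) \<le> p t \<theta>" by (rule grow[OF \<theta> True t])
        also have "\<dots> \<le> k * (norm (X t \<theta>))\<^sup>2" unfolding p_def by (rule ple[OF X_closure_Theta[OF \<theta> t0]])
        finally show ?thesis using True k weq[OF \<theta>] by (simp add: field_simps)
      next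
        case False
        then show ?thesis using weq[OF \<theta>] by simp
      qed
    qed (rule ni)
    finally show ?thesis unfolding Nt by simp
  qed
  let ?R = "risk l P (atomic (return_pmf 0))"
  obtain y where y: "0 \<le> y" "(N 0 + 4 * ?R * T) + (4 * ?R) * y < I / k * exp (\<kappa> * y)"
    using exp_not_le_affine[of "I / k" \<kappa> "N 0 + 4 * ?R * T" "4 * ?R"] I k \<kappa> by auto
  have "I / k * exp (\<kappa> * y) \<le> N (T + y)" using low[of "T + y"] y(1) by simp
  also have "\<dots> \<le> N 0 + 4 * ?R * (T + y)" using N_growth[of "T + y"] T(1) y(1) by simp
  finally show False using y(2) by (simp add: distrib_left)
qed

lemma Omega_singleton_zero:
  assumes \<Omega>: "Omega_lim l P flow = {(g, V)}"
    and ms: "morse_sard l P flow" and omni: "omni_directional (flow 0)"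
    and \<theta>: "\<theta> \<in> closure Theta"
  shows "g \<theta> = 0"
proof -
  obtain a u where au: "\<theta> = (a, u)" by (cases \<theta>)
  have "(- a, u) \<in> closure Theta" using \<theta> by (simp add: au closure_Theta)
  from Omega_singleton_nonneg[OF \<Omega> ms omni this] Omega_singleton_nonneg[OF \<Omega> ms omni \<theta>]
    Omega_props(7)[of g V, OF _ \<theta> au] \<Omega>
  show ?thesis by simp
qed

lemma Omega_singleton_risk_limit:
  assumes \<Omega>: "Omega_lim l P flow = {(g, V)}"
    and ms: "morse_sard l P flow" and omni: "omni_directional (flow 0)"
  shows "((\<lambda>t. risk l P (flow t)) \<longlongrightarrow> (INF \<pi>\<in>P2. risk l P \<pi>)) at_top"
proof -
  have mem: "(g, V) \<in> Omega_lim l P flow" using \<Omega> by simp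
  have zero: "g \<theta> = 0" if "\<theta> \<in> closure Theta" for \<theta> by (rule Omega_singleton_zero[OF \<Omega> ms omni that])
  have bdd: "bdd_below ((\<lambda>\<pi>. risk l P \<pi>) ` P2)" using risk_nonneg by (auto simp: bdd_below_def)
  have key: "\<exists>T\<ge>0. risk l P (flow T) < risk l P \<pi> + e" if \<pi>: "\<pi> \<in> P2" and e: "0 < e" for \<pi> e
  proof (rule ccontr)
    assume "\<not> ?thesis"
    then have ge: "risk l P \<pi> + e \<le> risk l P (flow t)" if "0 \<le> t" for t using that by (auto simp: not_less)
    \<comment> \<open>Makes \<open>\<epsilon>\<close> times the second moment of the competitor at
      most \<open>e\<close>; the summand 1 avoids division by zero.\<close>
    define \<epsilon> where "\<epsilon> = e / (second_moment \<pi> + 1)"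
    have \<epsilon>: "0 < \<epsilon>" using e second_moment_nonneg[of \<pi>] by (simp add: \<epsilon>_def add_nonneg_pos)
    obtain T where T: "0 \<le> T" "\<And>t \<theta>. T \<le> t \<Longrightarrow> \<theta> \<in> closure Theta \<Longrightarrow> norm (pgrad (\<rho> t) \<theta> - V \<theta>) \<le> \<epsilon> * norm \<theta>"
      using Omega_singleton_approx[OF \<Omega> \<epsilon>] by blast
    \<comment> \<open>Convexity gives a gain of \<open>4 * e\<close> from the assumed gap in risk;
      the potential, close to the zero limit, costs at most \<open>2 * e\<close> when integrated
      against the competitor.\<close>
    have rate: "- 4 * (\<integral>\<theta>. delta_risk l P (flow t) \<theta> \<partial>flow t) \<le> - 2 * e" if t: "T \<le> t" for t
    proof -
      have t0: "0 \<le> t" using t T(1) by simp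
      have pl: "pot (\<rho> t) \<theta> \<ge> - (\<epsilon> / 2 * (norm \<theta>)\<^sup>2)" if \<theta>: "\<theta> \<in> closure Theta" for \<theta>
      proof -
        have "\<theta> \<bullet> V \<theta> = 0" using Omega_props(1)[OF mem \<theta>] zero[OF \<theta>] by simp
        then have "2 * pot (\<rho> t) \<theta> = \<theta> \<bullet> (pgrad (\<rho> t) \<theta> - V \<theta>)"
          using inner_pgrad(1)[OF residual_\<rho>[OF t0], of \<theta>] by (simp add: inner_diff_right)
        moreover have "\<bar>\<theta> \<bullet> (pgrad (\<rho> t) \<theta> - V \<theta>)\<bar> \<le> norm \<theta> * (\<epsilon> * norm \<theta>)"
          using order_trans[OF Cauchy_Schwarz_ineq2 mult_left_mono[OF T(2)[OF t \<theta>] norm_ge_zero]] .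
        ultimately show ?thesis by (simp add: power2_eq_square abs_le_iff algebra_simps)
      qed
      have "- (\<epsilon> / 2 * second_moment \<pi>) = (\<integral>\<theta>. - (\<epsilon> / 2 * (norm \<theta>)\<^sup>2) \<partial>\<pi>)" by (simp add: second_moment_def)
      also have "\<dots> \<le> (\<integral>\<theta>. pot (\<rho> t) \<theta> \<partial>\<pi>)"
        by (rule integral_mono) (use P2_integrable[OF \<pi>] integrable_pot_P2[OF residual_\<rho>[OF t0] \<pi>] pl P2_space[OF \<pi>] in auto)
      finally have 1: "- (\<epsilon> / 2 * second_moment \<pi>) \<le> (\<integral>\<theta>. delta_risk l P (flow t) \<theta> \<partial>\<pi>)" by (simp add: delta_risk_flow)
      have "\<epsilon> * second_moment \<pi> \<le> e"
        using e second_moment_nonneg[of \<pi>] by (simp add: \<epsilon>_def field_simps)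
      then show ?thesis using 1 risk_tangent[OF flow_P2[OF t0] \<pi>] ge[OF t0] by linarith
    qed
    have lin: "N t \<le> N T - 2 * e * (t - T)" if t: "T \<le> t" for t
    proof -
      have d: "((\<lambda>s. N s + 2 * e * s) has_real_derivative - 4 * (\<integral>\<theta>. delta_risk l P (flow s) \<theta> \<partial>flow s) + 2 * e) (at s within {0..})"
        if "0 \<le> s" for s
        using N_DERIV[OF that] by (auto intro!: derivative_eq_intros)
      have "N t + 2 * e * t \<le> N T + 2 * e * T"
      proof (rule DERIV_nonpos_imp_decreasing_open[OF t, where f = "\<lambda>s. N s + 2 * e * s"])
        fix s assume s: "T < s" "s < t"
        have "at s within {0..} = at s" using s T(1) by (intro at_within_atLeast) simp
        then have "((\<lambda>s. N s + 2 * e * s) has_real_derivative - 4 * (\<integral>\<theta>. delta_risk l P (flow s) \<theta> \<partial>flow s) + 2 * e) (at s)"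
          using d[of s] s T(1) by simp
        then show "\<exists>y. ((\<lambda>s. N s + 2 * e * s) has_real_derivative y) (at s) \<and> y \<le> 0" using rate[of s] s by force
      next
        have "continuous_on {0..} (\<lambda>s. N s + 2 * e * s)"
          unfolding continuous_on_eq_continuous_within using DERIV_continuous[OF d] by auto
        then show "continuous_on {T..t} (\<lambda>s. N s + 2 * e * s)" by (rule continuous_on_subset) (use T(1) in auto)
      qed
      then show ?thesis by (simp add: algebra_simps)
    qed
    \<comment> \<open>The time at which the linear upper bound for the second moment reaches
      -1.\<close>
    define t where "t = T + (N T + 1) / (2 * e)"
    have "T \<le> t" using second_moment_nonneg[of "flow T"] e by (simp add: t_def)
    from lin[OF this] e have "N t \<le> - 1" by (simp add: t_def)
    then show False using second_moment_nonneg[of "flow t"] by simp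
  qed
  show ?thesis
  proof (rule tendstoI)
    fix e :: real assume e: "0 < e"
    have "\<exists>\<pi>\<in>P2. risk l P \<pi> < (INF \<pi>\<in>P2. risk l P \<pi>) + e / 2"
      using cINF_less_iff[OF _ bdd, of "(INF \<pi>\<in>P2. risk l P \<pi>) + e / 2"] flow_P2[of 0] e by auto
    then obtain \<pi> where \<pi>: "\<pi> \<in> P2" "risk l P \<pi> < (INF \<pi>\<in>P2. risk l P \<pi>) + e / 2" by blast
    \<comment> \<open>One good time is enough, because the risk does not increase
      afterwards.\<close>
    obtain T where T: "0 \<le> T" "risk l P (flow T) < risk l P \<pi> + e / 2" using key[OF \<pi>(1), of "e / 2"] e by auto
    have "dist (risk l P (flow t)) (INF \<pi>\<in>P2. risk l P \<pi>) < e" if t: "T \<le> t" for t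
    proof -
      have "(INF \<pi>\<in>P2. risk l P \<pi>) \<le> risk l P (flow t)" by (rule cINF_lower[OF bdd flow_P2]) (use t T in simp)
      moreover have "risk l P (flow t) \<le> risk l P (flow T)" by (rule risk_antimono[OF T(1) t])
      ultimately show ?thesis using T(2) \<pi>(2) by (simp add: dist_real_def)
    qed
    then show "\<forall>\<^sub>F t in at_top. dist (risk l P (flow t)) (INF \<pi>\<in>P2. risk l P \<pi>) < e"
      unfolding eventually_at_top_linorder by blast
  qed
qed

end

section \<open>Minimising sequences\<close>

text \<open>Minimisers need not be unique, so the points \<open>\<alpha> n\<close> may fail to
  converge. Coercivity confines them to a ball; where \<bar>J\<bar> is at least e in that ball,
  \<open>L\<close> stays above its minimum by compactness, since \<open>J\<close> vanishes at every
  minimiser.\<close>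

lemma derivative_at_minimiser_tendsto_0:
  fixes L J :: "real \<Rightarrow> real" and \<alpha> :: "nat \<Rightarrow> real"
  assumes Lc: "continuous_on UNIV L" and Jc: "continuous_on UNIV J"
    and tangent: "\<And>x y. J x * (y - x) \<le> L y - L x"
    and coercive: "filterlim L at_top at_infinity"
    and min: "\<And>x. L x0 \<le> L x" and lim: "(\<lambda>n. L (\<alpha> n) - L x0) \<longlonglongrightarrow> 0"
  shows "(\<lambda>n. J (\<alpha> n)) \<longlonglongrightarrow> 0"
proof -
  have J0: "J x = 0" if x: "L x = L x0" for x
  proof -
    have i: "((\<lambda>n. x + inverse (real (Suc n))) \<longlongrightarrow> x + 0) sequentially" "((\<lambda>n. x - inverse (real (Suc n))) \<longlongrightarrow> x - 0) sequentially"
      by (intro tendsto_intros LIMSEQ_inverse_real_of_nat)+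
    \<comment> \<open>The tangent line at \<open>x + h\<close>, evaluated at the minimiser, shows
      that the slope points away from the minimiser on both sides; continuity of \<open>J\<close>
      then gives slope zero at the minimiser.\<close>
    have sg: "0 \<le> J (x + h) * h" for h
      using tangent[of "x + h" x] min[of "x + h"] x by (simp add: algebra_simps)
    have "(\<lambda>n. J (x + inverse (real (Suc n)))) \<longlonglongrightarrow> J x" "(\<lambda>n. J (x - inverse (real (Suc n)))) \<longlonglongrightarrow> J x"
      using i Jc unfolding continuous_on_sequentially comp_def by auto
    moreover have "0 \<le> J (x + inverse (real (Suc n)))" for n
      using sg[of "inverse (real (Suc n))"] by (simp add: zero_le_mult_iff del: of_nat_Suc)
    moreover have "J (x - inverse (real (Suc n))) \<le> 0" for n
      using sg[of "- inverse (real (Suc n))"] by (simp add: zero_le_mult_iff mult_le_0_iff del: of_nat_Suc)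
    ultimately have "0 \<le> J x" "J x \<le> 0" by (auto intro: LIMSEQ_le_const LIMSEQ_le_const2)
    then show ?thesis by simp
  qed
  have "eventually (\<lambda>x. L x0 + 1 \<le> L x) at_infinity" using coercive by (simp add: filterlim_at_top)
  then obtain B where B: "\<And>x. B \<le> norm x \<Longrightarrow> L x0 + 1 \<le> L x" by (auto simp: eventually_at_infinity)
  show ?thesis
  proof (rule tendstoI)
    fix e :: real assume e: "0 < e"
    define Z where "Z = {x \<in> cball 0 B. e \<le> \<bar>J x\<bar>}"
    have "closed Z" unfolding Z_def
      using continuous_on_closed_Collect_le[OF continuous_on_const continuous_on_rabs[OF continuous_on_subset[OF Jc]], of "cball 0 B" e] by auto
    moreover have "bounded Z" by (rule bounded_subset[of "cball 0 B"]) (auto simp: Z_def)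
    ultimately have cZ: "compact Z" by (simp add: compact_eq_bounded_closed)
    have "\<exists>m>L x0. \<forall>x\<in>Z. m \<le> L x"
    proof (cases "Z = {}")
      case True
      then show ?thesis by (intro exI[of _ "L x0 + 1"]) auto
    next
      case False
      obtain z where z: "z \<in> Z" "\<And>x. x \<in> Z \<Longrightarrow> L z \<le> L x"
        using continuous_attains_inf[OF cZ False continuous_on_subset[OF Lc]] by blast
      have "L z \<noteq> L x0" using J0[of z] z(1) e by (auto simp: Z_def)
      then show ?thesis using min[of z] z(2) by (intro exI[of _ "L z"]) auto
    qed
    then obtain m where m: "L x0 < m" "\<And>x. x \<in> Z \<Longrightarrow> m \<le> L x" by blast
    have "eventually (\<lambda>n. L (\<alpha> n) - L x0 < Min {1, m - L x0}) sequentially"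
      by (rule order_tendstoD(2)[OF lim]) (use m in auto)
    then show "\<forall>\<^sub>F n in sequentially. dist (J (\<alpha> n)) 0 < e"
    proof (rule eventually_mono)
      fix n assume n: "L (\<alpha> n) - L x0 < Min {1, m - L x0}"
      have "norm (\<alpha> n) < B" using B[of "\<alpha> n"] n by (auto simp: not_le[symmetric])
      then have "\<alpha> n \<in> cball 0 B" by simp
      moreover have "\<alpha> n \<notin> Z" using m(2)[of "\<alpha> n"] n by auto
      ultimately show "dist (J (\<alpha> n)) 0 < e" by (auto simp: Z_def)
    qed
  qed
qed

section \<open>Disintegration and the optimal regressor\<close>

locale disintegrated_data = mean_field P l for P :: "((real ^ 'n::finite) \<times> real) measure" and l +
  fixes Px :: "real ^ 'n \<Rightarrow> real measure"
  assumes cond: "conditional_distribution P Px"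
    and compat: "compatibility_assms l P Px"
begin

abbreviation "M \<equiv> marginal P"

lemma sets_M [measurable_cong]: "sets M = sets borel" and space_M [simp]: "space M = UNIV"
  by (simp_all add: marginal_def)

lemma fst_P [measurable]: "fst \<in> P \<rightarrow>\<^sub>M borel"
  by measurable

lemma prob_M: "prob_space M"
  unfolding marginal_def by (rule prob_space_distr) measurable

lemma Px_measurable: "Px \<in> M \<rightarrow>\<^sub>M subprob_algebra borel"
  using cond measurable_prob_algebraD[of Px borel borel] unfolding conditional_distribution_def
  by (simp cong: measurable_cong_sets add: sets_M)

lemma Px_prob: "prob_space (Px x)" and Px_sets [measurable_cong]: "sets (Px x) = sets borel"
proof -
  have "Px x \<in> space (prob_algebra borel)"
    using cond measurable_space[of Px borel "prob_algebra borel" x] by (auto simp: conditional_distribution_def)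
  then show "prob_space (Px x)" "sets (Px x) = sets borel" by (auto simp: space_prob_algebra)
qed

lemma Px_space [simp]: "space (Px x) = UNIV"
  using sets_eq_imp_space_eq[OF Px_sets] by simp

lemma measure_Px_UNIV [simp]: "measure (Px x) UNIV = 1"
  using prob_space.prob_space[OF Px_prob[of x]] by simp

lemma kernel_measurable: "(\<lambda>x. distr (Px x) borel (Pair x)) \<in> M \<rightarrow>\<^sub>M subprob_algebra (borel :: ((real ^ 'n) \<times> real) measure)"
proof (rule measurable_distr2[OF _ Px_measurable])
  have "(\<lambda>z::(real ^ 'n) \<times> real. (fst z, snd z)) \<in> borel_measurable (M \<Otimes>\<^sub>M borel)"
    by (intro borel_measurable_Pair measurable_compose[OF measurable_fst] measurable_compose[OF measurable_snd])
       (auto simp: measurable_ident_sets sets_M)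
  then show "(\<lambda>(x, y). (x, y)) \<in> M \<Otimes>\<^sub>M borel \<rightarrow>\<^sub>M (borel :: ((real ^ 'n) \<times> real) measure)"
    by (simp add: case_prod_beta')
qed

lemma Pair_measurable: "Pair x \<in> Px x \<rightarrow>\<^sub>M (borel :: ((real ^ 'n) \<times> real) measure)"
proof -
  have "(\<lambda>y. (x, y)) \<in> Px x \<rightarrow>\<^sub>M (borel :: ((real ^ 'n) \<times> real) measure)"
    by (intro borel_measurable_Pair) (auto simp: measurable_ident_sets Px_sets)
  then show ?thesis by simp
qed

text \<open>Rectangles generate the Borel sets and are stable under intersection, so the defining
  property of the conditional distribution identifies \<open>P\<close> with a kernel composition,
  for which iterated integration is available.\<close>

lemma P_eq_bind: "P = M \<bind> (\<lambda>x. distr (Px x) borel (Pair x))"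
proof (rule measure_eqI_generator_eq)
  let ?E = "{A \<times> B | A B. A \<in> sets (borel :: (real ^ 'n) measure) \<and> B \<in> sets (borel :: real measure)}"
  let ?K = "\<lambda>x. distr (Px x) borel (Pair x)"
  show "Int_stable ?E" by (rule Int_stable_pair_measure_generator)
  show "?E \<subseteq> Pow UNIV" by simp
  have gen: "sets (borel :: ((real ^ 'n) \<times> real) measure) = sigma_sets UNIV ?E"
    unfolding borel_prod[symmetric] sets_pair_measure by simp
  show "sets P = sigma_sets UNIV ?E" using gen sets_P by simp
  have ne: "space M \<noteq> {}" by simp
  have "sets (M \<bind> ?K) = sets (borel :: ((real ^ 'n) \<times> real) measure)"
    by (rule sets_bind) auto
  then show "sets (M \<bind> ?K) = sigma_sets UNIV ?E" using gen by simp
  fix X assume "X \<in> ?E"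
  then obtain A B where X: "X = A \<times> B" "A \<in> sets borel" "B \<in> sets borel" by blast
  have Xb: "X \<in> sets (borel :: ((real ^ 'n) \<times> real) measure)" using X by (auto intro: borel_Times)
  have "emeasure (M \<bind> ?K) X = (\<integral>\<^sup>+ x. emeasure (?K x) X \<partial>M)"
    by (rule emeasure_bind[OF ne kernel_measurable Xb])
  also have "\<dots> = (\<integral>\<^sup>+ x\<in>A. emeasure (Px x) B \<partial>M)"
  proof (rule nn_integral_cong)
    fix x
    have "emeasure (?K x) X = emeasure (Px x) (Pair x -` X)"
      using emeasure_distr[OF Pair_measurable Xb, of x] by simp
    also have "Pair x -` X = (if x \<in> A then B else {})" by (auto simp: X)
    finally show "emeasure (?K x) X = emeasure (Px x) B * indicator A x" by (simp add: indicator_def)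
  qed
  finally show "emeasure P X = emeasure (M \<bind> ?K) X"
    using cond X unfolding conditional_distribution_def by simp
next
  show "range (\<lambda>_::nat. UNIV) \<subseteq> {A \<times> B | A B. A \<in> sets (borel :: (real ^ 'n) measure) \<and> B \<in> sets (borel :: real measure)}"
    by (auto intro!: exI[of _ UNIV])
  show "emeasure P UNIV \<noteq> \<infinity>" using emeasure_space_1 by simp
qed auto

lemma disintegration_nn:
  assumes h: "h \<in> borel_measurable borel"
  shows "(\<integral>\<^sup>+ p. h p \<partial>P) = (\<integral>\<^sup>+ x. \<integral>\<^sup>+ y. h (x, y) \<partial>Px x \<partial>M)"
proof -
  have "(\<integral>\<^sup>+ p. h p \<partial>P) = (\<integral>\<^sup>+ p. h p \<partial>(M \<bind> (\<lambda>x. distr (Px x) borel (Pair x))))"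
    by (subst P_eq_bind) (rule refl)
  also have "\<dots> = (\<integral>\<^sup>+ x. \<integral>\<^sup>+ p. h p \<partial>distr (Px x) borel (Pair x) \<partial>M)"
    by (rule nn_integral_bind[OF h kernel_measurable])
  also have "\<dots> = (\<integral>\<^sup>+ x. \<integral>\<^sup>+ y. h (x, y) \<partial>Px x \<partial>M)"
    by (intro nn_integral_cong nn_integral_distr[OF Pair_measurable]) (use h in simp)
  finally show ?thesis .
qed

lemma section_measurable:
  assumes "h \<in> borel_measurable (borel :: ((real ^ 'n) \<times> real) measure)"
  shows "(\<lambda>y. h (x, y)) \<in> borel_measurable (Px x)"
  using measurable_compose[OF Pair_measurable assms] by simp

lemma nn_integral_Px_measurable:
  fixes h :: "(real ^ 'n) \<times> real \<Rightarrow> ennreal"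
  assumes h: "h \<in> borel_measurable borel"
  shows "(\<lambda>x. \<integral>\<^sup>+ y. h (x, y) \<partial>Px x) \<in> borel_measurable M"
proof (rule nn_integral_measurable_subprob_algebra2[OF _ Px_measurable])
  have "(\<lambda>z::(real ^ 'n) \<times> real. (fst z, snd z)) \<in> borel_measurable (M \<Otimes>\<^sub>M borel)"
    by (intro borel_measurable_Pair measurable_compose[OF measurable_fst] measurable_compose[OF measurable_snd])
       (auto simp: measurable_ident_sets sets_M)
  from measurable_compose[OF this h] show "(\<lambda>(x, y). h (x, y)) \<in> borel_measurable (M \<Otimes>\<^sub>M borel)"
    by (simp add: case_prod_beta')
qed

lemma integral_Px_nonneg_measurable:
  assumes h: "h \<in> borel_measurable (borel :: ((real ^ 'n) \<times> real) measure)" and nn: "\<And>p. (0::real) \<le> h p"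
  shows "(\<lambda>x. \<integral>y. h (x, y) \<partial>Px x) \<in> borel_measurable M"
proof -
  \<comment> \<open>This holds also where the integral is infinite: both sides are then 0 by
    convention, so measurability needs no integrability.\<close>
  have "(\<integral>y. h (x, y) \<partial>Px x) = enn2real (\<integral>\<^sup>+ y. ennreal (h (x, y)) \<partial>Px x)" for x
    by (rule integral_eq_nn_integral[OF section_measurable[OF h]]) (use nn in simp)
  then show ?thesis using nn_integral_Px_measurable[of "\<lambda>p. ennreal (h p)"] h by simp
qed

lemma disintegration_nonneg:
  assumes h: "h \<in> borel_measurable (borel :: ((real ^ 'n) \<times> real) measure)" and nn: "\<And>p. (0::real) \<le> h p"
    and i: "integrable P h"
  shows "AE x in M. integrable (Px x) (\<lambda>y. h (x, y))"
    and "integrable M (\<lambda>x. \<integral>y. h (x, y) \<partial>Px x)"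
    and "(\<integral>p. h p \<partial>P) = (\<integral>x. \<integral>y. h (x, y) \<partial>Px x \<partial>M)"
proof -
  have hm: "(\<lambda>p. ennreal (h p)) \<in> borel_measurable borel" using h by simp
  have fin: "(\<integral>\<^sup>+ x. \<integral>\<^sup>+ y. ennreal (h (x, y)) \<partial>Px x \<partial>M) = ennreal (\<integral>p. h p \<partial>P)"
    using disintegration_nn[OF hm] nn_integral_eq_integral[OF i] nn by simp
  have "AE x in M. (\<integral>\<^sup>+ y. ennreal (h (x, y)) \<partial>Px x) \<noteq> \<infinity>"
    by (rule nn_integral_PInf_AE[OF nn_integral_Px_measurable[OF hm]]) (use fin in simp)
  then show ae: "AE x in M. integrable (Px x) (\<lambda>y. h (x, y))"
  proof (rule eventually_mono)
    fix x assume "(\<integral>\<^sup>+ y. ennreal (h (x, y)) \<partial>Px x) \<noteq> \<infinity>"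
    then show "integrable (Px x) (\<lambda>y. h (x, y))"
      using nn section_measurable[OF h] by (intro integrableI_nonneg) (auto simp: top.not_eq_extremum)
  qed
  have eq: "AE x in M. (\<integral>\<^sup>+ y. ennreal (h (x, y)) \<partial>Px x) = ennreal (\<integral>y. h (x, y) \<partial>Px x)"
    using ae by (rule eventually_mono) (use nn in \<open>auto intro: nn_integral_eq_integral\<close>)
  have fin': "(\<integral>\<^sup>+ x. ennreal (\<integral>y. h (x, y) \<partial>Px x) \<partial>M) = ennreal (\<integral>p. h p \<partial>P)"
    using nn_integral_cong_AE[OF eq] fin by simp
  show I: "integrable M (\<lambda>x. \<integral>y. h (x, y) \<partial>Px x)"
    by (rule integrableI_nonneg[OF integral_Px_nonneg_measurable[OF h nn]])
       (use fin' nn in \<open>auto intro: Bochner_Integration.integral_nonneg\<close>)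
  have "ennreal (\<integral>x. \<integral>y. h (x, y) \<partial>Px x \<partial>M) = ennreal (\<integral>p. h p \<partial>P)"
    using nn_integral_eq_integral[OF I] fin' nn by (simp add: Bochner_Integration.integral_nonneg)
  then show "(\<integral>p. h p \<partial>P) = (\<integral>x. \<integral>y. h (x, y) \<partial>Px x \<partial>M)"
    using nn by (subst (asm) ennreal_inj) (auto intro!: Bochner_Integration.integral_nonneg)
qed

text \<open>Reduction to positive and negative parts. The inner integral is passed as a measurable
  version \<open>k\<close>, since conditional integrability of a signed \<open>h\<close> is known
  only for almost every x.\<close>

lemma disintegration:
  assumes h: "h \<in> borel_measurable (borel :: ((real ^ 'n) \<times> real) measure)" and i: "integrable P (h :: _ \<Rightarrow> real)"
    and k: "k \<in> borel_measurable M" "AE x in M. k x = (\<integral>y. h (x, y) \<partial>Px x)"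
  shows "(\<integral>p. h p \<partial>P) = (\<integral>x. k x \<partial>M)"
proof -
  let ?a = "\<lambda>p. max (h p) 0" and ?b = "\<lambda>p. max (- h p) 0"
  have m: "?a \<in> borel_measurable borel" "?b \<in> borel_measurable borel" using h by auto
  have ab: "integrable P ?a" "integrable P ?b" using i by auto
  have nn: "0 \<le> ?a p" "0 \<le> ?b p" for p by auto
  note A = disintegration_nonneg[OF m(1) nn(1) ab(1)] and B = disintegration_nonneg[OF m(2) nn(2) ab(2)]
  have hab: "h p = ?a p - ?b p" for p by (auto simp: max_def)
  have "(\<integral>p. h p \<partial>P) = (\<integral>p. ?a p \<partial>P) - (\<integral>p. ?b p \<partial>P)"
    by (subst hab) (rule Bochner_Integration.integral_diff[OF ab])
  also have "\<dots> = (\<integral>x. \<integral>y. ?a (x, y) \<partial>Px x \<partial>M) - (\<integral>x. \<integral>y. ?b (x, y) \<partial>Px x \<partial>M)"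
    using A(3) B(3) by simp
  also have "\<dots> = (\<integral>x. (\<integral>y. ?a (x, y) \<partial>Px x) - (\<integral>y. ?b (x, y) \<partial>Px x) \<partial>M)"
    by (rule Bochner_Integration.integral_diff[symmetric]) (use A(2) B(2) in auto)
  also have "\<dots> = (\<integral>x. k x \<partial>M)"
  proof (rule integral_cong_AE)
    show "AE x in M. (\<integral>y. ?a (x, y) \<partial>Px x) - (\<integral>y. ?b (x, y) \<partial>Px x) = k x"
      using A(1) B(1) k(2)
    proof (eventually_elim)
      case (elim x)
      have "(\<integral>y. h (x, y) \<partial>Px x) = (\<integral>y. ?a (x, y) - ?b (x, y) \<partial>Px x)" by (subst hab) (rule refl)
      also have "\<dots> = (\<integral>y. ?a (x, y) \<partial>Px x) - (\<integral>y. ?b (x, y) \<partial>Px x)"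
        by (rule Bochner_Integration.integral_diff) (use elim in auto)
      finally show ?case using elim(3) by simp
    qed
  qed (use k integral_Px_nonneg_measurable[OF m(1)] integral_Px_nonneg_measurable[OF m(2)] in auto)
  finally show ?thesis .
qed

text \<open>The slope of the conditional loss. It enters only through its continuity and the tangent
  inequality, so the conditional loss is never differentiated under the integral.\<close>

definition J :: "real ^ 'n \<Rightarrow> real \<Rightarrow> real" where
  "J x \<alpha> = (\<integral>y. D1 l \<alpha> y \<partial>Px x)"

abbreviation Lx :: "real ^ 'n \<Rightarrow> real \<Rightarrow> real" where
  "Lx \<equiv> conditional_loss l Px"

lemma integrable_D1: "integrable (Px x) (\<lambda>y. D1 l \<alpha> y)"
proof -
  interpret p: prob_space "Px x" by (rule Px_prob)
  show ?thesis by (rule p.integrable_const_bound[of _ loss_const]) (auto simp: D1_le intro!: D1_measurable)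
qed

lemma J_le: "\<bar>J x \<alpha>\<bar> \<le> loss_const"
proof -
  interpret p: prob_space "Px x" by (rule Px_prob)
  have "norm (J x \<alpha>) \<le> (\<integral>y. loss_const \<partial>Px x)" unfolding J_def
    by (rule Bochner_Integration.integral_norm_bound_integral[OF integrable_D1]) (auto simp: D1_le)
  then show ?thesis by (simp add: p.prob_space)
qed

lemma J_continuous: "continuous_on UNIV (J x)"
  unfolding continuous_on_sequentially comp_def
proof (intro ballI allI impI, elim conjE)
  fix u :: "nat \<Rightarrow> real" and \<alpha> assume u: "u \<longlonglongrightarrow> \<alpha>"
  interpret p: prob_space "Px x" by (rule Px_prob)
  show "(\<lambda>n. J x (u n)) \<longlonglongrightarrow> J x \<alpha>"
    unfolding J_def
  proof (rule integral_dominated_convergence[where w = "\<lambda>_. loss_const"])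
    show "AE y in Px x. (\<lambda>n. D1 l (u n) y) \<longlonglongrightarrow> D1 l \<alpha> y"
      using D1_continuous u unfolding continuous_on_sequentially comp_def by (intro AE_I2) auto
  qed (auto simp: D1_le intro!: D1_measurable)
qed

lemma J_measurable:
  assumes f: "f \<in> borel_measurable borel"
  shows "(\<lambda>x. J x (f x)) \<in> borel_measurable M"
proof -
  \<comment> \<open>Adding the bound of the derivative makes the integrand nonnegative, the case in
    which measurability of the conditional integral is settled.\<close>
  let ?h = "\<lambda>p. D1 l (f (fst p)) (snd p) + loss_const"
  have m: "?h \<in> borel_measurable borel"
    by (intro borel_measurable_add D1_measurable measurable_compose[OF _ f]) measurable
  have nn: "0 \<le> ?h p" for p using D1_le[of "f (fst p)" "snd p"] by linarith
  have "(\<integral>y. ?h (x, y) \<partial>Px x) = J x (f x) + loss_const" for x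
  proof -
    interpret p: prob_space "Px x" by (rule Px_prob)
    show ?thesis using integrable_D1 by (simp add: J_def p.prob_space)
  qed
  then have "(\<lambda>x. J x (f x)) = (\<lambda>x. (\<integral>y. ?h (x, y) \<partial>Px x) - loss_const)" by auto
  then show ?thesis using integral_Px_nonneg_measurable[OF m nn] by simp
qed

lemma AE_integrable_loss: "AE x in M. integrable (Px x) (\<lambda>y. l 0 y)"
proof -
  have "(\<lambda>p::(real ^ 'n) \<times> real. l 0 (snd p)) \<in> borel_measurable borel" by measurable
  from disintegration_nonneg(1)[OF this] loss_nonneg integrable_loss_0
  show ?thesis by (simp add: case_prod_beta')
qed

lemma Lx_props:
  assumes i: "integrable (Px x) (\<lambda>y. l 0 y)"
  shows "integrable (Px x) (\<lambda>y. l \<alpha> y)" "continuous_on UNIV (Lx x)" "J x \<alpha> * (\<beta> - \<alpha>) \<le> Lx x \<beta> - Lx x \<alpha>"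
proof -
  interpret p: prob_space "Px x" by (rule Px_prob)
  have int: "integrable (Px x) (\<lambda>y. l \<alpha> y)" for \<alpha>
  proof (rule Bochner_Integration.integrable_bound)
    show "integrable (Px x) (\<lambda>y. l 0 y + loss_const * \<bar>\<alpha>\<bar>)" using i by simp
    show "AE y in Px x. norm (l \<alpha> y) \<le> norm (l 0 y + loss_const * \<bar>\<alpha>\<bar>)"
    proof (rule AE_I2)
      fix y
      show "norm (l \<alpha> y) \<le> norm (l 0 y + loss_const * \<bar>\<alpha>\<bar>)"
        using loss_lipschitz[of \<alpha> y 0] loss_nonneg[of \<alpha> y] loss_nonneg[of 0 y] by simp
    qed
  qed (auto intro!: loss_measurable)
  then show "integrable (Px x) (\<lambda>y. l \<alpha> y)" .
  have tan: "J x \<alpha> * (\<beta> - \<alpha>) \<le> Lx x \<beta> - Lx x \<alpha>" for \<alpha> \<beta>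
  proof -
    have "J x \<alpha> * (\<beta> - \<alpha>) = (\<integral>y. D1 l \<alpha> y * (\<beta> - \<alpha>) \<partial>Px x)" by (simp add: J_def)
    also have "\<dots> \<le> (\<integral>y. l \<beta> y - l \<alpha> y \<partial>Px x)"
      using integrable_D1 int loss_tangent by (intro integral_mono) auto
    also have "\<dots> = Lx x \<beta> - Lx x \<alpha>" using int by (simp add: conditional_loss_def)
    finally show ?thesis .
  qed
  then show "J x \<alpha> * (\<beta> - \<alpha>) \<le> Lx x \<beta> - Lx x \<alpha>" .
  have lip: "Lx x \<alpha> - Lx x \<beta> \<le> loss_const * \<bar>\<alpha> - \<beta>\<bar>" for \<alpha> \<beta>
  proof -
    have "Lx x \<alpha> - Lx x \<beta> \<le> - (J x \<alpha> * (\<beta> - \<alpha>))" using tan[of \<alpha> \<beta>] by linarith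
    also have "\<dots> \<le> \<bar>J x \<alpha>\<bar> * \<bar>\<alpha> - \<beta>\<bar>" by (metis abs_ge_minus_self abs_minus_commute abs_mult)
    also have "\<dots> \<le> loss_const * \<bar>\<alpha> - \<beta>\<bar>" by (intro mult_right_mono J_le) simp
    finally show ?thesis .
  qed
  show "continuous_on UNIV (Lx x)"
  proof (rule lipschitz_on_continuous_on[of loss_const], rule lipschitz_onI)
    show "dist (Lx x \<alpha>) (Lx x \<beta>) \<le> loss_const * dist \<alpha> \<beta>" for \<alpha> \<beta>
      using lip[of \<alpha> \<beta>] lip[of \<beta> \<alpha>] by (simp add: dist_real_def abs_le_iff abs_minus_commute)
  qed (rule loss_const_nonneg)
qed

definition regression :: "(real ^ 'n \<Rightarrow> real) \<Rightarrow> real" where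
  "regression f = (\<integral>p. l (f (fst p)) (snd p) \<partial>P)"

lemma risk_regression: "risk l P \<pi> = regression (network \<pi>)"
  by (simp add: risk_eq regression_def)

lemma integrable_M_iff: "f \<in> borel_measurable borel \<Longrightarrow> integrable M f \<longleftrightarrow> integrable P (\<lambda>p. f (fst p) :: real)"
  unfolding marginal_def by (rule integrable_distr_eq[OF fst_P])

lemma integral_M: "f \<in> borel_measurable borel \<Longrightarrow> (\<integral>x. f x \<partial>M) = (\<integral>p. f (fst p) \<partial>P :: real)"
  unfolding marginal_def by (rule integral_distr[OF fst_P])

lemma regression_Lx:
  assumes f: "f \<in> borel_measurable borel" and i: "integrable M f"
  shows "integrable M (\<lambda>x. Lx x (f x))" "regression f = (\<integral>x. Lx x (f x) \<partial>M)"
proof -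
  have m: "(\<lambda>p. l (f (fst p)) (snd p)) \<in> borel_measurable borel"
    by (intro loss_measurable measurable_compose[OF _ f]) measurable
  have il: "integrable P (\<lambda>p. l (f (fst p)) (snd p))"
    by (rule integrable_loss[OF f]) (use i integrable_M_iff[OF f] in simp)
  note d = disintegration_nonneg[OF m _ il]
  show "integrable M (\<lambda>x. Lx x (f x))" "regression f = (\<integral>x. Lx x (f x) \<partial>M)"
    using d(2,3) loss_nonneg by (auto simp: conditional_loss_def regression_def)
qed

lemma regression_lipschitz:
  assumes f: "f \<in> borel_measurable borel" "integrable M f" and g: "g \<in> borel_measurable borel" "integrable M g"
  shows "regression f - regression g \<le> loss_const * (\<integral>x. \<bar>g x - f x\<bar> \<partial>M)"
proof -
  have i: "integrable P (\<lambda>p. l (f (fst p)) (snd p))" "integrable P (\<lambda>p. l (g (fst p)) (snd p))"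
    by (rule integrable_loss[OF f(1) f(2)[unfolded integrable_M_iff[OF f(1)]]])
       (rule integrable_loss[OF g(1) g(2)[unfolded integrable_M_iff[OF g(1)]]])
  have d: "integrable P (\<lambda>p. \<bar>g (fst p) - f (fst p)\<bar>)"
    by (intro integrable_abs Bochner_Integration.integrable_diff
        f(2)[unfolded integrable_M_iff[OF f(1)]] g(2)[unfolded integrable_M_iff[OF g(1)]])
  have "regression f - regression g = (\<integral>p. l (f (fst p)) (snd p) - l (g (fst p)) (snd p) \<partial>P)"
    using i by (simp add: regression_def)
  also have "\<dots> \<le> (\<integral>p. loss_const * \<bar>g (fst p) - f (fst p)\<bar> \<partial>P)"
  proof (rule integral_mono)
    show "l (f (fst p)) (snd p) - l (g (fst p)) (snd p) \<le> loss_const * \<bar>g (fst p) - f (fst p)\<bar>" for p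
      using loss_lipschitz[of "f (fst p)" "snd p" "g (fst p)"] by (simp add: abs_le_iff abs_minus_commute)
  qed (use i d in auto)
  also have "\<dots> = loss_const * (\<integral>x. \<bar>g x - f x\<bar> \<partial>M)"
    using integral_M[of "\<lambda>x. \<bar>g x - f x\<bar>"] f(1) g(1) by simp
  finally show ?thesis .
qed

text \<open>A coefficient is absorbed into its neuron: both layers are scaled by the square root of
  its modulus, and its sign goes to the outer weight. Equal scaling of the layers does not leave the
  cone, so arbitrary linear combinations are averages of neurons.\<close>

lemma sum_as_network:
  fixes c :: "'n param \<Rightarrow> real"
  assumes T: "finite T" "T \<subseteq> Theta"
  shows "\<exists>\<pi>\<in>P2. network \<pi> = (\<lambda>x. \<Sum>\<theta>\<in>T. c \<theta> * phi \<theta> x)"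
proof -
  \<comment> \<open>The zero neuron makes the index set nonempty, as a uniform distribution
    requires, and adds nothing to the sum.\<close>
  let ?T = "insert 0 T"
  define n where "n = real (card ?T)"
  have n: "n \<noteq> 0" using T(1) by (simp add: n_def card_gt_0_iff)
  \<comment> \<open>The factor \<open>n\<close> undoes the division by the number of atoms in the
    uniform distribution.\<close>
  define s where "s = (\<lambda>\<theta> :: 'n param. let k = n * c \<theta> in (sgn k * sqrt \<bar>k\<bar> * fst \<theta>, sqrt \<bar>k\<bar> *\<^sub>R snd \<theta>))"
  have sphi: "phi (s \<theta>) x = n * c \<theta> * phi \<theta> x" for \<theta> x
  proof -
    define k where "k = n * c \<theta>"
    have "phi (s \<theta>) x = sgn k * (sqrt \<bar>k\<bar> * sqrt \<bar>k\<bar>) * (fst \<theta> * relu (snd \<theta> \<bullet> (x, 1)))"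
      by (simp add: s_def Let_def k_def phi_eq relu_scale)
    also have "\<dots> = k * phi \<theta> x" by (simp add: phi_eq sgn_mult_abs)
    finally show ?thesis by (simp add: k_def)
  qed
  have scl: "s \<theta> \<in> closure Theta" if "\<theta> \<in> ?T" for \<theta>
  proof -
    have "\<theta> \<in> closure Theta" using that T(2) Theta_subset zero_closure_Theta by auto
    moreover have "\<bar>sgn k\<bar> \<le> 1" for k :: real by (simp add: sgn_if)
    ultimately have "\<bar>sgn (n * c \<theta>)\<bar> * (sqrt \<bar>n * c \<theta>\<bar> * \<bar>fst \<theta>\<bar>) \<le> 1 * (sqrt \<bar>n * c \<theta>\<bar> * norm (snd \<theta>))"
      by (intro mult_mono mult_left_mono) (auto simp: closure_Theta)
    then show ?thesis by (simp add: s_def Let_def closure_Theta abs_mult mult.assoc)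
  qed
  define p where "p = map_pmf s (pmf_of_set ?T)"
  have "network (atomic p) x = (\<Sum>\<theta>\<in>T. c \<theta> * phi \<theta> x)" for x
  proof -
    have "network (atomic p) x = (\<integral>\<theta>. phi (clamp_cone (s \<theta>)) x \<partial>measure_pmf (pmf_of_set ?T))"
      unfolding network_def by (subst atomic_integral) (auto simp: p_def)
    also have "\<dots> = (\<Sum>\<theta>\<in>?T. phi (clamp_cone (s \<theta>)) x) / card ?T"
      by (rule integral_pmf_of_set) (use T in auto)
    also have "(\<Sum>\<theta>\<in>?T. phi (clamp_cone (s \<theta>)) x) = (\<Sum>\<theta>\<in>?T. n * (c \<theta> * phi \<theta> x))"
      by (rule sum.cong) (auto simp: clamp_cone_id scl sphi)
    also have "\<dots> / card ?T = (\<Sum>\<theta>\<in>?T. c \<theta> * phi \<theta> x)"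
      using n by (simp add: sum_distrib_left[symmetric] n_def)
    also have "\<dots> = (\<Sum>\<theta>\<in>T. c \<theta> * phi \<theta> x)"
      using T(1) by (cases "0 \<in> T") (auto simp: insert_absorb phi_eq)
    finally show ?thesis .
  qed
  moreover have "atomic p \<in> P2" by (rule atomic_P2) (use T in \<open>simp add: p_def\<close>)
  ultimately show ?thesis by blast
qed

text \<open>No network beats a pointwise minimiser of the conditional loss; conversely the
  regression loss is Lipschitz in L1, and density of the span brings networks arbitrarily close. So
  the infimum over networks is attained by a function, though perhaps by no network.\<close>

lemma optimal_regressor:
  obtains f where "f \<in> borel_measurable borel" "integrable M f"
    "AE x in M. \<forall>\<alpha>. Lx x (f x) \<le> Lx x \<alpha>" "regression f = (INF \<pi>\<in>P2. risk l P \<pi>)"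
proof -
  obtain f where f: "integrable M f" "AE x in M. \<forall>\<alpha>. Lx x (f x) \<le> Lx x \<alpha>"
    using compat unfolding compatibility_assms_def by blast
  have fm: "f \<in> borel_measurable borel" using borel_measurable_integrable[OF f(1)] unfolding measurable_cong_sets[OF sets_M refl] .
  have bdd: "bdd_below ((\<lambda>\<pi>. risk l P \<pi>) ` P2)" using risk_nonneg by (auto simp: bdd_below_def)
  have ne: "(P2 :: 'n param measure set) \<noteq> {}" using atomic_P2[of "return_pmf 0"] by auto
  have "regression f \<le> (INF \<pi>\<in>P2. risk l P \<pi>)"
  proof (rule cINF_greatest[OF ne])
    fix \<pi> :: "'n param measure" assume \<pi>: "\<pi> \<in> P2"
    have nm: "network \<pi> \<in> borel_measurable borel" by (rule network_measurable[OF \<pi>])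
    have ni: "integrable M (network \<pi>)" using integrable_network[OF \<pi>] integrable_M_iff[OF nm] by simp
    show "regression f \<le> risk l P \<pi>"
      unfolding risk_regression regression_Lx(2)[OF fm f(1)] regression_Lx(2)[OF nm ni]
      by (rule integral_mono_AE[OF regression_Lx(1)[OF fm f(1)] regression_Lx(1)[OF nm ni]])
         (use f(2) in \<open>auto elim: eventually_mono\<close>)
  qed
  moreover have "(INF \<pi>\<in>P2. risk l P \<pi>) \<le> regression f + e" if e: "0 < e" for e
  proof -
    \<comment> \<open>L1 accuracy that costs at most \<open>e\<close> in the loss; the 1 guards
      against a vanishing Lipschitz constant.\<close>
    define d where "d = e / (loss_const + 1)"
    have d: "0 < d" using e loss_const_nonneg by (simp add: d_def add_nonneg_pos)
    have "\<exists>T c. finite T \<and> T \<subseteq> Theta \<and> (\<integral>x. \<bar>f x - (\<Sum>\<theta>\<in>T. c \<theta> * phi \<theta> x)\<bar> \<partial>M) < d"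
      using data f(1) d unfolding data_assms_def by blast
    then obtain T c where T: "finite T" "T \<subseteq> Theta" "(\<integral>x. \<bar>f x - (\<Sum>\<theta>\<in>T. c \<theta> * phi \<theta> x)\<bar> \<partial>M) < d" by blast
    obtain \<pi> where \<pi>: "\<pi> \<in> P2" "network \<pi> = (\<lambda>x. \<Sum>\<theta>\<in>T. c \<theta> * phi \<theta> x)"
      using sum_as_network[OF T(1,2)] by blast
    have nm: "network \<pi> \<in> borel_measurable borel" by (rule network_measurable[OF \<pi>(1)])
    have ni: "integrable M (network \<pi>)" using integrable_network[OF \<pi>(1)] integrable_M_iff[OF nm] by simp
    have "regression (network \<pi>) - regression f \<le> loss_const * (\<integral>x. \<bar>f x - network \<pi> x\<bar> \<partial>M)"
      by (rule regression_lipschitz[OF nm ni fm f(1)])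
    also have "\<dots> \<le> loss_const * d" using T(3) \<pi>(2) loss_const_nonneg by (intro mult_left_mono) auto
    also have "\<dots> \<le> e" using e loss_const_nonneg by (simp add: d_def field_simps)
    finally show ?thesis using cINF_lower[OF bdd \<pi>(1)] by (simp add: risk_regression)
  qed
  then have "(INF \<pi>\<in>P2. risk l P \<pi>) \<le> regression f" by (rule field_le_epsilon)
  ultimately show ?thesis using that[OF fm f] by simp
qed

text \<open>Along a minimising sequence of regressors the excess conditional losses tend to \<open>0\<close> in
  \<open>L\<^sup>1\<close>, hence almost everywhere along a subsequence; coercivity then forces the conditional
  derivatives to \<open>0\<close>.\<close>

lemma minimising_sequence_derivative:
  assumes f: "\<And>n. f n \<in> borel_measurable borel" "\<And>n. integrable M (f n)"
    and lim: "(\<lambda>n::nat. regression (f n)) \<longlonglongrightarrow> (INF \<pi>\<in>P2. risk l P \<pi>)"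
  shows "\<exists>r. strict_mono r \<and> (\<forall>h B. h \<in> borel_measurable borel \<longrightarrow> (\<forall>x. \<bar>h x\<bar> \<le> B * norm (x, 1::real)) \<longrightarrow>
    (\<lambda>n. \<integral>p. res (f (r n)) p * h (fst p) \<partial>P) \<longlonglongrightarrow> 0)"
proof -
  interpret m: prob_space M by (rule prob_M)
  obtain g where g: "g \<in> borel_measurable borel" "integrable M g"
    "AE x in M. \<forall>\<alpha>. Lx x (g x) \<le> Lx x \<alpha>" "regression g = (INF \<pi>\<in>P2. risk l P \<pi>)" using optimal_regressor by blast
  define u where "u = (\<lambda>n x. Lx x (f n x) - Lx x (g x))"
  have ui: "integrable M (u n)" for n
    unfolding u_def using regression_Lx(1)[OF f(1,2), of n] regression_Lx(1)[OF g(1,2)] by simp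
  have "(\<integral>x. norm (u n x) \<partial>M) = regression (f n) - regression g" for n
  proof -
    \<comment> \<open>Since \<open>g\<close> minimises the conditional loss, the excess is
      nonnegative almost everywhere, and convergence of the risks is convergence in L1.\<close>
    have "(\<integral>x. norm (u n x) \<partial>M) = (\<integral>x. u n x \<partial>M)"
      by (rule integral_cong_AE) (use ui g(3) in \<open>auto simp: u_def elim!: eventually_mono\<close>)
    also have "\<dots> = regression (f n) - regression g"
      unfolding u_def regression_Lx(2)[OF f(1,2), of n] regression_Lx(2)[OF g(1,2)]
      by (rule Bochner_Integration.integral_diff[OF regression_Lx(1)[OF f(1,2)] regression_Lx(1)[OF g(1,2)]])
    finally show ?thesis .
  qed
  then have "(\<lambda>n. \<integral>x. norm (u n x) \<partial>M) \<longlonglongrightarrow> 0" using lim g(4) by (simp add: LIM_zero_iff)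
  from tendsto_L1_AE_subseq[OF ui this] obtain r where r: "strict_mono r" "AE x in M. (\<lambda>n. u (r n) x) \<longlonglongrightarrow> 0" by blast
  have co: "AE x in M. filterlim (Lx x) at_top at_infinity" using compat by (simp add: compatibility_assms_def)
  have J0: "AE x in M. (\<lambda>n. J x (f (r n) x)) \<longlonglongrightarrow> 0"
    using r(2) co AE_integrable_loss g(3)
  proof eventually_elim
    case (elim x)
    show ?case
      by (rule derivative_at_minimiser_tendsto_0[OF Lx_props(2)[OF elim(3)] J_continuous Lx_props(3)[OF elim(3)] elim(2), of "g x"])
         (use elim in \<open>auto simp: u_def\<close>)
  qed
  have "(\<lambda>n. \<integral>p. res (f (r n)) p * h (fst p) \<partial>P) \<longlonglongrightarrow> 0"
    if h: "h \<in> borel_measurable borel" and hB: "\<forall>x. \<bar>h x\<bar> \<le> B * norm (x, 1::real)" for h B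
  proof -
    have hi: "integrable M (\<lambda>x. \<bar>h x\<bar>)"
    proof -
      have "integrable P (\<lambda>p. h (fst p))"
      proof (rule Bochner_Integration.integrable_bound)
        show "integrable P (\<lambda>p. B * q p)" using integrable_q by simp
        show "(\<lambda>p. h (fst p)) \<in> borel_measurable P" by (rule measurable_compose[OF fst_P h])
        show "AE p in P. norm (h (fst p)) \<le> norm (B * q p)"
          using hB by (intro AE_I2) (auto intro: order_trans[OF _ abs_ge_self])
      qed
      then show ?thesis using integrable_M_iff[OF h] by simp
    qed
    \<comment> \<open>\<open>h\<close> depends on the input only, so conditioning on x replaces the
      residual by the conditional slope \<open>J\<close>.\<close>
    have eq: "(\<integral>p. res (f n) p * h (fst p) \<partial>P) = (\<integral>x. J x (f n x) * h x \<partial>M)" for n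
    proof (rule disintegration)
      have "res (f n) \<in> borel_measurable borel"
        using residual_res[OF f(1)] unfolding residual_def measurable_cong_sets[OF sets_P refl] by blast
      moreover have "(\<lambda>p::(real ^ 'n) \<times> real. h (fst p)) \<in> borel_measurable borel" by (rule measurable_compose[OF _ h]) measurable
      ultimately show "(\<lambda>p. res (f n) p * h (fst p)) \<in> borel_measurable borel" by simp
      have hP: "(\<lambda>p. h (fst p)) \<in> borel_measurable P" by (rule measurable_compose[OF fst_P h])
      show "integrable P (\<lambda>p. res (f n) p * h (fst p))"
        using integrable_residual[OF residual_res[OF f(1)] hP, of B n] hB by simp
      show "(\<lambda>x. J x (f n x) * h x) \<in> borel_measurable M" using J_measurable[OF f(1)] h by simp
      show "AE x in M. J x (f n x) * h x = (\<integral>y. res (f n) (x, y) * h (fst (x, y)) \<partial>Px x)"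
        by (simp add: res_def J_def)
    qed
    have "(\<lambda>n. \<integral>x. J x (f (r n) x) * h x \<partial>M) \<longlonglongrightarrow> (\<integral>x. 0 \<partial>M)"
    proof (rule integral_dominated_convergence[where w = "\<lambda>x. loss_const * \<bar>h x\<bar>"])
      show "(\<lambda>x. J x (f (r n) x) * h x) \<in> borel_measurable M" for n using J_measurable[OF f(1)] h by simp
      show "integrable M (\<lambda>x. loss_const * \<bar>h x\<bar>)" using hi by simp
      show "AE x in M. (\<lambda>n. J x (f (r n) x) * h x) \<longlonglongrightarrow> 0"
        using J0 by (rule eventually_mono) (auto intro: tendsto_mult_left_zero)
      show "AE x in M. norm (J x (f (r n) x) * h x) \<le> loss_const * \<bar>h x\<bar>" for n
        using J_le by (auto simp: abs_mult intro!: mult_right_mono)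
    qed simp
    then show ?thesis by (simp add: eq)
  qed
  then show ?thesis using r(1) by blast
qed

end

context flow_setting
begin

text \<open>Convergence of the gradients along all times passes to the potentials by Euler's
  identity, which costs a factor \<open>R * R\<close> on the ball of radius
  \<open>R\<close>.\<close>

lemma Omega_singleton_pot_limit:
  assumes \<Omega>: "Omega_lim l P flow = {(g, V)}"
  shows "locally_uniform_limit (closure Theta) (\<lambda>t. delta_risk l P (flow t)) g at_top"
proof (rule locally_uniform_limitI_cballs, rule uniform_limitI)
  fix R e :: real assume R: "0 < R" and e: "0 < e"
  have mem: "(g, V) \<in> Omega_lim l P flow" using \<Omega> by simp
  define \<epsilon> where "\<epsilon> = e / (R * R)"
  have \<epsilon>: "0 < \<epsilon>" using R e by (simp add: \<epsilon>_def)
  obtain T where T: "0 \<le> T" "\<And>t \<theta>. T \<le> t \<Longrightarrow> \<theta> \<in> closure Theta \<Longrightarrow> norm (pgrad (\<rho> t) \<theta> - V \<theta>) \<le> \<epsilon> * norm \<theta>"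
    using Omega_singleton_approx[OF \<Omega> \<epsilon>] by blast
  have "dist (delta_risk l P (flow t) \<theta>) (g \<theta>) < e" if t: "T \<le> t" and \<theta>: "\<theta> \<in> closure Theta \<inter> cball 0 R" for t \<theta>
  proof -
    have \<theta>': "\<theta> \<in> closure Theta" "norm \<theta> \<le> R" using \<theta> by auto
    have t0: "0 \<le> t" using t T(1) by simp
    have "2 * (pot (\<rho> t) \<theta> - g \<theta>) = \<theta> \<bullet> (pgrad (\<rho> t) \<theta> - V \<theta>)"
      using inner_pgrad(1)[OF residual_\<rho>[OF t0], of \<theta>] Omega_props(1)[OF mem \<theta>'(1)] by (simp add: inner_diff_right)
    moreover have "\<bar>\<theta> \<bullet> (pgrad (\<rho> t) \<theta> - V \<theta>)\<bar> \<le> norm \<theta> * (\<epsilon> * norm \<theta>)"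
      using order_trans[OF Cauchy_Schwarz_ineq2 mult_left_mono[OF T(2)[OF t \<theta>'(1)] norm_ge_zero]] .
    moreover have "norm \<theta> * (\<epsilon> * norm \<theta>) \<le> R * (\<epsilon> * R)"
      using \<theta>'(2) \<epsilon> R by (intro mult_mono) auto
    moreover have "R * (\<epsilon> * R) = e" using R by (simp add: \<epsilon>_def)
    ultimately have "\<bar>2 * (pot (\<rho> t) \<theta> - g \<theta>)\<bar> \<le> e" by simp
    then show ?thesis using e unfolding delta_risk_flow dist_real_def by (simp add: abs_mult)
  qed
  then show "\<forall>\<^sub>F t in at_top. \<forall>\<theta>\<in>closure Theta \<inter> cball 0 R. dist (delta_risk l P (flow t) \<theta>) (g \<theta>) < e"
    unfolding eventually_at_top_linorder by blast
qed

end

locale gradient_flow = flow_setting P l flow m + disintegrated_data P l Px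
  for P :: "((real ^ 'n::finite) \<times> real) measure" and l flow m Px
begin

text \<open>The components of the feature gradient at a fixed \<theta> depend on the input only and
  grow at most linearly, so they are admissible multipliers \<open>h\<close> in
  \<open>minimising_sequence_derivative\<close>. A subsequence suffices because the limit
  \<open>V \<theta>\<close> already exists; \<open>g\<close> follows by Euler's identity.\<close>

lemma risk_limit_Omega_zero:
  assumes lim: "((\<lambda>t. risk l P (flow t)) \<longlongrightarrow> (INF \<pi>\<in>P2. risk l P \<pi>)) at_top"
    and \<Omega>: "(g, V) \<in> Omega_lim l P flow" and \<theta>: "\<theta> \<in> closure Theta"
  shows "V \<theta> = 0" "g \<theta> = 0"
proof -
  obtain t where t: "\<And>n. 0 \<le> t n" and tl: "filterlim t at_top sequentially"
    and G: "\<And>\<theta>. \<theta> \<in> closure Theta \<Longrightarrow> (\<lambda>n. pot (\<rho> (t n)) \<theta>) \<longlonglongrightarrow> g \<theta>"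
    and W: "\<And>\<theta>. \<theta> \<in> closure Theta \<Longrightarrow> (\<lambda>n. pgrad (\<rho> (t n)) \<theta>) \<longlonglongrightarrow> V \<theta>"
    by (rule Omega_limit[OF \<Omega>]) (assumption | rule that)+
  define f where "f = (\<lambda>n. network (flow (t n)))"
  have fm: "f n \<in> borel_measurable borel" for n unfolding f_def by (rule network_measurable[OF flow_P2[OF t]])
  have fi: "integrable M (f n)" for n
    unfolding integrable_M_iff[OF fm] unfolding f_def by (rule integrable_network[OF flow_P2[OF t]])
  have "(\<lambda>n. regression (f n)) \<longlonglongrightarrow> (INF \<pi>\<in>P2. risk l P \<pi>)"
    using filterlim_compose[OF lim tl] by (simp add: risk_regression f_def)
  from minimising_sequence_derivative[OF fm fi this] obtain r where r: "strict_mono r"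
    and z: "\<And>h B. h \<in> borel_measurable borel \<Longrightarrow> (\<forall>x. \<bar>h x\<bar> \<le> B * norm (x, 1::real)) \<Longrightarrow>
      (\<lambda>n. \<integral>p. res (f (r n)) p * h (fst p) \<partial>P) \<longlonglongrightarrow> 0" by blast
  show V: "V \<theta> = 0"
  proof (rule euclidean_eqI)
    fix i :: "'n param" assume i: "i \<in> Basis"
    have "(\<lambda>n. \<integral>p. res (f (r n)) p * (grad_phi \<theta> (fst p) \<bullet> i) \<partial>P) \<longlonglongrightarrow> 0"
    proof (rule z[of _ "norm \<theta>"])
      show "(\<lambda>x. grad_phi \<theta> x \<bullet> i) \<in> borel_measurable borel" by measurable
      show "\<forall>x. \<bar>grad_phi \<theta> x \<bullet> i\<bar> \<le> norm \<theta> * norm (x, 1::real)"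
      proof
        fix x
        have "\<bar>grad_phi \<theta> x \<bullet> i\<bar> \<le> norm (grad_phi \<theta> x)" by (rule Basis_le_norm[OF i])
        also have "\<dots> \<le> norm \<theta> * norm (x, 1::real)" by (rule norm_grad_phi_le)
        finally show "\<bar>grad_phi \<theta> x \<bullet> i\<bar> \<le> norm \<theta> * norm (x, 1::real)" .
      qed
    qed
    moreover have "(\<integral>p. res (f (r n)) p * (grad_phi \<theta> (fst p) \<bullet> i) \<partial>P) = pgrad (\<rho> (t (r n))) \<theta> \<bullet> i" for n
    proof -
      have "(\<integral>p. (res (f (r n)) p *\<^sub>R grad_phi \<theta> (fst p)) \<bullet> i \<partial>P) = (\<integral>p. res (f (r n)) p *\<^sub>R grad_phi \<theta> (fst p) \<partial>P) \<bullet> i"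
        by (rule integral_inner_left) (rule integrable_pgrad[OF residual_res[OF fm]])
      then show ?thesis by (simp add: pgrad_def \<rho>_def f_def)
    qed
    moreover have "(\<lambda>n. pgrad (\<rho> (t (r n))) \<theta> \<bullet> i) \<longlonglongrightarrow> V \<theta> \<bullet> i"
      by (rule tendsto_inner[OF LIMSEQ_subseq_LIMSEQ[OF W[OF \<theta>] r, unfolded comp_def] tendsto_const])
    ultimately show "V \<theta> \<bullet> i = 0 \<bullet> i" using LIMSEQ_unique by fastforce
  qed
  show "g \<theta> = 0" using Omega_props(1)[OF \<Omega> \<theta>] V by simp
qed

text \<open>Any two limits vanish on the cone, and extensionality makes them equal off it as well;
  existence is \<open>Omega_nonempty\<close>.\<close>

lemma risk_limit_Omega_singleton:
  assumes lim: "((\<lambda>t. risk l P (flow t)) \<longlongrightarrow> (INF \<pi>\<in>P2. risk l P \<pi>)) at_top"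
  shows "\<exists>g V. Omega_lim l P flow = {(g, V)}"
proof -
  have "g = g' \<and> V = V'" if m: "(g, V) \<in> Omega_lim l P flow" "(g', V') \<in> Omega_lim l P flow" for g V g' V'
  proof -
    have e: "g \<in> extensional (closure Theta)" "g' \<in> extensional (closure Theta)"
      "V \<in> extensional (closure Theta)" "V' \<in> extensional (closure Theta)"
      using m by (auto simp: Omega_lim_def)
    show ?thesis
      using extensionalityI[OF e(1,2)] extensionalityI[OF e(3,4)]
        risk_limit_Omega_zero[OF lim m(1)] risk_limit_Omega_zero[OF lim m(2)] by simp
  qed
  moreover obtain g V where "(g, V) \<in> Omega_lim l P flow" using Omega_nonempty by fastforce
  ultimately have "Omega_lim l P flow = {(g, V)}" by auto
  then show ?thesis by blast
qed

end

theorem theorem3p5: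
  fixes l :: "real \<Rightarrow> real \<Rightarrow> real"
    and P :: "((real ^ 'n::finite) \<times> real) measure"
    and Px :: "real ^ 'n \<Rightarrow> real measure"
    and \<pi>0 :: "'n param measure"
    and flow :: "real \<Rightarrow> 'n param measure"
  assumes "loss_assms l"
    and "data_assms P"
    and "conditional_distribution P Px"
    and "compatibility_assms l P Px"
    and "\<pi>0 \<in> P2"
    and "omni_directional \<pi>0"
    and "wasserstein_gradient_flow l P \<pi>0 flow"
    and "morse_sard l P flow"
  shows "Omega_lim l P flow \<noteq> {} \<and>
    (((\<lambda>t. risk l P (flow t)) \<longlongrightarrow> (INF \<pi>\<in>P2. risk l P \<pi>)) at_top \<longleftrightarrow>
       (\<exists>g V. Omega_lim l P flow = {(g, V)})) \<and>
    (\<forall>g V. Omega_lim l P flow = {(g, V)} \<longrightarrow>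
       locally_uniform_limit (closure Theta) (\<lambda>t. delta_risk l P (flow t)) g at_top \<and>
       (\<forall>\<theta>\<in>closure Theta. g \<theta> = 0))"
proof -
  note gf = assms(7)[unfolded wasserstein_gradient_flow_def]
  obtain m where m: "\<And>T. 0 < T \<Longrightarrow> set_integrable lborel {0..T} m"
    "\<And>s t. 0 \<le> s \<Longrightarrow> s \<le> t \<Longrightarrow> wasserstein2 (flow s) (flow t) \<le> (LINT r:{s..t}|lborel. m r)"
    using gf unfolding locally_AC_curve_def by blast
  have i: "integrable P (\<lambda>(x, y). l 0 y)"
    using assms(4) unfolding compatibility_assms_def by blast
  have mf: "mean_field P l"
    by (intro mean_field.intro mean_field_axioms.intro relu_data.intro assms i)
  interpret gradient_flow P l flow m Px
    by (intro gradient_flow.intro flow_setting.intro disintegrated_data.intro mf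
        flow_setting_axioms.intro disintegrated_data_axioms.intro assms m) (use gf in blast)+
  have omni: "omni_directional (flow 0)" using assms(6) gf by simp
  note singleton = Omega_singleton_zero[OF _ assms(8) omni] Omega_singleton_risk_limit[OF _ assms(8) omni]
  show ?thesis
    using Omega_nonempty risk_limit_Omega_singleton singleton Omega_singleton_pot_limit by blast
qed

end
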